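(* Let $c$ be a real nonzero constant, $L>0$, and $H$ the real parameter of the operator $P_H$. Consider the evolution $$\partial_t u_{H,0}=P_H\mathcal L P_H^{-1}u_{H,0}+f,\qquad x\in\mathbb{R},$$ where $f(t,x)$ is the Gaussian random force with spatial covariance $\mathcal C_f$, a real and even function of its argument, $\mathcal L$ is the linear operator $\mathcal Lu(t,x)=2i\pi c\,x\,u(t,x)$, and $P_H$ is the Fourier multiplier with symbol $|k|_{1/L}^{-(H+1/2)}$. Once expressed in Fourier space, this dynamics reads $$\partial_t\hat u_{H,0}+c\,\partial_k\hat u_{H,0}+c\left(H+\tfrac12\right)\frac{k}{|k|_{1/L}^2}\,\hat u_{H,0}=\hat f .$$ Starting from the initial condition $u_{H,0}(0,x)=0$, the solution of this evolution is a zero-average Gaussian field $u_{H,0}(t,x)$. Its correlation in space $\mathcal C_{u_{H,0}}(t,x-y)=\mathbb{E}[u_{H,0}(t,x)u_{H,0}^*(t,y)]$ is a function of the difference of the positions only, and its Fourier transform is $$\hat{\mathcal C}_{u_{H,0}}(t,k)=|k|_{1/L}^{-(2H+1)}\int_0^t|k-cs|_{1/L}^{2H+1}\,\hat{\mathcal C}_f(k-cs)\,ds .$$ Furthermore, for any $H>0$, the solution goes towards a statistically stationary regime as $t\to\infty$, such that its variance is finite, i.e. $$\lim_{t\to\infty}\mathbb{E}|u_{H,0}|^2<\infty,$$ and its correlation function is given by $$\lim_{t\to\infty}\hat{\mathcal C}_{u_{H,0}}(t,k)=\begin{cases}\dfrac1c\,|k|_{1/L}^{-(2H+1)}\displaystyle\int_{-\infty}^k|s|_{1/L}^{2H+1}\,\hat{\mathcal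 C}_f(s)\,ds & \text{if } c>0,\\[2mm] \dfrac1{-c}\,|k|_{1/L}^{-(2H+1)}\displaystyle\int_k^{\infty}|s|_{1/L}^{2H+1}\,\hat{\mathcal C}_f(s)\,ds & \text{if } c<0.\end{cases}$$ As $t\to\infty$ and for $H\in(0,1)$, the solution shares the same local regularity as a fractional Brownian motion of parameter $H$, independently of the precise regularization procedure taking place at the scale $L$. Consequently, whatever the sign of $c$, the second-order structure function, with $\delta_\ell u_{H,0}(t,x)=u_{H,0}(t,x+\ell)-u_{H,0}(t,x)$, behaves at small scales as $$\lim_{t\to\infty}\mathbb{E}|\delta_\ell u_{H,0}|^2\ \underset{\ell\to0^+}{\sim}\ c_H\,\ell^{2H},$$ where, with $\Gamma(z)=\int_0^\infty x^{z-1}e^{-x}\,dx$, $$c_H=\frac{1}{2|c|}\,\frac{(2\pi)^{2H+1}}{\sin(\pi H)\,\Gamma(1+2H)}\int_{-\infty}^{\infty}|s|_{1/L}^{2H+1}\,\hat{\mathcal C}_f(s)\,ds .$$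
   Context: Fourier transform in space: $\hat u(t,k)=\int_{\mathbb{R}}e^{-2i\pi kx}u(t,x)\,dx$, and likewise $\hat{\mathcal C}(t,k)=\int_{\mathbb{R}}e^{-2i\pi kx}\mathcal C(t,x)\,dx$ for covariances. Forcing: $f(t,x)\in\mathbb{C}$ is a zero-average complex Gaussian field, uncorrelated in time and statistically homogeneous in space, with $$\mathbb{E}[f(t,x)f^*(t',x')]=\delta(t-t')\,\mathcal C_f(x-x'),\qquad \mathbb{E}[f(t,x)f(t',x')]=0,$$ where $^*$ is complex conjugation and $\mathcal C_f$ is a smooth function that decays rapidly away from the origin (for example $\mathcal C_f(x)=e^{-x^2/(2L^2)}$). Operators: $P_Hu(t,x)=\int e^{2i\pi kx}|k|_{1/L}^{-(H+1/2)}\hat u(t,k)\,dk$ and $P_H^{-1}u(t,x)=\int e^{2i\pi kx}|k|_{1/L}^{H+1/2}\hat u(t,k)\,dk$. Here $|k|_{1/L}$ is a regularized absolute value of $k$ over the wavelength $1/L$: its exact expression is not specified, but it is required to behave as $|k|$ at large arguments and to go to a finite positive value of order $1/L$ as $|k|\to0$. To set ideas, one can keep in mind $|k|_{1/L}^2=|k|^2+1/L^2$. The field $u_{H,0}$ takes values in $\mathbb{C}$. $A(\ell)\sim B(\ell)$ means $A(\ell)/B(\ell)\to1$.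
   Formalization: The drift k/|k|² fails for general regularizations: g'/g, g=|k|_{1/L}, is used, and the displayed form for g²=k²+1/L². g is taken smooth with polynomially bounded derivatives. fBm-like regularity is the structure function law; stationarity is convergence of two-time second moments. *)

theory Defs
  imports "HOL-Probability.Probability" "HOL-Library.Landau_Symbols"
begin

section \<open>Schwartz functions and the Fourier transform\<close>

definition schwartz :: "(real \<Rightarrow> 'a::real_normed_vector) \<Rightarrow> bool" where
  "schwartz \<phi> \<longleftrightarrow> (\<exists>D. D 0 = \<phi> \<and>
     (\<forall>n x. (D n has_vector_derivative D (Suc n) x) (at x)) \<and>
     (\<forall>m n. bounded (range (\<lambda>x. x ^ m *\<^sub>R D n x))))"

definition fourier :: "(real \<Rightarrow> complex) \<Rightarrow> real \<Rightarrow> complex" where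
  "fourier \<phi> k = (LINT x|lborel. cis (- 2 * pi * k * x) * \<phi> x)"

definition fourier_inv :: "(real \<Rightarrow> complex) \<Rightarrow> real \<Rightarrow> complex" where
  "fourier_inv \<zeta> x = (LINT k|lborel. cis (2 * pi * k * x) * \<zeta> k)"

section \<open>The operators\<close>

text \<open>
  \<open>regularized_abs L g\<close>: the function \<open>g\<close> is an admissible choice of the regularized absolute
  value over the wavelength \<open>1 / L\<close>, for instance \<open>g k = sqrt (k\<^sup>2 + 1 / L\<^sup>2)\<close>. Smoothness with
  polynomially bounded derivatives is what makes Fourier multiplication by powers of \<open>g\<close>
  meaningful on tempered distributions, such as the paths of a spatially homogeneous field.
\<close>

definition regularized_abs :: "real \<Rightarrow> (real \<Rightarrow> real) \<Rightarrow> bool" where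
  "regularized_abs L g \<longleftrightarrow>
     (\<forall>k. g k > 0) \<and>
     ((\<lambda>k. g k / \<bar>k\<bar>) \<longlongrightarrow> 1) at_infinity \<and>
     (\<exists>\<kappa>>0. (g \<longlongrightarrow> \<kappa> / L) (at 0)) \<and>
     (\<exists>D. D 0 = g \<and>
        (\<forall>n k. (D n has_vector_derivative D (Suc n) k) (at k)) \<and>
        (\<forall>n. \<exists>K m. \<forall>k. \<bar>D n k\<bar> \<le> K * (1 + \<bar>k\<bar>) ^ m))"

definition P_op :: "(real \<Rightarrow> real) \<Rightarrow> real \<Rightarrow> (real \<Rightarrow> complex) \<Rightarrow> real \<Rightarrow> complex" where
  "P_op g H \<phi> = fourier_inv (\<lambda>k. complex_of_real (g k powr (- (H + 1/2))) * fourier \<phi> k)"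

definition P_inv_op :: "(real \<Rightarrow> real) \<Rightarrow> real \<Rightarrow> (real \<Rightarrow> complex) \<Rightarrow> real \<Rightarrow> complex" where
  "P_inv_op g H \<phi> = fourier_inv (\<lambda>k. complex_of_real (g k powr (H + 1/2)) * fourier \<phi> k)"

definition L_op :: "real \<Rightarrow> (real \<Rightarrow> complex) \<Rightarrow> real \<Rightarrow> complex" where
  "L_op c \<phi> x = 2 * \<i> * of_real pi * of_real c * of_real x * \<phi> x"

definition evolution_op ::
  "real \<Rightarrow> (real \<Rightarrow> real) \<Rightarrow> real \<Rightarrow> (real \<Rightarrow> complex) \<Rightarrow> real \<Rightarrow> complex" where
  "evolution_op c g H \<phi> = P_op g H (L_op c (P_inv_op g H \<phi>))"

text \<open>
  The field \<open>u\<close> does not decay in space, so \<open>evolution_op\<close> acts on it by duality: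
  \<open>adjoint_pair c g H \<phi> \<psi>\<close> says that \<open>\<psi>\<close> is the image of the Schwartz function \<open>\<phi>\<close> under
  the formal \<open>L\<^sup>2\<close>-adjoint.
\<close>

definition adjoint_pair ::
  "real \<Rightarrow> (real \<Rightarrow> real) \<Rightarrow> real \<Rightarrow> (real \<Rightarrow> complex) \<Rightarrow> (real \<Rightarrow> complex) \<Rightarrow> bool" where
  "adjoint_pair c g H \<phi> \<psi> \<longleftrightarrow> schwartz \<phi> \<and> schwartz \<psi> \<and>
     (\<forall>\<eta>. schwartz \<eta> \<longrightarrow>
        (LINT x|lborel. evolution_op c g H \<eta> x * cnj (\<phi> x)) = (LINT x|lborel. \<eta> x * cnj (\<psi> x)))"

section \<open>Gaussian families and the forcing\<close>

text \<open>The second alternative is the degenerate (constant) case.\<close>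

definition gaussian_rv :: "'w measure \<Rightarrow> ('w \<Rightarrow> real) \<Rightarrow> bool" where
  "gaussian_rv M X \<longleftrightarrow>
     (\<exists>\<mu> \<sigma>. \<sigma> > 0 \<and> distributed M lborel X (normal_density \<mu> \<sigma>)) \<or>
     (\<exists>\<mu>. X \<in> borel_measurable M \<and> (AE \<omega> in M. X \<omega> = \<mu>))"

text \<open>
  Joint Gaussianity of a complex family: \<open>Re (a * z)\<close> with complex \<open>a\<close> runs through all
  real-linear functionals of \<open>z\<close>.
\<close>

definition gaussian_family :: "'w measure \<Rightarrow> 'i set \<Rightarrow> ('i \<Rightarrow> 'w \<Rightarrow> complex) \<Rightarrow> bool" where
  "gaussian_family M I X \<longleftrightarrow>
     (\<forall>J a. finite J \<and> J \<subseteq> I \<longrightarrow> gaussian_rv M (\<lambda>\<omega>. Re (\<Sum>i\<in>J. a i * X i \<omega>)))"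

definition forcing_test :: "(real \<Rightarrow> real \<Rightarrow> complex) \<Rightarrow> bool" where
  "forcing_test \<Phi> \<longleftrightarrow> (\<lambda>(t, x). \<Phi> t x) \<in> borel_measurable (borel \<Otimes>\<^sub>M borel) \<and>
     (\<exists>T K. \<forall>t x. (\<bar>t\<bar> > T \<longrightarrow> \<Phi> t x = 0) \<and> cmod (\<Phi> t x) \<le> K / (1 + x\<^sup>2))"

text \<open>
  The forcing is a generalized field: \<open>f \<Phi>\<close> stands for the integral of \<open>f(t,x) \<Phi>(t,x)\<close> over
  space and time. The two second moments are those of a field with
  \<open>E[f(t,x) f*(t',x')] = \<delta>(t-t') C(x-x')\<close> and \<open>E[f(t,x) f(t',x')] = 0\<close>; the first one
  makes \<open>f\<close> almost surely linear in \<open>\<Phi>\<close>.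
\<close>

definition white_in_time_forcing ::
  "'w measure \<Rightarrow> (real \<Rightarrow> real) \<Rightarrow> ((real \<Rightarrow> real \<Rightarrow> complex) \<Rightarrow> 'w \<Rightarrow> complex) \<Rightarrow> bool" where
  "white_in_time_forcing M C f \<longleftrightarrow>
     gaussian_family M {\<Phi>. forcing_test \<Phi>} f \<and>
     (\<forall>\<Phi>. forcing_test \<Phi> \<longrightarrow> (\<integral>\<omega>. f \<Phi> \<omega> \<partial>M) = 0) \<and>
     (\<forall>\<Phi> \<Psi>. forcing_test \<Phi> \<and> forcing_test \<Psi> \<longrightarrow>
        (\<integral>\<omega>. f \<Phi> \<omega> * cnj (f \<Psi> \<omega>) \<partial>M) =
          (LINT t|lborel. LINT x|lborel. LINT y|lborel.
             \<Phi> t x * cnj (\<Psi> t y) * complex_of_real (C (x - y))) \<and>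
        (\<integral>\<omega>. f \<Phi> \<omega> * f \<Psi> \<omega> \<partial>M) = 0)"

section \<open>Solutions\<close>

definition pairing :: "(real \<Rightarrow> complex) \<Rightarrow> (real \<Rightarrow> complex) \<Rightarrow> complex" where
  "pairing v \<phi> = (LINT x|lborel. v x * cnj (\<phi> x))"

text \<open>The time-integrated weak form of \<open>\<partial>\<^sub>t u = (evolution_op c g H) u + f\<close>.\<close>

definition solves_evolution ::
  "'w measure \<Rightarrow> ((real \<Rightarrow> real \<Rightarrow> complex) \<Rightarrow> 'w \<Rightarrow> complex) \<Rightarrow> real \<Rightarrow> (real \<Rightarrow> real) \<Rightarrow> real \<Rightarrow>
   (real \<Rightarrow> real \<Rightarrow> 'w \<Rightarrow> complex) \<Rightarrow> bool" where
  "solves_evolution M f c g H u \<longleftrightarrow>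
     (\<forall>\<phi> \<psi> t. adjoint_pair c g H \<phi> \<psi> \<and> t \<ge> 0 \<longrightarrow>
        (AE \<omega> in M.
           pairing (\<lambda>x. u t x \<omega>) \<phi> =
             pairing (\<lambda>x. u 0 x \<omega>) \<phi>
             + (LINT s:{0..t}|lborel. pairing (\<lambda>x. u s x \<omega>) \<psi>)
             + f (\<lambda>s x. indicator {0..t} s * cnj (\<phi> x)) \<omega>))"

text \<open>
  The Fourier transform of a tempered \<open>v\<close>, as a distribution paired with a Schwartz function
  \<open>\<zeta>\<close> of the wavenumber; for integrable \<open>v\<close> this is \<open>pairing (fourier v) \<zeta>\<close>.
\<close>

definition fourier_pairing :: "(real \<Rightarrow> complex) \<Rightarrow> (real \<Rightarrow> complex) \<Rightarrow> complex" where
  "fourier_pairing v \<zeta> = pairing v (fourier_inv \<zeta>)"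

text \<open>
  The time-integrated weak form of \<open>\<partial>\<^sub>t v + c \<partial>\<^sub>k v + q(k) v = w\<close>, where \<open>v\<close> and \<open>w\<close>
  are the spatial Fourier transforms of \<open>u\<close> and \<open>f\<close> and \<open>q\<close> is real-valued.
\<close>

definition solves_fourier ::
  "'w measure \<Rightarrow> ((real \<Rightarrow> real \<Rightarrow> complex) \<Rightarrow> 'w \<Rightarrow> complex) \<Rightarrow> real \<Rightarrow> (real \<Rightarrow> real) \<Rightarrow>
   (real \<Rightarrow> real \<Rightarrow> 'w \<Rightarrow> complex) \<Rightarrow> bool" where
  "solves_fourier M f c q u \<longleftrightarrow>
     (\<forall>\<zeta> t. schwartz \<zeta> \<and> t \<ge> 0 \<longrightarrow>
        (AE \<omega> in M.
           fourier_pairing (\<lambda>x. u t x \<omega>) \<zeta> =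
             fourier_pairing (\<lambda>x. u 0 x \<omega>) \<zeta>
             + (LINT s:{0..t}|lborel. fourier_pairing (\<lambda>x. u s x \<omega>)
                  (\<lambda>k. of_real c * vector_derivative \<zeta> (at k) - of_real (q k) * \<zeta> k))
             + f (\<lambda>s x. indicator {0..t} s * cnj (fourier_inv \<zeta> x)) \<omega>))"

text \<open>
  Mean-square continuity in space makes the values of \<open>u\<close> at single points determined, up to
  null sets, by the weak equation.
\<close>

definition solution_from_zero ::
  "'w measure \<Rightarrow> ((real \<Rightarrow> real \<Rightarrow> complex) \<Rightarrow> 'w \<Rightarrow> complex) \<Rightarrow> real \<Rightarrow> (real \<Rightarrow> real) \<Rightarrow> real \<Rightarrow>
   (real \<Rightarrow> real \<Rightarrow> 'w \<Rightarrow> complex) \<Rightarrow> bool" where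
  "solution_from_zero M f c g H u \<longleftrightarrow>
     (\<lambda>(t, x, \<omega>). u t x \<omega>) \<in> borel_measurable (borel \<Otimes>\<^sub>M (borel \<Otimes>\<^sub>M M)) \<and>
     (\<forall>t\<ge>0. \<forall>x. integrable M (\<lambda>\<omega>. (cmod (u t x \<omega>))\<^sup>2)) \<and>
     (\<forall>T. \<exists>K. \<forall>t\<in>{0..T}. \<forall>x. (\<integral>\<omega>. (cmod (u t x \<omega>))\<^sup>2 \<partial>M) \<le> K) \<and>
     (\<forall>t\<ge>0. \<forall>x. ((\<lambda>y. \<integral>\<omega>. (cmod (u t y \<omega> - u t x \<omega>))\<^sup>2 \<partial>M) \<longlongrightarrow> 0) (at x)) \<and>
     (\<forall>x. AE \<omega> in M. u 0 x \<omega> = 0) \<and>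
     solves_evolution M f c g H u"

section \<open>Long-time behaviour\<close>

text \<open>
  For a centred Gaussian field, the limits of these two second moments determine the limits of
  all finite-dimensional laws of the time-shifted field; that they depend on \<open>t\<close> and \<open>s\<close>
  through \<open>t - s\<close> only is the stationarity of the limit.
\<close>

definition asymptotically_stationary ::
  "'w measure \<Rightarrow> (real \<Rightarrow> real \<Rightarrow> 'w \<Rightarrow> complex) \<Rightarrow> bool" where
  "asymptotically_stationary M u \<longleftrightarrow>
     (\<exists>R Q. \<forall>t s x y.
        ((\<lambda>T. \<integral>\<omega>. u (T + t) x \<omega> * cnj (u (T + s) y \<omega>) \<partial>M) \<longlongrightarrow> R (t - s) x y) at_top \<and>
        ((\<lambda>T. \<integral>\<omega>. u (T + t) x \<omega> * u (T + s) y \<omega> \<partial>M) \<longlongrightarrow> Q (t - s) x y) at_top)"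

definition weighted_spectrum ::
  "(real \<Rightarrow> real) \<Rightarrow> real \<Rightarrow> (real \<Rightarrow> real) \<Rightarrow> real \<Rightarrow> complex" where
  "weighted_spectrum g H C s =
     of_real (g s powr (2 * H + 1)) * fourier (\<lambda>x. complex_of_real (C x)) s"

text \<open>The values are real; they are complex-typed only because \<open>fourier\<close> is.\<close>

definition structure_const ::
  "real \<Rightarrow> (real \<Rightarrow> real) \<Rightarrow> real \<Rightarrow> (real \<Rightarrow> real) \<Rightarrow> complex" where
  "structure_const c g H C =
     of_real (1 / (2 * \<bar>c\<bar>) * ((2 * pi) powr (2 * H + 1) / (sin (pi * H) * Gamma (1 + 2 * H)))) *
     (LINT s|lborel. weighted_spectrum g H C s)"

end

theory Submission
  imports Defs
begin

text \<open>
  Conjugated by \<open>|k| powr (H + 1/2)\<close>, the evolution in Fourier space is transport at speed \<open>c\<close>,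
  so the solution is the stochastic integral over \<open>s\<close> of the forcing moved along the characteristics
  \<open>k \<mapsto> k + c (t - s)\<close>.  The forcing is an isometry from \<open>L\<^sup>2\<close> of the measure
  \<open>ds \<otimes> spectrum(k) dk\<close> into Gaussian variables, and the kernel of \<open>u(t, x)\<close> in that space is
  explicit; the solution is obtained as an almost sure limit along dyadic approximations of this kernel.
  Uniqueness holds because, for each square-integrable \<open>Z\<close>, the function \<open>E[u(t, x) Z*]\<close> of a difference
  of solutions solves the unforced transport equation and is tested against transported functions.
  The isometry gives the spectrum \<open>|k| powr - (2 H + 1) * G t k\<close>, where \<open>G t\<close> is the integral of the
  weighted spectrum over a segment of length \<open>\<bar>c\<bar> t\<close>, divided by \<open>\<bar>c\<bar>\<close>.  As \<open>t\<close> tends to infinity \<open>G\<close>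
  converges boundedly to a function that is \<open>0\<close> at one end of the line and \<open>mass / \<bar>c\<bar>\<close> at the other.
  Rescaling \<open>k\<close> by \<open>l\<close> in the structure function leaves in the limit only these two values, times
  the integral of \<open>(2 - 2 cos (2 pi k)) k powr - (2 H + 1)\<close> over the half line.
\<close>

section \<open>Schwartz functions and multipliers\<close>

text \<open>Each \<open>f \<Phi>\<close> is pinned down only up to a null set, and so is each
  instance of the weak equation; uncountably many points \<open>(t, x)\<close> or test functions
  cannot be handled path by path. This shapes both halves. For existence the field must be jointly
  measurable in \<open>(t, x, \<omega>)\<close>, hence \<open>t\<close>, \<open>x\<close> and the
  time of the forcing are rounded to dyadic numbers: each level uses countably many test functions,
  and the errors are summable enough for almost sure convergence. For uniqueness the equation is
  paired with one random variable \<open>Z\<close> before anything else is done with it. Moreover a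
  test function of the forcing has to decay in space, whereas the kernel of a point value is merely
  polynomially bounded in \<open>k\<close>; a Gaussian cutoff that fades with the level repairs
  this. Positivity of the spectral density follows from the existence of the forcing and is
  extracted from its variance. The condition \<open>H > 0\<close> enters through the integrability
  of \<open>g powr - (2 * H + 1)\<close>, which up to a constant dominates the spectra at all
  times.\<close>

definition slow_growth :: "(real \<Rightarrow> complex) \<Rightarrow> bool" where
  "slow_growth f \<longleftrightarrow> (\<exists>K m. \<forall>x. cmod (f x) \<le> K * (1 + \<bar>x\<bar>) ^ m)"

definition rapid_decay :: "(real \<Rightarrow> complex) \<Rightarrow> bool" where
  "rapid_decay f \<longleftrightarrow> (\<forall>m. \<exists>K. \<forall>x. cmod (f x) * (1 + \<bar>x\<bar>) ^ m \<le> K)"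

text \<open>This is the space usually called O_M: order and constant of the polynomial bound may
  depend on the derivative. Multiplication by its members preserves Schwartz functions, which is why
  powers of \<open>g\<close> may be applied to test functions.\<close>

definition multiplier :: "(real \<Rightarrow> complex) \<Rightarrow> bool" where
  "multiplier h \<longleftrightarrow> (\<exists>D. D 0 = h \<and>
     (\<forall>n x. (D n has_vector_derivative D (Suc n) x) (at x)) \<and> (\<forall>n. slow_growth (D n)))"

abbreviation vderiv :: "(real \<Rightarrow> complex) \<Rightarrow> real \<Rightarrow> complex" where
  "vderiv f \<equiv> (\<lambda>x. vector_derivative f (at x))"

text \<open>Iterating a chosen derivative inside \<open>S\<close> produces the whole sequence
  demanded by \<open>schwartz_def\<close>, so that smoothness becomes a closure property of a set
  and no formula for the n-th derivative is needed.\<close>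

lemma smooth_sequence:
  assumes "f \<in> S" "\<And>f. f \<in> S \<Longrightarrow> \<exists>f'\<in>S. \<forall>x. (f has_vector_derivative f' x) (at x)"
  obtains D where "D (0::nat) = f" "\<And>n. D n \<in> S" "\<And>n x. (D n has_vector_derivative D (Suc n) x) (at x)"
proof -
  obtain d where d: "\<And>f. f \<in> S \<Longrightarrow> d f \<in> S \<and> (\<forall>x. (f has_vector_derivative d f x) (at x))"
    using assms(2) by metis
  have S: "(d ^^ n) f \<in> S" for n by (induction n) (use assms(1) d in auto)
  show ?thesis
    by (rule that[of "\<lambda>n. (d ^^ n) f"]) (use S d in auto)
qed

lemma one_plus_power_le: "(1 + \<bar>x::real\<bar>) ^ m \<le> 2 ^ m * (1 + \<bar>x\<bar> ^ m)"
proof -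
  have "(1 + \<bar>x\<bar>) ^ m \<le> (2 * max 1 \<bar>x\<bar>) ^ m" by (intro power_mono) auto
  also have "\<dots> = 2 ^ m * (max 1 \<bar>x\<bar>) ^ m" by (simp add: power_mult_distrib)
  also have "(max 1 \<bar>x\<bar>) ^ m \<le> 1 + \<bar>x\<bar> ^ m" by (auto simp: max_def)
  finally show ?thesis by simp
qed

lemma rapid_decay_iff: "rapid_decay f \<longleftrightarrow> (\<forall>m. bounded (range (\<lambda>x. x ^ m *\<^sub>R f x)))"
proof
  assume f: "rapid_decay f"
  show "\<forall>m. bounded (range (\<lambda>x. x ^ m *\<^sub>R f x))"
  proof
    fix m
    obtain K where K: "\<And>x. cmod (f x) * (1 + \<bar>x\<bar>) ^ m \<le> K" using f unfolding rapid_decay_def by blast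
    have "norm (x ^ m *\<^sub>R f x) \<le> K" for x
    proof -
      have "norm (x ^ m *\<^sub>R f x) = cmod (f x) * \<bar>x\<bar> ^ m" by (simp add: power_abs)
      also have "\<dots> \<le> cmod (f x) * (1 + \<bar>x\<bar>) ^ m" by (intro mult_left_mono power_mono) auto
      finally show ?thesis using K[of x] by linarith
    qed
    then show "bounded (range (\<lambda>x. x ^ m *\<^sub>R f x))" unfolding bounded_iff by blast
  qed
next
  assume B: "\<forall>m. bounded (range (\<lambda>x. x ^ m *\<^sub>R f x))"
  show "rapid_decay f" unfolding rapid_decay_def
  proof
    fix m
    obtain K where K: "\<And>x. norm (x ^ m *\<^sub>R f x) \<le> K" using B unfolding bounded_iff by blast
    obtain K0 where K0: "\<And>x. norm (x ^ 0 *\<^sub>R f x) \<le> K0" using B unfolding bounded_iff by blast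
    have "cmod (f x) * (1 + \<bar>x\<bar>) ^ m \<le> 2 ^ m * (K0 + K)" for x
    proof -
      have "cmod (f x) * (1 + \<bar>x\<bar>) ^ m \<le> cmod (f x) * (2 ^ m * (1 + \<bar>x\<bar> ^ m))"
        by (intro mult_left_mono one_plus_power_le) auto
      also have "\<dots> = 2 ^ m * (cmod (f x) + cmod (f x) * \<bar>x\<bar> ^ m)" by (simp add: algebra_simps)
      also have "\<dots> \<le> 2 ^ m * (K0 + K)"
        using K[of x] K0[of x] by (intro mult_left_mono add_mono) (auto simp: power_abs mult.commute)
      finally show ?thesis .
    qed
    then show "\<exists>K. \<forall>x. cmod (f x) * (1 + \<bar>x\<bar>) ^ m \<le> K" by blast
  qed
qed

lemma schwartz_iff: "schwartz f \<longleftrightarrow> (\<exists>D. D 0 = f \<and>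
     (\<forall>n x. (D n has_vector_derivative D (Suc n) x) (at x)) \<and> (\<forall>n. rapid_decay (D n)))"
  unfolding schwartz_def rapid_decay_iff by (rule ex_cong1) blast

text \<open>Coinduction by an invariant: any set closed under differentiation and consisting of
  rapidly decaying functions lies inside the Schwartz space. Most closure properties below amount to
  the choice of a suitable \<open>S\<close>.\<close>

lemma schwartz_coinduct:
  assumes "f \<in> S" "\<And>f. f \<in> S \<Longrightarrow> \<exists>f'\<in>S. \<forall>x. (f has_vector_derivative f' x) (at x)"
    "\<And>f. f \<in> S \<Longrightarrow> rapid_decay f"
  shows "schwartz f"
  unfolding schwartz_iff by (rule smooth_sequence[OF assms(1,2)]) (use assms(3) in blast)+

lemma multiplier_coinduct:
  assumes "f \<in> S" "\<And>f. f \<in> S \<Longrightarrow> \<exists>f'\<in>S. \<forall>x. (f has_vector_derivative f' x) (at x)"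
    "\<And>f. f \<in> S \<Longrightarrow> slow_growth f"
  shows "multiplier f"
  unfolding multiplier_def by (rule smooth_sequence[OF assms(1,2)]) (use assms(3) in blast)+

lemma schwartz_rapid: "schwartz f \<Longrightarrow> rapid_decay f"
  unfolding schwartz_iff by metis

lemma multiplier_slow: "multiplier f \<Longrightarrow> slow_growth f"
  unfolding multiplier_def by metis

lemma schwartz_vderiv:
  assumes "schwartz f"
  shows "schwartz (vderiv f)" "(f has_vector_derivative vderiv f x) (at x)"
proof -
  obtain D where D: "D 0 = f" "\<And>n x. (D n has_vector_derivative D (Suc n) x) (at x)" "\<And>n. rapid_decay (D n)"
    using assms unfolding schwartz_iff by blast
  have e: "vderiv f = D (Suc 0)"
    using D(2)[of 0] unfolding D(1) by (auto intro!: ext vector_derivative_at)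
  show "schwartz (vderiv f)" unfolding schwartz_iff e
    by (rule exI[of _ "\<lambda>n. D (Suc n)"]) (use D in auto)
  show "(f has_vector_derivative vderiv f x) (at x)"
    using D(2)[of 0 x] unfolding D(1) using fun_cong[OF e, of x] by simp
qed

lemma multiplier_vderiv:
  assumes "multiplier f"
  shows "multiplier (vderiv f)" "(f has_vector_derivative vderiv f x) (at x)"
proof -
  obtain D where D: "D 0 = f" "\<And>n x. (D n has_vector_derivative D (Suc n) x) (at x)" "\<And>n. slow_growth (D n)"
    using assms unfolding multiplier_def by blast
  have e: "vderiv f = D (Suc 0)"
    using D(2)[of 0] unfolding D(1) by (auto intro!: ext vector_derivative_at)
  show "multiplier (vderiv f)" unfolding multiplier_def e
    by (rule exI[of _ "\<lambda>n. D (Suc n)"]) (use D in auto)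
  show "(f has_vector_derivative vderiv f x) (at x)"
    using D(2)[of 0 x] unfolding D(1) using fun_cong[OF e, of x] by simp
qed

lemma multiplier_has_deriv:
  "f \<in> Collect multiplier \<Longrightarrow> \<exists>f'\<in>Collect multiplier. \<forall>x. (f has_vector_derivative f' x) (at x)"
  by (rule bexI[of _ "vderiv f"]) (auto intro: multiplier_vderiv)

lemma schwartz_has_deriv:
  "(f :: real \<Rightarrow> complex) \<in> Collect schwartz \<Longrightarrow> \<exists>f'\<in>Collect schwartz. \<forall>x. (f has_vector_derivative f' x) (at x)"
  by (rule bexI[of _ "vderiv f"]) (auto intro: schwartz_vderiv)

lemma slow_growthE:
  assumes "slow_growth f"
  obtains K m where "K \<ge> 0" "\<And>x. cmod (f x) \<le> K * (1 + \<bar>x\<bar>) ^ m"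
proof -
  obtain K m where K: "\<And>x. cmod (f x) \<le> K * (1 + \<bar>x\<bar>) ^ m" using assms unfolding slow_growth_def by blast
  have "K \<ge> 0" using order_trans[OF norm_ge_zero K[of 0]] by simp
  then show ?thesis using that K by blast
qed

lemma slow_growth_add:
  assumes "slow_growth f" "slow_growth h" shows "slow_growth (\<lambda>x. f x + h x)"
proof -
  obtain K m where K: "K \<ge> 0" "\<And>x. cmod (f x) \<le> K * (1 + \<bar>x\<bar>) ^ m" by (rule slow_growthE[OF assms(1)]) blast
  obtain K' m' where K': "K' \<ge> 0" "\<And>x. cmod (h x) \<le> K' * (1 + \<bar>x\<bar>) ^ m'" by (rule slow_growthE[OF assms(2)]) blast
  have "cmod (f x + h x) \<le> (K + K') * (1 + \<bar>x\<bar>) ^ (m + m')" for x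
  proof -
    have "cmod (f x + h x) \<le> K * (1 + \<bar>x\<bar>) ^ m + K' * (1 + \<bar>x\<bar>) ^ m'"
      using K(2)[of x] K'(2)[of x] norm_triangle_ineq[of "f x" "h x"] by linarith
    also have "\<dots> \<le> K * (1 + \<bar>x\<bar>) ^ (m + m') + K' * (1 + \<bar>x\<bar>) ^ (m + m')"
      using K(1) K'(1) by (intro add_mono mult_left_mono power_increasing) auto
    finally show ?thesis by (simp add: algebra_simps)
  qed
  then show ?thesis unfolding slow_growth_def by blast
qed

lemma slow_growth_mult:
  assumes "slow_growth f" "slow_growth h" shows "slow_growth (\<lambda>x. f x * h x)"
proof -
  obtain K m where K: "K \<ge> 0" "\<And>x. cmod (f x) \<le> K * (1 + \<bar>x\<bar>) ^ m" by (rule slow_growthE[OF assms(1)]) blast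
  obtain K' m' where K': "K' \<ge> 0" "\<And>x. cmod (h x) \<le> K' * (1 + \<bar>x\<bar>) ^ m'" by (rule slow_growthE[OF assms(2)]) blast
  have "cmod (f x * h x) \<le> (K * K') * (1 + \<bar>x\<bar>) ^ (m + m')" for x
  proof -
    have "cmod (f x * h x) \<le> (K * (1 + \<bar>x\<bar>) ^ m) * (K' * (1 + \<bar>x\<bar>) ^ m')"
      unfolding norm_mult using K K' by (intro mult_mono) auto
    then show ?thesis by (simp add: algebra_simps power_add)
  qed
  then show ?thesis unfolding slow_growth_def by blast
qed

lemma rapid_decay_add:
  assumes "rapid_decay f" "rapid_decay h" shows "rapid_decay (\<lambda>x. f x + h x)"
  unfolding rapid_decay_def
proof
  fix m
  obtain K where K: "\<And>x. cmod (f x) * (1 + \<bar>x\<bar>) ^ m \<le> K" using assms(1) unfolding rapid_decay_def by blast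
  obtain K' where K': "\<And>x. cmod (h x) * (1 + \<bar>x\<bar>) ^ m \<le> K'" using assms(2) unfolding rapid_decay_def by blast
  have "cmod (f x + h x) * (1 + \<bar>x\<bar>) ^ m \<le> K + K'" for x
  proof -
    have "cmod (f x + h x) * (1 + \<bar>x\<bar>) ^ m \<le> (cmod (f x) + cmod (h x)) * (1 + \<bar>x\<bar>) ^ m"
      by (intro mult_right_mono norm_triangle_ineq) auto
    then show ?thesis using K[of x] K'[of x] by (simp add: algebra_simps)
  qed
  then show "\<exists>K. \<forall>x. cmod (f x + h x) * (1 + \<bar>x\<bar>) ^ m \<le> K" by blast
qed

lemma rapid_decay_mult:
  assumes "slow_growth f" "rapid_decay h" shows "rapid_decay (\<lambda>x. f x * h x)"
  unfolding rapid_decay_def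
proof
  fix m
  obtain K j where K: "K \<ge> 0" "\<And>x. cmod (f x) \<le> K * (1 + \<bar>x\<bar>) ^ j" by (rule slow_growthE[OF assms(1)]) blast
  obtain K' where K': "\<And>x. cmod (h x) * (1 + \<bar>x\<bar>) ^ (j + m) \<le> K'" using assms(2) unfolding rapid_decay_def by blast
  have "cmod (f x * h x) * (1 + \<bar>x\<bar>) ^ m \<le> K * K'" for x
  proof -
    have "cmod (f x * h x) * (1 + \<bar>x\<bar>) ^ m \<le> (K * (1 + \<bar>x\<bar>) ^ j) * cmod (h x) * (1 + \<bar>x\<bar>) ^ m"
      unfolding norm_mult using K by (intro mult_right_mono) auto
    also have "\<dots> = K * (cmod (h x) * (1 + \<bar>x\<bar>) ^ (j + m))" by (simp add: algebra_simps power_add)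
    also have "\<dots> \<le> K * K'" using K(1) K' by (intro mult_left_mono) auto
    finally show ?thesis .
  qed
  then show "\<exists>K. \<forall>x. cmod (f x * h x) * (1 + \<bar>x\<bar>) ^ m \<le> K" by blast
qed

lemma slow_growth_const: "slow_growth (\<lambda>x. a)"
  unfolding slow_growth_def by (rule exI[of _ "cmod a"], rule exI[of _ 0]) auto

lemma rapid_slow_growth: "rapid_decay f \<Longrightarrow> slow_growth f"
  unfolding rapid_decay_def slow_growth_def
  by (drule spec[of _ 0]) (metis mult.right_neutral power_0)

text \<open>The Leibniz rule turns a product into a sum of two products; this is the smallest family
  that contains the products and is stable under that step. It replaces the binomial formula for
  higher derivatives.\<close>

inductive_set product_sums :: "(real \<Rightarrow> complex) set \<Rightarrow> (real \<Rightarrow> complex) set \<Rightarrow> (real \<Rightarrow> complex) set"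
  for A B where
  mult: "f \<in> A \<Longrightarrow> h \<in> B \<Longrightarrow> (\<lambda>x. f x * h x) \<in> product_sums A B"
| add: "f \<in> product_sums A B \<Longrightarrow> h \<in> product_sums A B \<Longrightarrow> (\<lambda>x. f x + h x) \<in> product_sums A B"

lemma product_sums_deriv:
  assumes "\<And>f. f \<in> A \<Longrightarrow> \<exists>f'\<in>A. \<forall>x. (f has_vector_derivative f' x) (at x)"
    "\<And>f. f \<in> B \<Longrightarrow> \<exists>f'\<in>B. \<forall>x. (f has_vector_derivative f' x) (at x)"
    "f \<in> product_sums A B"
  shows "\<exists>f'\<in>product_sums A B. \<forall>x. (f has_vector_derivative f' x) (at x)"
  using assms(3)
proof induction
  case (mult f h)
  obtain f' where f': "f' \<in> A" "\<And>x. (f has_vector_derivative f' x) (at x)" using assms(1) mult by metis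
  obtain h' where h': "h' \<in> B" "\<And>x. (h has_vector_derivative h' x) (at x)" using assms(2) mult by metis
  have "(\<lambda>x. f x * h' x + f' x * h x) \<in> product_sums A B"
    by (intro product_sums.add product_sums.mult f' h' mult)
  moreover have "((\<lambda>x. f x * h x) has_vector_derivative (f x * h' x + f' x * h x)) (at x)" for x
    by (intro has_vector_derivative_mult f' h')
  ultimately show ?case by (intro bexI[of _ "\<lambda>x. f x * h' x + f' x * h x"] allI)
next
  case (add f h)
  then obtain f' h' where "f' \<in> product_sums A B" "\<And>x. (f has_vector_derivative f' x) (at x)"
    "h' \<in> product_sums A B" "\<And>x. (h has_vector_derivative h' x) (at x)" by metis
  then show ?case
    by (intro bexI[of _ "\<lambda>x. f' x + h' x"]) (auto intro: product_sums.add has_vector_derivative_add)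
qed

lemma multiplier_mult:
  assumes "multiplier f" "multiplier h" shows "multiplier (\<lambda>x. f x * h x)"
proof (rule multiplier_coinduct[of _ "product_sums (Collect multiplier) (Collect multiplier)"])
  show "(\<lambda>x. f x * h x) \<in> product_sums (Collect multiplier) (Collect multiplier)"
    using assms by (auto intro: product_sums.mult)
  show "\<exists>f'\<in>product_sums (Collect multiplier) (Collect multiplier). \<forall>x. (f has_vector_derivative f' x) (at x)"
    if "f \<in> product_sums (Collect multiplier) (Collect multiplier)" for f
    using product_sums_deriv[OF multiplier_has_deriv multiplier_has_deriv that] .
  show "slow_growth f" if "f \<in> product_sums (Collect multiplier) (Collect multiplier)" for f
    using that by induction (auto intro: slow_growth_mult slow_growth_add multiplier_slow)
qed

lemma multiplier_times_schwartz:
  assumes "multiplier f" "schwartz h" shows "schwartz (\<lambda>x. f x * h x)"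
proof (rule schwartz_coinduct[of _ "product_sums (Collect multiplier) (Collect schwartz)"])
  show "(\<lambda>x. f x * h x) \<in> product_sums (Collect multiplier) (Collect schwartz)"
    using assms by (auto intro: product_sums.mult)
  show "\<exists>f'\<in>product_sums (Collect multiplier) (Collect schwartz). \<forall>x. (f has_vector_derivative f' x) (at x)"
    if "f \<in> product_sums (Collect multiplier) (Collect schwartz)" for f
    using product_sums_deriv[OF multiplier_has_deriv schwartz_has_deriv that] .
  show "rapid_decay f" if "f \<in> product_sums (Collect multiplier) (Collect schwartz)" for f
    using that by induction (auto intro: rapid_decay_mult rapid_decay_add multiplier_slow schwartz_rapid)
qed

lemma multiplier_const: "multiplier (\<lambda>x. a)"
  by (rule multiplier_coinduct[of _ "range (\<lambda>a x. a)"])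
     (auto intro!: slow_growth_const exI[of _ 0] has_vector_derivative_const simp: bex_simps)

lemma multiplier_add:
  assumes "multiplier f" "multiplier h" shows "multiplier (\<lambda>x. f x + h x)"
proof (rule multiplier_coinduct[of _ "{\<lambda>x. f x + h x | f h. multiplier f \<and> multiplier h}"])
  fix u assume "u \<in> {\<lambda>x. f x + h x | f h. multiplier f \<and> multiplier h}"
  then obtain f h where *: "u = (\<lambda>x. f x + h x)" "multiplier f" "multiplier h" by blast
  show "slow_growth u" unfolding * using * by (intro slow_growth_add multiplier_slow)
  show "\<exists>f'\<in>{\<lambda>x. f x + h x | f h. multiplier f \<and> multiplier h}. \<forall>x. (u has_vector_derivative f' x) (at x)"
    unfolding *(1) using *(2,3)
    by (intro bexI[of _ "\<lambda>x. vderiv f x + vderiv h x"])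
       (auto intro!: has_vector_derivative_add multiplier_vderiv)
qed (use assms in blast)

lemma schwartz_add:
  assumes "schwartz f" "schwartz h" shows "schwartz (\<lambda>x. f x + h x :: complex)"
proof (rule schwartz_coinduct[of _ "{\<lambda>x. f x + h x | f h. schwartz f \<and> schwartz h}"])
  fix u :: "real \<Rightarrow> complex" assume "u \<in> {\<lambda>x. f x + h x | f h. schwartz f \<and> schwartz h}"
  then obtain f h where *: "u = (\<lambda>x. f x + h x)" "schwartz f" "schwartz h" by blast
  show "rapid_decay u" unfolding * using * by (intro rapid_decay_add schwartz_rapid)
  show "\<exists>f'\<in>{\<lambda>x. f x + h x | f h. schwartz f \<and> schwartz h}. \<forall>x. (u has_vector_derivative f' x) (at x)"
    unfolding *(1) using *(2,3)
    by (intro bexI[of _ "\<lambda>x. vderiv f x + vderiv h x"])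
       (auto intro!: has_vector_derivative_add schwartz_vderiv)
qed (use assms in blast)

lemma schwartz_scale: "schwartz f \<Longrightarrow> schwartz (\<lambda>x. a * f x :: complex)"
  by (rule multiplier_times_schwartz[OF multiplier_const])

lemma schwartz_diff:
  assumes "schwartz f" "schwartz h" shows "schwartz (\<lambda>x. f x - h x :: complex)"
  using schwartz_add[OF assms(1) schwartz_scale[OF assms(2), of "-1"]] by simp

lemma multiplier_of_real: "multiplier of_real"
proof (rule multiplier_coinduct[of _ "insert of_real (Collect multiplier)"])
  fix f :: "real \<Rightarrow> complex" assume f: "f \<in> insert of_real (Collect multiplier)"
  show "slow_growth f"
  proof (cases "f = of_real")
    case True then show ?thesis unfolding slow_growth_def
      by (intro exI[of _ 1] exI[of _ 1]) auto
  qed (use f multiplier_slow in blast)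
  show "\<exists>f'\<in>insert of_real (Collect multiplier). \<forall>x. (f has_vector_derivative f' x) (at x)"
  proof (cases "f = of_real")
    case True
    have "((of_real :: real \<Rightarrow> complex) has_vector_derivative 1) (at x)" for x
      using has_vector_derivative_of_real[OF DERIV_ident[of "at x"]] by (simp add: id_def)
    then show ?thesis unfolding True by (intro bexI[of _ "\<lambda>x. 1"]) (simp_all add: multiplier_const)
  next
    case False
    then have "f \<in> Collect multiplier" using f by blast
    from multiplier_has_deriv[OF this] show ?thesis by blast
  qed
qed auto

lemma has_vector_derivative_cis_mult:
  "((\<lambda>x. cis (r * x)) has_vector_derivative (\<i> * of_real r * cis (r * x))) (at x)"
proof -
  have "((cis \<circ> (\<lambda>x. r * x)) has_vector_derivative (r *\<^sub>R (\<i> * cis (r * x)))) (at x)"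
  proof (rule vector_diff_chain_at)
    show "((\<lambda>y. r * y) has_vector_derivative r) (at x)"
      by (auto intro!: derivative_eq_intros simp: has_real_derivative_iff_has_vector_derivative[symmetric])
    show "(cis has_vector_derivative (\<i> * cis (r * x))) (at (r * x))"
      unfolding has_vector_derivative_def using has_derivative_cis[of "\<lambda>x. x" "\<lambda>x. x" "r * x" UNIV]
      by (simp add: scaleR_conv_of_real algebra_simps)
  qed
  then show ?thesis by (simp add: o_def scaleR_conv_of_real algebra_simps)
qed

lemma multiplier_cis: "multiplier (\<lambda>x. cis (r * x))"
proof (rule multiplier_coinduct[of _ "range (\<lambda>a x. a * cis (r * x))"])
  show "(\<lambda>x. cis (r * x)) \<in> range (\<lambda>a x. a * cis (r * x))"
    by (rule image_eqI[of _ _ 1]) auto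
  fix f assume "f \<in> range (\<lambda>a x. a * cis (r * x))"
  then obtain a where f: "f = (\<lambda>x. a * cis (r * x))" by blast
  show "slow_growth f" unfolding f slow_growth_def
    by (rule exI[of _ "cmod a"], rule exI[of _ 0]) (auto simp: norm_mult)
  have "(f has_vector_derivative (a * \<i> * of_real r) * cis (r * x)) (at x)" for x
    unfolding f using has_vector_derivative_mult_right[OF has_vector_derivative_cis_mult[of r x], of a]
    by (simp add: algebra_simps)
  then show "\<exists>f'\<in>range (\<lambda>a x. a * cis (r * x)). \<forall>x. (f has_vector_derivative f' x) (at x)"
    by (intro bexI[of _ "\<lambda>x. (a * \<i> * of_real r) * cis (r * x)"]) auto
qed

lemma power_times_gauss_bounded:
  assumes "e > 0" shows "\<exists>K. \<forall>x::real. (1 + \<bar>x\<bar>) ^ m * exp (- e * x\<^sup>2) \<le> K"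
proof -
  \<comment> \<open>For \<open>\<bar>x\<bar>\<close> beyond \<open>q\<close> one has
    \<open>2 * m * \<bar>x\<bar> \<le> e * x\<^sup>2\<close>, so the Gaussian beats
    \<open>exp (m * \<bar>x\<bar>)\<close>, which in turn bounds the power; below \<open>q\<close>
    the power is at most \<open>(1 + q) ^ m\<close>.\<close>
  define q where "q = max 1 (2 * real m / e)"
  have "(1 + \<bar>x\<bar>) ^ m * exp (- e * x\<^sup>2) \<le> (1 + q) ^ m + exp (2 * real m)" for x
  proof (cases "\<bar>x\<bar> \<le> q")
    case True
    have "(1 + \<bar>x\<bar>) ^ m * exp (- e * x\<^sup>2) \<le> (1 + q) ^ m * 1"
      using True assms by (intro mult_mono power_mono) auto
    then show ?thesis by (simp add: add_increasing2)
  next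
    case False
    have x1: "\<bar>x\<bar> \<ge> 1" "\<bar>x\<bar> \<ge> 2 * real m / e" using False by (auto simp: q_def)
    have "1 + \<bar>x\<bar> \<le> exp \<bar>x\<bar>" by (rule exp_ge_add_one_self)
    then have "(1 + \<bar>x\<bar>) ^ m \<le> exp \<bar>x\<bar> ^ m" by (intro power_mono) auto
    also have "\<dots> = exp (real m * \<bar>x\<bar>)" by (simp add: exp_of_nat_mult)
    finally have a: "(1 + \<bar>x\<bar>) ^ m \<le> exp (real m * \<bar>x\<bar>)" .
    have "2 * real m \<le> e * \<bar>x\<bar>" using x1(2) assms by (simp add: field_simps)
    then have "2 * real m * \<bar>x\<bar> \<le> e * \<bar>x\<bar> * \<bar>x\<bar>" by (intro mult_right_mono) auto
    then have "2 * (real m * \<bar>x\<bar>) \<le> e * x\<^sup>2" by (simp add: power2_eq_square algebra_simps)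
    then have b: "real m * \<bar>x\<bar> - e * x\<^sup>2 \<le> 0"
      by (smt (verit) mult_nonneg_nonneg of_nat_0_le_iff abs_ge_zero)
    have "(1 + \<bar>x\<bar>) ^ m * exp (- e * x\<^sup>2) \<le> exp (real m * \<bar>x\<bar>) * exp (- e * x\<^sup>2)"
      using a by (intro mult_right_mono) auto
    also have "\<dots> = exp (real m * \<bar>x\<bar> - e * x\<^sup>2)" by (simp add: exp_add[symmetric])
    also have "\<dots> \<le> 1" using b by simp
    also have "\<dots> \<le> exp (2 * real m)" by simp
    finally show ?thesis using \<open>\<bar>x\<bar> \<ge> 1\<close> by (smt (verit) zero_le_power q_def)
  qed
  then show ?thesis by blast
qed

text \<open>The invariant set consists of multipliers times the fixed Gaussian: differentiation
  sends the multiplier \<open>p\<close> to \<open>p' - 2 * e * x * p\<close>, again a multiplier,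
  and the decay always comes from the Gaussian.\<close>

lemma schwartz_gauss:
  assumes "e > 0" shows "schwartz (\<lambda>x. of_real (exp (- e * x\<^sup>2)) :: complex)"
proof (rule schwartz_coinduct[of _ "{\<lambda>x. p x * of_real (exp (- e * x\<^sup>2)) | p. multiplier p}"])
  show "(\<lambda>x. of_real (exp (- e * x\<^sup>2))) \<in> {\<lambda>x. p x * complex_of_real (exp (- e * x\<^sup>2)) | p. multiplier p}"
    using multiplier_const[of 1] by (auto intro!: exI[of _ "\<lambda>x. 1"])
  fix f assume "f \<in> {\<lambda>x. p x * complex_of_real (exp (- e * x\<^sup>2)) | p. multiplier p}"
  then obtain p where p: "f = (\<lambda>x. p x * complex_of_real (exp (- e * x\<^sup>2)))" "multiplier p" by blast
  have "rapid_decay (\<lambda>x. complex_of_real (exp (- e * x\<^sup>2)))"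
    unfolding rapid_decay_def using power_times_gauss_bounded[OF assms] by (auto simp: mult.commute)
  then show "rapid_decay f" unfolding p(1) using p(2) by (intro rapid_decay_mult multiplier_slow)
  define p' where "p' = (\<lambda>x. vderiv p x + p x * (of_real (-2 * e) * of_real x))"
  have p': "multiplier p'" unfolding p'_def
    by (intro multiplier_add multiplier_mult multiplier_const multiplier_of_real p multiplier_vderiv)
  have "(f has_vector_derivative p' x * of_real (exp (- e * x\<^sup>2))) (at x)" for x
  proof -
    have "((\<lambda>x. exp (- e * x\<^sup>2)) has_field_derivative (exp (- e * x\<^sup>2) * (- e * (2 * x)))) (at x)"
      by (auto intro!: derivative_eq_intros)
    from has_vector_derivative_mult[OF multiplier_vderiv(2)[OF p(2), of x] has_vector_derivative_of_real[OF this]]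
    show ?thesis unfolding p(1) p'_def by (simp add: algebra_simps)
  qed
  then show "\<exists>f'\<in>{\<lambda>x. p x * complex_of_real (exp (- e * x\<^sup>2)) | p. multiplier p}.
    \<forall>x. (f has_vector_derivative f' x) (at x)" using p' by (intro bexI[of _ "\<lambda>x. p' x * complex_of_real (exp (- e * x\<^sup>2))"]) auto
qed

lemma schwartz_cnj: assumes "schwartz f" shows "schwartz (\<lambda>x. cnj (f x))"
proof (rule schwartz_coinduct[of _ "{\<lambda>x. cnj (f x) | f. schwartz f}"])
  fix u assume "u \<in> {\<lambda>x. cnj (f x) | f. schwartz f}"
  then obtain f where u: "u = (\<lambda>x. cnj (f x))" "schwartz f" by blast
  show "rapid_decay u" unfolding u(1) using schwartz_rapid[OF u(2)] unfolding rapid_decay_def by simp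
  show "\<exists>f'\<in>{\<lambda>x. cnj (f x) | f. schwartz f}. \<forall>x. (u has_vector_derivative f' x) (at x)"
    unfolding u(1) using schwartz_vderiv[OF u(2)]
    by (intro bexI[of _ "\<lambda>x. cnj (vderiv f x)"]) (auto intro!: has_vector_derivative_cnj)
qed (use assms in blast)

text \<open>Peetre's inequality: polynomial weights survive translations of bounded size with a
  constant that depends only on the bound \<open>R\<close>. It serves the estimates that must be
  uniform along the characteristics.\<close>

lemma one_plus_shift_le:
  fixes r R x :: real
  assumes "\<bar>r\<bar> \<le> R" shows "(1 + \<bar>x\<bar>) \<le> (1 + R) * (1 + \<bar>x + r\<bar>)"
proof -
  have "1 + \<bar>x\<bar> \<le> 1 + \<bar>x + r\<bar> + R" using assms by (smt (verit))
  also have "\<dots> \<le> (1 + R) * (1 + \<bar>x + r\<bar>)" using assms by (simp add: algebra_simps)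
  finally show ?thesis .
qed

lemma schwartz_shift: assumes "schwartz f" shows "schwartz (\<lambda>x. f (x + r) :: complex)"
proof (rule schwartz_coinduct[of _ "{\<lambda>x. f (x + r) | f. schwartz f}"])
  fix u :: "real \<Rightarrow> complex" assume "u \<in> {\<lambda>x. f (x + r) | f. schwartz f}"
  then obtain f where u: "u = (\<lambda>x. f (x + r))" "schwartz f" by blast
  show "rapid_decay u" unfolding u(1) rapid_decay_def
  proof
    fix m
    obtain K where K: "\<And>x. cmod (f x) * (1 + \<bar>x\<bar>) ^ m \<le> K" using schwartz_rapid[OF u(2)] unfolding rapid_decay_def by blast
    have "cmod (f (x + r)) * (1 + \<bar>x\<bar>) ^ m \<le> (1 + \<bar>r\<bar>) ^ m * K" for x
    proof -
      have "cmod (f (x + r)) * (1 + \<bar>x\<bar>) ^ m \<le> cmod (f (x + r)) * ((1 + \<bar>r\<bar>) * (1 + \<bar>x + r\<bar>)) ^ m"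
        by (intro mult_left_mono power_mono one_plus_shift_le) auto
      also have "\<dots> = (1 + \<bar>r\<bar>) ^ m * (cmod (f (x + r)) * (1 + \<bar>x + r\<bar>) ^ m)" by (simp add: power_mult_distrib)
      also have "\<dots> \<le> (1 + \<bar>r\<bar>) ^ m * K" by (intro mult_left_mono K) auto
      finally show ?thesis .
    qed
    then show "\<exists>K. \<forall>x. cmod (f (x + r)) * (1 + \<bar>x\<bar>) ^ m \<le> K" by blast
  qed
  have "((\<lambda>x. f (x + r)) has_vector_derivative vderiv f (x + r)) (at x)" for x
  proof -
    have "((f \<circ> (\<lambda>x. x + r)) has_vector_derivative (1 *\<^sub>R vderiv f (x + r))) (at x)"
      by (rule vector_diff_chain_at) (auto intro!: derivative_eq_intros schwartz_vderiv[OF u(2)])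
    then show ?thesis by (simp add: o_def)
  qed
  then show "\<exists>f'\<in>{\<lambda>x. f (x + r) | f. schwartz f}. \<forall>x. (u has_vector_derivative f' x) (at x)"
    unfolding u(1) using schwartz_vderiv[OF u(2)] by (intro bexI[of _ "\<lambda>x. vderiv f (x + r)"]) auto
qed (use assms in blast)

lemma schwartz_reflect: assumes "schwartz f" shows "schwartz (\<lambda>x. f (- x) :: complex)"
proof (rule schwartz_coinduct[of _ "{\<lambda>x. f (- x) | f. schwartz f}"])
  fix u :: "real \<Rightarrow> complex" assume "u \<in> {\<lambda>x. f (- x) | f. schwartz f}"
  then obtain f where u: "u = (\<lambda>x. f (- x))" "schwartz f" by blast
  show "rapid_decay u" unfolding u(1) rapid_decay_def
    using schwartz_rapid[OF u(2)] unfolding rapid_decay_def by (metis abs_minus_cancel)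
  have "((\<lambda>x. f (- x)) has_vector_derivative (-1) * vderiv f (- x)) (at x)" for x
  proof -
    have "((f \<circ> (\<lambda>x. - x)) has_vector_derivative ((- 1) *\<^sub>R vderiv f (- x))) (at x)"
      by (rule vector_diff_chain_at) (auto intro!: derivative_eq_intros schwartz_vderiv[OF u(2)])
    then show ?thesis by (simp add: o_def)
  qed
  then show "\<exists>f'\<in>{\<lambda>x. f (- x) | f. schwartz f}. \<forall>x. (u has_vector_derivative f' x) (at x)"
    unfolding u(1) using schwartz_scale[OF schwartz_vderiv(1)[OF u(2)], of "-1"]
    by (intro bexI[of _ "\<lambda>x. (-1) * vderiv f (- x)"]) (auto intro!: exI[of _ "\<lambda>x. - vderiv f x"])
qed (use assms in blast)

lemma schwartz_of_real: assumes "schwartz (C :: real \<Rightarrow> real)" shows "schwartz (\<lambda>x. complex_of_real (C x))"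
proof -
  obtain D where D: "D 0 = C" "\<And>n x. (D n has_vector_derivative D (Suc n) x) (at x)"
    "\<And>m n. bounded (range (\<lambda>x. x ^ m *\<^sub>R D n x))"
    using assms unfolding schwartz_def by blast
  have "bounded (range (\<lambda>x. x ^ m *\<^sub>R complex_of_real (D n x)))" for m n
    using D(3)[of m n] unfolding bounded_iff by (simp add: norm_mult abs_mult)
  moreover have "((\<lambda>x. complex_of_real (D n x)) has_vector_derivative complex_of_real (D (Suc n) x)) (at x)" for n x
    using D(2)[of n x] by (intro has_vector_derivative_of_real) (simp add: has_real_derivative_iff_has_vector_derivative)
  ultimately show ?thesis unfolding schwartz_def
    by (intro exI[of _ "\<lambda>n x. complex_of_real (D n x)"]) (use D(1) in auto)
qed

text \<open>Meant for functions given as integrals, whose derivative is visibly Schwartz. The decay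
  of the function itself has to be supplied, since an antiderivative need not vanish at both ends of
  the line.\<close>

lemma schwartz_antiderivative:
  assumes "rapid_decay f" "schwartz f'" "\<And>x. (f has_vector_derivative f' x) (at x)"
  shows "schwartz f"
  by (rule schwartz_coinduct[of _ "insert f (Collect schwartz)"])
     (use assms schwartz_has_deriv schwartz_rapid in blast)+

lemma multiplier_continuous: "multiplier f \<Longrightarrow> continuous_on UNIV f"
  by (meson continuous_at_imp_continuous_on has_vector_derivative_continuous multiplier_vderiv(2))

lemma schwartz_continuous: "schwartz f \<Longrightarrow> continuous_on UNIV (f :: real \<Rightarrow> complex)"
  by (meson continuous_at_imp_continuous_on has_vector_derivative_continuous schwartz_vderiv(2))

lemma schwartz_measurable: "schwartz f \<Longrightarrow> (f :: real \<Rightarrow> complex) \<in> borel_measurable borel"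
  by (rule borel_measurable_continuous_onI[OF schwartz_continuous])

lemma multiplier_measurable: "multiplier f \<Longrightarrow> f \<in> borel_measurable borel"
  by (rule borel_measurable_continuous_onI[OF multiplier_continuous])

section \<open>The Fourier transform of Schwartz functions\<close>

lemma integrable_inverse_square: "integrable lborel (\<lambda>x::real. 1 / (1 + x\<^sup>2))"
  using integrable_inverse_1_plus_square by (simp add: set_integrable_def inverse_eq_divide)

lemma integrable_le_inverse_square:
  fixes f :: "real \<Rightarrow> 'a::{banach, second_countable_topology}"
  assumes "f \<in> borel_measurable borel" "\<And>x. norm (f x) \<le> K / (1 + x\<^sup>2)"
  shows "integrable lborel f"
proof (rule Bochner_Integration.integrable_bound)
  show "integrable lborel (\<lambda>x. K * (1 / (1 + x\<^sup>2)))"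
    by (intro integrable_mult_right integrable_inverse_square)
  show "AE x in lborel. norm (f x) \<le> norm (K * (1 / (1 + x\<^sup>2)))"
  proof (intro AE_I2)
    fix x show "norm (f x) \<le> norm (K * (1 / (1 + x\<^sup>2)))"
      using order_trans[OF assms(2)[of x] abs_ge_self[of "K / (1 + x\<^sup>2)"]] by simp
  qed
qed (use assms in simp)

lemma rapid_decay_bound:
  assumes "rapid_decay f" obtains K where "K \<ge> 0" "\<And>x. cmod (f x) \<le> K / (1 + x\<^sup>2)"
proof -
  obtain K where K: "\<And>x. cmod (f x) * (1 + \<bar>x\<bar>) ^ 2 \<le> K" using assms unfolding rapid_decay_def by blast
  have "cmod (f x) \<le> K / (1 + x\<^sup>2)" for x
  proof -
    have "cmod (f x) * (1 + x\<^sup>2) \<le> cmod (f x) * (1 + \<bar>x\<bar>) ^ 2"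
      by (intro mult_left_mono) (auto simp: power2_eq_square algebra_simps)
    then have "cmod (f x) * (1 + x\<^sup>2) \<le> K" using K[of x] by linarith
    moreover have "1 + x\<^sup>2 > 0" by (simp add: add_pos_nonneg)
    ultimately show ?thesis by (simp add: pos_le_divide_eq)
  qed
  moreover have "K \<ge> 0" using order_trans[OF mult_nonneg_nonneg[OF norm_ge_zero] K[of 0]] by simp
  ultimately show ?thesis using that by blast
qed

lemma schwartz_integrable:
  assumes "schwartz (f :: real \<Rightarrow> complex)" shows "integrable lborel f"
  by (rule rapid_decay_bound[OF schwartz_rapid[OF assms]])
     (rule integrable_le_inverse_square[OF schwartz_measurable[OF assms]])

lemma schwartz_bounded:
  assumes "schwartz (f :: real \<Rightarrow> complex)" obtains B where "\<And>x. cmod (f x) \<le> B"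
  using schwartz_rapid[OF assms] unfolding rapid_decay_def
  by (metis mult.right_neutral power_0)

lemma schwartz_tendsto_zero:
  assumes "schwartz (f :: real \<Rightarrow> complex)"
  shows "(f \<longlongrightarrow> 0) at_top" "(f \<longlongrightarrow> 0) at_bot"
proof -
  obtain K where K: "\<And>x. cmod (f x) \<le> K / (1 + x\<^sup>2)"
    using rapid_decay_bound[OF schwartz_rapid[OF assms]] by blast
  have 1: "((\<lambda>x::real. K / (1 + x\<^sup>2)) \<longlongrightarrow> 0) at_top"
    by (intro tendsto_divide_0[OF tendsto_const] filterlim_at_top_imp_at_infinity
        filterlim_tendsto_add_at_top[OF tendsto_const] filterlim_pow_at_top filterlim_ident) auto
  have 2: "((\<lambda>x::real. K / (1 + x\<^sup>2)) \<longlongrightarrow> 0) at_bot"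
    using 1 unfolding filterlim_at_bot_mirror by simp
  show "(f \<longlongrightarrow> 0) at_top" by (rule Lim_null_comparison[OF _ 1]) (use K in simp)
  show "(f \<longlongrightarrow> 0) at_bot" by (rule Lim_null_comparison[OF _ 2]) (use K in simp)
qed

lemma integral_vderiv_schwartz:
  assumes "schwartz f" shows "(LINT x|lborel. vderiv f x) = 0"
proof -
  have "(LBINT x=-\<infinity>..\<infinity>. vderiv f x) = 0 - 0"
  proof (rule interval_integral_FTC_integrable)
    show "isCont (vderiv f) x" for x
      using schwartz_continuous[OF schwartz_vderiv(1)[OF assms]] by (simp add: continuous_on_eq_continuous_at)
    show "set_integrable lborel (einterval (-\<infinity>) \<infinity>) (vderiv f)"
      using schwartz_integrable[OF schwartz_vderiv(1)[OF assms]] by (simp add: set_integrable_def)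
    show "((f \<circ> real_of_ereal) \<longlongrightarrow> 0) (at_right (- \<infinity>))" "((f \<circ> real_of_ereal) \<longlongrightarrow> 0) (at_left \<infinity>)"
      using schwartz_tendsto_zero[OF assms] by (simp_all add: ereal_tendsto_simps)
  qed (use schwartz_vderiv(2)[OF assms] in auto)
  then show ?thesis by (simp add: interval_lebesgue_integral_def set_lebesgue_integral_def)
qed

section \<open>Derivatives and decay of Fourier transforms\<close>

lemma measurable_cis [measurable]: "cis \<in> borel_measurable borel"
  by (intro borel_measurable_continuous_onI continuous_intros)

lemma integrable_cis_mult:
  assumes "integrable M f" "h \<in> borel_measurable M"
  shows "integrable M (\<lambda>x. cis (h x) * f x)"
  by (rule Bochner_Integration.integrable_bound[OF assms(1)])
     (use assms in \<open>auto simp: norm_mult borel_measurable_integrable\<close>)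

lemma fourier_norm_le:
  assumes "integrable lborel f" shows "cmod (fourier f k) \<le> (LINT x|lborel. cmod (f x))"
  unfolding fourier_def
  by (rule order_trans[OF integral_norm_bound]) (simp add: norm_mult)

lemma fourier_inv_eq: "fourier_inv f k = fourier f (- k)"
  unfolding fourier_def fourier_inv_def by (simp add: mult.commute mult.left_commute)

lemma fourier_inv_eq_reflect: "fourier_inv f = fourier (\<lambda>x. f (- x))"
proof
  fix k
  show "fourier_inv f k = fourier (\<lambda>x. f (- x)) k"
    unfolding fourier_def fourier_inv_def
    by (subst lborel_integral_real_affine[of "-1" _ 0]) (auto simp: mult.commute mult.left_commute)
qed

text \<open>A quadratic remainder is what the second-order estimate of \<open>cis\<close> delivers
  after integration, so the Fourier transform can be differentiated under the integral sign with an
  explicit error instead of dominated convergence.\<close>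

lemma has_vector_derivative_quadratic:
  fixes f :: "real \<Rightarrow> 'a::real_normed_vector"
  assumes "\<And>y. norm (f y - f x - (y - x) *\<^sub>R f') \<le> K * (y - x)\<^sup>2"
  shows "(f has_vector_derivative f') (at x)"
  unfolding has_vector_derivative_def has_derivative_at_alt
proof (intro conjI allI impI)
  show "bounded_linear (\<lambda>x. x *\<^sub>R f')" by (rule bounded_linear_scaleR_left)
  fix e :: real assume "e > 0"
  show "\<exists>d>0. \<forall>y. norm (y - x) < d \<longrightarrow> norm (f y - f x - (y - x) *\<^sub>R f') \<le> e * norm (y - x)"
  proof (intro exI[of _ "e / (\<bar>K\<bar> + 1)"] conjI allI impI)
    fix y assume y: "norm (y - x) < e / (\<bar>K\<bar> + 1)"
    have "\<bar>K\<bar> * \<bar>y - x\<bar> \<le> e"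
    proof -
      have "\<bar>K\<bar> * \<bar>y - x\<bar> \<le> (\<bar>K\<bar> + 1) * \<bar>y - x\<bar>" by (intro mult_right_mono) auto
      also have "\<dots> \<le> e" using y by (simp add: field_simps)
      finally show ?thesis .
    qed
    then have "\<bar>K\<bar> * \<bar>y - x\<bar> * \<bar>y - x\<bar> \<le> e * \<bar>y - x\<bar>" by (intro mult_right_mono) auto
    moreover have "K * (y - x)\<^sup>2 \<le> \<bar>K\<bar> * \<bar>y - x\<bar> * \<bar>y - x\<bar>"
    proof -
      have "\<bar>y - x\<bar> * \<bar>y - x\<bar> = (y - x)\<^sup>2" by (simp add: power2_eq_square)
      then have "\<bar>K\<bar> * \<bar>y - x\<bar> * \<bar>y - x\<bar> = \<bar>K\<bar> * (y - x)\<^sup>2" by (simp only: mult.assoc)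
      moreover have "K * (y - x)\<^sup>2 \<le> \<bar>K\<bar> * (y - x)\<^sup>2" by (intro mult_right_mono) auto
      ultimately show ?thesis by (simp only:)
    qed
    ultimately show "norm (f y - f x - (y - x) *\<^sub>R f') \<le> e * norm (y - x)"
      using assms[of y] by simp
  qed (use \<open>e > 0\<close> in simp)
qed

lemma cis_second_order: "cmod (cis t - 1 - \<i> * of_real t) \<le> t\<^sup>2"
proof -
  have "cmod (iexp t - (\<Sum>k\<le>1. (\<i> * t)^k / fact k)) \<le> \<bar>t\<bar>^(Suc 1) / fact (Suc 1)" by (rule iexp_approx1)
  also have "\<dots> \<le> t\<^sup>2" by (simp add: power2_eq_square)
  finally show ?thesis by (simp add: cis_conv_exp diff_diff_eq)
qed

text \<open>The second-order remainder of \<open>cis\<close> costs a factor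
  \<open>(2 * pi * x)\<^sup>2\<close>; since \<open>f\<close> is Schwartz, its second absolute
  moment is finite and provides the constant of the quadratic bound.\<close>

lemma fourier_has_vector_derivative:
  assumes "schwartz f"
  shows "(fourier f has_vector_derivative fourier (\<lambda>x. (- 2 * pi * \<i> * x) * f x) k) (at k)"
proof (rule has_vector_derivative_quadratic)
  define g where "g = (\<lambda>x. (- 2 * pi * \<i> * complex_of_real x) * f x)"
  have sg: "schwartz g" unfolding g_def
    by (intro multiplier_times_schwartz multiplier_mult multiplier_const multiplier_of_real assms)
  have sgg: "schwartz (\<lambda>x. (- 2 * pi * \<i> * complex_of_real x) * g x)"
    by (intro multiplier_times_schwartz multiplier_mult multiplier_const multiplier_of_real sg)
  have i: "integrable lborel (\<lambda>x. cis (- 2 * pi * k * x) * f x)" for k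
    by (intro integrable_cis_mult schwartz_integrable assms) measurable
  have ig: "integrable lborel (\<lambda>x. cis (- 2 * pi * k * x) * g x)" for k
    by (intro integrable_cis_mult schwartz_integrable sg) measurable
  fix y
  have eq: "fourier f y - fourier f k - (y - k) *\<^sub>R fourier g k =
    (LINT x|lborel. cis (- 2 * pi * y * x) * f x - cis (- 2 * pi * k * x) * f x - (y - k) *\<^sub>R (cis (- 2 * pi * k * x) * g x))"
    unfolding fourier_def using i ig by simp
  have "norm (LINT x|lborel. cis (- 2 * pi * y * x) * f x - cis (- 2 * pi * k * x) * f x - (y - k) *\<^sub>R (cis (- 2 * pi * k * x) * g x))
     \<le> (LINT x|lborel. (y - k)\<^sup>2 * cmod ((- 2 * pi * \<i> * complex_of_real x) * g x))"
  proof (rule order_trans[OF integral_norm_bound], rule integral_mono)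
    show "integrable lborel (\<lambda>x. cmod (cis (- 2 * pi * y * x) * f x - cis (- 2 * pi * k * x) * f x - (y - k) *\<^sub>R (cis (- 2 * pi * k * x) * g x)))"
      by (intro integrable_norm Bochner_Integration.integrable_diff i integrable_scaleR_right ig)
    show "integrable lborel (\<lambda>x. (y - k)\<^sup>2 * cmod ((- 2 * pi * \<i> * complex_of_real x) * g x))"
      by (intro integrable_mult_right integrable_norm schwartz_integrable sgg)
    fix x
    define t where "t = - 2 * pi * (y - k) * x"
    have "cis (- 2 * pi * y * x) = cis (- 2 * pi * k * x) * cis t"
      by (simp add: cis_mult t_def algebra_simps)
    moreover have "(y - k) *\<^sub>R (cis (- 2 * pi * k * x) * g x) = cis (- 2 * pi * k * x) * (\<i> * of_real t) * f x"
      by (simp add: g_def t_def scaleR_conv_of_real)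
    ultimately have "cis (- 2 * pi * y * x) * f x - cis (- 2 * pi * k * x) * f x - (y - k) *\<^sub>R (cis (- 2 * pi * k * x) * g x)
      = cis (- 2 * pi * k * x) * (cis t - 1 - \<i> * of_real t) * f x"
      by (simp add: algebra_simps)
    then have "cmod (cis (- 2 * pi * y * x) * f x - cis (- 2 * pi * k * x) * f x - (y - k) *\<^sub>R (cis (- 2 * pi * k * x) * g x))
       = cmod (cis t - 1 - \<i> * of_real t) * cmod (f x)" by (simp add: norm_mult)
    also have "\<dots> \<le> t\<^sup>2 * cmod (f x)" by (intro mult_right_mono cis_second_order) auto
    also have "\<dots> = (y - k)\<^sup>2 * cmod ((- 2 * pi * \<i> * complex_of_real x) * g x)"
      by (simp add: t_def g_def norm_mult power2_eq_square abs_mult)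
    finally show "cmod (cis (- 2 * pi * y * x) * f x - cis (- 2 * pi * k * x) * f x - (y - k) *\<^sub>R (cis (- 2 * pi * k * x) * g x))
      \<le> (y - k)\<^sup>2 * cmod ((- 2 * pi * \<i> * complex_of_real x) * g x)" .
  qed
  also have "\<dots> = (LINT x|lborel. cmod ((- 2 * pi * \<i> * complex_of_real x) * g x)) * (y - k)\<^sup>2"
    by (simp only: integral_mult_right_zero mult.commute)
  finally show "norm (fourier f y - fourier f k - (y - k) *\<^sub>R fourier (\<lambda>x. (- 2 * pi * \<i> * x) * f x) k)
     \<le> (LINT x|lborel. cmod ((- 2 * pi * \<i> * complex_of_real x) * g x)) * (y - k)\<^sup>2"
    unfolding eq[unfolded g_def] g_def .
qed

lemma fourier_vderiv:
  assumes "schwartz f" shows "fourier (vderiv f) k = (2 * pi * \<i> * k) * fourier f k"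
proof -
  let ?e = "\<lambda>x. cis ((- 2 * pi * k) * x)"
  have s: "schwartz (\<lambda>x. ?e x * f x)" by (intro multiplier_times_schwartz multiplier_cis assms)
  have "((\<lambda>x. ?e x * f x) has_vector_derivative ?e x * vderiv f x + (\<i> * of_real (- 2 * pi * k) * ?e x) * f x) (at x)" for x
    by (intro has_vector_derivative_mult has_vector_derivative_cis_mult schwartz_vderiv assms)
  then have e: "vderiv (\<lambda>x. ?e x * f x) = (\<lambda>x. ?e x * vderiv f x + (\<i> * of_real (- 2 * pi * k)) * (?e x * f x))"
    by (intro ext vector_derivative_at) (simp add: mult.assoc)
  have i: "integrable lborel (\<lambda>x. ?e x * f x)" by (rule schwartz_integrable[OF s])
  have i': "integrable lborel (\<lambda>x. ?e x * vderiv f x)"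
    by (intro schwartz_integrable multiplier_times_schwartz multiplier_cis schwartz_vderiv assms)
  have "0 = (LINT x|lborel. ?e x * vderiv f x + (\<i> * of_real (- 2 * pi * k)) * (?e x * f x))"
    using integral_vderiv_schwartz[OF s] unfolding e by simp
  also have "\<dots> = fourier (vderiv f) k + (\<i> * of_real (- 2 * pi * k)) * fourier f k"
    unfolding fourier_def using i i' by (subst Bochner_Integration.integral_add) auto
  finally show ?thesis by (simp add: algebra_simps eq_neg_iff_add_eq_0)
qed

lemma fourier_rapid:
  assumes "schwartz f" shows "rapid_decay (fourier f)"
  unfolding rapid_decay_iff
proof
  fix m show "bounded (range (\<lambda>k. k ^ m *\<^sub>R fourier f k))" using assms
  proof (induction m arbitrary: f)
    case 0
    then show ?case using fourier_norm_le[OF schwartz_integrable[OF 0]]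
      unfolding bounded_iff by (intro exI[of _ "LINT x|lborel. cmod (f x)"]) auto
  next
    case (Suc m)
    obtain B where B: "\<And>k. norm (k ^ m *\<^sub>R fourier (vderiv f) k) \<le> B"
      using Suc.IH[OF schwartz_vderiv(1)[OF Suc.prems]] unfolding bounded_iff by blast
    have "norm (k ^ Suc m *\<^sub>R fourier f k) \<le> B" for k
    proof -
      have "norm (k ^ m *\<^sub>R fourier (vderiv f) k) = (2 * pi) * norm (k ^ Suc m *\<^sub>R fourier f k)"
        unfolding fourier_vderiv[OF Suc.prems] by (simp add: norm_mult abs_mult)
      moreover have "1 * norm (k ^ Suc m *\<^sub>R fourier f k) \<le> (2 * pi) * norm (k ^ Suc m *\<^sub>R fourier f k)"
        using pi_gt3 by (intro mult_right_mono) auto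
      ultimately show ?thesis using B[of k] by linarith
    qed
    then show ?case unfolding bounded_iff by blast
  qed
qed

lemma schwartz_fourier:
  assumes "schwartz f" shows "schwartz (fourier f)"
proof (rule schwartz_coinduct[of _ "fourier ` Collect schwartz"])
  fix u assume "u \<in> fourier ` Collect schwartz"
  then obtain f where u: "u = fourier f" "schwartz f" by blast
  show "rapid_decay u" unfolding u(1) by (rule fourier_rapid[OF u(2)])
  let ?g = "\<lambda>x. (- 2 * pi * \<i> * complex_of_real x) * f x"
  have "schwartz ?g"
    by (intro multiplier_times_schwartz multiplier_mult multiplier_const multiplier_of_real u)
  then show "\<exists>f'\<in>fourier ` Collect schwartz. \<forall>x. (u has_vector_derivative f' x) (at x)"
    unfolding u(1) by (intro bexI[of _ "fourier ?g"] allI fourier_has_vector_derivative u imageI) simp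
qed (use assms in simp)

lemma schwartz_fourier_inv: "schwartz f \<Longrightarrow> schwartz (fourier_inv f)"
  unfolding fourier_inv_eq_reflect by (intro schwartz_fourier schwartz_reflect)

section \<open>Inversion and Parseval formulas\<close>

lemma std_normal_density_integral: "(LINT z|lborel. std_normal_density z) = 1"
  using prob_space.prob_space[OF prob_space_normal_density[of 1 0]]
  by (simp add: integral_density[symmetric])

text \<open>Gaussians of width \<open>X n\<close> form an approximate identity. The sign of
  \<open>X n\<close> is left free because a reflection in the inversion theorem makes the scale
  negative.\<close>

lemma gauss_approx:
  fixes \<phi> :: "real \<Rightarrow> complex" and X :: "nat \<Rightarrow> real"
  assumes [measurable]: "\<phi> \<in> borel_measurable borel" and "\<And>x. cmod (\<phi> x) \<le> B" "isCont \<phi> y" "X \<longlonglongrightarrow> 0"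
  shows "(\<lambda>n. LINT z|lborel. of_real (std_normal_density z) * \<phi> (y + X n * z)) \<longlonglongrightarrow> \<phi> y"
proof -
  have "(\<lambda>n. LINT z|lborel. of_real (std_normal_density z) * \<phi> (y + X n * z))
     \<longlonglongrightarrow> (LINT z|lborel. of_real (std_normal_density z) * \<phi> y)"
  proof (rule integral_dominated_convergence)
    show "integrable lborel (\<lambda>z. std_normal_density z * B)" by simp
    show "AE z in lborel. (\<lambda>n. of_real (std_normal_density z) * \<phi> (y + X n * z)) \<longlonglongrightarrow> of_real (std_normal_density z) * \<phi> y"
    proof (intro AE_I2 tendsto_mult tendsto_const)
      fix z
      have "(\<lambda>n. y + X n * z) \<longlonglongrightarrow> y" using assms(4) by (auto intro!: tendsto_eq_intros)
      then show "(\<lambda>n. \<phi> (y + X n * z)) \<longlonglongrightarrow> \<phi> y" by (rule isCont_tendsto_compose[OF assms(3)])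
    qed
    show "AE x in lborel. cmod (complex_of_real (std_normal_density x) * \<phi> (y + X n * x)) \<le> std_normal_density x * B" for n
      using assms(2) by (auto simp: norm_mult intro!: mult_left_mono)
  qed auto
  also have "(LINT z|lborel. of_real (std_normal_density z) * \<phi> y) = \<phi> y"
    using std_normal_density_integral by simp
  finally show ?thesis .
qed

text \<open>The transform of a Gaussian is read off the characteristic function of the standard
  normal law, after the substitution \<open>x = e * k\<close>.\<close>

lemma fourier_gauss_kernel:
  assumes "e > 0"
  shows "(LINT k|lborel. cis (2 * pi * k * w) * of_real (exp (- (e\<^sup>2 / 2) * k\<^sup>2)))
     = of_real (2 * pi / e * std_normal_density (2 * pi / e * w))"
proof -
  let ?t = "2 * pi / e * w"
  have "char std_normal_distribution ?t = (LINT x|lborel. std_normal_density x *\<^sub>R iexp (?t * x))"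
    unfolding char_def by (subst integral_density) auto
  also have "\<dots> = e *\<^sub>R (LINT k|lborel. std_normal_density (e * k) *\<^sub>R iexp (?t * (e * k)))"
    using assms by (subst lborel_integral_real_affine[of e _ 0]) auto
  also have "(\<lambda>k. std_normal_density (e * k) *\<^sub>R iexp (?t * (e * k))) =
     (\<lambda>k. of_real (1 / sqrt (2 * pi)) * (cis (2 * pi * k * w) * of_real (exp (- (e\<^sup>2 / 2) * k\<^sup>2))))"
    using assms by (intro ext) (simp add: std_normal_density_def cis_conv_exp power_mult_distrib scaleR_conv_of_real field_simps)
  finally have "char std_normal_distribution ?t = of_real (e / sqrt (2 * pi)) *
     (LINT k|lborel. cis (2 * pi * k * w) * of_real (exp (- (e\<^sup>2 / 2) * k\<^sup>2)))"
    by (simp add: scaleR_conv_of_real)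
  then have "(LINT k|lborel. cis (2 * pi * k * w) * of_real (exp (- (e\<^sup>2 / 2) * k\<^sup>2)))
     = of_real (sqrt (2 * pi) / e * exp (- ?t\<^sup>2 / 2))"
    unfolding char_std_normal_distribution using assms by (simp add: field_simps)
  also have "sqrt (2 * pi) / e * exp (- ?t\<^sup>2 / 2) = 2 * pi / e * std_normal_density ?t"
  proof -
    have "2 * pi / e * std_normal_density ?t = (2 * pi / sqrt (2 * pi)) / e * exp (- ?t\<^sup>2 / 2)"
      by (simp add: std_normal_density_def)
    also have "2 * pi / sqrt (2 * pi) = sqrt (2 * pi)" by (simp add: real_div_sqrt)
    finally show ?thesis by (rule sym)
  qed
  finally show ?thesis .
qed

lemma (in pair_sigma_finite) integrable_product_mult:
  fixes f g :: "_ \<Rightarrow> complex"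
  assumes f: "integrable M1 f" and g: "integrable M2 g"
  shows "integrable (M1 \<Otimes>\<^sub>M M2) (\<lambda>(x, y). f x * g y)"
proof (rule Fubini_integrable)
  have [measurable]: "f \<in> borel_measurable M1" "g \<in> borel_measurable M2" using f g by auto
  show "(\<lambda>(x, y). f x * g y) \<in> borel_measurable (M1 \<Otimes>\<^sub>M M2)" by measurable
  show "integrable M1 (\<lambda>x. LINT y|M2. norm (case (x, y) of (x, y) \<Rightarrow> f x * g y))"
    using f by (simp add: norm_mult)
qed (use g in simp)

text \<open>Fubini on the product of two integrable functions. It lets the transform change sides
  before any inversion formula is available, which is how inversion itself is proved.\<close>

lemma multiplication_formula:
  assumes \<alpha>: "integrable lborel \<alpha>" and \<gamma>: "integrable lborel \<gamma>"
  shows "(LINT x|lborel. fourier_inv \<alpha> x * \<gamma> x) = (LINT k|lborel. \<alpha> k * fourier_inv \<gamma> k)"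
proof -
  interpret lborel_pair: pair_sigma_finite lborel lborel ..
  have [measurable]: "\<alpha> \<in> borel_measurable borel" "\<gamma> \<in> borel_measurable borel" using assms by auto
  have "integrable (lborel \<Otimes>\<^sub>M lborel) (\<lambda>(x, k). cis (2 * pi * k * x) * (\<gamma> x * \<alpha> k))"
    using integrable_cis_mult[OF lborel_pair.integrable_product_mult[OF \<gamma> \<alpha>], of "\<lambda>(x, k). 2 * pi * k * x"]
    by (simp add: case_prod_unfold)
  from lborel_pair.Fubini_integral[OF this]
  have "(LINT k|lborel. LINT x|lborel. cis (2 * pi * k * x) * (\<gamma> x * \<alpha> k)) =
        (LINT x|lborel. LINT k|lborel. cis (2 * pi * k * x) * (\<gamma> x * \<alpha> k))" by simp
  also have "(LINT k|lborel. LINT x|lborel. cis (2 * pi * k * x) * (\<gamma> x * \<alpha> k)) = (LINT k|lborel. \<alpha> k * fourier_inv \<gamma> k)"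
  proof (rule Bochner_Integration.integral_cong[OF refl])
    fix k
    have "(\<lambda>x. cis (2 * pi * k * x) * (\<gamma> x * \<alpha> k)) = (\<lambda>x. \<alpha> k * (cis (2 * pi * x * k) * \<gamma> x))"
      by (simp add: algebra_simps)
    then show "(LINT x|lborel. cis (2 * pi * k * x) * (\<gamma> x * \<alpha> k)) = \<alpha> k * fourier_inv \<gamma> k"
      unfolding fourier_inv_def by simp
  qed
  also have "(LINT x|lborel. LINT k|lborel. cis (2 * pi * k * x) * (\<gamma> x * \<alpha> k)) = (LINT x|lborel. fourier_inv \<alpha> x * \<gamma> x)"
  proof (rule Bochner_Integration.integral_cong[OF refl])
    fix x
    have "(\<lambda>k. cis (2 * pi * k * x) * (\<gamma> x * \<alpha> k)) = (\<lambda>k. (cis (2 * pi * k * x) * \<alpha> k) * \<gamma> x)"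
      by (simp add: algebra_simps)
    then show "(LINT k|lborel. cis (2 * pi * k * x) * (\<gamma> x * \<alpha> k)) = fourier_inv \<alpha> x * \<gamma> x"
      unfolding fourier_inv_def by simp
  qed
  finally show ?thesis by simp
qed

text \<open>The integral is damped by the Gaussian \<open>G n\<close>, and removing the damping is
  dominated convergence. While it is present, the transform can be moved from \<open>\<phi>\<close>
  to the Gaussian by \<open>multiplication_formula\<close>; the Gaussian becomes an approximate
  identity around \<open>y\<close>, and the two limits are compared.\<close>

lemma fourier_inv_fourier:
  assumes "schwartz \<phi>" shows "fourier_inv (fourier \<phi>) = \<phi>"
proof
  fix y
  define X where "X = (\<lambda>n. 1 / real (Suc n))"
  have X: "X n > 0" "X \<longlonglongrightarrow> 0" for n
    unfolding X_def by (simp, rule LIMSEQ_Suc[OF lim_1_over_n])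
  have sF: "schwartz (fourier \<phi>)" by (rule schwartz_fourier[OF assms])
  have [measurable]: "\<phi> \<in> borel_measurable borel" "fourier \<phi> \<in> borel_measurable borel"
    using schwartz_measurable assms sF by auto
  obtain B where B: "\<And>x. cmod (\<phi> x) \<le> B" by (rule schwartz_bounded[OF assms]) blast
  define G where "G n k = complex_of_real (exp (- ((X n)\<^sup>2 / 2) * k\<^sup>2))" for n k
  define E where "E n k = cis (2 * pi * k * y) * G n k" for n k
  have sG: "schwartz (G n)" for n unfolding G_def using X(1)[of n] by (intro schwartz_gauss) simp
  have sE: "schwartz (E n)" for n
    unfolding E_def using multiplier_times_schwartz[OF multiplier_cis[of "2 * pi * y"] sG] by (simp add: algebra_simps)
  have 1: "(\<lambda>n. LINT k|lborel. E n k * fourier \<phi> k) \<longlonglongrightarrow> (LINT k|lborel. cis (2 * pi * k * y) * fourier \<phi> k)"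
  proof (rule integral_dominated_convergence)
    show "integrable lborel (\<lambda>k. cmod (fourier \<phi> k))" by (intro integrable_norm schwartz_integrable sF)
    show "AE k in lborel. (\<lambda>n. E n k * fourier \<phi> k) \<longlonglongrightarrow> cis (2 * pi * k * y) * fourier \<phi> k"
    proof (intro AE_I2)
      fix k
      have "(\<lambda>n. cis (2 * pi * k * y) * complex_of_real (exp (- ((X n)\<^sup>2 / 2) * k\<^sup>2)) * fourier \<phi> k) \<longlonglongrightarrow>
        cis (2 * pi * k * y) * complex_of_real (exp (- (0\<^sup>2 / 2) * k\<^sup>2)) * fourier \<phi> k"
        by (intro tendsto_intros X) simp
      then show "(\<lambda>n. E n k * fourier \<phi> k) \<longlonglongrightarrow> cis (2 * pi * k * y) * fourier \<phi> k"
        unfolding E_def G_def by simp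
    qed
    show "AE k in lborel. cmod (E n k * fourier \<phi> k) \<le> cmod (fourier \<phi> k)" for n
    proof (intro AE_I2)
      fix k
      have "cmod (E n k) \<le> 1" unfolding E_def G_def by (simp add: norm_mult)
      then show "cmod (E n k * fourier \<phi> k) \<le> cmod (fourier \<phi> k)"
        by (simp add: norm_mult mult_left_le_one_le)
    qed
    show "(\<lambda>k. E n k * fourier \<phi> k) \<in> borel_measurable lborel" for n
      using schwartz_measurable[OF sE[of n]] by simp
  qed simp
  have 2: "(LINT k|lborel. E n k * fourier \<phi> k) =
      (LINT z|lborel. of_real (std_normal_density z) * \<phi> (y + (- X n / (2 * pi)) * z))" for n
  proof -
    let ?r = "- X n / (2 * pi)"
    have "(LINT k|lborel. E n k * fourier \<phi> k) = (LINT k|lborel. E n k * fourier_inv (\<lambda>x. \<phi> (- x)) k)"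
      by (simp add: fourier_inv_eq_reflect)
    also have "\<dots> = (LINT x|lborel. fourier_inv (E n) x * \<phi> (- x))"
      by (rule multiplication_formula[symmetric]) (intro schwartz_integrable sE schwartz_reflect assms)+
    also have "\<dots> = (LINT x|lborel. of_real (2 * pi / X n * std_normal_density (2 * pi / X n * (x + y))) * \<phi> (- x))"
    proof (rule Bochner_Integration.integral_cong[OF refl])
      fix x
      have "fourier_inv (E n) x = (LINT k|lborel. cis (2 * pi * k * (x + y)) * of_real (exp (- ((X n)\<^sup>2 / 2) * k\<^sup>2)))"
        unfolding fourier_inv_def E_def G_def
      proof (rule Bochner_Integration.integral_cong[OF refl])
        fix k
        have "cis (2 * pi * k * (x + y)) = cis (2 * pi * k * x) * cis (2 * pi * k * y)"
          unfolding cis_mult by (simp only: distrib_left)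
        then show "cis (2 * pi * k * x) * (cis (2 * pi * k * y) * complex_of_real (exp (- ((X n)\<^sup>2 / 2) * k\<^sup>2)))
           = cis (2 * pi * k * (x + y)) * complex_of_real (exp (- ((X n)\<^sup>2 / 2) * k\<^sup>2))"
          by (simp only: mult.assoc)
      qed
      then show "fourier_inv (E n) x * \<phi> (- x) = of_real (2 * pi / X n * std_normal_density (2 * pi / X n * (x + y))) * \<phi> (- x)"
        using fourier_gauss_kernel[OF X(1)] by simp
    qed
    also have "\<dots> = \<bar>X n / (2 * pi)\<bar> *\<^sub>R (LINT z|lborel. of_real (2 * pi / X n * std_normal_density z) * \<phi> (y + ?r * z))"
    proof -
      have a: "- (- y + X n / (2 * pi) * z) = y + ?r * z" for z by simp
      have b: "2 * pi / X n * (- y + X n / (2 * pi) * z + y) = z" for z using X(1)[of n] by simp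
      have "X n / (2 * pi) \<noteq> 0" using X(1)[of n] by simp
      from lborel_integral_real_affine[OF this, of "\<lambda>x. complex_of_real (2 * pi / X n * std_normal_density (2 * pi / X n * (x + y))) * \<phi> (- x)" "- y"]
      show ?thesis by (simp only: a b)
    qed
    also have "\<dots> = \<bar>X n / (2 * pi)\<bar> *\<^sub>R (of_real (2 * pi / X n) * (LINT z|lborel. of_real (std_normal_density z) * \<phi> (y + ?r * z)))"
      by (simp add: mult.assoc)
    also have "\<dots> = (LINT z|lborel. of_real (std_normal_density z) * \<phi> (y + ?r * z))"
      using X(1)[of n] by (simp add: scaleR_conv_of_real field_simps)
    finally show ?thesis .
  qed
  have "(\<lambda>n. LINT k|lborel. E n k * fourier \<phi> k) \<longlonglongrightarrow> \<phi> y"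
    unfolding 2
  proof (rule gauss_approx[OF _ B])
    show "isCont \<phi> y" using schwartz_continuous[OF assms] by (simp add: continuous_on_eq_continuous_at)
    show "(\<lambda>n. - X n / (2 * pi)) \<longlonglongrightarrow> 0" using X(2) by (auto intro!: tendsto_eq_intros)
  qed simp
  from LIMSEQ_unique[OF 1 this] show "fourier_inv (fourier \<phi>) y = \<phi> y" unfolding fourier_inv_def .
qed

lemma fourier_fourier_inv:
  assumes "schwartz \<phi>" shows "fourier (fourier_inv \<phi>) = \<phi>"
proof
  fix k
  have "fourier (fourier_inv \<phi>) k = fourier_inv (fourier (\<lambda>x. \<phi> (- x))) (- k)"
    unfolding fourier_inv_eq_reflect[of \<phi>] fourier_inv_eq by simp
  then show "fourier (fourier_inv \<phi>) k = \<phi> k"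
    unfolding fourier_inv_fourier[OF schwartz_reflect[OF assms]] by simp
qed

lemma cnj_fourier_inv: "cnj (fourier_inv \<beta> x) = fourier (\<lambda>k. cnj (\<beta> k)) x"
  unfolding fourier_inv_def fourier_def by (simp add: Bochner_Integration.integral_cnj[symmetric] cis_cnj mult.commute mult.left_commute del: Bochner_Integration.integral_cnj)

lemma cnj_fourier: "cnj (fourier \<beta> x) = fourier_inv (\<lambda>k. cnj (\<beta> k)) x"
  unfolding fourier_inv_def fourier_def by (simp add: Bochner_Integration.integral_cnj[symmetric] cis_cnj mult.commute mult.left_commute del: Bochner_Integration.integral_cnj)

lemma fourier_parseval:
  assumes "schwartz \<alpha>" "schwartz \<beta>"
  shows "(LINT x|lborel. fourier_inv \<alpha> x * cnj (fourier_inv \<beta> x)) = (LINT k|lborel. \<alpha> k * cnj (\<beta> k))"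
proof -
  have s: "schwartz (\<lambda>k. cnj (\<beta> k))" by (rule schwartz_cnj[OF assms(2)])
  have "(LINT x|lborel. fourier_inv \<alpha> x * fourier (\<lambda>k. cnj (\<beta> k)) x)
      = (LINT k|lborel. \<alpha> k * fourier_inv (fourier (\<lambda>k. cnj (\<beta> k))) k)"
    by (intro multiplication_formula schwartz_integrable schwartz_fourier s assms)
  then show ?thesis unfolding cnj_fourier_inv fourier_inv_fourier[OF s] .
qed

text \<open>Testing with ever narrower Gaussians centred at \<open>y\<close> recovers the point
  value. This is the passage from weak identities to pointwise ones, for Schwartz functions and
  later for correlations in space.\<close>

lemma bounded_continuous_eq_zero:
  fixes m :: "real \<Rightarrow> complex"
  assumes "continuous_on UNIV m" "\<And>x. cmod (m x) \<le> B"
    "\<And>\<phi>. schwartz \<phi> \<Longrightarrow> (LINT x|lborel. m x * cnj (\<phi> x)) = 0"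
  shows "m y = 0"
proof -
  define X where "X = (\<lambda>n. 1 / real (Suc n))"
  have X: "X n > 0" "X \<longlonglongrightarrow> 0" for n
    unfolding X_def by (simp, rule LIMSEQ_Suc[OF lim_1_over_n])
  have "(LINT z|lborel. of_real (std_normal_density z) * m (y + X n * z)) = 0" for n
  proof -
    define \<phi> where "\<phi> x = complex_of_real (exp (- (1 / (2 * (X n)\<^sup>2)) * (x + (- y))\<^sup>2))" for x
    have "schwartz \<phi>" unfolding \<phi>_def
      using schwartz_shift[OF schwartz_gauss[of "1 / (2 * (X n)\<^sup>2)"], of "- y"] X(1)[of n] by simp
    then have "0 = (LINT x|lborel. m x * cnj (\<phi> x))" using assms(3) by simp
    also have "\<dots> = \<bar>X n\<bar> *\<^sub>R (LINT z|lborel. m (y + X n * z) * cnj (\<phi> (y + X n * z)))"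
      using X(1)[of n] by (intro lborel_integral_real_affine) simp
    also have "(\<lambda>z. m (y + X n * z) * cnj (\<phi> (y + X n * z))) =
       (\<lambda>z. of_real (sqrt (2 * pi)) * (of_real (std_normal_density z) * m (y + X n * z)))"
      using X(1)[of n] by (intro ext) (simp add: \<phi>_def std_normal_density_def field_simps power_mult_distrib)
    finally show ?thesis using X(1)[of n] by simp
  qed
  moreover have "(\<lambda>n. LINT z|lborel. of_real (std_normal_density z) * m (y + X n * z)) \<longlonglongrightarrow> m y"
    by (rule gauss_approx[OF borel_measurable_continuous_onI[OF assms(1)] assms(2) _ X(2)])
       (use assms(1) in \<open>simp add: continuous_on_eq_continuous_at\<close>)
  ultimately have "(\<lambda>n. 0) \<longlonglongrightarrow> m y" by simp
  then show ?thesis using LIMSEQ_unique[OF tendsto_const] by metis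
qed

section \<open>Powers of the regularized absolute value\<close>

lemma schwartz_multiplier: "schwartz f \<Longrightarrow> multiplier f"
  unfolding schwartz_iff multiplier_def by (metis rapid_slow_growth)

lemma vderiv_mult:
  assumes "(f has_vector_derivative f') (at x)" "(h has_vector_derivative h') (at x)"
  shows "vderiv (\<lambda>x. f x * h x) x = f x * h' + f' * h x"
  by (rule vector_derivative_at[OF has_vector_derivative_mult[OF assms]])

lemma integral_by_parts_schwartz:
  assumes "schwartz u" "schwartz v"
  shows "(LINT x|lborel. vderiv u x * v x) = - (LINT x|lborel. u x * vderiv v x)"
proof -
  have s: "schwartz (\<lambda>x. u x * v x)" "schwartz (\<lambda>x. u x * vderiv v x)" "schwartz (\<lambda>x. vderiv u x * v x)"
    by (intro multiplier_times_schwartz schwartz_multiplier schwartz_vderiv assms)+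
  have "0 = (LINT x|lborel. vderiv (\<lambda>x. u x * v x) x)" using integral_vderiv_schwartz[OF s(1)] by simp
  also have "\<dots> = (LINT x|lborel. u x * vderiv v x + vderiv u x * v x)"
    by (intro Bochner_Integration.integral_cong refl vderiv_mult schwartz_vderiv(2) assms)
  also have "\<dots> = (LINT x|lborel. u x * vderiv v x) + (LINT x|lborel. vderiv u x * v x)"
    by (intro Bochner_Integration.integral_add schwartz_integrable s)
  finally show ?thesis by (simp add: eq_neg_iff_add_eq_0 add.commute)
qed

locale regularization =
  fixes L H c :: real and g :: "real \<Rightarrow> real"
  assumes L_pos: "L > 0" and regularized: "regularized_abs L g" and c_nonzero: "c \<noteq> 0"
begin

definition gpow :: "real \<Rightarrow> real \<Rightarrow> complex" where
  "gpow b k = complex_of_real (g k powr b)"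

lemma g_pos: "g k > 0"
  using regularized unfolding regularized_abs_def by blast

lemma g_deriv: "(g has_real_derivative deriv g k) (at k)"
proof -
  obtain D where "D 0 = g" "\<And>n k. (D n has_vector_derivative D (Suc n) k) (at k)"
    using regularized unfolding regularized_abs_def by blast
  then have "(g has_real_derivative D (Suc 0) k) (at k)"
    by (metis has_real_derivative_iff_has_vector_derivative)
  then show ?thesis by (metis DERIV_imp_deriv)
qed

lemma multiplier_g: "multiplier (\<lambda>k. complex_of_real (g k))"
proof -
  obtain D where D: "D 0 = g" "\<And>n k. (D n has_vector_derivative D (Suc n) k) (at k)"
    "\<And>n. \<exists>K m. \<forall>k. \<bar>D n k\<bar> \<le> K * (1 + \<bar>k\<bar>) ^ m"
    using regularized unfolding regularized_abs_def by blast
  have "((\<lambda>k. complex_of_real (D n k)) has_vector_derivative complex_of_real (D (Suc n) k)) (at k)" for n k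
    using D(2)[of n k] by (intro has_vector_derivative_of_real) (simp add: has_real_derivative_iff_has_vector_derivative)
  moreover have "slow_growth (\<lambda>k. complex_of_real (D n k))" for n
    using D(3)[of n] unfolding slow_growth_def by simp
  ultimately show ?thesis unfolding multiplier_def
    by (intro exI[of _ "\<lambda>n x. complex_of_real (D n x)"]) (simp add: D(1))
qed

lemma vderiv_g: "vderiv (\<lambda>k. complex_of_real (g k)) k = of_real (deriv g k)"
  by (rule vector_derivative_at) (rule has_vector_derivative_of_real[OF g_deriv])

lemma multiplier_deriv_g: "multiplier (\<lambda>k. complex_of_real (deriv g k))"
  using multiplier_vderiv(1)[OF multiplier_g] unfolding vderiv_g .

lemma g_continuous: "continuous_on UNIV g"
  using g_deriv by (meson DERIV_isCont continuous_at_imp_continuous_on)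

lemma g_measurable [measurable]: "g \<in> borel_measurable borel"
  by (rule borel_measurable_continuous_onI[OF g_continuous])

lemma gpow_measurable [measurable]: "gpow b \<in> borel_measurable borel"
  unfolding gpow_def[abs_def] by measurable

text \<open>Near infinity \<open>g k\<close> is comparable to \<open>\<bar>k\<bar>\<close>, and on
  the remaining compact interval a positive continuous function has a positive minimum. The bound
  controls negative powers of \<open>g\<close> and yields their integrability.\<close>

lemma g_lower: "\<exists>m>0. \<forall>k. m * (1 + \<bar>k\<bar>) \<le> g k"
proof -
  have "((\<lambda>k. g k / \<bar>k\<bar>) \<longlongrightarrow> 1) at_infinity" using regularized unfolding regularized_abs_def by blast
  then have "eventually (\<lambda>k. g k / \<bar>k\<bar> > 1/2) at_infinity" by (rule order_tendstoD) simp
  then obtain R where R: "\<And>k. \<bar>k\<bar> \<ge> R \<Longrightarrow> g k / \<bar>k\<bar> > 1/2"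
    unfolding eventually_at_infinity by auto
  define R' where "R' = max 1 R"
  have far: "g k \<ge> 1/4 * (1 + \<bar>k\<bar>)" if "\<bar>k\<bar> \<ge> R'" for k
  proof -
    have k: "\<bar>k\<bar> \<ge> 1" "\<bar>k\<bar> \<ge> R" using that by (auto simp: R'_def)
    have "1/2 * \<bar>k\<bar> < g k" using R[OF k(2)] k(1) by (simp add: field_simps)
    then show ?thesis using k(1) by simp
  qed
  have R': "R' \<ge> 1" by (simp add: R'_def)
  have "\<exists>x\<in>{-R'..R'}. \<forall>k\<in>{-R'..R'}. g x \<le> g k"
    by (intro continuous_attains_inf continuous_on_subset[OF g_continuous]) (use R' in auto)
  then obtain x where x: "x \<in> {-R'..R'}" "\<And>k. k \<in> {-R'..R'} \<Longrightarrow> g x \<le> g k" by blast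
  have near: "g k \<ge> g x / (1 + R') * (1 + \<bar>k\<bar>)" if "\<bar>k\<bar> < R'" for k
  proof -
    have "g x / (1 + R') * (1 + \<bar>k\<bar>) \<le> g x / (1 + R') * (1 + R')"
      using that R' g_pos[of x] by (intro mult_left_mono) auto
    also have "\<dots> = g x" using R' by simp
    also have "\<dots> \<le> g k" using that by (intro x) auto
    finally show ?thesis .
  qed
  show ?thesis
  proof (intro exI[of _ "min (1/4) (g x / (1 + R'))"] conjI allI)
    show "0 < min (1/4) (g x / (1 + R'))" using g_pos[of x] R' by simp
    fix k
    have "min (1/4) (g x / (1 + R')) * (1 + \<bar>k\<bar>) \<le> 1/4 * (1 + \<bar>k\<bar>)"
         "min (1/4) (g x / (1 + R')) * (1 + \<bar>k\<bar>) \<le> g x / (1 + R') * (1 + \<bar>k\<bar>)"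
      by (intro mult_right_mono min.cobounded1 min.cobounded2; simp)+
    then show "min (1/4) (g x / (1 + R')) * (1 + \<bar>k\<bar>) \<le> g k"
      using far[of k] near[of k] by linarith
  qed
qed

lemma gpow_slow: "slow_growth (gpow b)"
proof (cases "b \<ge> 0")
  case True
  obtain K m where K: "K \<ge> 0" "\<And>k. cmod (complex_of_real (g k)) \<le> K * (1 + \<bar>k\<bar>) ^ m"
    by (rule slow_growthE[OF multiplier_slow[OF multiplier_g]]) blast
  have "cmod (gpow b k) \<le> K powr b * (1 + \<bar>k\<bar>) ^ nat \<lceil>real m * b\<rceil>" for k
  proof -
    have "cmod (gpow b k) = g k powr b" by (simp add: gpow_def)
    also have "\<dots> \<le> (K * (1 + \<bar>k\<bar>) ^ m) powr b"
      using K(2)[of k] g_pos[of k] True by (intro powr_mono2) auto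
    also have "\<dots> = K powr b * (1 + \<bar>k\<bar>) powr (real m * b)"
      using K(1) by (simp add: powr_mult powr_powr powr_realpow[symmetric])
    \<comment> \<open>Rounding the real exponent up is harmless because the base is at least
      \<open>1\<close>; \<open>slow_growth\<close> asks for a natural exponent.\<close>
    also have "\<dots> \<le> K powr b * (1 + \<bar>k\<bar>) powr real (nat \<lceil>real m * b\<rceil>)"
      by (intro mult_left_mono powr_mono) (auto simp: real_nat_ceiling_ge)
    also have "\<dots> = K powr b * (1 + \<bar>k\<bar>) ^ nat \<lceil>real m * b\<rceil>" by (simp add: powr_realpow)
    finally show ?thesis .
  qed
  then show ?thesis unfolding slow_growth_def by blast
next
  case False
  obtain m where m: "m > 0" "\<And>k. m * (1 + \<bar>k\<bar>) \<le> g k" using g_lower by blast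
  have "cmod (gpow b k) \<le> m powr b * (1 + \<bar>k\<bar>) ^ 0" for k
  proof -
    have "m * 1 \<le> m * (1 + \<bar>k\<bar>)" using m(1) by (intro mult_left_mono) auto
    then have "m \<le> g k" using m(2)[of k] by linarith
    then have "g k powr b \<le> m powr b" using m(1) False by (intro powr_mono2') auto
    then show ?thesis by (simp add: gpow_def)
  qed
  then show ?thesis unfolding slow_growth_def by blast
qed

lemma gpow_has_deriv:
  "(gpow b has_vector_derivative of_real (b * deriv g k) * gpow (b - 1) k) (at k)"
proof -
  have "((\<lambda>k. g k powr b) has_real_derivative (b * deriv g k) * g k powr (b - 1)) (at k)"
    using DERIV_powr[OF g_deriv g_pos DERIV_const[of b]] g_pos[of k]
    by (auto simp: powr_diff field_simps)
  from has_vector_derivative_of_real[OF this] show ?thesis unfolding gpow_def[abs_def] by simp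
qed

text \<open>Derivatives lower the exponent, so the invariant set has to allow all exponents
  \<open>b\<close> at once. The Leibniz term in which \<open>p\<close> is differentiated is brought
  to exponent \<open>b - 1\<close> by pulling out one factor \<open>g\<close>.\<close>

lemma multiplier_gpow: "multiplier (gpow b)"
proof (rule multiplier_coinduct[of _ "{\<lambda>k. p k * gpow b k | p b. multiplier p}"])
  have "gpow b = (\<lambda>k. 1 * gpow b k)" by simp
  then show "gpow b \<in> {\<lambda>k. p k * gpow b k | p b. multiplier p}"
    using multiplier_const[of 1] by (auto intro!: exI[of _ "\<lambda>x. 1"] exI[of _ b])
  fix f assume "f \<in> {\<lambda>k. p k * gpow b k | p b. multiplier p}"
  then obtain p b where f: "f = (\<lambda>k. p k * gpow b k)" "multiplier p" by blast
  show "slow_growth f" unfolding f(1) by (intro slow_growth_mult multiplier_slow f gpow_slow)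
  define p' where "p' = (\<lambda>k. p k * (of_real b * of_real (deriv g k)) + vderiv p k * of_real (g k))"
  have p': "multiplier p'" unfolding p'_def
    by (intro multiplier_add multiplier_mult multiplier_const multiplier_deriv_g multiplier_g f multiplier_vderiv)
  have "(f has_vector_derivative p' k * gpow (b - 1) k) (at k)" for k
  proof -
    have "gpow b k = of_real (g k) * gpow (b - 1) k"
      using g_pos[of k] by (simp add: gpow_def powr_diff)
    then have "p k * (of_real (b * deriv g k) * gpow (b - 1) k) + vderiv p k * gpow b k = p' k * gpow (b - 1) k"
      by (simp add: p'_def algebra_simps)
    with has_vector_derivative_mult[OF multiplier_vderiv(2)[OF f(2), of k] gpow_has_deriv[of b k]]
    show ?thesis unfolding f(1) by simp
  qed
  then show "\<exists>f'\<in>{\<lambda>k. p k * gpow b k | p b. multiplier p}. \<forall>k. (f has_vector_derivative f' k) (at k)"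
    using p' by (intro bexI[of _ "\<lambda>k. p' k * gpow (b - 1) k"]) auto
qed

lemma schwartz_gpow: "schwartz \<zeta> \<Longrightarrow> schwartz (\<lambda>k. gpow b k * \<zeta> k)"
  by (rule multiplier_times_schwartz[OF multiplier_gpow])

lemma gpow_inverse: "gpow b k * gpow (- b) k = 1"
  using g_pos[of k] by (simp add: gpow_def powr_minus flip: of_real_mult)

lemma gpow_cnj [simp]: "cnj (gpow b k) = gpow b k"
  by (simp add: gpow_def)

section \<open>The evolution in Fourier space\<close>

text \<open>The adjoint of \<open>- (c * \<partial> + q)\<close> for the real potential
  \<open>q = c * (H + 1/2) * g' / g\<close>: integration by parts flips the sign of the derivative
  and leaves that of \<open>q\<close>.\<close>

definition dual_op :: "(real \<Rightarrow> complex) \<Rightarrow> real \<Rightarrow> complex" where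
  "dual_op \<zeta> k = of_real c * vector_derivative \<zeta> (at k) - of_real (c * (H + 1/2) * (deriv g k / g k)) * \<zeta> k"

text \<open>Conjugating with \<open>g powr (H + 1/2)\<close> removes the zeroth order term.\<close>

lemma dual_op_eq:
  assumes "schwartz \<zeta>"
  shows "dual_op \<zeta> k = of_real c * gpow (H + 1/2) k * vderiv (\<lambda>k. gpow (- (H + 1/2)) k * \<zeta> k) k"
proof -
  define a where "a = H + 1/2"
  have eq: "vderiv (\<lambda>k. gpow (- a) k * \<zeta> k) k
      = gpow (- a) k * vderiv \<zeta> k + (of_real (- a * deriv g k) * gpow (- a - 1) k) * \<zeta> k"
    by (intro vderiv_mult gpow_has_deriv schwartz_vderiv assms)
  have "gpow a k * vderiv (\<lambda>k. gpow (- a) k * \<zeta> k) k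
      = (gpow a k * gpow (- a) k) * vderiv \<zeta> k + of_real (- a * deriv g k) * (gpow a k * gpow (- a - 1) k) * \<zeta> k"
    unfolding eq by (simp add: algebra_simps)
  also have "gpow a k * gpow (- a - 1) k = of_real (1 / g k)"
    using g_pos[of k] by (simp add: gpow_def powr_diff powr_minus flip: of_real_mult)
  finally have eq2: "gpow a k * vderiv (\<lambda>k. gpow (- a) k * \<zeta> k) k
      = vderiv \<zeta> k + of_real (- a * deriv g k) * of_real (1 / g k) * \<zeta> k"
    unfolding gpow_inverse by simp
  show ?thesis
    unfolding dual_op_def a_def[symmetric] mult.assoc[of "of_real c"] eq2 by (simp add: algebra_simps)
qed

lemma schwartz_dual_op:
  assumes "schwartz \<zeta>" shows "schwartz (dual_op \<zeta>)"
proof -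
  have "dual_op \<zeta> = (\<lambda>k. of_real c * (gpow (H + 1/2) k * vderiv (\<lambda>k. gpow (- (H + 1/2)) k * \<zeta> k) k))"
    using dual_op_eq[OF assms] by (simp add: mult.assoc fun_eq_iff)
  then show ?thesis by (simp only: schwartz_scale schwartz_gpow schwartz_vderiv assms)
qed

lemma fourier_scale: "fourier (\<lambda>x. b * f x) k = b * fourier f k"
proof -
  have "(\<lambda>x. cis (- 2 * pi * k * x) * (b * f x)) = (\<lambda>x. b * (cis (- 2 * pi * k * x) * f x))"
    by (intro ext) (simp only: mult.left_commute)
  then show ?thesis unfolding fourier_def by simp
qed

text \<open>Multiplication by \<open>x\<close> is differentiation in the wavenumber: the derivative
  formula for \<open>fourier\<close> is applied to \<open>fourier_inv \<beta>\<close> and read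
  through inversion.\<close>

lemma fourier_L_op:
  assumes "schwartz \<beta>"
  shows "fourier (L_op c (fourier_inv \<beta>)) k = - of_real c * vderiv \<beta> k"
proof -
  have "(\<beta> has_vector_derivative fourier (\<lambda>x. (- 2 * pi * \<i> * x) * fourier_inv \<beta> x) k) (at k)"
    using fourier_has_vector_derivative[OF schwartz_fourier_inv[OF assms], of k]
    unfolding fourier_fourier_inv[OF assms] .
  then have "vderiv \<beta> k = fourier (\<lambda>x. (- 2 * pi * \<i> * x) * fourier_inv \<beta> x) k"
    by (rule vector_derivative_at)
  moreover have "L_op c (fourier_inv \<beta>) = (\<lambda>x. - of_real c * ((- 2 * pi * \<i> * x) * fourier_inv \<beta> x))"
    by (intro ext) (simp add: L_op_def)
  ultimately show ?thesis by (simp only: fourier_scale)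
qed

lemma evolution_op_eq:
  assumes "schwartz \<eta>"
  shows "evolution_op c g H \<eta> = fourier_inv (\<lambda>k. - of_real c * (gpow (- (H + 1/2)) k *
     vderiv (\<lambda>k. gpow (H + 1/2) k * fourier \<eta> k) k))"
proof -
  have s: "schwartz (\<lambda>k. gpow (H + 1/2) k * fourier \<eta> k)" by (intro schwartz_gpow schwartz_fourier assms)
  have "P_inv_op g H \<eta> = fourier_inv (\<lambda>k. gpow (H + 1/2) k * fourier \<eta> k)"
    unfolding P_inv_op_def gpow_def ..
  then show ?thesis
    unfolding evolution_op_def P_op_def gpow_def[symmetric] by (simp only: fourier_L_op[OF s] mult.left_commute)
qed

text \<open>Parseval moves everything to the wavenumber, where the powers of \<open>g\<close> are
  real and pass to the other factor. What remains is one integration by parts between the conjugated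
  functions \<open>u\<close> and \<open>v\<close>.\<close>

lemma evolution_op_adjoint:
  assumes "schwartz \<eta>" "schwartz \<zeta>"
  shows "(LINT x|lborel. evolution_op c g H \<eta> x * cnj (fourier_inv \<zeta> x))
       = (LINT x|lborel. \<eta> x * cnj (fourier_inv (dual_op \<zeta>) x))"
proof -
  define a where "a = H + 1/2"
  define u where "u = (\<lambda>k. gpow a k * fourier \<eta> k)"
  define v where "v = (\<lambda>k. gpow (- a) k * \<zeta> k)"
  have su: "schwartz u" unfolding u_def by (intro schwartz_gpow schwartz_fourier assms)
  have sv: "schwartz v" unfolding v_def by (intro schwartz_gpow assms)
  have sv': "schwartz (\<lambda>k. cnj (v k))" by (rule schwartz_cnj[OF sv])
  have vd: "vderiv (\<lambda>k. cnj (v k)) k = cnj (vderiv v k)" for k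
    by (intro vector_derivative_at has_vector_derivative_cnj schwartz_vderiv sv)
  have s: "schwartz (\<lambda>k. - of_real c * (gpow (- a) k * vderiv u k))"
    by (intro schwartz_scale schwartz_gpow schwartz_vderiv su)
  have "(LINT x|lborel. evolution_op c g H \<eta> x * cnj (fourier_inv \<zeta> x))
      = (LINT k|lborel. - of_real c * (gpow (- a) k * vderiv u k) * cnj (\<zeta> k))"
    using fourier_parseval[OF s assms(2)] unfolding evolution_op_eq[OF assms(1)] a_def[symmetric] u_def[symmetric] .
  also have "\<dots> = (LINT k|lborel. - of_real c * (vderiv u k * cnj (v k)))"
    by (intro Bochner_Integration.integral_cong refl) (simp add: v_def)
  also have "\<dots> = - of_real c * (LINT k|lborel. vderiv u k * cnj (v k))" by simp
  also have "\<dots> = of_real c * (LINT k|lborel. u k * cnj (vderiv v k))"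
    unfolding integral_by_parts_schwartz[OF su sv'] vd by simp
  also have "\<dots> = (LINT k|lborel. of_real c * (u k * cnj (vderiv v k)))" by simp
  also have "\<dots> = (LINT k|lborel. fourier \<eta> k * cnj (dual_op \<zeta> k))"
    unfolding dual_op_eq[OF assms(2)] a_def[symmetric] v_def[symmetric]
    by (intro Bochner_Integration.integral_cong refl) (simp add: u_def mult.assoc mult.left_commute)
  also have "\<dots> = (LINT x|lborel. \<eta> x * cnj (fourier_inv (dual_op \<zeta>) x))"
    using fourier_parseval[OF schwartz_fourier[OF assms(1)] schwartz_dual_op[OF assms(2)]]
    unfolding fourier_inv_fourier[OF assms(1)] by simp
  finally show ?thesis .
qed

lemma schwartz_test_zero:
  assumes "schwartz \<psi>" "(LINT x|lborel. \<psi> x * cnj (\<psi> x)) = 0"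
  shows "\<psi> y = 0"
proof -
  obtain B where B: "\<And>x. cmod (\<psi> x) \<le> B" by (rule schwartz_bounded[OF assms(1)]) blast
  have s: "schwartz (\<lambda>x. \<psi> x * cnj (\<psi> x))"
    by (intro multiplier_times_schwartz schwartz_multiplier schwartz_cnj assms)
  have "complex_of_real (LINT x|lborel. (cmod (\<psi> x))\<^sup>2) = (LINT x|lborel. complex_of_real ((cmod (\<psi> x))\<^sup>2))"
    by (simp only: integral_complex_of_real)
  also have "\<dots> = 0" using assms(2) by (simp only: complex_norm_square)
  finally have 0: "(LINT x|lborel. (cmod (\<psi> x))\<^sup>2) = 0" by simp
  have i: "integrable lborel (\<lambda>x. (cmod (\<psi> x))\<^sup>2)"
    using integrable_norm[OF schwartz_integrable[OF s]] by (simp add: norm_mult power2_eq_square)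
  have ae: "AE x in lborel. \<psi> x = 0"
    using integral_nonneg_eq_0_iff_AE[OF i] 0 by simp
  have "(LINT x|lborel. \<psi> x * cnj (\<phi> x)) = 0" for \<phi>
    by (rule integral_eq_zero_AE) (use ae in auto)
  then show ?thesis
    using bounded_continuous_eq_zero[OF schwartz_continuous[OF assms(1)] B] by simp
qed

text \<open>The definition characterizes the adjoint image only by testing. The formula of
  \<open>dual_op\<close> supplies one image, and two images agree because their difference can
  itself be used as the function \<open>\<eta>\<close>. Quantifying over adjoint pairs thus amounts
  to quantifying over \<open>\<zeta>\<close>.\<close>

lemma adjoint_pair_iff:
  "adjoint_pair c g H \<phi> \<psi> \<longleftrightarrow> (\<exists>\<zeta>. schwartz \<zeta> \<and> \<phi> = fourier_inv \<zeta> \<and> \<psi> = fourier_inv (dual_op \<zeta>))"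
proof
  assume "\<exists>\<zeta>. schwartz \<zeta> \<and> \<phi> = fourier_inv \<zeta> \<and> \<psi> = fourier_inv (dual_op \<zeta>)"
  then show "adjoint_pair c g H \<phi> \<psi>"
    unfolding adjoint_pair_def using schwartz_fourier_inv schwartz_dual_op evolution_op_adjoint by metis
next
  assume A: "adjoint_pair c g H \<phi> \<psi>"
  then have s: "schwartz \<phi>" "schwartz \<psi>" unfolding adjoint_pair_def by auto
  define \<zeta> where "\<zeta> = fourier \<phi>"
  have z: "schwartz \<zeta>" "\<phi> = fourier_inv \<zeta>" unfolding \<zeta>_def using s by (simp_all add: schwartz_fourier fourier_inv_fourier)
  define \<psi>' where "\<psi>' = fourier_inv (dual_op \<zeta>)"
  have s': "schwartz \<psi>'" unfolding \<psi>'_def by (intro schwartz_fourier_inv schwartz_dual_op z)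
  define d where "d = (\<lambda>x. \<psi> x - \<psi>' x)"
  have sd: "schwartz d" unfolding d_def by (intro schwartz_diff s s')
  have eq: "(LINT x|lborel. d x * cnj (\<psi> x)) = (LINT x|lborel. d x * cnj (\<psi>' x))"
    using A sd evolution_op_adjoint[OF sd z(1)] unfolding adjoint_pair_def z(2) \<psi>'_def by auto
  have i: "integrable lborel (\<lambda>x. d x * cnj (\<psi> x))" "integrable lborel (\<lambda>x. d x * cnj (\<psi>' x))"
    by (intro schwartz_integrable multiplier_times_schwartz schwartz_multiplier schwartz_cnj s s' sd)+
  have "(LINT x|lborel. d x * cnj (d x)) = (LINT x|lborel. d x * cnj (\<psi> x) - d x * cnj (\<psi>' x))"
    by (simp add: d_def algebra_simps)
  also have "\<dots> = 0" using Bochner_Integration.integral_diff[OF i] eq by simp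
  finally have "d x = 0" for x using schwartz_test_zero[OF sd] by blast
  then have "\<psi> = \<psi>'" unfolding d_def by auto
  then show "\<exists>\<zeta>. schwartz \<zeta> \<and> \<phi> = fourier_inv \<zeta> \<and> \<psi> = fourier_inv (dual_op \<zeta>)"
    using z unfolding \<psi>'_def by blast
qed

lemma solves_evolution_iff_fourier:
  "solves_evolution M f c g H u \<longleftrightarrow> solves_fourier M f c (\<lambda>k. c * (H + 1/2) * (deriv g k / g k)) u"
  unfolding solves_evolution_def solves_fourier_def fourier_pairing_def adjoint_pair_iff dual_op_def[abs_def]
  by blast

lemma deriv_g_eq:
  assumes "\<forall>k. (g k)\<^sup>2 = k\<^sup>2 + 1 / L\<^sup>2"
  shows "deriv g k / g k = k / (g k)\<^sup>2"
proof -
  have "((\<lambda>k. (g k)\<^sup>2) has_real_derivative 2 * g k * deriv g k) (at k)"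
    by (auto intro!: derivative_eq_intros g_deriv)
  moreover have "((\<lambda>k. (g k)\<^sup>2) has_real_derivative 2 * k) (at k)"
    unfolding assms[rule_format] by (auto intro!: derivative_eq_intros)
  ultimately have "2 * g k * deriv g k = 2 * k" by (rule DERIV_unique)
  then show ?thesis using g_pos[of k] by (simp add: field_simps power2_eq_square)
qed

end

section \<open>The constant of the structure function\<close>

text \<open>The constant is computed with nonnegative integrals, so that the order of integration
  can be exchanged freely. The scaled Gamma integral serves to write powers as Laplace
  integrals.\<close>

lemma nn_integral_gamma_scaled:
  assumes u: "u > 0" and s: "s > (0::real)"
  shows "(\<integral>\<^sup>+r. ennreal (indicator {0..} r * (r powr (s - 1) * exp (- (u * r)))) \<partial>lborel) = ennreal (Gamma s * u powr (- s))"
proof -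
  let ?I = "\<integral>\<^sup>+r. ennreal (indicator {0..} r * (r powr (s - 1) * exp (- (u * r)))) \<partial>lborel"
  have "ennreal (Gamma s) = (\<integral>\<^sup>+t. ennreal (indicator {0..} t * t powr (s - 1) / exp t) \<partial>lborel)"
    by (rule Gamma_conv_nn_integral_real[OF s])
  also have "\<dots> = ennreal u * (\<integral>\<^sup>+r. ennreal (indicator {0..} (0 + u * r) * (0 + u * r) powr (s - 1) / exp (0 + u * r)) \<partial>lborel)"
    using u by (subst nn_integral_real_affine[of _ u 0]) auto
  also have "(\<lambda>r. ennreal (indicator {0..} (0 + u * r) * (0 + u * r) powr (s - 1) / exp (0 + u * r)))
     = (\<lambda>r. ennreal (u powr (s - 1)) * ennreal (indicator {0..} r * (r powr (s - 1) * exp (- (u * r)))))"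
  proof
    fix r
    have "indicator {0..} (0 + u * r) * (0 + u * r) powr (s - 1) / exp (0 + u * r)
        = u powr (s - 1) * (indicator {0..} r * (r powr (s - 1) * exp (- (u * r))))"
      using u by (cases "r \<ge> 0") (auto simp: powr_mult exp_minus field_simps indicator_def zero_le_mult_iff)
    then show "ennreal (indicator {0..} (0 + u * r) * (0 + u * r) powr (s - 1) / exp (0 + u * r))
     = ennreal (u powr (s - 1)) * ennreal (indicator {0..} r * (r powr (s - 1) * exp (- (u * r))))"
      by (simp add: ennreal_mult)
  qed
  also have "(\<integral>\<^sup>+r. ennreal (u powr (s - 1)) * ennreal (indicator {0..} r * (r powr (s - 1) * exp (- (u * r)))) \<partial>lborel)
     = ennreal (u powr (s - 1)) * ?I"
    by (rule nn_integral_cmult) measurable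
  also have "ennreal u * (ennreal (u powr (s - 1)) * ?I) = ennreal (u powr s) * ?I"
    using u by (simp add: mult.assoc[symmetric] ennreal_mult[symmetric] powr_diff)
  finally have "ennreal (u powr (- s)) * ennreal (Gamma s) = ennreal (u powr (- s)) * (ennreal (u powr s) * ?I)" by simp
  also have "\<dots> = ?I"
    using u by (simp add: mult.assoc[symmetric] ennreal_mult[symmetric] powr_minus)
  finally show ?thesis using Gamma_real_pos[OF s] by (simp add: ennreal_mult[symmetric] mult.commute)
qed

lemma nn_integral_one_minus_cos_exp:
  assumes r: "r > 0"
  shows "(\<integral>\<^sup>+u. ennreal (indicator {0..} u * ((1 - cos u) * exp (- (u * r)))) \<partial>lborel) = ennreal (1 / (r * (1 + r\<^sup>2)))"
proof -
  \<comment> \<open>An antiderivative that vanishes at infinity: the first part integrates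
    \<open>exp (- (u * r))\<close>, and the standard antiderivative of
    \<open>cos u * exp (- (u * r))\<close> is subtracted.\<close>
  define F where "F u = - exp (- (u * r)) / r - exp (- (u * r)) * (sin u - r * cos u) / (1 + r\<^sup>2)" for u
  have p: "1 + r\<^sup>2 > 0" by (simp add: add_pos_nonneg)
  have d: "(F has_real_derivative (1 - cos u) * exp (- (u * r))) (at u)" for u
  proof -
    have "(F has_real_derivative (exp (- (u * r)) * r) / r - (exp (- (u * r)) * (cos u + r * sin u) + (- exp (- (u * r)) * r) * (sin u - r * cos u)) / (1 + r\<^sup>2)) (at u)"
      unfolding F_def[abs_def] using r p by (auto intro!: derivative_eq_intros)
    also have "(exp (- (u * r)) * r) / r - (exp (- (u * r)) * (cos u + r * sin u) + (- exp (- (u * r)) * r) * (sin u - r * cos u)) / (1 + r\<^sup>2)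
        = exp (- (u * r)) - exp (- (u * r)) * (cos u * (1 + r\<^sup>2)) / (1 + r\<^sup>2)"
      using r by (simp add: algebra_simps power2_eq_square)
    also have "exp (- (u * r)) * (cos u * (1 + r\<^sup>2)) / (1 + r\<^sup>2) = exp (- (u * r)) * cos u" using p by simp
    also have "exp (- (u * r)) - exp (- (u * r)) * cos u = (1 - cos u) * exp (- (u * r))" by (simp add: algebra_simps)
    finally show ?thesis .
  qed
  have lim: "(F \<longlongrightarrow> 0) at_top"
  proof -
    have e: "((\<lambda>u. exp (- (u * r))) \<longlongrightarrow> 0) at_top"
    proof -
      have "filterlim (\<lambda>u. - (u * r)) at_bot at_top"
        using r unfolding filterlim_uminus_at_bot
        by (simp add: filterlim_at_top_mult_tendsto_pos[OF tendsto_const r filterlim_ident])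
      then show ?thesis by (rule filterlim_compose[OF exp_at_bot])
    qed
    have "((\<lambda>u. exp (- (u * r)) * ((sin u - r * cos u) / (1 + r\<^sup>2))) \<longlongrightarrow> 0) at_top"
    proof (rule Lim_null_comparison)
      show "((\<lambda>u. exp (- (u * r)) * ((1 + r) / (1 + r\<^sup>2))) \<longlongrightarrow> 0) at_top"
        using tendsto_mult_right[OF e, of "(1 + r) / (1 + r\<^sup>2)"] by simp
      have "\<bar>sin u - r * cos u\<bar> \<le> 1 + r" for u
      proof -
        have "\<bar>r * cos u\<bar> \<le> r * 1" using r by (simp add: abs_mult)
        then show ?thesis using abs_sin_le_one[of u] by linarith
      qed
      then show "\<forall>\<^sub>F u in at_top. norm (exp (- (u * r)) * ((sin u - r * cos u) / (1 + r\<^sup>2))) \<le> exp (- (u * r)) * ((1 + r) / (1 + r\<^sup>2))"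
        using p by (intro always_eventually allI) (simp add: abs_mult divide_right_mono)
    qed
    moreover have "((\<lambda>u. - exp (- (u * r)) / r) \<longlongrightarrow> 0) at_top"
      using tendsto_divide[OF tendsto_minus[OF e] tendsto_const[of r]] r by simp
    ultimately have "((\<lambda>u. - exp (- (u * r)) / r - exp (- (u * r)) * ((sin u - r * cos u) / (1 + r\<^sup>2))) \<longlongrightarrow> 0 - 0) at_top"
      by (intro tendsto_diff)
    then show ?thesis unfolding F_def[abs_def] by simp
  qed
  have "(\<integral>\<^sup>+u. ennreal ((1 - cos u) * exp (- (u * r))) * indicator {0..} u \<partial>lborel) = ennreal (0 - F 0)"
    by (rule nn_integral_FTC_atLeast[OF _ d _ lim]) auto
  also have "0 - F 0 = 1 / (r * (1 + r\<^sup>2))"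
    unfolding F_def using r p by (simp add: field_simps power2_eq_square)
  finally show ?thesis
    by (simp add: mult.commute ennreal_indicator[symmetric] ennreal_mult'[symmetric] del: ennreal_indicator)
qed

lemma nn_integral_swap_lborel:
  fixes f :: "real \<Rightarrow> real \<Rightarrow> real"
  assumes "case_prod f \<in> borel_measurable (borel \<Otimes>\<^sub>M borel)"
  shows "(\<integral>\<^sup>+x. \<integral>\<^sup>+y. ennreal (f x y) \<partial>lborel \<partial>lborel) = (\<integral>\<^sup>+y. \<integral>\<^sup>+x. ennreal (f x y) \<partial>lborel \<partial>lborel)"
proof -
  have "(\<lambda>(x, y). ennreal (f x y)) \<in> borel_measurable (lborel \<Otimes>\<^sub>M lborel)"
    using assms by (simp add: case_prod_unfold)
  from lborel_pair.Fubini'[OF this] show ?thesis by simp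
qed

text \<open>A Beta integral evaluated by exchanging integrals rather than by substitution. First
  \<open>1 / (1 + r\<^sup>2)\<close> is written as the integral of
  \<open>1 / (1 + p)\<^sup>2\<close> over \<open>p \<ge> r\<^sup>2\<close>; integrating over
  \<open>r\<close> first leaves \<open>p powr H / (2 * H)\<close>. Then
  \<open>1 / (1 + p)\<^sup>2\<close> becomes the Laplace integral of
  \<open>v * exp (- ((1 + p) * v))\<close>, and the integrals over \<open>p\<close> and
  \<open>v\<close> are Gamma integrals.\<close>

lemma nn_integral_beta_type:
  assumes H: "0 < H" "H < (1::real)"
  shows "(\<integral>\<^sup>+r. ennreal (indicator {0..} r * (r powr (2 * H - 1) * (1 / (1 + r\<^sup>2)))) \<partial>lborel)
    = ennreal (Gamma (H + 1) * Gamma (1 - H) / (2 * H))"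
proof -
  have 1: "ennreal (indicator {0..} r * (r powr (2 * H - 1) * (1 / (1 + r\<^sup>2))))
     = (\<integral>\<^sup>+p. ennreal (indicator {0..} r * r powr (2 * H - 1) * (indicator {r\<^sup>2..} p * (1 / (1 + p)\<^sup>2))) \<partial>lborel)" for r :: real
  proof -
    have "(\<integral>\<^sup>+p. ennreal (indicator {r\<^sup>2..} p * (1 / (1 + p)\<^sup>2)) \<partial>lborel)
        = (\<integral>\<^sup>+p. ennreal (1 / (1 + p)\<^sup>2) * indicator {r\<^sup>2..} p \<partial>lborel)"
      by (intro nn_integral_cong) (simp add: indicator_def)
    also have "\<dots> = ennreal (0 - (- 1 / (1 + r\<^sup>2)))"
    proof (rule nn_integral_FTC_atLeast)
      fix p :: real assume "r\<^sup>2 \<le> p"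
      then have "p \<ge> 0" using zero_le_power2[of r] by linarith
      then show "((\<lambda>p. - 1 / (1 + p)) has_real_derivative 1 / (1 + p)\<^sup>2) (at p)"
        by (auto intro!: derivative_eq_intros simp: power2_eq_square)
    next
      show "((\<lambda>p::real. - 1 / (1 + p)) \<longlongrightarrow> 0) at_top"
        by (intro tendsto_divide_0[OF tendsto_const] filterlim_at_top_imp_at_infinity
          filterlim_tendsto_add_at_top[OF tendsto_const] filterlim_ident)
    qed auto
    finally have a: "(\<integral>\<^sup>+p. ennreal (indicator {r\<^sup>2..} p * (1 / (1 + p)\<^sup>2)) \<partial>lborel) = ennreal (1 / (1 + r\<^sup>2))" by simp
    have "(\<integral>\<^sup>+p. ennreal (indicator {0..} r * r powr (2 * H - 1) * (indicator {r\<^sup>2..} p * (1 / (1 + p)\<^sup>2))) \<partial>lborel)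
       = (\<integral>\<^sup>+p. ennreal (indicator {0..} r * r powr (2 * H - 1)) * ennreal (indicator {r\<^sup>2..} p * (1 / (1 + p)\<^sup>2)) \<partial>lborel)"
      by (intro nn_integral_cong ennreal_mult) auto
    also have "\<dots> = ennreal (indicator {0..} r * r powr (2 * H - 1)) * ennreal (1 / (1 + r\<^sup>2))"
      unfolding a[symmetric] by (rule nn_integral_cmult) measurable
    also have "\<dots> = ennreal (indicator {0..} r * (r powr (2 * H - 1) * (1 / (1 + r\<^sup>2))))"
      by (subst ennreal_mult[symmetric]) (auto simp: mult.assoc)
    finally show ?thesis by simp
  qed
  have 2: "(\<integral>\<^sup>+r. ennreal (indicator {0..} r * r powr (2 * H - 1) * (indicator {r\<^sup>2..} p * (1 / (1 + p)\<^sup>2))) \<partial>lborel)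
      = ennreal (1 / (2 * H)) * ennreal (indicator {0..} p * p powr H * (1 / (1 + p)\<^sup>2))" for p :: real
  proof (cases "p \<ge> 0")
    case True
    have eq: "indicator {0..} r * r powr (2 * H - 1) * (indicator {r\<^sup>2..} p * (1 / (1 + p)\<^sup>2))
       = (1 / (1 + p)\<^sup>2) * (indicator {0..sqrt p} r * r powr (2 * H - 1))" for r
    proof -
      have "r\<^sup>2 \<le> p \<longleftrightarrow> r \<le> sqrt p" if "r \<ge> 0"
        using real_le_rsqrt[of r p] power_mono[OF _ that, of "sqrt p" 2] True by auto
      then show ?thesis by (auto simp: indicator_def)
    qed
    have "(\<integral>\<^sup>+r. ennreal (indicator {0..} r * r powr (2 * H - 1) * (indicator {r\<^sup>2..} p * (1 / (1 + p)\<^sup>2))) \<partial>lborel)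
       = (\<integral>\<^sup>+r. ennreal (1 / (1 + p)\<^sup>2) * ennreal (indicator {0..sqrt p} r * r powr (2 * H - 1)) \<partial>lborel)"
      by (intro nn_integral_cong, subst eq, rule ennreal_mult) auto
    also have "\<dots> = ennreal (1 / (1 + p)\<^sup>2) * (\<integral>\<^sup>+r. ennreal (indicator {0..sqrt p} r * r powr (2 * H - 1)) \<partial>lborel)"
      by (rule nn_integral_cmult) measurable
    also have "(\<integral>\<^sup>+r. ennreal (indicator {0..sqrt p} r * r powr (2 * H - 1)) \<partial>lborel) = ennreal (sqrt p powr (2 * H - 1 + 1) / (2 * H - 1 + 1))"
      by (rule nn_integral_has_integral_lebesgue[OF _ has_integral_powr_from_0]) (use H True in auto)
    also have "sqrt p powr (2 * H - 1 + 1) / (2 * H - 1 + 1) = 1 / (2 * H) * p powr H"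
      using True by (simp add: powr_half_sqrt[symmetric] powr_powr)
    also have "ennreal (1 / (1 + p)\<^sup>2) * ennreal (1 / (2 * H) * p powr H) = ennreal (1 / (2 * H)) * ennreal (indicator {0..} p * p powr H * (1 / (1 + p)\<^sup>2))"
      using True H by (simp add: ennreal_mult[symmetric])
    finally show ?thesis .
  next
    case False
    have "indicator {r\<^sup>2..} p = (0::real)" for r
    proof -
      have "\<not> r\<^sup>2 \<le> p" using order_trans[OF zero_le_power2, of r p] False by blast
      then show ?thesis by simp
    qed
    then show ?thesis using False by simp
  qed
  have 3: "ennreal (indicator {0..} p * p powr H * (1 / (1 + p)\<^sup>2))
     = (\<integral>\<^sup>+v. ennreal (indicator {0..} p * p powr H * (indicator {0..} v * (v * exp (- ((1 + p) * v))))) \<partial>lborel)" for p :: real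
  proof (cases "p \<ge> 0")
    case True
    have "(\<integral>\<^sup>+v. ennreal (indicator {0..} v * (v powr (2 - 1) * exp (- ((1 + p) * v)))) \<partial>lborel) = ennreal (Gamma 2 * (1 + p) powr (- 2))"
      by (rule nn_integral_gamma_scaled) (use True in auto)
    also have "Gamma 2 * (1 + p) powr (- 2) = 1 / (1 + p)\<^sup>2"
      using True Gamma_fact[of 1, where 'a=real] by (simp add: powr_minus_divide powr_numeral)
    also have "(\<lambda>v. ennreal (indicator {0..} v * (v powr (2 - 1) * exp (- ((1 + p) * v))))) = (\<lambda>v. ennreal (indicator {0..} v * (v * exp (- ((1 + p) * v)))))"
      by (auto simp: indicator_def fun_eq_iff)
    finally have a: "(\<integral>\<^sup>+v. ennreal (indicator {0..} v * (v * exp (- ((1 + p) * v)))) \<partial>lborel) = ennreal (1 / (1 + p)\<^sup>2)" .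
    have "(\<integral>\<^sup>+v. ennreal (indicator {0..} p * p powr H * (indicator {0..} v * (v * exp (- ((1 + p) * v))))) \<partial>lborel)
       = (\<integral>\<^sup>+v. ennreal (indicator {0..} p * p powr H) * ennreal (indicator {0..} v * (v * exp (- ((1 + p) * v)))) \<partial>lborel)"
      by (intro nn_integral_cong ennreal_mult) (auto simp: indicator_def)
    also have "\<dots> = ennreal (indicator {0..} p * p powr H) * ennreal (1 / (1 + p)\<^sup>2)"
      unfolding a[symmetric] by (rule nn_integral_cmult) measurable
    also have "\<dots> = ennreal (indicator {0..} p * p powr H * (1 / (1 + p)\<^sup>2))"
      by (rule ennreal_mult[symmetric]) auto
    finally show ?thesis by (rule sym)
  qed simp
  have 4: "(\<integral>\<^sup>+p. ennreal (indicator {0..} p * p powr H * (indicator {0..} v * (v * exp (- ((1 + p) * v))))) \<partial>lborel)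
      = ennreal (Gamma (H + 1)) * ennreal (indicator {0..} v * v powr ((1 - H) - 1) / exp v)" for v :: real
  proof (cases "v > 0")
    case True
    have "(\<integral>\<^sup>+p. ennreal (indicator {0..} p * p powr H * (indicator {0..} v * (v * exp (- ((1 + p) * v))))) \<partial>lborel)
      = (\<integral>\<^sup>+p. ennreal (v * exp (- v)) * ennreal (indicator {0..} p * (p powr ((H + 1) - 1) * exp (- (v * p)))) \<partial>lborel)"
    proof (intro nn_integral_cong, subst ennreal_mult[symmetric])
      fix p :: real
      have "exp (- ((1 + p) * v)) = exp (- v) * exp (- (v * p))" by (simp add: exp_add[symmetric] algebra_simps)
      then show "ennreal (indicator {0..} p * p powr H * (indicator {0..} v * (v * exp (- ((1 + p) * v))))) =
        ennreal (v * exp (- v) * (indicator {0..} p * (p powr (H + 1 - 1) * exp (- (v * p)))))"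
        using True by (simp add: mult_ac)
    qed (use True in auto)
    also have "\<dots> = ennreal (v * exp (- v)) * (\<integral>\<^sup>+p. ennreal (indicator {0..} p * (p powr ((H + 1) - 1) * exp (- (v * p)))) \<partial>lborel)"
      by (rule nn_integral_cmult) measurable
    also have "\<dots> = ennreal (v * exp (- v)) * ennreal (Gamma (H + 1) * v powr (- (H + 1)))"
      using H by (subst nn_integral_gamma_scaled[OF True]) auto
    also have "\<dots> = ennreal ((v * exp (- v)) * (Gamma (H + 1) * v powr (- (H + 1))))"
      using True H by (intro ennreal_mult[symmetric]) (auto intro!: mult_nonneg_nonneg less_imp_le[OF Gamma_real_pos])
    also have "(v * exp (- v)) * (Gamma (H + 1) * v powr (- (H + 1))) = Gamma (H + 1) * (indicator {0..} v * v powr ((1 - H) - 1) / exp v)"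
    proof -
      have "v * v powr (- (H + 1)) = v powr (1 - H - 1)" using True powr_add[of v 1 "- (H + 1)"] by simp
      then have "exp (- v) * Gamma (H + 1) * (v * v powr (- (H + 1))) = exp (- v) * Gamma (H + 1) * v powr (1 - H - 1)"
        by (simp only:)
      then show ?thesis using True by (simp add: exp_minus divide_inverse mult_ac)
    qed
    also have "ennreal \<dots> = ennreal (Gamma (H + 1)) * ennreal (indicator {0..} v * v powr ((1 - H) - 1) / exp v)"
      using H by (intro ennreal_mult) (auto intro!: less_imp_le[OF Gamma_real_pos])
    finally show ?thesis .
  next
    case False
    then show ?thesis by (cases "v = 0") auto
  qed
  have "(\<integral>\<^sup>+r. ennreal (indicator {0..} r * (r powr (2 * H - 1) * (1 / (1 + r\<^sup>2)))) \<partial>lborel)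
    = (\<integral>\<^sup>+p. ennreal (1 / (2 * H)) * ennreal (indicator {0..} p * p powr H * (1 / (1 + p)\<^sup>2)) \<partial>lborel)"
    unfolding 1
  proof (subst nn_integral_swap_lborel)
    have [measurable]: "Measurable.pred (borel \<Otimes>\<^sub>M borel) (\<lambda>w::real \<times> real. (fst w)\<^sup>2 \<le> snd w)" by measurable
    have "(\<lambda>w. indicator {0..} (fst w) * fst w powr (2 * H - 1) * ((if (fst w)\<^sup>2 \<le> snd w then 1 else 0) * (1 / (1 + snd w)\<^sup>2))) \<in> borel_measurable (borel \<Otimes>\<^sub>M borel)"
      by measurable
    then show "(\<lambda>(r, p). indicator {0..} r * r powr (2 * H - 1) * (indicator {r\<^sup>2..} p * (1 / (1 + p)\<^sup>2))) \<in> borel_measurable (borel \<Otimes>\<^sub>M borel)"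
      by (simp add: case_prod_unfold indicator_def)
  qed (simp only: 2)
  also have "\<dots> = ennreal (1 / (2 * H)) * (\<integral>\<^sup>+p. ennreal (indicator {0..} p * p powr H * (1 / (1 + p)\<^sup>2)) \<partial>lborel)"
    by (rule nn_integral_cmult) measurable
  also have "(\<integral>\<^sup>+p. ennreal (indicator {0..} p * p powr H * (1 / (1 + p)\<^sup>2)) \<partial>lborel)
      = (\<integral>\<^sup>+v. ennreal (Gamma (H + 1)) * ennreal (indicator {0..} v * v powr ((1 - H) - 1) / exp v) \<partial>lborel)"
    unfolding 3 by (subst nn_integral_swap_lborel, measurable, simp only: 4)
  also have "\<dots> = ennreal (Gamma (H + 1)) * (\<integral>\<^sup>+v. ennreal (indicator {0..} v * v powr ((1 - H) - 1) / exp v) \<partial>lborel)"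
    by (rule nn_integral_cmult) measurable
  also have "(\<integral>\<^sup>+v. ennreal (indicator {0..} v * v powr ((1 - H) - 1) / exp v) \<partial>lborel) = ennreal (Gamma (1 - H))"
    by (rule Gamma_conv_nn_integral_real[symmetric]) (use H in simp)
  finally show ?thesis
    using H Gamma_real_pos[of "H + 1"] Gamma_real_pos[of "1 - H"] by (simp add: ennreal_mult[symmetric])
qed

lemma Gamma_reflection_real: "Gamma H * Gamma (1 - H) = pi / sin (pi * H)" for H :: real
proof -
  have "complex_of_real (Gamma H * Gamma (1 - H)) = complex_of_real (pi / sin (pi * H))"
    using Gamma_reflection_complex[of "of_real H"]
    by (simp add: Gamma_complex_of_real[symmetric] sin_of_real[symmetric] del: sin_of_real)
  then show ?thesis by (simp only: of_real_eq_iff)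
qed

text \<open>Multiplying by \<open>Gamma (2 * H + 1)\<close> allows
  \<open>u powr - (2 * H + 1)\<close> to be replaced by a Laplace integral in \<open>r\<close>.
  After the exchange the integral in \<open>u\<close> is elementary and what remains is the Beta
  integral; the reflection formula produces the sine.\<close>

lemma nn_integral_one_minus_cos_powr:
  assumes H: "0 < H" "H < (1::real)"
  shows "(\<integral>\<^sup>+u. ennreal (indicator {0..} u * ((1 - cos u) * u powr (- (2 * H + 1)))) \<partial>lborel)
    = ennreal (pi / (2 * (sin (pi * H) * Gamma (1 + 2 * H))))"
proof -
  let ?s = "2 * H + 1"
  let ?N = "\<integral>\<^sup>+u. ennreal (indicator {0..} u * ((1 - cos u) * u powr (- ?s))) \<partial>lborel"
  have G: "Gamma ?s > 0" using H by (intro Gamma_real_pos) simp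
  have 1: "ennreal (Gamma ?s) * ennreal (indicator {0..} u * ((1 - cos u) * u powr (- ?s)))
     = (\<integral>\<^sup>+r. ennreal (indicator {0..} u * (1 - cos u) * (indicator {0..} r * (r powr (?s - 1) * exp (- (u * r))))) \<partial>lborel)" for u :: real
  proof (cases "u > 0")
    case True
    have "(\<integral>\<^sup>+r. ennreal (indicator {0..} u * (1 - cos u) * (indicator {0..} r * (r powr (?s - 1) * exp (- (u * r))))) \<partial>lborel)
       = (\<integral>\<^sup>+r. ennreal (indicator {0..} u * (1 - cos u)) * ennreal (indicator {0..} r * (r powr (?s - 1) * exp (- (u * r)))) \<partial>lborel)"
      by (intro nn_integral_cong ennreal_mult) auto
    also have "\<dots> = ennreal (indicator {0..} u * (1 - cos u)) * (\<integral>\<^sup>+r. ennreal (indicator {0..} r * (r powr (?s - 1) * exp (- (u * r)))) \<partial>lborel)"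
      by (rule nn_integral_cmult) measurable
    also have "\<dots> = ennreal (indicator {0..} u * (1 - cos u)) * ennreal (Gamma ?s * u powr (- ?s))"
      using H by (subst nn_integral_gamma_scaled[OF True]) auto
    also have "\<dots> = ennreal (indicator {0..} u * (1 - cos u) * (Gamma ?s * u powr (- ?s)))"
      using G by (intro ennreal_mult[symmetric]) auto
    also have "\<dots> = ennreal (Gamma ?s * (indicator {0..} u * ((1 - cos u) * u powr (- ?s))))"
      by (simp only: mult_ac)
    also have "\<dots> = ennreal (Gamma ?s) * ennreal (indicator {0..} u * ((1 - cos u) * u powr (- ?s)))"
      using G by (intro ennreal_mult) auto
    finally show ?thesis by simp
  next
    case False
    then show ?thesis by (cases "u = 0") auto
  qed
  have 2: "(\<integral>\<^sup>+u. ennreal (indicator {0..} u * (1 - cos u) * (indicator {0..} r * (r powr (?s - 1) * exp (- (u * r))))) \<partial>lborel)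
     = ennreal (indicator {0..} r * (r powr (2 * H - 1) * (1 / (1 + r\<^sup>2))))" for r :: real
  proof (cases "r > 0")
    case True
    have "(\<integral>\<^sup>+u. ennreal (indicator {0..} u * (1 - cos u) * (indicator {0..} r * (r powr (?s - 1) * exp (- (u * r))))) \<partial>lborel)
      = (\<integral>\<^sup>+u. ennreal (r powr (2 * H)) * ennreal (indicator {0..} u * ((1 - cos u) * exp (- (u * r)))) \<partial>lborel)"
      using True by (intro nn_integral_cong, subst ennreal_mult[symmetric]) (auto simp: mult_ac)
    also have "\<dots> = ennreal (r powr (2 * H)) * ennreal (1 / (r * (1 + r\<^sup>2)))"
      unfolding nn_integral_one_minus_cos_exp[OF True, symmetric] by (rule nn_integral_cmult) measurable
    also have "\<dots> = ennreal (r powr (2 * H) * (1 / (r * (1 + r\<^sup>2))))"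
      using True by (intro ennreal_mult[symmetric]) (auto simp: add_nonneg_nonneg)
    also have "r powr (2 * H) * (1 / (r * (1 + r\<^sup>2))) = indicator {0..} r * (r powr (2 * H - 1) * (1 / (1 + r\<^sup>2)))"
      using True by (simp add: powr_diff)
    finally show ?thesis .
  next
    case False
    then show ?thesis by (cases "r = 0") auto
  qed
  have "ennreal (Gamma ?s) * ?N = (\<integral>\<^sup>+u. ennreal (Gamma ?s) * ennreal (indicator {0..} u * ((1 - cos u) * u powr (- ?s))) \<partial>lborel)"
    by (rule nn_integral_cmult[symmetric]) measurable
  also have "\<dots> = (\<integral>\<^sup>+r. ennreal (indicator {0..} r * (r powr (2 * H - 1) * (1 / (1 + r\<^sup>2)))) \<partial>lborel)"
    unfolding 1 by (subst nn_integral_swap_lborel, measurable, simp only: 2)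
  also have "\<dots> = ennreal (Gamma (H + 1) * Gamma (1 - H) / (2 * H))" by (rule nn_integral_beta_type[OF H])
  also have "Gamma (H + 1) * Gamma (1 - H) / (2 * H) = pi / (2 * sin (pi * H))"
  proof -
    have "Gamma (H + 1) = H * Gamma H" using H by (subst Gamma_plus1) (auto elim!: nonpos_Ints_cases)
    then have "Gamma (H + 1) * Gamma (1 - H) / (2 * H) = (Gamma H * Gamma (1 - H)) / 2" using H by simp
    then show ?thesis by (simp add: Gamma_reflection_real)
  qed
  finally have "ennreal (1 / Gamma ?s) * (ennreal (Gamma ?s) * ?N) = ennreal (1 / Gamma ?s) * ennreal (pi / (2 * sin (pi * H)))" by simp
  moreover have "ennreal (1 / Gamma ?s) * (ennreal (Gamma ?s) * ?N) = ?N"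
    using G by (simp add: mult.assoc[symmetric] ennreal_mult[symmetric])
  moreover have "sin (pi * H) > 0" using H by (intro sin_gt_zero) auto
  ultimately show ?thesis using G by (simp add: ennreal_mult[symmetric] add.commute mult_ac)
qed

text \<open>For \<open>0 < H < 1\<close> this is the integral over the half line of
  \<open>(2 - 2 * cos (2 * pi * k)) * k powr - (2 * H + 1)\<close>, where
  \<open>2 - 2 * cos (2 * pi * k)\<close> is the squared modulus of
  \<open>cis (2 * pi * k) - 1\<close>, the symbol of an increment of unit length.\<close>

definition increment_integral :: "real \<Rightarrow> real" where
  "increment_integral H = (2 * pi) powr (2 * H + 1) / (2 * (sin (pi * H) * Gamma (1 + 2 * H)))"

lemma has_bochner_integral_increment_pos:
  assumes H: "0 < H" "H < (1::real)"
  shows "has_bochner_integral lborel (\<lambda>k. indicator {0..} k * ((2 - 2 * cos (2 * pi * k)) * \<bar>k\<bar> powr (- (2 * H + 1)))) (increment_integral H)"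
proof -
  let ?C = "pi / (2 * (sin (pi * H) * Gamma (1 + 2 * H)))"
  have s: "sin (pi * H) > 0" using H by (intro sin_gt_zero) auto
  have G: "Gamma (1 + 2 * H) > 0" using H by (intro Gamma_real_pos) simp
  have "has_bochner_integral lborel (\<lambda>u. indicator {0..} u * ((1 - cos u) * u powr (- (2 * H + 1)))) ?C"
    by (rule has_bochner_integral_nn_integral)
       (use s G nn_integral_one_minus_cos_powr[OF H] in \<open>auto intro!: AE_I2\<close>)
  then have "has_bochner_integral lborel (\<lambda>k. indicator {0..} (0 + 2 * pi * k) * ((1 - cos (0 + 2 * pi * k)) * (0 + 2 * pi * k) powr (- (2 * H + 1)))) (?C /\<^sub>R \<bar>2 * pi\<bar>)"
    by (subst (asm) lborel_has_bochner_integral_real_affine_iff[of "2 * pi" _ _ 0]) auto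
  then have "has_bochner_integral lborel (\<lambda>k. 2 * (2 * pi) powr (2 * H + 1) * (indicator {0..} (0 + 2 * pi * k) * ((1 - cos (0 + 2 * pi * k)) * (0 + 2 * pi * k) powr (- (2 * H + 1)))))
      (2 * (2 * pi) powr (2 * H + 1) * (?C /\<^sub>R \<bar>2 * pi\<bar>))"
    by (rule has_bochner_integral_mult_right)
  then have "has_bochner_integral lborel (\<lambda>k. 2 * (2 * pi) powr (2 * H + 1) * (indicator {0..} (2 * pi * k) * ((1 - cos (2 * pi * k)) * (2 * pi * k) powr (- (2 * H + 1)))))
      (2 * (2 * pi) powr (2 * H + 1) * (?C /\<^sub>R (2 * pi)))" by simp
  moreover have "2 * (2 * pi) powr (2 * H + 1) * (?C /\<^sub>R (2 * pi)) = increment_integral H"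
    by (simp add: increment_integral_def field_simps)
  moreover have "2 * (2 * pi) powr (2 * H + 1) * (indicator {0..} (2 * pi * k) * ((1 - cos (2 * pi * k)) * (2 * pi * k) powr (- (2 * H + 1))))
      = indicator {0..} k * ((2 - 2 * cos (2 * pi * k)) * \<bar>k\<bar> powr (- (2 * H + 1)))" for k
  proof (cases "k \<ge> 0")
    case True
    have 1: "(2 * pi) powr (2 * H + 1) * (2 * pi) powr (- (2 * H + 1)) = 1"
      by (simp only: powr_add[symmetric]) simp
    have 2: "(2 * pi * k) powr (- (2 * H + 1)) = (2 * pi) powr (- (2 * H + 1)) * k powr (- (2 * H + 1))"
      by (rule powr_mult)
    have "(2 * pi) powr (2 * H + 1) * (2 * pi * k) powr (- (2 * H + 1)) = k powr (- (2 * H + 1))"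
      unfolding 2 mult.assoc[symmetric] 1 by simp
    then have "2 * (1 - cos (2 * pi * k)) * ((2 * pi) powr (2 * H + 1) * (2 * pi * k) powr (- (2 * H + 1))) = 2 * (1 - cos (2 * pi * k)) * k powr (- (2 * H + 1))"
      by (simp only:)
    then show ?thesis using True by (simp add: algebra_simps)
  next
    case False
    then have "2 * pi * k < 0" by (simp add: mult_pos_neg)
    then show ?thesis using False by simp
  qed
  ultimately show ?thesis by simp
qed

text \<open>The two half lines carry the weights \<open>p\<close> and \<open>q\<close>, the limits
  of the rescaled spectral density at the two ends. Both indicators contain \<open>k = 0\<close>,
  where the kernel vanishes.\<close>

lemma has_bochner_integral_increment:
  assumes H: "0 < H" "H < (1::real)"
  shows "has_bochner_integral lborel (\<lambda>k. (2 - 2 * cos (2 * pi * k)) * \<bar>k\<bar> powr (- (2 * H + 1)) * (if k > 0 then p else q)) ((p + q) * increment_integral H)"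
proof -
  let ?K = "\<lambda>k. (2 - 2 * cos (2 * pi * k)) * \<bar>k\<bar> powr (- (2 * H + 1))"
  have 1: "has_bochner_integral lborel (\<lambda>k. indicator {0..} k * ?K k) (increment_integral H)"
    by (rule has_bochner_integral_increment_pos[OF H])
  then have "has_bochner_integral lborel (\<lambda>k. indicator {0..} (0 + (-1) * k) * ?K (0 + (-1) * k)) (increment_integral H /\<^sub>R \<bar>-1\<bar>)"
    by (subst (asm) lborel_has_bochner_integral_real_affine_iff[of "-1" _ _ 0]) auto
  then have 2: "has_bochner_integral lborel (\<lambda>k. indicator {0..} (- k) * ?K k) (increment_integral H)" by simp
  have "has_bochner_integral lborel (\<lambda>k. p * (indicator {0..} k * ?K k) + q * (indicator {0..} (- k) * ?K k)) (p * increment_integral H + q * increment_integral H)"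
    by (intro has_bochner_integral_add has_bochner_integral_mult_right 1 2)
  moreover have "p * (indicator {0..} k * ?K k) + q * (indicator {0..} (- k) * ?K k) = ?K k * (if k > 0 then p else q)" for k
    by (auto simp: indicator_def)
  ultimately show ?thesis by (simp add: distrib_right)
qed

text \<open>Replacing \<open>k\<close> by \<open>t * k\<close> with \<open>t = 1 / l\<close> turns
  small scales into large wavenumbers, where \<open>g (t * k) / t\<close> tends to
  \<open>\<bar>k\<bar>\<close> whatever the regularization, and \<open>G\<close> tends to one of its
  limits at the ends. The lower bound of \<open>g\<close> makes the domination uniform in
  \<open>t\<close>.\<close>

lemma (in regularization) structure_limit:
  fixes G :: "real \<Rightarrow> real"
  assumes H: "0 < H" "H < 1" and G: "G \<in> borel_measurable borel" "\<And>k. 0 \<le> G k" "\<And>k. G k \<le> B"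
    "(G \<longlongrightarrow> p) at_top" "(G \<longlongrightarrow> q) at_bot"
  shows "((\<lambda>l. (LINT k|lborel. (2 - 2 * cos (2 * pi * k * l)) * (g k powr (- (2 * H + 1)) * G k)) / l powr (2 * H))
    \<longlongrightarrow> (p + q) * increment_integral H) (at_right 0)"
proof -
  let ?s = "2 * H + 1"
  define F where "F t k = (2 - 2 * cos (2 * pi * k)) * ((g (t * k) / t) powr (- ?s) * G (t * k))" for t k
  define F0 where "F0 k = (2 - 2 * cos (2 * pi * k)) * \<bar>k\<bar> powr (- ?s) * (if k > 0 then p else q)" for k
  note [measurable] = G(1)
  obtain m where m: "m > 0" "\<And>k. m * (1 + \<bar>k\<bar>) \<le> g k" using g_lower by blast
  have inf: "((\<lambda>k. g k / \<bar>k\<bar>) \<longlongrightarrow> 1) at_infinity" using regularized unfolding regularized_abs_def by blast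
  have hb: "has_bochner_integral lborel (\<lambda>k. (2 - 2 * cos (2 * pi * k)) * \<bar>k\<bar> powr (- ?s) * (if k > 0 then x else y)) ((x + y) * increment_integral H)" for x y
    by (rule has_bochner_integral_increment[OF H])
  have "((\<lambda>t. LINT k|lborel. F t k) \<longlongrightarrow> (LINT k|lborel. F0 k)) at_top"
  proof (rule integral_dominated_convergence_at_top)
    show "F0 \<in> borel_measurable lborel" unfolding F0_def[abs_def] by measurable
    show "F t \<in> borel_measurable lborel" for t unfolding F_def[abs_def] by measurable
    show "integrable lborel (\<lambda>k. (2 - 2 * cos (2 * pi * k)) * \<bar>k\<bar> powr (- ?s) * (m powr (- ?s) * B))"
      using hb[of "m powr (- ?s) * B" "m powr (- ?s) * B"] by (simp add: has_bochner_integral_iff)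
    show "AE k in lborel. ((\<lambda>t. F t k) \<longlongrightarrow> F0 k) at_top"
    proof (intro AE_I2)
      fix k :: real
      show "((\<lambda>t. F t k) \<longlongrightarrow> F0 k) at_top"
      proof (cases "k = 0")
        case False
        have top: "filterlim (\<lambda>t. t * k) at_top at_top" if "k > 0"
          using filterlim_tendsto_pos_mult_at_top[OF tendsto_const[of k at_top] that filterlim_ident] by (simp add: mult.commute)
        have bot: "filterlim (\<lambda>t. t * k) at_bot at_top" if "- k > 0"
          using filterlim_tendsto_pos_mult_at_top[OF tendsto_const[of "- k" at_top] that filterlim_ident]
          unfolding filterlim_uminus_at_bot by (simp add: mult.commute)
        have tk: "filterlim (\<lambda>t. t * k) at_infinity at_top"
        proof (cases "k > 0")
          case True
          show ?thesis by (rule filterlim_mono[OF top[OF True] at_top_le_at_infinity order_refl])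
        next
          case F: False
          then have "- k > 0" using False by simp
          show ?thesis by (rule filterlim_mono[OF bot[OF \<open>- k > 0\<close>] at_bot_le_at_infinity order_refl])
        qed
        have "((\<lambda>t. g (t * k) / \<bar>t * k\<bar>) \<longlongrightarrow> 1) at_top" by (rule filterlim_compose[OF inf tk])
        from tendsto_mult_right[OF this, of "\<bar>k\<bar>"] have "((\<lambda>t. \<bar>k\<bar> * (g (t * k) / \<bar>t * k\<bar>)) \<longlongrightarrow> \<bar>k\<bar>) at_top" 
          by (simp add: mult.commute)
        moreover have "eventually (\<lambda>t. \<bar>k\<bar> * (g (t * k) / \<bar>t * k\<bar>) = g (t * k) / t) at_top"
          using eventually_gt_at_top[of 0] by eventually_elim (use False in \<open>simp add: abs_mult\<close>)
        ultimately have "((\<lambda>t. g (t * k) / t) \<longlongrightarrow> \<bar>k\<bar>) at_top" by (rule Lim_transform_eventually)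
        then have 1: "((\<lambda>t. (g (t * k) / t) powr (- ?s)) \<longlongrightarrow> \<bar>k\<bar> powr (- ?s)) at_top"
          using False by (intro tendsto_powr tendsto_const) auto
        have 2: "((\<lambda>t. G (t * k)) \<longlongrightarrow> (if k > 0 then p else q)) at_top"
        proof (cases "k > 0")
          case True
          show ?thesis using True filterlim_compose[OF G(4) top[OF True]] by simp
        next
          case F: False
          then have "- k > 0" using False by simp
          show ?thesis using F filterlim_compose[OF G(5) bot[OF \<open>- k > 0\<close>]] by simp
        qed
        show ?thesis unfolding F_def F0_def mult.assoc by (intro tendsto_mult tendsto_const 1 2)
      qed (simp add: F_def F0_def)
    qed
    show "\<forall>\<^sub>F t in at_top. AE k in lborel. norm (F t k) \<le> (2 - 2 * cos (2 * pi * k)) * \<bar>k\<bar> powr (- ?s) * (m powr (- ?s) * B)"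
      using eventually_gt_at_top[of 0]
    proof eventually_elim
      fix t :: real assume t: "t > 0"
      show "AE k in lborel. norm (F t k) \<le> (2 - 2 * cos (2 * pi * k)) * \<bar>k\<bar> powr (- ?s) * (m powr (- ?s) * B)"
      proof (intro AE_I2)
        fix k :: real
        have c: "0 \<le> 2 - 2 * cos (2 * pi * k)" using cos_le_one[of "2 * pi * k"] by simp
        show "norm (F t k) \<le> (2 - 2 * cos (2 * pi * k)) * \<bar>k\<bar> powr (- ?s) * (m powr (- ?s) * B)"
        proof (cases "k = 0")
          case False
          have "m * \<bar>t * k\<bar> \<le> m * (1 + \<bar>t * k\<bar>)" using m(1) by (intro mult_left_mono) auto
          then have "m * \<bar>t * k\<bar> \<le> g (t * k)" using m(2)[of "t * k"] by linarith
          then have "m * \<bar>k\<bar> \<le> g (t * k) / t" using t by (simp add: field_simps abs_mult)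
          then have "(g (t * k) / t) powr (- ?s) \<le> (m * \<bar>k\<bar>) powr (- ?s)"
            using m(1) False H by (intro powr_mono2') auto
          also have "\<dots> = \<bar>k\<bar> powr (- ?s) * m powr (- ?s)" using m(1) by (simp add: powr_mult mult.commute)
          finally have "(g (t * k) / t) powr (- ?s) * G (t * k) \<le> (\<bar>k\<bar> powr (- ?s) * m powr (- ?s)) * B"
            using G(2,3) by (intro mult_mono) auto
          then have "F t k \<le> (2 - 2 * cos (2 * pi * k)) * ((\<bar>k\<bar> powr (- ?s) * m powr (- ?s)) * B)"
            unfolding F_def using c by (intro mult_left_mono) auto
          moreover have "F t k \<ge> 0" unfolding F_def using c G(2) by simp
          ultimately show ?thesis by (simp add: mult.assoc)
        qed (simp add: F_def)
      qed
    qed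
  qed
  also have "(LINT k|lborel. F0 k) = (p + q) * increment_integral H"
    unfolding F0_def using hb[of p q] by (simp add: has_bochner_integral_iff)
  finally have lim: "((\<lambda>t. LINT k|lborel. F t k) \<longlongrightarrow> (p + q) * increment_integral H) at_top" .
  \<comment> \<open>The power \<open>t powr (2 * H + 1)\<close> freed by the rescaling of
    \<open>g\<close> is the Jacobian \<open>t\<close> times the normalization
    \<open>l powr - (2 * H)\<close>.\<close>
  have eq: "(LINT k|lborel. (2 - 2 * cos (2 * pi * k * inverse t)) * (g k powr (- ?s) * G k)) / inverse t powr (2 * H) = (LINT k|lborel. F t k)"
    if t: "t > 0" for t
  proof -
    have e1: "(LINT k|lborel. (2 - 2 * cos (2 * pi * k * inverse t)) * (g k powr (- ?s) * G k))
        = \<bar>t\<bar> *\<^sub>R (LINT k|lborel. (2 - 2 * cos (2 * pi * (0 + t * k) * inverse t)) * (g (0 + t * k) powr (- ?s) * G (0 + t * k)))"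
      by (rule lborel_integral_real_affine) (use t in simp)
    have e2: "\<bar>t\<bar> *\<^sub>R (LINT k|lborel. (2 - 2 * cos (2 * pi * (0 + t * k) * inverse t)) * (g (0 + t * k) powr (- ?s) * G (0 + t * k)))
       / inverse t powr (2 * H) = (LINT k|lborel. t * t powr (2 * H) * ((2 - 2 * cos (2 * pi * k)) * (g (t * k) powr (- ?s) * G (t * k))))"
    proof -
      have 1: "2 * pi * (0 + t * k) * inverse t = 2 * pi * k" for k using t by simp
      have 2: "inverse (inverse t powr (2 * H)) = t powr (2 * H)" using t by (simp add: inverse_powr)
      show ?thesis
        unfolding 1 divide_inverse 2 integral_mult_right_zero using t by (simp only: real_scaleR_def add_0 abs_of_pos mult_ac)
    qed
    have e3: "(LINT k|lborel. t * t powr (2 * H) * ((2 - 2 * cos (2 * pi * k)) * (g (t * k) powr (- ?s) * G (t * k)))) = (LINT k|lborel. F t k)"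
    proof (rule Bochner_Integration.integral_cong[OF refl])
      fix k
      have "(g (t * k) / t) powr (- ?s) = g (t * k) powr (- ?s) * t powr ?s"
        using t g_pos[of "t * k"]
        by (simp only: powr_minus divide_inverse powr_mult inverse_powr inverse_mult_distrib inverse_inverse_eq less_imp_le)
      moreover have "t powr ?s = t * t powr (2 * H)" using t by (simp add: powr_add)
      ultimately show "t * t powr (2 * H) * ((2 - 2 * cos (2 * pi * k)) * (g (t * k) powr (- ?s) * G (t * k))) = F t k"
        unfolding F_def by (simp only: mult_ac)
    qed
    show ?thesis unfolding e1 e2 e3 ..
  qed
  show ?thesis
    unfolding filterlim_at_right_to_top
  proof (rule Lim_transform_eventually[OF lim])
    show "\<forall>\<^sub>F t in at_top. (LINT k|lborel. F t k) =
       (LINT k|lborel. (2 - 2 * cos (2 * pi * k * inverse t)) * (g k powr (- ?s) * G k)) / inverse t powr (2 * H)"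
      using eventually_gt_at_top[of "0::real"] by eventually_elim (rule eq[symmetric])
  qed
qed

section \<open>Square-integrable functions\<close>

definition square_integrable :: "'a measure \<Rightarrow> ('a \<Rightarrow> complex) \<Rightarrow> bool" where
  "square_integrable M h \<longleftrightarrow> h \<in> borel_measurable M \<and> integrable M (\<lambda>x. (cmod (h x))\<^sup>2)"

definition sqnorm :: "'a measure \<Rightarrow> ('a \<Rightarrow> complex) \<Rightarrow> real" where
  "sqnorm M h = (LINT x|M. (cmod (h x))\<^sup>2)"

lemma borel_measurable_cnj [measurable]: "cnj \<in> borel_measurable borel"
  by (intro borel_measurable_continuous_onI continuous_intros)

lemma square_integrable_measurable: "square_integrable M h \<Longrightarrow> h \<in> borel_measurable M"
  unfolding square_integrable_def by blast

lemma square_integrable_integrable: "square_integrable M h \<Longrightarrow> integrable M (\<lambda>x. (cmod (h x))\<^sup>2)"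
  unfolding square_integrable_def by blast

lemma sqnorm_nonneg [simp]: "sqnorm M h \<ge> 0"
  unfolding sqnorm_def by simp

lemma two_mult_le_squares: "(a::real) * b \<le> a\<^sup>2 + b\<^sup>2"
proof -
  have "0 \<le> (a - b)\<^sup>2" by simp
  then have "2 * (a * b) \<le> a\<^sup>2 + b\<^sup>2" by (simp add: power2_diff algebra_simps)
  moreover have "0 \<le> a\<^sup>2 + b\<^sup>2" by simp
  ultimately show ?thesis by linarith
qed

lemma square_integrable_bound:
  assumes "square_integrable M k" "h \<in> borel_measurable M" "\<And>x. x \<in> space M \<Longrightarrow> cmod (h x) \<le> C * cmod (k x)"
  shows "square_integrable M h"
  unfolding square_integrable_def
proof
  note [measurable] = assms(2)
  show "integrable M (\<lambda>x. (cmod (h x))\<^sup>2)"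
  proof (rule Bochner_Integration.integrable_bound)
    show "integrable M (\<lambda>x. C\<^sup>2 * (cmod (k x))\<^sup>2)" by (intro integrable_mult_right square_integrable_integrable assms)
    show "AE x in M. norm ((cmod (h x))\<^sup>2) \<le> norm (C\<^sup>2 * (cmod (k x))\<^sup>2)"
    proof (intro AE_I2)
      fix x assume "x \<in> space M"
      then have "(cmod (h x))\<^sup>2 \<le> (C * cmod (k x))\<^sup>2" by (intro power_mono assms) auto
      then show "norm ((cmod (h x))\<^sup>2) \<le> norm (C\<^sup>2 * (cmod (k x))\<^sup>2)" by (simp add: power_mult_distrib)
    qed
  qed simp
qed (rule assms)

lemma square_integrable_cnj: "square_integrable M h \<Longrightarrow> square_integrable M (\<lambda>x. cnj (h x))"
  unfolding square_integrable_def by (auto intro: measurable_compose[OF _ borel_measurable_cnj])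

lemma square_integrable_cmult: "square_integrable M h \<Longrightarrow> square_integrable M (\<lambda>x. a * h x)"
  unfolding square_integrable_def by (auto simp: norm_mult power_mult_distrib)

lemma square_integrable_add:
  assumes "square_integrable M h" "square_integrable M k"
  shows "square_integrable M (\<lambda>x. h x + k x)" "sqnorm M (\<lambda>x. h x + k x) \<le> 2 * sqnorm M h + 2 * sqnorm M k"
proof -
  have [measurable]: "h \<in> borel_measurable M" "k \<in> borel_measurable M" using assms by (auto simp: square_integrable_def)
  have b: "(cmod (h x + k x))\<^sup>2 \<le> 2 * (cmod (h x))\<^sup>2 + 2 * (cmod (k x))\<^sup>2" for x
  proof -
    have "(cmod (h x + k x))\<^sup>2 \<le> (cmod (h x) + cmod (k x))\<^sup>2" by (intro power_mono norm_triangle_ineq) auto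
    also have "\<dots> \<le> 2 * (cmod (h x))\<^sup>2 + 2 * (cmod (k x))\<^sup>2"
      using zero_le_power2[of "cmod (h x) - cmod (k x)"] by (simp add: power2_sum power2_diff)
    finally show ?thesis .
  qed
  have i: "integrable M (\<lambda>x. 2 * (cmod (h x))\<^sup>2 + 2 * (cmod (k x))\<^sup>2)"
    by (intro Bochner_Integration.integrable_add integrable_mult_right square_integrable_integrable assms)
  have i2: "integrable M (\<lambda>x. (cmod (h x + k x))\<^sup>2)"
    by (rule Bochner_Integration.integrable_bound[OF i]) (use b in \<open>auto intro!: AE_I2\<close>)
  then show "square_integrable M (\<lambda>x. h x + k x)" unfolding square_integrable_def by simp
  have "sqnorm M (\<lambda>x. h x + k x) \<le> (LINT x|M. 2 * (cmod (h x))\<^sup>2 + 2 * (cmod (k x))\<^sup>2)"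
    unfolding sqnorm_def by (intro integral_mono i i2 b)
  also have "\<dots> = 2 * sqnorm M h + 2 * sqnorm M k"
    unfolding sqnorm_def using assms by (simp add: square_integrable_integrable)
  finally show "sqnorm M (\<lambda>x. h x + k x) \<le> 2 * sqnorm M h + 2 * sqnorm M k" .
qed

lemma square_integrable_diff:
  assumes "square_integrable M h" "square_integrable M k"
  shows "square_integrable M (\<lambda>x. h x - k x)" "sqnorm M (\<lambda>x. h x - k x) \<le> 2 * sqnorm M h + 2 * sqnorm M k"
  using square_integrable_add[OF assms(1) square_integrable_cmult[OF assms(2), of "-1"]]
  by (simp_all add: sqnorm_def)

lemma sqnorm_minus_commute: "sqnorm M (\<lambda>x. h x - k x) = sqnorm M (\<lambda>x. k x - h x)"
  by (simp add: sqnorm_def norm_minus_commute)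

lemma square_integrable_zero: "square_integrable M (\<lambda>x. 0)"
  unfolding square_integrable_def by simp

lemma square_integrable_sum:
  assumes "finite J" "\<And>i. i \<in> J \<Longrightarrow> square_integrable M (h i)"
  shows "square_integrable M (\<lambda>x. \<Sum>i\<in>J. h i x)"
  using assms by (induction J rule: finite_induct) (simp_all add: square_integrable_zero square_integrable_add)

lemma square_integrable_product:
  assumes "square_integrable M h" "square_integrable M k"
  shows "integrable M (\<lambda>x. h x * k x)"
proof (rule Bochner_Integration.integrable_bound)
  have [measurable]: "h \<in> borel_measurable M" "k \<in> borel_measurable M" using assms by (auto simp: square_integrable_def)
  show "integrable M (\<lambda>x. (cmod (h x))\<^sup>2 + (cmod (k x))\<^sup>2)"
    by (intro Bochner_Integration.integrable_add square_integrable_integrable assms)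
  show "(\<lambda>x. h x * k x) \<in> borel_measurable M" by measurable
  show "AE x in M. norm (h x * k x) \<le> norm ((cmod (h x))\<^sup>2 + (cmod (k x))\<^sup>2)"
    using two_mult_le_squares by (auto simp: norm_mult intro!: AE_I2)
qed

lemma cauchy_schwarz_integral:
  assumes "square_integrable M h" "square_integrable M k"
  shows "(LINT x|M. cmod (h x) * cmod (k x)) \<le> sqrt (sqnorm M h) * sqrt (sqnorm M k)"
proof -
  have [measurable]: "h \<in> borel_measurable M" "k \<in> borel_measurable M" using assms by (auto simp: square_integrable_def)
  have i: "integrable M (\<lambda>x. cmod (h x) * cmod (k x))"
    using integrable_norm[OF square_integrable_product[OF assms]] by (simp add: norm_mult)
  let ?I = "LINT x|M. cmod (h x) * cmod (k x)"
  have p: "?I \<ge> 0" by simp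
  have "ennreal (?I\<^sup>2) = (\<integral>\<^sup>+x. ennreal (cmod (h x)) * ennreal (cmod (k x)) \<partial>M)\<^sup>2"
    using nn_integral_eq_integral[OF i] p by (simp add: ennreal_mult ennreal_power)
  also have "\<dots> \<le> (\<integral>\<^sup>+x. (ennreal (cmod (h x)))\<^sup>2 \<partial>M) * (\<integral>\<^sup>+x. (ennreal (cmod (k x)))\<^sup>2 \<partial>M)"
    by (rule Cauchy_Schwarz_nn_integral) measurable
  also have "\<dots> = ennreal (sqnorm M h) * ennreal (sqnorm M k)"
    using nn_integral_eq_integral[OF square_integrable_integrable[OF assms(1)]]
      nn_integral_eq_integral[OF square_integrable_integrable[OF assms(2)]]
    by (simp add: sqnorm_def ennreal_power)
  also have "\<dots> = ennreal (sqnorm M h * sqnorm M k)" by (simp add: ennreal_mult)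
  finally have "?I\<^sup>2 \<le> sqnorm M h * sqnorm M k" by simp
  then have "?I \<le> sqrt (sqnorm M h * sqnorm M k)" using p by (simp add: real_le_rsqrt)
  then show ?thesis by (simp add: real_sqrt_mult)
qed

text \<open>The product is not conjugated, so that one statement passes covariances,
  pseudo-covariances and variances of real parts to the limit. The product is expanded around the
  limits and Cauchy--Schwarz is used on each of the three terms.\<close>

lemma tendsto_integral_product:
  assumes h: "\<And>n. square_integrable M (h n)" "square_integrable M h0" "(\<lambda>n. sqnorm M (\<lambda>x. h n x - h0 x)) \<longlonglongrightarrow> 0"
    and k: "\<And>n. square_integrable M (k n)" "square_integrable M k0" "(\<lambda>n. sqnorm M (\<lambda>x. k n x - k0 x)) \<longlonglongrightarrow> 0"
  shows "(\<lambda>n. LINT x|M. h n x * k n x) \<longlonglongrightarrow> (LINT x|M. h0 x * k0 x)"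
proof (rule LIM_zero_cancel, rule Lim_null_comparison)
  define d where "d n x = h n x - h0 x" for n x
  define e where "e n x = k n x - k0 x" for n x
  have d: "square_integrable M (d n)" for n unfolding d_def[abs_def] by (intro square_integrable_diff h)
  have e: "square_integrable M (e n)" for n unfolding e_def[abs_def] by (intro square_integrable_diff k)
  have dl: "(\<lambda>n. sqrt (sqnorm M (d n))) \<longlonglongrightarrow> 0" using tendsto_real_sqrt[OF h(3)] unfolding d_def[abs_def] by simp
  have el: "(\<lambda>n. sqrt (sqnorm M (e n))) \<longlonglongrightarrow> 0" using tendsto_real_sqrt[OF k(3)] unfolding e_def[abs_def] by simp
  let ?b = "\<lambda>n. sqrt (sqnorm M (d n)) * sqrt (sqnorm M (e n)) + sqrt (sqnorm M (d n)) * sqrt (sqnorm M k0) + sqrt (sqnorm M h0) * sqrt (sqnorm M (e n))"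
  have "?b \<longlonglongrightarrow> 0 * 0 + 0 * sqrt (sqnorm M k0) + sqrt (sqnorm M h0) * 0"
    by (intro tendsto_intros dl el)
  then show "?b \<longlonglongrightarrow> 0" by simp
  have "norm ((LINT x|M. h n x * k n x) - (LINT x|M. h0 x * k0 x)) \<le> ?b n" for n
  proof -
    have i: "integrable M (\<lambda>x. d n x * e n x)" "integrable M (\<lambda>x. d n x * k0 x)" "integrable M (\<lambda>x. h0 x * e n x)"
      by (intro square_integrable_product d e h k)+
    have n: "norm (LINT x|M. p x * q x) \<le> sqrt (sqnorm M p) * sqrt (sqnorm M q)"
      if "square_integrable M p" "square_integrable M q" for p q
      using integral_norm_bound[of M "\<lambda>x. p x * q x"] cauchy_schwarz_integral[OF that] by (simp add: norm_mult)
    have "(LINT x|M. h n x * k n x) - (LINT x|M. h0 x * k0 x) = (LINT x|M. h n x * k n x - h0 x * k0 x)"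
      by (intro Bochner_Integration.integral_diff[symmetric] square_integrable_product h k)
    also have "\<dots> = (LINT x|M. d n x * e n x + d n x * k0 x + h0 x * e n x)"
      by (intro Bochner_Integration.integral_cong refl) (simp add: d_def e_def algebra_simps)
    also have "\<dots> = (LINT x|M. d n x * e n x) + (LINT x|M. d n x * k0 x) + (LINT x|M. h0 x * e n x)"
      using i by simp
    finally show ?thesis
      using n[OF d e, of n n] n[OF d k(2), of n] n[OF h(2) e, of n]
      by (smt (verit) norm_triangle_ineq)
  qed
  then show "\<forall>\<^sub>F n in sequentially. norm ((LINT x|M. h n x * k n x) - (LINT x|M. h0 x * k0 x)) \<le> ?b n"
    by (intro always_eventually allI)
qed

lemma sqnorm_cnj: "sqnorm M (\<lambda>x. cnj (h x) - cnj (k x)) = sqnorm M (\<lambda>x. h x - k x)"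
  unfolding sqnorm_def by (simp flip: complex_cnj_diff)

lemma sqnorm_eq_inner: "complex_of_real (sqnorm M h) = (LINT x|M. h x * cnj (h x))"
  unfolding sqnorm_def by (simp only: integral_complex_of_real[symmetric] complex_norm_square)

lemma sqnorm_eq_0:
  assumes "square_integrable M h" "sqnorm M h = 0" shows "AE x in M. h x = 0"
  using assms integral_nonneg_eq_0_iff_AE[OF square_integrable_integrable[OF assms(1)]]
  by (simp add: sqnorm_def)

lemma sqnorm_cong_AE:
  assumes "h \<in> borel_measurable M" "k \<in> borel_measurable M" "AE x in M. h x = k x"
  shows "sqnorm M h = sqnorm M k"
  unfolding sqnorm_def by (rule integral_cong_AE) (use assms in \<open>auto elim: eventually_mono\<close>)

lemma square_integrable_cong_AE:
  assumes "square_integrable M h" "k \<in> borel_measurable M" "AE x in M. h x = k x"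
  shows "square_integrable M k"
proof -
  have "integrable M (\<lambda>x. (cmod (k x))\<^sup>2)"
    by (rule integrable_cong_AE_imp[OF square_integrable_integrable[OF assms(1)]])
       (use assms in \<open>auto elim: eventually_mono\<close>)
  then show ?thesis using assms(2) unfolding square_integrable_def by simp
qed

text \<open>A non-integrable \<open>f\<close> has integral \<open>0\<close> by convention, which
  keeps the bound true; it is applied path by path, where integrability is not yet known.\<close>

lemma norm_integral_le_nn_integral:
  fixes f :: "'a \<Rightarrow> complex"
  shows "ennreal (cmod (integral\<^sup>L M f)) \<le> (\<integral>\<^sup>+x. ennreal (cmod (f x)) \<partial>M)"
proof (cases "integrable M f")
  case True
  then show ?thesis by (rule integral_norm_bound_ennreal)
qed (simp add: not_integrable_integral_eq)

context prob_space
begin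

lemma square_integrable_const: "square_integrable M (\<lambda>x. a)"
  unfolding square_integrable_def by simp

lemma square_integrable_expectation: "square_integrable M X \<Longrightarrow> integrable M X"
  using square_integrable_product[OF _ square_integrable_const[of 1]] by simp

lemma tendsto_expectation:
  assumes "\<And>n. square_integrable M (X n)" "square_integrable M Y" "(\<lambda>n. sqnorm M (\<lambda>x. X n x - Y x)) \<longlonglongrightarrow> 0"
  shows "(\<lambda>n. LINT x|M. X n x) \<longlonglongrightarrow> (LINT x|M. Y x)"
  using tendsto_integral_product[OF assms square_integrable_const[of 1] square_integrable_const[of 1]]
  by (simp add: sqnorm_def)

end

section \<open>Gaussian random variables\<close>

text \<open>Both alternatives of \<open>gaussian_rv\<close> obey the same formula for the
  characteristic function of a centred variable, the constant case with variance \<open>0\<close>.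
  Limits of Gaussian variables are handled through that formula.\<close>

lemma (in prob_space) gaussian_rv_moments:
  assumes "gaussian_rv M X"
  shows "X \<in> borel_measurable M" "integrable M (\<lambda>\<omega>. (X \<omega>)\<^sup>2)"
    "(\<integral>\<omega>. X \<omega> \<partial>M) = 0 \<Longrightarrow> (\<integral>\<omega>. cis (t * X \<omega>) \<partial>M) = of_real (exp (- (t\<^sup>2 * (\<integral>\<omega>. (X \<omega>)\<^sup>2 \<partial>M) / 2)))"
proof -
  consider (normal) \<mu> \<sigma> where "\<sigma> > 0" "distributed M lborel X (normal_density \<mu> \<sigma>)"
    | (const) \<mu> where "X \<in> borel_measurable M" "AE \<omega> in M. X \<omega> = \<mu>"
    using assms unfolding gaussian_rv_def by blast
  then have "X \<in> borel_measurable M \<and> integrable M (\<lambda>\<omega>. (X \<omega>)\<^sup>2) \<and>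
    ((\<integral>\<omega>. X \<omega> \<partial>M) = 0 \<longrightarrow> (\<integral>\<omega>. cis (t * X \<omega>) \<partial>M) = of_real (exp (- (t\<^sup>2 * (\<integral>\<omega>. (X \<omega>)\<^sup>2 \<partial>M) / 2))))"
  proof cases
    case normal
    have m: "X \<in> borel_measurable M" using distributed_measurable[OF normal(2)] by simp
    have i2: "integrable lborel (\<lambda>x. normal_density \<mu> \<sigma> x * x\<^sup>2)"
    proof -
      have "integrable lborel (\<lambda>x. normal_density \<mu> \<sigma> x * (x - \<mu>)^2 + 2 * \<mu> * (normal_density \<mu> \<sigma> x * x) - \<mu>\<^sup>2 * normal_density \<mu> \<sigma> x)"
        by (intro Bochner_Integration.integrable_add Bochner_Integration.integrable_diff integrable_mult_right
            integrable_normal_moment integrable_normal_moment_nz_1 integrable_normal_density normal)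
      then show ?thesis by (simp add: power2_diff algebra_simps power2_eq_square)
    qed
    have iX: "integrable M (\<lambda>\<omega>. (X \<omega>)\<^sup>2)"
      using distributed_integrable[OF normal(2), of "\<lambda>x. x\<^sup>2"] i2 by simp
    have eX: "(\<integral>\<omega>. X \<omega> \<partial>M) = \<mu>"
      using distributed_integral[OF normal(2), of "\<lambda>x. x"] integral_normal_moment_nz_1[OF normal(1), of \<mu>] by simp
    have "(\<integral>\<omega>. cis (t * X \<omega>) \<partial>M) = of_real (exp (- (t\<^sup>2 * (\<integral>\<omega>. (X \<omega>)\<^sup>2 \<partial>M) / 2)))" if "(\<integral>\<omega>. X \<omega> \<partial>M) = 0"
    proof -
      have \<mu>: "\<mu> = 0" using eX that by simp
      have v: "(\<integral>\<omega>. (X \<omega>)\<^sup>2 \<partial>M) = \<sigma>\<^sup>2"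
        using distributed_integral[OF normal(2), of "\<lambda>x. x\<^sup>2"] integral_normal_moment_even[OF normal(1), of 0 1]
        by (simp add: \<mu>)
      define Y where "Y = (\<lambda>\<omega>. X \<omega> / \<sigma>)"
      have Ym: "Y \<in> borel_measurable M" unfolding Y_def using m by measurable
      have "distributed M lborel Y std_normal_density"
        using normal(2) unfolding \<mu> normal_standard_normal_convert[OF normal(1)] Y_def by simp
      then have "distr M lborel Y = std_normal_distribution" by (rule distributed_distr_eq_density)
      moreover have "distr M lborel Y = distr M borel Y" by (rule distr_cong) auto
      ultimately have d: "distr M borel Y = std_normal_distribution" by simp
      have "(\<integral>\<omega>. cis (t * X \<omega>) \<partial>M) = (\<integral>\<omega>. iexp (t * \<sigma> * Y \<omega>) \<partial>M)"
        using normal(1) by (simp add: Y_def cis_conv_exp)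
      also have "\<dots> = char (distr M borel Y) (t * \<sigma>)"
        unfolding char_def by (rule integral_distr[symmetric]) (use Ym in auto)
      also have "\<dots> = of_real (exp (- (t\<^sup>2 * (\<integral>\<omega>. (X \<omega>)\<^sup>2 \<partial>M) / 2)))"
        unfolding d char_std_normal_distribution v by (simp add: power_mult_distrib)
      finally show ?thesis .
    qed
    then show ?thesis using m iX by blast
  next
    case const
    note [measurable] = const(1)
    have iX: "integrable M (\<lambda>\<omega>. (X \<omega>)\<^sup>2)"
      by (rule integrable_cong_AE_imp[of M "\<lambda>\<omega>. \<mu>\<^sup>2"]) (use const(2) in \<open>auto elim: eventually_mono\<close>)
    have "(\<integral>\<omega>. cis (t * X \<omega>) \<partial>M) = of_real (exp (- (t\<^sup>2 * (\<integral>\<omega>. (X \<omega>)\<^sup>2 \<partial>M) / 2)))" if E: "(\<integral>\<omega>. X \<omega> \<partial>M) = 0"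
    proof -
      have "(\<integral>\<omega>. X \<omega> \<partial>M) = (\<integral>\<omega>. \<mu> \<partial>M)" by (rule integral_cong_AE) (use const in auto)
      then have "\<mu> = 0" using E by (simp add: prob_space)
      then have ae: "AE \<omega> in M. X \<omega> = 0" using const(2) by simp
      have "(\<integral>\<omega>. (X \<omega>)\<^sup>2 \<partial>M) = (\<integral>\<omega>. 0 \<partial>M)" by (rule integral_cong_AE) (use ae in \<open>auto elim: eventually_mono\<close>)
      moreover have "(\<integral>\<omega>. cis (t * X \<omega>) \<partial>M) = (\<integral>\<omega>. 1 \<partial>M)"
        by (rule integral_cong_AE) (use ae in \<open>auto elim: eventually_mono\<close>)
      ultimately show ?thesis by (simp add: prob_space)
    qed
    then show ?thesis using const(1) iX by blast
  qed
  then show "X \<in> borel_measurable M" "integrable M (\<lambda>\<omega>. (X \<omega>)\<^sup>2)"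
    "(\<integral>\<omega>. X \<omega> \<partial>M) = 0 \<Longrightarrow> (\<integral>\<omega>. cis (t * X \<omega>) \<partial>M) = of_real (exp (- (t\<^sup>2 * (\<integral>\<omega>. (X \<omega>)\<^sup>2 \<partial>M) / 2)))"
    by blast+
qed

text \<open>After division by the standard deviation the law is identified by Levy uniqueness;
  variance \<open>0\<close> leads to the degenerate alternative of the definition.\<close>

lemma (in prob_space) gaussian_rv_of_char:
  assumes X: "X \<in> borel_measurable M" "integrable M (\<lambda>\<omega>. (X \<omega>)\<^sup>2)" and v: "v = (\<integral>\<omega>. (X \<omega>)\<^sup>2 \<partial>M)"
    and ch: "\<And>t. (\<integral>\<omega>. cis (t * X \<omega>) \<partial>M) = of_real (exp (- (t\<^sup>2 * v / 2)))"
  shows "gaussian_rv M X"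
proof (cases "v = 0")
  case True
  then have "AE \<omega> in M. X \<omega> = 0" using integral_nonneg_eq_0_iff_AE[OF X(2)] v by simp
  then show ?thesis using X(1) unfolding gaussian_rv_def by blast
next
  case False
  have "v \<ge> 0" unfolding v by simp
  with False have p: "sqrt v > 0" by simp
  define Y where "Y = (\<lambda>\<omega>. X \<omega> / sqrt v)"
  have Ym: "Y \<in> borel_measurable M" unfolding Y_def using X(1) by measurable
  have "char (distr M borel Y) = char std_normal_distribution"
  proof
    fix t
    have "char (distr M borel Y) t = (\<integral>\<omega>. iexp (t * Y \<omega>) \<partial>M)"
      unfolding char_def by (rule integral_distr) (use Ym in auto)
    also have "\<dots> = (\<integral>\<omega>. cis ((t / sqrt v) * X \<omega>) \<partial>M)" by (simp add: Y_def cis_conv_exp)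
    also have "\<dots> = char std_normal_distribution t"
      unfolding ch char_std_normal_distribution using p \<open>v \<ge> 0\<close> False by (simp add: power_divide)
    finally show "char (distr M borel Y) t = char std_normal_distribution t" .
  qed
  then have d: "distr M borel Y = std_normal_distribution"
    by (intro Levy_uniqueness real_distribution_distr real_dist_normal_dist) (use Ym in auto)
  have "distr M lborel Y = distr M borel Y" by (rule distr_cong) auto
  then have "distributed M lborel Y std_normal_density"
    unfolding distributed_def using d Ym by simp
  then have "distributed M lborel X (normal_density 0 (sqrt v))"
    unfolding normal_standard_normal_convert[OF p] Y_def by simp
  then show ?thesis unfolding gaussian_rv_def using p by blast
qed

lemma cmod_cis_diff_le: "cmod (cis a - cis b) \<le> \<bar>a - b\<bar>"
proof -
  have "cis a - cis b = cis b * (cis (a - b) - 1)" by (simp add: algebra_simps cis_mult)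
  then have "cmod (cis a - cis b) = cmod (cis (a - b) - 1)" by (simp add: norm_mult)
  also have "\<dots> \<le> \<bar>a - b\<bar>"
    using iexp_approx1[of "a - b" 0] by (simp add: cis_conv_exp)
  finally show ?thesis .
qed

text \<open>Centred Gaussian laws are closed under mean-square limits: the variances converge, hence
  so do the explicit characteristic functions, and these converge to that of the limit because
  \<open>cis\<close> is Lipschitz.\<close>

lemma (in prob_space) gaussian_rv_limit:
  assumes S: "\<And>n. square_integrable M (S n)" "square_integrable M S0" "(\<lambda>n. sqnorm M (\<lambda>\<omega>. S n \<omega> - S0 \<omega>)) \<longlonglongrightarrow> 0"
    and G: "\<And>n. gaussian_rv M (\<lambda>\<omega>. Re (S n \<omega>))" "\<And>n. (\<integral>\<omega>. S n \<omega> \<partial>M) = 0"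
  shows "gaussian_rv M (\<lambda>\<omega>. Re (S0 \<omega>))"
proof -
  have [measurable]: "S n \<in> borel_measurable M" "S0 \<in> borel_measurable M" for n
    using S by (auto simp: square_integrable_def)
  \<comment> \<open>Real parts are viewed as complex variables so that the mean-square results for
    complex functions apply.\<close>
  define R where "R n \<omega> = complex_of_real (Re (S n \<omega>))" for n \<omega>
  define R0 where "R0 \<omega> = complex_of_real (Re (S0 \<omega>))" for \<omega>
  have R: "square_integrable M (R n)" for n
    unfolding R_def[abs_def] by (rule square_integrable_bound[OF S(1)[of n], of _ 1]) (auto simp: abs_Re_le_cmod)
  have R0: "square_integrable M R0"
    unfolding R0_def[abs_def] by (rule square_integrable_bound[OF S(2), of _ 1]) (auto simp: abs_Re_le_cmod)
  have Rl: "(\<lambda>n. sqnorm M (\<lambda>\<omega>. R n \<omega> - R0 \<omega>)) \<longlonglongrightarrow> 0"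
  proof (rule tendsto_sandwich[OF _ _ tendsto_const S(3)])
    have "sqnorm M (\<lambda>\<omega>. R n \<omega> - R0 \<omega>) \<le> sqnorm M (\<lambda>\<omega>. S n \<omega> - S0 \<omega>)" for n
      unfolding sqnorm_def
    proof (rule integral_mono)
      show "integrable M (\<lambda>\<omega>. (cmod (R n \<omega> - R0 \<omega>))\<^sup>2)" "integrable M (\<lambda>\<omega>. (cmod (S n \<omega> - S0 \<omega>))\<^sup>2)"
        by (intro square_integrable_integrable square_integrable_diff R R0 S)+
      show "(cmod (R n \<omega> - R0 \<omega>))\<^sup>2 \<le> (cmod (S n \<omega> - S0 \<omega>))\<^sup>2" for \<omega>
        using abs_Re_le_cmod[of "S n \<omega> - S0 \<omega>"] by (intro power_mono) (auto simp: R_def R0_def simp flip: of_real_diff)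
    qed
    then show "\<forall>\<^sub>F n in sequentially. sqnorm M (\<lambda>\<omega>. R n \<omega> - R0 \<omega>) \<le> sqnorm M (\<lambda>\<omega>. S n \<omega> - S0 \<omega>)" by simp
  qed simp
  define v where "v = (\<integral>\<omega>. (Re (S0 \<omega>))\<^sup>2 \<partial>M)"
  have RR: "R n \<omega> * R n \<omega> = complex_of_real ((Re (S n \<omega>))\<^sup>2)" "R0 \<omega> * R0 \<omega> = complex_of_real ((Re (S0 \<omega>))\<^sup>2)" for n \<omega>
    by (simp_all add: R_def R0_def power2_eq_square)
  have "(\<lambda>n. LINT \<omega>|M. R n \<omega> * R n \<omega>) \<longlonglongrightarrow> (LINT \<omega>|M. R0 \<omega> * R0 \<omega>)"
    by (rule tendsto_integral_product[OF R R0 Rl R R0 Rl])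
  then have vl: "(\<lambda>n. \<integral>\<omega>. (Re (S n \<omega>))\<^sup>2 \<partial>M) \<longlonglongrightarrow> v"
    unfolding RR integral_complex_of_real v_def by (simp only: tendsto_of_real_iff)
  have iR0: "integrable M (\<lambda>\<omega>. (Re (S0 \<omega>))\<^sup>2)"
    using square_integrable_integrable[OF R0] by (simp add: R0_def)
  have ch: "(\<integral>\<omega>. cis (t * Re (S0 \<omega>)) \<partial>M) = of_real (exp (- (t\<^sup>2 * v / 2)))" for t
  proof (rule LIMSEQ_unique)
    have c: "square_integrable M (\<lambda>\<omega>. cis (t * Re (S n \<omega>)))" "square_integrable M (\<lambda>\<omega>. cis (t * Re (S0 \<omega>)))" for n
      unfolding square_integrable_def by simp_all
    show "(\<lambda>n. \<integral>\<omega>. cis (t * Re (S n \<omega>)) \<partial>M) \<longlonglongrightarrow> (\<integral>\<omega>. cis (t * Re (S0 \<omega>)) \<partial>M)"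
    proof (rule tendsto_expectation[OF c], rule tendsto_sandwich[OF _ _ tendsto_const])
      show "(\<lambda>n. t\<^sup>2 * sqnorm M (\<lambda>\<omega>. R n \<omega> - R0 \<omega>)) \<longlonglongrightarrow> 0"
        using tendsto_mult_left[OF Rl, of "t\<^sup>2"] by simp
      have "sqnorm M (\<lambda>\<omega>. cis (t * Re (S n \<omega>)) - cis (t * Re (S0 \<omega>))) \<le> (LINT \<omega>|M. t\<^sup>2 * (cmod (R n \<omega> - R0 \<omega>))\<^sup>2)" for n
        unfolding sqnorm_def
      proof (rule integral_mono)
        show "integrable M (\<lambda>\<omega>. (cmod (cis (t * Re (S n \<omega>)) - cis (t * Re (S0 \<omega>))))\<^sup>2)"
          by (intro square_integrable_integrable square_integrable_diff c)
        show "integrable M (\<lambda>\<omega>. t\<^sup>2 * (cmod (R n \<omega> - R0 \<omega>))\<^sup>2)"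
          by (intro integrable_mult_right square_integrable_integrable square_integrable_diff R R0)
        fix \<omega>
        have "cmod (cis (t * Re (S n \<omega>)) - cis (t * Re (S0 \<omega>))) \<le> \<bar>t * Re (S n \<omega>) - t * Re (S0 \<omega>)\<bar>"
          by (rule cmod_cis_diff_le)
        also have "\<dots> = \<bar>t\<bar> * cmod (R n \<omega> - R0 \<omega>)"
          unfolding R_def R0_def by (simp only: of_real_diff[symmetric] norm_of_real right_diff_distrib[symmetric] abs_mult)
        finally have "(cmod (cis (t * Re (S n \<omega>)) - cis (t * Re (S0 \<omega>))))\<^sup>2 \<le> (\<bar>t\<bar> * cmod (R n \<omega> - R0 \<omega>))\<^sup>2"
          by (rule power_mono) simp
        then show "(cmod (cis (t * Re (S n \<omega>)) - cis (t * Re (S0 \<omega>))))\<^sup>2 \<le> t\<^sup>2 * (cmod (R n \<omega> - R0 \<omega>))\<^sup>2"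
          by (simp add: power_mult_distrib)
      qed
      then show "\<forall>\<^sub>F n in sequentially. sqnorm M (\<lambda>\<omega>. cis (t * Re (S n \<omega>)) - cis (t * Re (S0 \<omega>))) \<le> t\<^sup>2 * sqnorm M (\<lambda>\<omega>. R n \<omega> - R0 \<omega>)"
        unfolding sqnorm_def by simp
    qed simp
    have "(\<integral>\<omega>. Re (S n \<omega>) \<partial>M) = 0" for n
      using G(2)[of n] integral_Re[OF square_integrable_expectation[OF S(1)[of n]]] by simp
    then have "(\<integral>\<omega>. cis (t * Re (S n \<omega>)) \<partial>M) = of_real (exp (- (t\<^sup>2 * (\<integral>\<omega>. (Re (S n \<omega>))\<^sup>2 \<partial>M) / 2)))" for n
      by (rule gaussian_rv_moments(3)[OF G(1)])
    moreover have "(\<lambda>n. complex_of_real (exp (- (t\<^sup>2 * (\<integral>\<omega>. (Re (S n \<omega>))\<^sup>2 \<partial>M) / 2)))) \<longlonglongrightarrow> of_real (exp (- (t\<^sup>2 * v / 2)))"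
      by (intro tendsto_intros vl) simp
    ultimately show "(\<lambda>n. \<integral>\<omega>. cis (t * Re (S n \<omega>)) \<partial>M) \<longlonglongrightarrow> of_real (exp (- (t\<^sup>2 * v / 2)))" by simp
  qed
  show ?thesis by (rule gaussian_rv_of_char[OF _ iR0 v_def ch]) measurable
qed

section \<open>Spectral representation of the forcing\<close>

lemma multiplication_formula_fourier:
  assumes \<alpha>: "integrable lborel \<alpha>" and \<gamma>: "integrable lborel \<gamma>"
  shows "(LINT x|lborel. fourier \<alpha> x * \<gamma> x) = (LINT k|lborel. \<alpha> k * fourier \<gamma> k)"
proof -
  have r: "integrable lborel (\<lambda>x. \<alpha> (- x))"
    using lborel_integrable_real_affine[OF \<alpha>, of "-1" 0] by simp
  have "(LINT x|lborel. fourier \<alpha> x * \<gamma> x) = (LINT x|lborel. fourier_inv (\<lambda>x. \<alpha> (- x)) x * \<gamma> x)"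
    by (simp add: fourier_inv_eq_reflect)
  also have "\<dots> = (LINT k|lborel. \<alpha> (- k) * fourier_inv \<gamma> k)" by (rule multiplication_formula[OF r \<gamma>])
  also have "\<dots> = (LINT k|lborel. \<alpha> k * fourier_inv \<gamma> (- k))"
    by (subst lborel_integral_real_affine[of "-1" _ 0]) auto
  finally show ?thesis by (simp add: fourier_inv_eq)
qed

lemma fourier_inv_measurable:
  assumes "\<phi> \<in> borel_measurable borel" shows "fourier_inv \<phi> \<in> borel_measurable borel"
proof -
  have [measurable]: "\<phi> \<in> borel_measurable borel" by fact
  show ?thesis unfolding fourier_inv_def[abs_def]
    by (rule lborel.borel_measurable_lebesgue_integral) (simp add: case_prod_unfold, measurable)
qed

lemma fourier_inv_norm_le:
  assumes "integrable lborel f" shows "cmod (fourier_inv f k) \<le> (LINT x|lborel. cmod (f x))"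
  unfolding fourier_inv_eq by (rule fourier_norm_le[OF assms])

locale driven_evolution = prob_space M + regularization L H c g
  for M :: "'w measure" and L H c :: real and g :: "real \<Rightarrow> real" +
  fixes f :: "(real \<Rightarrow> real \<Rightarrow> complex) \<Rightarrow> 'w \<Rightarrow> complex" and Cf :: "real \<Rightarrow> real"
  assumes schwartz_Cf: "schwartz Cf" and Cf_even: "\<And>x. Cf (- x) = Cf x"
    and white: "white_in_time_forcing M Cf f"
begin

definition spectrum :: "real \<Rightarrow> complex" where
  "spectrum = fourier (\<lambda>x. complex_of_real (Cf x))"

definition density_re :: "real \<Rightarrow> real" where
  "density_re k = Re (spectrum k)"

lemma schwartz_spectrum: "schwartz spectrum"
  unfolding spectrum_def by (intro schwartz_fourier schwartz_of_real schwartz_Cf)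

lemma spectrum_real: "spectrum k = complex_of_real (density_re k)"
proof -
  have "cnj (spectrum k) = fourier_inv (\<lambda>x. complex_of_real (Cf x)) k"
    unfolding spectrum_def cnj_fourier by simp
  also have "\<dots> = spectrum k" unfolding spectrum_def fourier_inv_eq_reflect by (simp add: Cf_even)
  finally show ?thesis unfolding density_re_def by (metis Reals_cnj_iff of_real_Re)
qed

lemma density_re_measurable [measurable]: "density_re \<in> borel_measurable borel"
  unfolding density_re_def[abs_def] using schwartz_measurable[OF schwartz_spectrum] by measurable

lemma density_re_integrable: "integrable lborel density_re"
  unfolding density_re_def[abs_def] by (intro integrable_Re schwartz_integrable schwartz_spectrum)

text \<open>Inversion writes \<open>Cf (x - y)\<close> as a superposition of
  \<open>cis (2 * pi * k * (x - y))\<close>, which separates \<open>x\<close> from \<open>y\<close>;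
  the multiplication formula, once in each variable, carries out the two space integrals. This is
  the diagonalization of a homogeneous covariance.\<close>

lemma covariance_spectral:
  assumes \<phi>: "integrable lborel \<phi>" and \<psi>: "integrable lborel \<psi>"
  shows "(LINT x|lborel. LINT y|lborel. \<phi> x * cnj (\<psi> y) * complex_of_real (Cf (x - y)))
    = (LINT k|lborel. fourier_inv \<phi> k * cnj (fourier_inv \<psi> k) * spectrum k)"
proof -
  have [measurable]: "\<phi> \<in> borel_measurable borel" "\<psi> \<in> borel_measurable borel" using \<phi> \<psi> by auto
  have [measurable]: "fourier_inv \<psi> \<in> borel_measurable borel" by (rule fourier_inv_measurable) measurable
  have [measurable]: "spectrum \<in> borel_measurable borel" by (rule schwartz_measurable[OF schwartz_spectrum])
  define \<beta> where "\<beta> k = spectrum k * cnj (fourier_inv \<psi> k)" for k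
  have i\<beta>: "integrable lborel \<beta>"
  proof (rule Bochner_Integration.integrable_bound)
    show "integrable lborel (\<lambda>k. (LINT x|lborel. cmod (\<psi> x)) * cmod (spectrum k))"
      by (intro integrable_mult_right integrable_norm schwartz_integrable schwartz_spectrum)
    show "AE k in lborel. norm (\<beta> k) \<le> norm ((LINT x|lborel. cmod (\<psi> x)) * cmod (spectrum k))"
    proof (rule AE_I2)
      fix k
      have "cmod (spectrum k) * cmod (fourier_inv \<psi> k) \<le> cmod (spectrum k) * (LINT x|lborel. cmod (\<psi> x))"
        by (intro mult_left_mono fourier_inv_norm_le[OF \<psi>]) simp
      also have "\<dots> = (LINT x|lborel. cmod (\<psi> x)) * cmod (spectrum k)" by (rule mult.commute)
      also have "\<dots> \<le> norm ((LINT x|lborel. cmod (\<psi> x)) * cmod (spectrum k))" by (simp only: real_norm_def abs_ge_self)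
      finally show "norm (\<beta> k) \<le> norm ((LINT x|lborel. cmod (\<psi> x)) * cmod (spectrum k))"
        unfolding \<beta>_def norm_mult complex_mod_cnj by simp
    qed
  qed (unfold \<beta>_def[abs_def], measurable)
  have C: "complex_of_real (Cf (x - y)) = fourier (\<lambda>k. cis (2 * pi * k * x) * spectrum k) y" for x y
  proof -
    have "complex_of_real (Cf (x - y)) = fourier_inv spectrum (x - y)"
      unfolding spectrum_def by (simp add: fourier_inv_fourier schwartz_of_real schwartz_Cf)
    also have "\<dots> = fourier (\<lambda>k. cis (2 * pi * k * x) * spectrum k) y"
      unfolding fourier_inv_def fourier_def
    proof (rule Bochner_Integration.integral_cong[OF refl])
      fix k
      have "2 * pi * k * (x - y) = - 2 * pi * y * k + 2 * pi * k * x" by (simp add: algebra_simps)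
      then show "cis (2 * pi * k * (x - y)) * spectrum k = cis (- 2 * pi * y * k) * (cis (2 * pi * k * x) * spectrum k)"
        by (simp only: cis_mult[symmetric] mult.assoc)
    qed
    finally show ?thesis .
  qed
  have "(LINT y|lborel. \<phi> x * cnj (\<psi> y) * complex_of_real (Cf (x - y))) = fourier_inv \<beta> x * \<phi> x" for x
  proof -
    have ic: "integrable lborel (\<lambda>k. cis (2 * pi * k * x) * spectrum k)"
      by (intro integrable_cis_mult schwartz_integrable schwartz_spectrum) measurable
    have "(LINT y|lborel. \<phi> x * cnj (\<psi> y) * complex_of_real (Cf (x - y)))
       = (LINT y|lborel. \<phi> x * (fourier (\<lambda>k. cis (2 * pi * k * x) * spectrum k) y * cnj (\<psi> y)))"
      unfolding C by (intro Bochner_Integration.integral_cong refl) (simp only: mult_ac)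
    also have "\<dots> = \<phi> x * (LINT y|lborel. fourier (\<lambda>k. cis (2 * pi * k * x) * spectrum k) y * cnj (\<psi> y))"
      by (rule integral_mult_right_zero)
    also have "(LINT y|lborel. fourier (\<lambda>k. cis (2 * pi * k * x) * spectrum k) y * cnj (\<psi> y))
       = (LINT k|lborel. cis (2 * pi * k * x) * spectrum k * fourier (\<lambda>y. cnj (\<psi> y)) k)"
      by (rule multiplication_formula_fourier[OF ic]) (use \<psi> in simp)
    also have "\<dots> = fourier_inv \<beta> x"
      unfolding fourier_inv_def[of \<beta>] \<beta>_def cnj_fourier_inv[symmetric] by (simp only: mult.assoc)
    finally show ?thesis by (simp only: mult.commute)
  qed
  then have "(LINT x|lborel. LINT y|lborel. \<phi> x * cnj (\<psi> y) * complex_of_real (Cf (x - y)))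
     = (LINT x|lborel. fourier_inv \<beta> x * \<phi> x)" by simp
  also have "\<dots> = (LINT k|lborel. \<beta> k * fourier_inv \<phi> k)" by (rule multiplication_formula[OF i\<beta> \<phi>])
  also have "\<dots> = (LINT k|lborel. fourier_inv \<phi> k * cnj (fourier_inv \<psi> k) * spectrum k)"
    unfolding \<beta>_def by (simp only: mult_ac)
  finally show ?thesis .
qed

lemma forcing_test_integrable:
  assumes "forcing_test \<Phi>" shows "integrable lborel (\<Phi> t)"
proof -
  obtain K where K: "\<And>x. cmod (\<Phi> t x) \<le> K / (1 + x\<^sup>2)" using assms unfolding forcing_test_def by blast
  have "(\<lambda>w. \<Phi> (fst w) (snd w)) \<in> borel_measurable (borel \<Otimes>\<^sub>M borel)"
    using assms by (simp add: forcing_test_def case_prod_unfold)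
  from measurable_compose[OF measurable_Pair1' this, of t] have "\<Phi> t \<in> borel_measurable borel" by simp
  then show ?thesis by (rule integrable_le_inverse_square[OF _ K])
qed

lemma forcing_covariance:
  assumes "forcing_test \<Phi>" "forcing_test \<Psi>"
  shows "(\<integral>\<omega>. f \<Phi> \<omega> * cnj (f \<Psi> \<omega>) \<partial>M)
    = (LINT t|lborel. LINT k|lborel. fourier_inv (\<Phi> t) k * cnj (fourier_inv (\<Psi> t) k) * spectrum k)"
proof -
  have "(\<integral>\<omega>. f \<Phi> \<omega> * cnj (f \<Psi> \<omega>) \<partial>M) =
          (LINT t|lborel. LINT x|lborel. LINT y|lborel. \<Phi> t x * cnj (\<Psi> t y) * complex_of_real (Cf (x - y)))"
    using white assms unfolding white_in_time_forcing_def by blast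
  then show ?thesis
    by (simp only: covariance_spectral[OF forcing_test_integrable[OF assms(1)] forcing_test_integrable[OF assms(2)]])
qed

lemma forcing_mean: "forcing_test \<Phi> \<Longrightarrow> (\<integral>\<omega>. f \<Phi> \<omega> \<partial>M) = 0"
  using white unfolding white_in_time_forcing_def by blast

lemma forcing_pseudo_covariance:
  "forcing_test \<Phi> \<Longrightarrow> forcing_test \<Psi> \<Longrightarrow> (\<integral>\<omega>. f \<Phi> \<omega> * f \<Psi> \<omega> \<partial>M) = 0"
  using white unfolding white_in_time_forcing_def by blast

lemma forcing_gaussian:
  assumes "finite J" "\<And>i. i \<in> J \<Longrightarrow> forcing_test (\<Phi> i)"
  shows "gaussian_rv M (\<lambda>\<omega>. Re (\<Sum>i\<in>J. a i * f (\<Phi> i) \<omega>))"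
proof -
  have fam: "gaussian_family M {\<Phi>. forcing_test \<Phi>} f" using white unfolding white_in_time_forcing_def by blast
  \<comment> \<open>\<open>gaussian_family\<close> speaks of sets of test functions, whereas the
    indexed family may repeat one; coefficients of equal test functions are therefore added
    up.\<close>
  define b where "b \<Psi> = (\<Sum>i | i \<in> J \<and> \<Phi> i = \<Psi>. a i)" for \<Psi>
  have "(\<Sum>\<Psi>\<in>\<Phi> ` J. b \<Psi> * f \<Psi> \<omega>) = (\<Sum>i\<in>J. a i * f (\<Phi> i) \<omega>)" for \<omega>
  proof -
    have "(\<Sum>\<Psi>\<in>\<Phi> ` J. b \<Psi> * f \<Psi> \<omega>) = (\<Sum>\<Psi>\<in>\<Phi> ` J. \<Sum>i | i \<in> J \<and> \<Phi> i = \<Psi>. a i * f (\<Phi> i) \<omega>)"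
      unfolding b_def sum_distrib_right by (intro sum.cong refl) auto
    also have "\<dots> = (\<Sum>i\<in>J. a i * f (\<Phi> i) \<omega>)" using sum.image_gen[OF assms(1), of "\<lambda>i. a i * f (\<Phi> i) \<omega>" \<Phi>] by simp
    finally show ?thesis .
  qed
  moreover have "gaussian_rv M (\<lambda>\<omega>. Re (\<Sum>\<Psi>\<in>\<Phi> ` J. b \<Psi> * f \<Psi> \<omega>))"
    by (rule fam[unfolded gaussian_family_def, rule_format, of "\<Phi> ` J" b]) (use assms in auto)
  ultimately show ?thesis by simp
qed

lemma forcing_square_integrable:
  assumes "forcing_test \<Phi>" shows "square_integrable M (f \<Phi>)"
proof -
  have 1: "gaussian_rv M (\<lambda>\<omega>. Re (f \<Phi> \<omega>))"
    using forcing_gaussian[of "{()}" "\<lambda>_. \<Phi>" "\<lambda>_. 1"] assms by simp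
  \<comment> \<open>The coefficient \<open>- \<i>\<close> turns the real part into the imaginary
    part.\<close>
  have 2: "gaussian_rv M (\<lambda>\<omega>. Im (f \<Phi> \<omega>))"
    using forcing_gaussian[of "{()}" "\<lambda>_. \<Phi>" "\<lambda>_. - \<i>"] assms by simp
  have m: "f \<Phi> \<in> borel_measurable M"
    using gaussian_rv_moments(1)[OF 1] gaussian_rv_moments(1)[OF 2] by (simp add: borel_measurable_complex_iff)
  have "integrable M (\<lambda>\<omega>. (Re (f \<Phi> \<omega>))\<^sup>2 + (Im (f \<Phi> \<omega>))\<^sup>2)"
    by (intro Bochner_Integration.integrable_add gaussian_rv_moments(2)[OF 1] gaussian_rv_moments(2)[OF 2])
  then show ?thesis using m unfolding square_integrable_def by (simp add: cmod_power2)
qed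

lemma forcing_test_separable:
  assumes "schwartz \<phi>" shows "forcing_test (\<lambda>s x. indicator {0..t} s * \<phi> x)"
proof -
  have [measurable]: "\<phi> \<in> borel_measurable borel" by (rule schwartz_measurable[OF assms])
  obtain K where K: "K \<ge> 0" "\<And>x. cmod (\<phi> x) \<le> K / (1 + x\<^sup>2)" by (rule rapid_decay_bound[OF schwartz_rapid[OF assms]]) blast
  have "cmod (indicator {0..t} s * \<phi> x) \<le> K / (1 + x\<^sup>2)" for s x
    using K(2)[of x] order_trans[OF norm_ge_zero K(2)] by (auto simp: indicator_def)
  moreover have "indicator {0..t} s * \<phi> x = 0" if "\<bar>s\<bar> > \<bar>t\<bar>" for s x
    using that by (auto simp: indicator_def)
  moreover have "(\<lambda>(s, x). indicator {0..t} s * \<phi> x) \<in> borel_measurable (borel \<Otimes>\<^sub>M borel)" by measurable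
  ultimately show ?thesis unfolding forcing_test_def by blast
qed

text \<open>The spectral density is nonnegative because the forcing has nonnegative variance: test with
  functions whose spectrum is an increasingly concentrated Gaussian.\<close>

lemma density_re_nonneg: "density_re k \<ge> 0"
proof -
  define X where "X = (\<lambda>n. 1 / real (Suc n))"
  have X: "X n > 0" "X \<longlonglongrightarrow> 0" for n
    unfolding X_def by (simp, rule LIMSEQ_Suc[OF lim_1_over_n])
  have [measurable]: "spectrum \<in> borel_measurable borel" by (rule schwartz_measurable[OF schwartz_spectrum])
  obtain B where B: "\<And>x. cmod (spectrum x) \<le> B" by (rule schwartz_bounded[OF schwartz_spectrum]) blast
  have lim: "(\<lambda>n. LINT z|lborel. of_real (std_normal_density z) * spectrum (k + X n * z)) \<longlonglongrightarrow> spectrum k"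
    by (rule gauss_approx[OF _ B _ X(2)])
       (use schwartz_continuous[OF schwartz_spectrum] in \<open>auto simp: continuous_on_eq_continuous_at\<close>)
  have "Re (LINT z|lborel. of_real (std_normal_density z) * spectrum (k + X n * z)) \<ge> 0" for n
  proof -
    \<comment> \<open>The factor \<open>4\<close> is chosen so that \<open>\<gamma>\<close> squared
      is proportional to the normal density of mean \<open>k\<close> and standard deviation
      \<open>X n\<close>.\<close>
    define \<gamma> where "\<gamma> j = complex_of_real (exp (- (1 / (4 * (X n)\<^sup>2)) * (j + (- k))\<^sup>2))" for j
    have s\<gamma>: "schwartz \<gamma>" unfolding \<gamma>_def
      using schwartz_shift[OF schwartz_gauss[of "1 / (4 * (X n)\<^sup>2)"], of "- k"] X(1)[of n] by simp
    define \<Phi> where "\<Phi> s x = indicator {0..1} s * fourier \<gamma> x" for s x :: real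
    have ft: "forcing_test \<Phi>" unfolding \<Phi>_def[abs_def] by (rule forcing_test_separable[OF schwartz_fourier[OF s\<gamma>]])
    have A: "fourier_inv (\<Phi> s) j = indicator {0..1} s * \<gamma> j" for s j
    proof -
      have "fourier_inv (\<Phi> s) j = indicator {0..1} s * fourier_inv (fourier \<gamma>) j"
        unfolding fourier_inv_eq \<Phi>_def[abs_def] fourier_scale ..
      then show ?thesis unfolding fourier_inv_fourier[OF s\<gamma>] .
    qed
    have "complex_of_real (sqnorm M (f \<Phi>)) = (LINT s::real|lborel. LINT j|lborel. (indicator {0..1} s * \<gamma> j) * cnj (indicator {0..1} s * \<gamma> j) * spectrum j)"
      unfolding sqnorm_eq_inner forcing_covariance[OF ft ft] A ..
    also have "\<dots> = (LINT s::real|lborel. indicator {0..1} s *\<^sub>R (LINT j|lborel. \<gamma> j * cnj (\<gamma> j) * spectrum j))"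
    proof (rule Bochner_Integration.integral_cong[OF refl])
      fix s :: real
      show "(LINT j|lborel. (indicator {0..1} s * \<gamma> j) * cnj (indicator {0..1} s * \<gamma> j) * spectrum j) =
        indicator {0..1} s *\<^sub>R (LINT j|lborel. \<gamma> j * cnj (\<gamma> j) * spectrum j)"
        by (cases "s \<in> {0..1}") auto
    qed
    also have "\<dots> = (LINT j|lborel. \<gamma> j * cnj (\<gamma> j) * spectrum j)" by simp
    also have "\<dots> = \<bar>X n\<bar> *\<^sub>R (LINT z|lborel. \<gamma> (k + X n * z) * cnj (\<gamma> (k + X n * z)) * spectrum (k + X n * z))"
      by (rule lborel_integral_real_affine) (use X(1)[of n] in simp)
    also have "(\<lambda>z. \<gamma> (k + X n * z) * cnj (\<gamma> (k + X n * z)) * spectrum (k + X n * z))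
       = (\<lambda>z. of_real (sqrt (2 * pi)) * (of_real (std_normal_density z) * spectrum (k + X n * z)))"
    proof
      fix z
      have "exp (- (1 / (4 * (X n)\<^sup>2)) * (k + X n * z + (- k))\<^sup>2) * exp (- (1 / (4 * (X n)\<^sup>2)) * (k + X n * z + (- k))\<^sup>2)
         = sqrt (2 * pi) * std_normal_density z"
        using X(1)[of n] by (simp add: std_normal_density_def exp_add[symmetric] power_mult_distrib)
      then have "\<gamma> (k + X n * z) * cnj (\<gamma> (k + X n * z)) = of_real (sqrt (2 * pi) * std_normal_density z)"
        unfolding \<gamma>_def complex_cnj_complex_of_real of_real_mult[symmetric] by (simp only:)
      then show "\<gamma> (k + X n * z) * cnj (\<gamma> (k + X n * z)) * spectrum (k + X n * z)
         = of_real (sqrt (2 * pi)) * (of_real (std_normal_density z) * spectrum (k + X n * z))"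
        by (simp only: of_real_mult mult.assoc)
    qed
    also have "\<bar>X n\<bar> *\<^sub>R (LINT z|lborel. of_real (sqrt (2 * pi)) * (of_real (std_normal_density z) * spectrum (k + X n * z)))
       = of_real (X n * sqrt (2 * pi)) * (LINT z|lborel. of_real (std_normal_density z) * spectrum (k + X n * z))"
      using X(1)[of n] by (simp add: scaleR_conv_of_real)
    finally have e: "complex_of_real (sqnorm M (f \<Phi>)) = of_real (X n * sqrt (2 * pi)) * (LINT z|lborel. of_real (std_normal_density z) * spectrum (k + X n * z))" .
    have "sqnorm M (f \<Phi>) = (X n * sqrt (2 * pi)) * Re (LINT z|lborel. of_real (std_normal_density z) * spectrum (k + X n * z))"
      using arg_cong[OF e, of Re] by simp
    then have "0 \<le> (X n * sqrt (2 * pi)) * Re (LINT z|lborel. of_real (std_normal_density z) * spectrum (k + X n * z))"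
      using sqnorm_nonneg by metis
    moreover have "X n * sqrt (2 * pi) > 0" using X(1)[of n] by simp
    ultimately show ?thesis by (simp add: zero_le_mult_iff)
  qed
  with tendsto_Re[OF lim] show ?thesis unfolding density_re_def
    by (intro tendsto_lowerbound[OF tendsto_Re[OF lim]]) auto
qed

end

section \<open>Mean-square limits and almost sure convergence\<close>

lemma sqnorm_diff_expand:
  assumes h: "square_integrable M h" and k: "square_integrable M k"
  shows "complex_of_real (sqnorm M (\<lambda>x. h x - k x)) = (LINT x|M. h x * cnj (h x)) - (LINT x|M. h x * cnj (k x))
    - (LINT x|M. k x * cnj (h x)) + (LINT x|M. k x * cnj (k x))"
proof -
  have i: "integrable M (\<lambda>x. h x * cnj (h x))" "integrable M (\<lambda>x. h x * cnj (k x))"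
    "integrable M (\<lambda>x. k x * cnj (h x))" "integrable M (\<lambda>x. k x * cnj (k x))"
    by (intro square_integrable_product square_integrable_cnj h k)+
  have "complex_of_real (sqnorm M (\<lambda>x. h x - k x)) = (LINT x|M. (h x * cnj (h x) - h x * cnj (k x)) - (k x * cnj (h x) - k x * cnj (k x)))"
    unfolding sqnorm_eq_inner by (intro Bochner_Integration.integral_cong refl) (simp add: algebra_simps)
  also have "\<dots> = ((LINT x|M. h x * cnj (h x)) - (LINT x|M. h x * cnj (k x))) - ((LINT x|M. k x * cnj (h x)) - (LINT x|M. k x * cnj (k x)))"
    using i by simp
  finally show ?thesis by simp
qed

lemma sqnorm_diff_le:
  assumes "square_integrable M h" "square_integrable M k" "square_integrable M l"
  shows "sqnorm M (\<lambda>x. h x - k x) \<le> 2 * sqnorm M (\<lambda>x. h x - l x) + 2 * sqnorm M (\<lambda>x. k x - l x)"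
  using square_integrable_diff(2)[OF square_integrable_diff(1)[OF assms(1,3)] square_integrable_diff(1)[OF assms(2,3)]]
  by simp

lemma tendsto_inner:
  assumes "\<And>n. square_integrable M (h n)" "square_integrable M h0" "(\<lambda>n. sqnorm M (\<lambda>x. h n x - h0 x)) \<longlonglongrightarrow> 0"
    and "\<And>n. square_integrable M (k n)" "square_integrable M k0" "(\<lambda>n. sqnorm M (\<lambda>x. k n x - k0 x)) \<longlonglongrightarrow> 0"
  shows "(\<lambda>n. LINT x|M. h n x * cnj (k n x)) \<longlonglongrightarrow> (LINT x|M. h0 x * cnj (k0 x))"
  by (rule tendsto_integral_product) (simp_all add: assms square_integrable_cnj sqnorm_cnj)

lemma sqnorm_sum_tendsto_zero:
  assumes "finite J" "\<And>i n. i \<in> J \<Longrightarrow> square_integrable M (h i n)" "\<And>i. i \<in> J \<Longrightarrow> square_integrable M (h0 i)"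
    "\<And>i. i \<in> J \<Longrightarrow> (\<lambda>n. sqnorm M (\<lambda>x. h i n x - h0 i x)) \<longlonglongrightarrow> 0"
  shows "(\<lambda>n. sqnorm M (\<lambda>x. (\<Sum>i\<in>J. a i * h i n x) - (\<Sum>i\<in>J. a i * h0 i x))) \<longlonglongrightarrow> 0"
  using assms
proof (induction J rule: finite_induct)
  case empty
  then show ?case by (simp add: sqnorm_def)
next
  case (insert j J)
  let ?A = "\<lambda>n x. (\<Sum>i\<in>J. a i * h i n x) - (\<Sum>i\<in>J. a i * h0 i x)"
  let ?B = "\<lambda>n x. a j * (h j n x - h0 j x)"
  have sA: "square_integrable M (?A n)" for n
    using insert.hyps(1) insert.prems by (intro square_integrable_diff square_integrable_sum square_integrable_cmult) auto
  have sB: "square_integrable M (?B n)" for n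
    using insert.prems by (intro square_integrable_diff square_integrable_cmult) auto
  have IH: "(\<lambda>n. sqnorm M (?A n)) \<longlonglongrightarrow> 0" using insert by blast
  have e: "sqnorm M (?B n) = (cmod (a j))\<^sup>2 * sqnorm M (\<lambda>x. h j n x - h0 j x)" for n
    unfolding sqnorm_def by (simp add: norm_mult power_mult_distrib)
  have "(\<lambda>n. 2 * ((cmod (a j))\<^sup>2 * sqnorm M (\<lambda>x. h j n x - h0 j x)) + 2 * sqnorm M (?A n)) \<longlonglongrightarrow> 2 * ((cmod (a j))\<^sup>2 * 0) + 2 * 0"
    using insert.prems by (intro tendsto_intros IH) auto
  then have l: "(\<lambda>n. 2 * sqnorm M (?B n) + 2 * sqnorm M (?A n)) \<longlonglongrightarrow> 0" unfolding e by simp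
  have eq: "(\<lambda>x. (\<Sum>i\<in>insert j J. a i * h i n x) - (\<Sum>i\<in>insert j J. a i * h0 i x)) = (\<lambda>x. ?B n x + ?A n x)" for n
    using insert.hyps by (auto simp: algebra_simps)
  have "sqnorm M (\<lambda>x. (\<Sum>i\<in>insert j J. a i * h i n x) - (\<Sum>i\<in>insert j J. a i * h0 i x)) \<le> 2 * sqnorm M (?B n) + 2 * sqnorm M (?A n)" for n
    unfolding eq by (rule square_integrable_add(2)[OF sB sA])
  then show ?case by (intro tendsto_sandwich[OF _ _ tendsto_const l] always_eventually allI) auto
qed

text \<open>A geometric rate makes the mean absolute increments summable, so the telescoping series
  converges absolutely almost surely; Fatou's lemma then shows that the pathwise limit is also the
  mean-square limit. \<open>Y\<close> is constrained only on paths that converge, which fits a field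
  defined by \<open>lim\<close>.\<close>

lemma (in prob_space) fast_cauchy_limit:
  assumes X: "\<And>n. square_integrable M (X n)" and C: "C \<ge> 0"
    "\<And>n m. n \<le> m \<Longrightarrow> sqnorm M (\<lambda>\<omega>. X m \<omega> - X n \<omega>) \<le> C * (1/2) ^ n"
    and Y: "Y \<in> borel_measurable M" "\<And>\<omega>. \<omega> \<in> space M \<Longrightarrow> convergent (\<lambda>n. X n \<omega>) \<Longrightarrow> (\<lambda>n. X n \<omega>) \<longlonglongrightarrow> Y \<omega>"
  shows "AE \<omega> in M. (\<lambda>n. X n \<omega>) \<longlonglongrightarrow> Y \<omega>" "square_integrable M Y"
    "(\<lambda>n. sqnorm M (\<lambda>\<omega>. X n \<omega> - Y \<omega>)) \<longlonglongrightarrow> 0"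
proof -
  have [measurable]: "X n \<in> borel_measurable M" "Y \<in> borel_measurable M" for n
    using X Y(1) by (auto simp: square_integrable_def)
  define d where "d n \<omega> = X (Suc n) \<omega> - X n \<omega>" for n \<omega>
  have dm[measurable]: "d n \<in> borel_measurable M" for n unfolding d_def[abs_def] by measurable
  have d2: "square_integrable M (d n)" for n unfolding d_def[abs_def] by (intro square_integrable_diff X)
  \<comment> \<open>The hypothesis bounds squared norms by multiples of \<open>(1/2) ^ n\<close>;
    norms, and thereby first moments, decay with the square root of that rate.\<close>
  define q where "q = sqrt (1/2::real)"
  have q: "0 < q" "q < 1" by (simp_all add: q_def real_sqrt_less_iff)
  have dn: "(\<integral>\<^sup>+\<omega>. ennreal (cmod (d n \<omega>)) \<partial>M) \<le> ennreal (sqrt C * q ^ n)" for n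
  proof -
    have "(\<integral>\<^sup>+\<omega>. ennreal (cmod (d n \<omega>)) \<partial>M) = ennreal (LINT \<omega>|M. cmod (d n \<omega>))"
      by (intro nn_integral_eq_integral integrable_norm square_integrable_expectation d2) auto
    also have "(LINT \<omega>|M. cmod (d n \<omega>)) \<le> sqrt (sqnorm M (d n))"
      using cauchy_schwarz_integral[OF d2[of n] square_integrable_const[of 1]] by (simp add: sqnorm_def prob_space)
    also have "sqrt (sqnorm M (d n)) \<le> sqrt (C * (1/2) ^ n)"
      using C(2)[of n "Suc n"] unfolding d_def[abs_def] by simp
    also have "sqrt (C * (1/2) ^ n) = sqrt C * q ^ n" by (simp add: real_sqrt_mult real_sqrt_power q_def)
    finally show ?thesis by (simp add: ennreal_leI)
  qed
  have "(\<integral>\<^sup>+\<omega>. (\<Sum>n. ennreal (cmod (d n \<omega>))) \<partial>M) = (\<Sum>n. \<integral>\<^sup>+\<omega>. ennreal (cmod (d n \<omega>)) \<partial>M)"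
    by (rule nn_integral_suminf) measurable
  also have "\<dots> \<le> (\<Sum>n. ennreal (sqrt C * q ^ n))" by (intro suminf_le dn) auto
  also have "\<dots> < \<infinity>"
  proof -
    have "summable (\<lambda>n. sqrt C * q ^ n)" using q by (intro summable_mult summable_geometric) auto
    then show ?thesis using q C(1) by (subst suminf_ennreal2) auto
  qed
  finally have "AE \<omega> in M. (\<Sum>n. ennreal (cmod (d n \<omega>))) \<noteq> \<infinity>"
    by (intro nn_integral_PInf_AE) auto
  then show ae: "AE \<omega> in M. (\<lambda>n. X n \<omega>) \<longlonglongrightarrow> Y \<omega>"
    using AE_space
  proof eventually_elim
    fix \<omega> assume \<omega>: "(\<Sum>n. ennreal (cmod (d n \<omega>))) \<noteq> \<infinity>" "\<omega> \<in> space M"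
    have "summable (\<lambda>n. norm (d n \<omega>))" using \<omega>(1) by (intro summable_suminf_not_top) auto
    then have "summable (\<lambda>n. d n \<omega>)" by (rule summable_norm_cancel)
    then have "convergent (\<lambda>n. \<Sum>i<n. d i \<omega>)" by (simp add: summable_iff_convergent)
    moreover have "(\<Sum>i<n. d i \<omega>) = X n \<omega> - X 0 \<omega>" for n unfolding d_def by (rule sum_lessThan_telescope)
    ultimately have "convergent (\<lambda>n. X n \<omega> - X 0 \<omega> + X 0 \<omega>)"
      by (intro convergent_add convergent_const) simp
    then show "(\<lambda>n. X n \<omega>) \<longlonglongrightarrow> Y \<omega>" using Y(2)[OF \<omega>(2)] by simp
  qed
  have b: "(\<integral>\<^sup>+\<omega>. ennreal ((cmod (X n \<omega> - Y \<omega>))\<^sup>2) \<partial>M) \<le> ennreal (C * (1/2) ^ n)" for n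
  proof -
    have "(\<integral>\<^sup>+\<omega>. ennreal ((cmod (X n \<omega> - Y \<omega>))\<^sup>2) \<partial>M) = (\<integral>\<^sup>+\<omega>. liminf (\<lambda>m. ennreal ((cmod (X n \<omega> - X m \<omega>))\<^sup>2)) \<partial>M)"
    proof (rule nn_integral_cong_AE)
      show "AE \<omega> in M. ennreal ((cmod (X n \<omega> - Y \<omega>))\<^sup>2) = liminf (\<lambda>m. ennreal ((cmod (X n \<omega> - X m \<omega>))\<^sup>2))"
        using ae
      proof eventually_elim
        fix \<omega> assume "(\<lambda>m. X m \<omega>) \<longlonglongrightarrow> Y \<omega>"
        then have "(\<lambda>m. ennreal ((cmod (X n \<omega> - X m \<omega>))\<^sup>2)) \<longlonglongrightarrow> ennreal ((cmod (X n \<omega> - Y \<omega>))\<^sup>2)"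
          by (intro tendsto_ennrealI tendsto_power tendsto_norm tendsto_diff tendsto_const)
        then show "ennreal ((cmod (X n \<omega> - Y \<omega>))\<^sup>2) = liminf (\<lambda>m. ennreal ((cmod (X n \<omega> - X m \<omega>))\<^sup>2))"
          using lim_imp_Liminf[OF sequentially_bot] by metis
      qed
    qed
    also have "\<dots> \<le> liminf (\<lambda>m. \<integral>\<^sup>+\<omega>. ennreal ((cmod (X n \<omega> - X m \<omega>))\<^sup>2) \<partial>M)"
      by (rule nn_integral_liminf) measurable
    also have "\<dots> \<le> ennreal (C * (1/2) ^ n)"
    proof (rule Liminf_le)
      show "\<forall>\<^sub>F m in sequentially. (\<integral>\<^sup>+\<omega>. ennreal ((cmod (X n \<omega> - X m \<omega>))\<^sup>2) \<partial>M) \<le> ennreal (C * (1/2) ^ n)"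
        using eventually_ge_at_top[of n]
      proof eventually_elim
        fix m assume nm: "n \<le> m"
        have "(\<integral>\<^sup>+\<omega>. ennreal ((cmod (X n \<omega> - X m \<omega>))\<^sup>2) \<partial>M) = ennreal (sqnorm M (\<lambda>\<omega>. X n \<omega> - X m \<omega>))"
          unfolding sqnorm_def by (intro nn_integral_eq_integral square_integrable_integrable square_integrable_diff X) auto
        also have "\<dots> \<le> ennreal (C * (1/2) ^ n)" using C(2)[OF nm] sqnorm_minus_commute[of M "X n" "X m"] by (simp add: ennreal_leI)
        finally show "(\<integral>\<^sup>+\<omega>. ennreal ((cmod (X n \<omega> - X m \<omega>))\<^sup>2) \<partial>M) \<le> ennreal (C * (1/2) ^ n)" .
      qed
    qed simp
    finally show ?thesis .
  qed
  have s: "square_integrable M (\<lambda>\<omega>. X n \<omega> - Y \<omega>)" for n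
    unfolding square_integrable_def
  proof (intro conjI integrableI_bounded)
    show "(\<integral>\<^sup>+\<omega>. ennreal (norm ((cmod (X n \<omega> - Y \<omega>))\<^sup>2)) \<partial>M) < \<infinity>"
      using b[of n] by (simp add: order_le_less_trans)
  qed measurable
  show "square_integrable M Y"
    using square_integrable_diff(1)[OF X[of 0] s[of 0]] by simp
  have le: "sqnorm M (\<lambda>\<omega>. X n \<omega> - Y \<omega>) \<le> C * (1/2) ^ n" for n
  proof -
    have "ennreal (sqnorm M (\<lambda>\<omega>. X n \<omega> - Y \<omega>)) = (\<integral>\<^sup>+\<omega>. ennreal ((cmod (X n \<omega> - Y \<omega>))\<^sup>2) \<partial>M)"
      unfolding sqnorm_def by (intro nn_integral_eq_integral[symmetric] square_integrable_integrable s) auto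
    with b[of n] have "ennreal (sqnorm M (\<lambda>\<omega>. X n \<omega> - Y \<omega>)) \<le> ennreal (C * (1/2) ^ n)" by (simp only:)
    then show ?thesis by (rule ennreal_le_iff[THEN iffD1, rotated]) (use C(1) in simp)
  qed
  have "(\<lambda>n. C * (1/2::real) ^ n) \<longlonglongrightarrow> C * 0" by (intro tendsto_mult tendsto_const LIMSEQ_power_zero) simp
  then have l: "(\<lambda>n. C * (1/2::real) ^ n) \<longlonglongrightarrow> 0" by simp
  have ev: "\<forall>\<^sub>F n in sequentially. 0 \<le> sqnorm M (\<lambda>\<omega>. X n \<omega> - Y \<omega>)"
    "\<forall>\<^sub>F n in sequentially. sqnorm M (\<lambda>\<omega>. X n \<omega> - Y \<omega>) \<le> C * (1/2) ^ n"
    by (rule always_eventually, rule allI, rule sqnorm_nonneg) (rule always_eventually, rule allI, rule le)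
  show "(\<lambda>n. sqnorm M (\<lambda>\<omega>. X n \<omega> - Y \<omega>)) \<longlonglongrightarrow> 0"
    by (rule tendsto_sandwich[OF ev tendsto_const l])
qed

section \<open>The isometry between forcing variables and their symbols\<close>

context driven_evolution
begin

definition spectral_measure :: "real measure" where
  "spectral_measure = density lborel (\<lambda>k. ennreal (density_re k))"

definition symbol_measure :: "(real \<times> real) measure" where
  "symbol_measure = lborel \<Otimes>\<^sub>M spectral_measure"

lemma sets_spectral_measure [measurable_cong]: "sets spectral_measure = sets borel"
  by (simp add: spectral_measure_def)

lemma sets_symbol_measure [measurable_cong]: "sets symbol_measure = sets (borel \<Otimes>\<^sub>M borel)"
  unfolding symbol_measure_def by (intro sets_pair_measure_cong) (auto simp: sets_spectral_measure)

lemma finite_spectral_measure: "finite_measure spectral_measure"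
proof
  have "emeasure spectral_measure (space spectral_measure) = (\<integral>\<^sup>+k. ennreal (density_re k) \<partial>lborel)"
    unfolding spectral_measure_def by (subst emeasure_density) auto
  also have "\<dots> < \<infinity>" using density_re_integrable density_re_nonneg unfolding integrable_iff_bounded by simp
  finally show "emeasure spectral_measure (space spectral_measure) \<noteq> \<infinity>" by simp
qed

lemma pair_symbol_measure: "pair_sigma_finite lborel spectral_measure"
  by (intro pair_sigma_finite.intro sigma_finite_lborel finite_measure.axioms(1)[OF finite_spectral_measure])

lemma integral_spectral_measure:
  fixes F :: "real \<Rightarrow> complex"
  assumes "F \<in> borel_measurable borel"
  shows "integral\<^sup>L spectral_measure F = (LINT k|lborel. F k * spectrum k)"
  unfolding spectral_measure_def using assms density_re_nonneg
  by (subst integral_density) (auto simp: spectrum_real scaleR_conv_of_real mult.commute)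

lemma integral_symbol_measure:
  fixes F :: "real \<times> real \<Rightarrow> complex"
  assumes F: "integrable symbol_measure F"
  shows "integral\<^sup>L symbol_measure F = (LINT s|lborel. LINT k|lborel. F (s, k) * spectrum k)"
proof -
  have [measurable]: "F \<in> borel_measurable (borel \<Otimes>\<^sub>M borel)"
    using borel_measurable_integrable[OF F] by (simp cong: measurable_cong_sets add: sets_symbol_measure)
  have "integral\<^sup>L symbol_measure F = (LINT s|lborel. integral\<^sup>L spectral_measure (\<lambda>k. F (s, k)))"
    unfolding symbol_measure_def
    by (rule pair_sigma_finite.integral_fst'[OF pair_symbol_measure F[unfolded symbol_measure_def], symmetric])
  also have "\<dots> = (LINT s|lborel. LINT k|lborel. F (s, k) * spectrum k)"
    by (intro Bochner_Integration.integral_cong refl integral_spectral_measure) measurable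
  finally show ?thesis .
qed

definition moment :: "nat \<Rightarrow> real" where
  "moment j = (LINT k|spectral_measure. (1 + \<bar>k\<bar>) ^ j)"

lemma moment_integrable: "integrable spectral_measure (\<lambda>k. (1 + \<bar>k\<bar>) ^ j)"
proof -
  obtain K where K: "\<And>k. cmod (spectrum k) * (1 + \<bar>k\<bar>) ^ (j + 2) \<le> K"
    using schwartz_rapid[OF schwartz_spectrum] unfolding rapid_decay_def by blast
  have "integrable lborel (\<lambda>k. density_re k * (1 + \<bar>k\<bar>) ^ j)"
  proof (rule integrable_le_inverse_square)
    fix k :: real
    have "cmod (spectrum k) = density_re k" using density_re_nonneg[of k] by (simp add: spectrum_real)
    then have "density_re k * (1 + \<bar>k\<bar>) ^ j * (1 + \<bar>k\<bar>)\<^sup>2 \<le> K" using K[of k] by (simp add: power_add power2_eq_square mult_ac)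
    moreover have "density_re k * (1 + \<bar>k\<bar>) ^ j * (1 + k\<^sup>2) \<le> density_re k * (1 + \<bar>k\<bar>) ^ j * (1 + \<bar>k\<bar>)\<^sup>2"
      using density_re_nonneg[of k] by (intro mult_left_mono) (auto simp: power2_eq_square algebra_simps)
    ultimately have "density_re k * (1 + \<bar>k\<bar>) ^ j * (1 + k\<^sup>2) \<le> K" by linarith
    then show "norm (density_re k * (1 + \<bar>k\<bar>) ^ j) \<le> K / (1 + k\<^sup>2)"
      using density_re_nonneg[of k] by (simp add: pos_le_divide_eq add_pos_nonneg)
  qed measurable
  then show ?thesis unfolding spectral_measure_def
    using density_re_nonneg by (subst integrable_density) auto
qed

text \<open>The kernels that occur live on a bounded strip of times and grow at most polynomially in
  \<open>k\<close>, while the spectral measure has all moments. Norm estimates in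
  \<open>symbol_measure\<close> thus reduce to pointwise bounds; squaring doubles the
  exponent.\<close>

lemma strip_bound:
  assumes F: "F \<in> borel_measurable (borel \<Otimes>\<^sub>M borel)" and ab: "a \<le> b"
    and b: "\<And>s k. cmod (F (s, k)) \<le> indicator {a..b} s * (C * (1 + \<bar>k\<bar>) ^ m)"
  shows "square_integrable symbol_measure F" "sqnorm symbol_measure F \<le> C\<^sup>2 * (b - a) * moment (2 * m)"
proof -
  interpret P: pair_sigma_finite lborel spectral_measure by (rule pair_symbol_measure)
  have [measurable]: "F \<in> borel_measurable symbol_measure" using F by (simp cong: measurable_cong_sets add: sets_symbol_measure)
  have i1: "integrable lborel (indicator {a..b} :: real \<Rightarrow> real)" by (rule integrable_real_indicator) (use ab in auto)
  have i: "integrable (lborel \<Otimes>\<^sub>M spectral_measure) (\<lambda>(s, k). complex_of_real (indicator {a..b} s) * complex_of_real (C\<^sup>2 * (1 + \<bar>k\<bar>) ^ (2 * m)))"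
    by (rule P.integrable_product_mult[OF integrable_of_real[OF i1] integrable_of_real[OF integrable_mult_right[OF moment_integrable]]])
  have re: "(\<lambda>w. indicator {a..b} (fst w) * (C\<^sup>2 * (1 + \<bar>snd w\<bar>) ^ (2 * m)))
     = (\<lambda>w. Re (case w of (s, k) \<Rightarrow> complex_of_real (indicator {a..b} s) * complex_of_real (C\<^sup>2 * (1 + \<bar>k\<bar>) ^ (2 * m))))"
    by (auto simp: fun_eq_iff)
  have ir: "integrable symbol_measure (\<lambda>w. indicator {a..b} (fst w) * (C\<^sup>2 * (1 + \<bar>snd w\<bar>) ^ (2 * m)))"
    unfolding re symbol_measure_def by (rule integrable_Re[OF i])
  have sq: "(cmod (F w))\<^sup>2 \<le> indicator {a..b} (fst w) * (C\<^sup>2 * (1 + \<bar>snd w\<bar>) ^ (2 * m))" for w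
  proof -
    have "(cmod (F w))\<^sup>2 \<le> (indicator {a..b} (fst w) * (C * (1 + \<bar>snd w\<bar>) ^ m))\<^sup>2"
      using b[of "fst w" "snd w"] by (intro power_mono) auto
    also have "\<dots> = indicator {a..b} (fst w) * (C\<^sup>2 * (1 + \<bar>snd w\<bar>) ^ (2 * m))"
      by (simp add: power_mult_distrib power_mult power2_eq_square indicator_def power_even_eq)
    finally show ?thesis .
  qed
  have i2: "integrable symbol_measure (\<lambda>w. (cmod (F w))\<^sup>2)"
    by (rule Bochner_Integration.integrable_bound[OF ir]) (use sq in \<open>auto intro!: AE_I2 simp: order_trans[OF sq abs_ge_self]\<close>)
  then show "square_integrable symbol_measure F" unfolding square_integrable_def by simp
  have "sqnorm symbol_measure F \<le> (LINT w|symbol_measure. indicator {a..b} (fst w) * (C\<^sup>2 * (1 + \<bar>snd w\<bar>) ^ (2 * m)))"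
    unfolding sqnorm_def by (intro integral_mono i2 ir sq)
  also have "\<dots> = (LINT s|lborel. LINT k|spectral_measure. indicator {a..b} s * (C\<^sup>2 * (1 + \<bar>k\<bar>) ^ (2 * m)))"
    using P.integral_fst'[of "\<lambda>w. indicator {a..b} (fst w) * (C\<^sup>2 * (1 + \<bar>snd w\<bar>) ^ (2 * m))"] ir
    unfolding symbol_measure_def by simp
  also have "\<dots> = (LINT s|lborel. indicator {a..b} s * (C\<^sup>2 * moment (2 * m)))" by (simp add: moment_def)
  also have "\<dots> = C\<^sup>2 * (b - a) * moment (2 * m)" using ab by simp
  finally show "sqnorm symbol_measure F \<le> C\<^sup>2 * (b - a) * moment (2 * m)" .
qed

text \<open>\<open>f \<Phi>\<close> is a pairing without conjugation, so that formally the Fourier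
  transform of \<open>f\<close> is integrated against the inverse transform of
  \<open>\<Phi>\<close>.\<close>

definition symbol :: "(real \<Rightarrow> real \<Rightarrow> complex) \<Rightarrow> real \<times> real \<Rightarrow> complex" where
  "symbol \<Phi> = (\<lambda>(s, k). fourier_inv (\<Phi> s) k)"

lemma symbol_square_integrable:
  assumes "forcing_test \<Phi>" shows "square_integrable symbol_measure (symbol \<Phi>)"
proof -
  have \<Phi>m[measurable]: "(\<lambda>w. \<Phi> (fst w) (snd w)) \<in> borel_measurable (borel \<Otimes>\<^sub>M borel)"
    using assms by (simp add: forcing_test_def case_prod_unfold)
  have "(\<lambda>w. (fst (fst w), snd w)) \<in> measurable ((borel \<Otimes>\<^sub>M borel) \<Otimes>\<^sub>M borel) (borel \<Otimes>\<^sub>M borel)" by measurable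
  from measurable_compose[OF this \<Phi>m]
  have [measurable]: "(\<lambda>w::(real \<times> real) \<times> real. \<Phi> (fst (fst w)) (snd w)) \<in> borel_measurable ((borel \<Otimes>\<^sub>M borel) \<Otimes>\<^sub>M borel)" by simp
  obtain T K where TK: "\<And>t x. \<bar>t\<bar> > T \<Longrightarrow> \<Phi> t x = 0" "\<And>t x. cmod (\<Phi> t x) \<le> K / (1 + x\<^sup>2)"
    using assms unfolding forcing_test_def by blast
  have m: "symbol \<Phi> \<in> borel_measurable (borel \<Otimes>\<^sub>M borel)"
    unfolding symbol_def fourier_inv_def case_prod_unfold
    by (rule lborel.borel_measurable_lebesgue_integral) (simp add: case_prod_unfold, measurable)
  define B where "B = (LINT x|lborel. K / (1 + x\<^sup>2))"
  have b: "cmod (symbol \<Phi> (s, k)) \<le> indicator {-\<bar>T\<bar>..\<bar>T\<bar>} s * (B * (1 + \<bar>k\<bar>) ^ 0)" for s k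
  proof (cases "\<bar>s\<bar> > T")
    case True
    have "symbol \<Phi> (s, k) = 0" unfolding symbol_def fourier_inv_def using TK(1)[OF True] by simp
    moreover have "B \<ge> 0" unfolding B_def using order_trans[OF norm_ge_zero TK(2)] by (intro integral_nonneg_AE AE_I2)
    ultimately show ?thesis by simp
  next
    case False
    have "cmod (symbol \<Phi> (s, k)) \<le> (LINT x|lborel. cmod (\<Phi> s x))"
      unfolding symbol_def using fourier_inv_norm_le[OF forcing_test_integrable[OF assms, of s]] by simp
    also have "\<dots> \<le> B" unfolding B_def
      using integrable_mult_right[OF integrable_inverse_square, of K]
      by (intro integral_mono integrable_norm forcing_test_integrable[OF assms] TK(2)) auto
    finally show ?thesis using False by (auto simp: indicator_def)
  qed
  show ?thesis by (rule strip_bound(1)[OF m _ b]) simp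
qed

lemma forcing_inner:
  assumes "forcing_test \<Phi>" "forcing_test \<Psi>"
  shows "(\<integral>\<omega>. f \<Phi> \<omega> * cnj (f \<Psi> \<omega>) \<partial>M) = (LINT w|symbol_measure. symbol \<Phi> w * cnj (symbol \<Psi> w))"
proof -
  have "integrable symbol_measure (\<lambda>w. symbol \<Phi> w * cnj (symbol \<Psi> w))"
    by (intro square_integrable_product square_integrable_cnj symbol_square_integrable assms)
  from integral_symbol_measure[OF this] show ?thesis
    unfolding forcing_covariance[OF assms] by (simp add: symbol_def)
qed

lemma forcing_isometry:
  assumes "forcing_test \<Phi>" "forcing_test \<Psi>"
  shows "sqnorm M (\<lambda>\<omega>. f \<Phi> \<omega> - f \<Psi> \<omega>) = sqnorm symbol_measure (\<lambda>w. symbol \<Phi> w - symbol \<Psi> w)"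
proof -
  have "complex_of_real (sqnorm M (\<lambda>\<omega>. f \<Phi> \<omega> - f \<Psi> \<omega>)) = complex_of_real (sqnorm symbol_measure (\<lambda>w. symbol \<Phi> w - symbol \<Psi> w))"
    by (simp only: sqnorm_diff_expand forcing_square_integrable symbol_square_integrable assms forcing_inner)
  then show ?thesis by (simp only: of_real_eq_iff)
qed

text \<open>The closure of the graph that links \<open>f \<Phi>\<close> to
  \<open>symbol \<Phi>\<close>, in which one sequence approximates the variable and its kernel at
  the same time. It plays the role of the stochastic integral of \<open>h\<close> without extending
  \<open>f\<close> to a linear operator on a completed space.\<close>

definition represents :: "('w \<Rightarrow> complex) \<Rightarrow> (real \<times> real \<Rightarrow> complex) \<Rightarrow> bool" where
  "represents X h \<longleftrightarrow> square_integrable M X \<and> square_integrable symbol_measure h \<and>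
    (\<exists>\<Phi>. (\<forall>n::nat. forcing_test (\<Phi> n)) \<and> (\<lambda>n. sqnorm M (\<lambda>\<omega>. f (\<Phi> n) \<omega> - X \<omega>)) \<longlonglongrightarrow> 0 \<and>
      (\<lambda>n. sqnorm symbol_measure (\<lambda>w. symbol (\<Phi> n) w - h w)) \<longlonglongrightarrow> 0)"

lemma representsE:
  assumes "represents X h"
  obtains \<Phi> where "square_integrable M X" "square_integrable symbol_measure h" "\<And>n::nat. forcing_test (\<Phi> n)"
    "(\<lambda>n. sqnorm M (\<lambda>\<omega>. f (\<Phi> n) \<omega> - X \<omega>)) \<longlonglongrightarrow> 0" "(\<lambda>n. sqnorm symbol_measure (\<lambda>w. symbol (\<Phi> n) w - h w)) \<longlonglongrightarrow> 0"
  using assms unfolding represents_def by blast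

lemma represents_forcing: "forcing_test \<Phi> \<Longrightarrow> represents (f \<Phi>) (symbol \<Phi>)"
  unfolding represents_def
  by (intro conjI exI[of _ "\<lambda>n. \<Phi>"]) (simp_all add: forcing_square_integrable symbol_square_integrable sqnorm_def)

lemma represents_inner:
  assumes "represents X h" "represents Y k"
  shows "(\<integral>\<omega>. X \<omega> * cnj (Y \<omega>) \<partial>M) = (LINT w|symbol_measure. h w * cnj (k w))"
proof -
  obtain \<Phi> where X: "square_integrable M X" "square_integrable symbol_measure h" "\<And>n. forcing_test (\<Phi> n)"
    "(\<lambda>n. sqnorm M (\<lambda>\<omega>. f (\<Phi> n) \<omega> - X \<omega>)) \<longlonglongrightarrow> 0" "(\<lambda>n. sqnorm symbol_measure (\<lambda>w. symbol (\<Phi> n) w - h w)) \<longlonglongrightarrow> 0"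
    by (rule representsE[OF assms(1)]) blast
  obtain \<Psi> where Y: "square_integrable M Y" "square_integrable symbol_measure k" "\<And>n. forcing_test (\<Psi> n)"
    "(\<lambda>n. sqnorm M (\<lambda>\<omega>. f (\<Psi> n) \<omega> - Y \<omega>)) \<longlonglongrightarrow> 0" "(\<lambda>n. sqnorm symbol_measure (\<lambda>w. symbol (\<Psi> n) w - k w)) \<longlonglongrightarrow> 0"
    by (rule representsE[OF assms(2)]) blast
  have "(\<lambda>n. \<integral>\<omega>. f (\<Phi> n) \<omega> * cnj (f (\<Psi> n) \<omega>) \<partial>M) \<longlonglongrightarrow> (\<integral>\<omega>. X \<omega> * cnj (Y \<omega>) \<partial>M)"
    by (rule tendsto_inner) (use X Y forcing_square_integrable in auto)
  moreover have "(\<lambda>n. LINT w|symbol_measure. symbol (\<Phi> n) w * cnj (symbol (\<Psi> n) w)) \<longlonglongrightarrow> (LINT w|symbol_measure. h w * cnj (k w))"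
    by (rule tendsto_inner) (use X Y symbol_square_integrable in auto)
  ultimately show ?thesis unfolding forcing_inner[OF X(3) Y(3)] by (rule LIMSEQ_unique)
qed

lemma represents_pseudo:
  assumes "represents X h" "represents Y k"
  shows "(\<integral>\<omega>. X \<omega> * Y \<omega> \<partial>M) = 0"
proof -
  obtain \<Phi> where X: "square_integrable M X" "square_integrable symbol_measure h" "\<And>n. forcing_test (\<Phi> n)"
    "(\<lambda>n. sqnorm M (\<lambda>\<omega>. f (\<Phi> n) \<omega> - X \<omega>)) \<longlonglongrightarrow> 0" "(\<lambda>n. sqnorm symbol_measure (\<lambda>w. symbol (\<Phi> n) w - h w)) \<longlonglongrightarrow> 0"
    by (rule representsE[OF assms(1)]) blast
  obtain \<Psi> where Y: "square_integrable M Y" "square_integrable symbol_measure k" "\<And>n. forcing_test (\<Psi> n)"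
    "(\<lambda>n. sqnorm M (\<lambda>\<omega>. f (\<Psi> n) \<omega> - Y \<omega>)) \<longlonglongrightarrow> 0" "(\<lambda>n. sqnorm symbol_measure (\<lambda>w. symbol (\<Psi> n) w - k w)) \<longlonglongrightarrow> 0"
    by (rule representsE[OF assms(2)]) blast
  have "(\<lambda>n. \<integral>\<omega>. f (\<Phi> n) \<omega> * f (\<Psi> n) \<omega> \<partial>M) \<longlonglongrightarrow> (\<integral>\<omega>. X \<omega> * Y \<omega> \<partial>M)"
    by (rule tendsto_integral_product) (use X Y forcing_square_integrable in auto)
  then have "(\<lambda>n. 0::complex) \<longlonglongrightarrow> (\<integral>\<omega>. X \<omega> * Y \<omega> \<partial>M)" unfolding forcing_pseudo_covariance[OF X(3) Y(3)] .
  then show ?thesis using LIMSEQ_unique[OF tendsto_const] by metis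
qed

text \<open>Each \<open>X i\<close> has its own approximating sequence; using the same index
  \<open>n\<close> in all of them gives finite combinations of forcing variables that converge to
  the combination of the \<open>X i\<close>.\<close>

lemma represents_gaussian:
  assumes J: "finite J" "\<And>i. i \<in> J \<Longrightarrow> represents (X i) (h i)"
  shows "gaussian_rv M (\<lambda>\<omega>. Re (\<Sum>i\<in>J. a i * X i \<omega>))" "(\<integral>\<omega>. (\<Sum>i\<in>J. a i * X i \<omega>) \<partial>M) = 0"
proof -
  have "\<forall>i\<in>J. \<exists>\<Phi>. square_integrable M (X i) \<and> (\<forall>n::nat. forcing_test (\<Phi> n)) \<and> (\<lambda>n. sqnorm M (\<lambda>\<omega>. f (\<Phi> n) \<omega> - X i \<omega>)) \<longlonglongrightarrow> 0"
    using J(2) unfolding represents_def by blast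
  from bchoice[OF this] obtain \<Phi> where \<Phi>': "\<forall>i\<in>J. square_integrable M (X i) \<and> (\<forall>n::nat. forcing_test (\<Phi> i n)) \<and> (\<lambda>n. sqnorm M (\<lambda>\<omega>. f (\<Phi> i n) \<omega> - X i \<omega>)) \<longlonglongrightarrow> 0" by blast
  have \<Phi>: "\<And>i. i \<in> J \<Longrightarrow> square_integrable M (X i)" "\<And>i n. i \<in> J \<Longrightarrow> forcing_test (\<Phi> i n)"
    "\<And>i. i \<in> J \<Longrightarrow> (\<lambda>n::nat. sqnorm M (\<lambda>\<omega>. f (\<Phi> i n) \<omega> - X i \<omega>)) \<longlonglongrightarrow> 0"
    using \<Phi>' by blast+
  define S where "S = (\<lambda>n \<omega>. \<Sum>i\<in>J. a i * f (\<Phi> i n) \<omega>)"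
  define S0 where "S0 = (\<lambda>\<omega>. \<Sum>i\<in>J. a i * X i \<omega>)"
  have s: "square_integrable M (S n)" for n
    unfolding S_def by (intro square_integrable_sum J(1) square_integrable_cmult forcing_square_integrable \<Phi>(2))
  have s0: "square_integrable M S0" unfolding S0_def by (intro square_integrable_sum J(1) square_integrable_cmult \<Phi>(1))
  have l: "(\<lambda>n. sqnorm M (\<lambda>\<omega>. S n \<omega> - S0 \<omega>)) \<longlonglongrightarrow> 0"
    unfolding S_def S0_def by (rule sqnorm_sum_tendsto_zero[OF J(1)]) (use \<Phi> forcing_square_integrable in auto)
  have m: "(\<integral>\<omega>. S n \<omega> \<partial>M) = 0" for n
  proof -
    have "(\<integral>\<omega>. S n \<omega> \<partial>M) = (\<Sum>i\<in>J. \<integral>\<omega>. a i * f (\<Phi> i n) \<omega> \<partial>M)"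
      unfolding S_def by (rule Bochner_Integration.integral_sum)
         (intro integrable_mult_right square_integrable_expectation forcing_square_integrable \<Phi>(2))
    also have "\<dots> = 0" using \<Phi>(2) by (intro sum.neutral) (auto simp: forcing_mean)
    finally show ?thesis .
  qed
  have "gaussian_rv M (\<lambda>\<omega>. Re (S n \<omega>))" for n
    unfolding S_def by (rule forcing_gaussian[OF J(1) \<Phi>(2)])
  from gaussian_rv_limit[OF s s0 l this m]
  show "gaussian_rv M (\<lambda>\<omega>. Re (\<Sum>i\<in>J. a i * X i \<omega>))" unfolding S0_def .
  have "(\<lambda>n. 0) \<longlonglongrightarrow> (\<integral>\<omega>. S0 \<omega> \<partial>M)" using tendsto_expectation[OF s s0 l] unfolding m .
  from LIMSEQ_unique[OF tendsto_const this]
  show "(\<integral>\<omega>. (\<Sum>i\<in>J. a i * X i \<omega>) \<partial>M) = 0" unfolding S0_def by simp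
qed

lemma represents_mean: "represents X h \<Longrightarrow> (\<integral>\<omega>. X \<omega> \<partial>M) = 0"
  using represents_gaussian(2)[of "{()}" "\<lambda>_. X" "\<lambda>_. h" "\<lambda>_. 1"] by simp

text \<open>Carries the representation from the constructed field to any other solution, which
  agrees with it only almost surely.\<close>

lemma represents_cong_AE:
  assumes "represents X h" "Y \<in> borel_measurable M" "AE \<omega> in M. X \<omega> = Y \<omega>"
  shows "represents Y h"
proof -
  obtain \<Phi> where X: "square_integrable M X" "square_integrable symbol_measure h" "\<And>n::nat. forcing_test (\<Phi> n)"
    "(\<lambda>n. sqnorm M (\<lambda>\<omega>. f (\<Phi> n) \<omega> - X \<omega>)) \<longlonglongrightarrow> 0" "(\<lambda>n. sqnorm symbol_measure (\<lambda>w. symbol (\<Phi> n) w - h w)) \<longlonglongrightarrow> 0"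
    by (rule representsE[OF assms(1)]) blast
  have Y: "square_integrable M Y" by (rule square_integrable_cong_AE[OF X(1) assms(2,3)])
  have "sqnorm M (\<lambda>\<omega>. f (\<Phi> n) \<omega> - X \<omega>) = sqnorm M (\<lambda>\<omega>. f (\<Phi> n) \<omega> - Y \<omega>)" for n
  proof (rule sqnorm_cong_AE)
    have m: "f (\<Phi> n) \<in> borel_measurable M" "X \<in> borel_measurable M"
      using forcing_square_integrable[OF X(3)] X(1) by (simp_all add: square_integrable_def)
    show "(\<lambda>\<omega>. f (\<Phi> n) \<omega> - X \<omega>) \<in> borel_measurable M" "(\<lambda>\<omega>. f (\<Phi> n) \<omega> - Y \<omega>) \<in> borel_measurable M"
      using m assms(2) by measurable
    show "AE \<omega> in M. f (\<Phi> n) \<omega> - X \<omega> = f (\<Phi> n) \<omega> - Y \<omega>"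
      using assms(3) by eventually_elim simp
  qed
  with X(4) have "(\<lambda>n. sqnorm M (\<lambda>\<omega>. f (\<Phi> n) \<omega> - Y \<omega>)) \<longlonglongrightarrow> 0" by (simp only:)
  then show ?thesis unfolding represents_def using X(2,3,5) Y by blast
qed

end

section \<open>Construction of the solution\<close>

lemma multiplier_shift: assumes "multiplier f" shows "multiplier (\<lambda>x. f (x + r))"
proof (rule multiplier_coinduct[of _ "{\<lambda>x. f (x + r) | f. multiplier f}"])
  fix u assume "u \<in> {\<lambda>x. f (x + r) | f. multiplier f}"
  then obtain f where u: "u = (\<lambda>x. f (x + r))" "multiplier f" by blast
  obtain K m where K: "K \<ge> 0" "\<And>x. cmod (f x) \<le> K * (1 + \<bar>x\<bar>) ^ m"
    by (rule slow_growthE[OF multiplier_slow[OF u(2)]]) blast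
  have "cmod (f (x + r)) \<le> (K * (1 + \<bar>r\<bar>) ^ m) * (1 + \<bar>x\<bar>) ^ m" for x
  proof -
    have "1 + \<bar>x + r\<bar> \<le> (1 + \<bar>r\<bar>) * (1 + \<bar>x\<bar>)" using one_plus_shift_le[of "- r" "\<bar>r\<bar>" "x + r"] by simp
    then have "K * (1 + \<bar>x + r\<bar>) ^ m \<le> K * ((1 + \<bar>r\<bar>) * (1 + \<bar>x\<bar>)) ^ m"
      using K(1) by (intro mult_left_mono power_mono) auto
    then show ?thesis using K(2)[of "x + r"] by (simp add: power_mult_distrib mult_ac)
  qed
  then show "slow_growth u" unfolding u(1) slow_growth_def by blast
  have "((\<lambda>x. f (x + r)) has_vector_derivative vderiv f (x + r)) (at x)" for x
  proof -
    have "((f \<circ> (\<lambda>x. x + r)) has_vector_derivative (1 *\<^sub>R vderiv f (x + r))) (at x)"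
      by (rule vector_diff_chain_at) (auto intro!: derivative_eq_intros multiplier_vderiv[OF u(2)])
    then show ?thesis by (simp add: o_def)
  qed
  then show "\<exists>f'\<in>{\<lambda>x. f (x + r) | f. multiplier f}. \<forall>x. (u has_vector_derivative f' x) (at x)"
    unfolding u(1) using multiplier_vderiv(1)[OF u(2)] by (intro bexI[of _ "\<lambda>x. vderiv f (x + r)"]) auto
qed (use assms in blast)

text \<open>Rounding is downwards, so that a nonnegative time stays nonnegative and never passes
  \<open>t\<close>.\<close>

definition dyadic :: "nat \<Rightarrow> real \<Rightarrow> real" where
  "dyadic n t = of_int \<lfloor>2 ^ n * t\<rfloor> / 2 ^ n"

lemma dyadic_bounds: "dyadic n t \<le> t" "t - dyadic n t \<le> (1/2) ^ n" "t \<ge> 0 \<Longrightarrow> dyadic n t \<ge> 0"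
proof -
  have f: "of_int \<lfloor>2 ^ n * t\<rfloor> \<le> 2 ^ n * t" "2 ^ n * t \<le> of_int \<lfloor>2 ^ n * t\<rfloor> + 1" by linarith+
  show "dyadic n t \<le> t" using f(1) by (simp add: dyadic_def divide_le_eq mult.commute)
  have "t \<le> (of_int \<lfloor>2 ^ n * t\<rfloor> + 1) / 2 ^ n" using f(2) by (simp add: le_divide_eq mult.commute)
  then show "t - dyadic n t \<le> (1/2) ^ n" by (simp add: dyadic_def add_divide_distrib power_divide)
  show "t \<ge> 0 \<Longrightarrow> dyadic n t \<ge> 0" by (simp add: dyadic_def)
qed

section \<open>The kernel of the solution and its dyadic approximation\<close>

context driven_evolution
begin

definition weight_exp :: real where "weight_exp = H + 1/2"

text \<open>Evaluation at the point \<open>x\<close> in Fourier space, combined with the weight that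
  \<open>P_op\<close> puts on the wavenumber.\<close>

definition mode :: "real \<Rightarrow> real \<Rightarrow> complex" where
  "mode x \<kappa> = cis (2 * pi * x * \<kappa>) * gpow (- weight_exp) \<kappa>"

text \<open>Duhamel's formula along characteristics: forcing at time \<open>s\<close> and wavenumber
  \<open>k\<close> enters with weight \<open>g powr (H + 1/2)\<close>, travels to
  \<open>k + c * (t - s)\<close> and contributes there to the value at \<open>x\<close>. The
  coordinates are those of the forcing rather than those of the arrival, because the isometry lives
  there.\<close>

definition kernel :: "real \<Rightarrow> real \<Rightarrow> real \<times> real \<Rightarrow> complex" where
  "kernel t x = (\<lambda>(s, k). indicator {0..t} s * (mode x (k + c * (t - s)) * gpow weight_exp k))"

lemma multiplier_mode: "multiplier (mode x)"
  unfolding mode_def[abs_def] by (intro multiplier_mult multiplier_gpow multiplier_cis)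

lemma mode_measurable [measurable]: "(\<lambda>w. mode (fst w) (snd w)) \<in> borel_measurable (borel \<Otimes>\<^sub>M borel)"
  unfolding mode_def by measurable

lemma cmod_mode: "cmod (mode x \<kappa>) = cmod (gpow (- weight_exp) \<kappa>)"
  by (simp add: mode_def norm_mult)

lemma DERIV_g_powr: "((\<lambda>k. g k powr b) has_real_derivative b * deriv g k * g k powr (b - 1)) (at k)"
  using DERIV_powr[OF g_deriv g_pos DERIV_const[of b]] g_pos[of k]
  by (auto simp: powr_diff field_simps)

text \<open>One pair \<open>C\<close>, \<open>m\<close> controls both the size of the kernel and its
  modulus of continuity on bounded sets, up to a polynomial in the wavenumber. The difference bound
  covers displacement in space, displacement in travel time and the cutoff
  \<open>exp (- e * k\<^sup>2)\<close> at once, since the approximation commits these three errors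
  together.\<close>

lemma mode_kernel_bounds:
  assumes R: "R \<ge> 0"
  obtains C m where "C \<ge> 0"
    "\<And>k x \<tau>. \<bar>\<tau>\<bar> \<le> R \<Longrightarrow> cmod (mode x (k + c * \<tau>) * gpow weight_exp k) \<le> C * (1 + \<bar>k\<bar>) ^ m"
    "\<And>k x x' \<tau> \<tau>' e. \<bar>x'\<bar> \<le> R \<Longrightarrow> \<bar>\<tau>\<bar> \<le> R \<Longrightarrow> \<bar>\<tau>'\<bar> \<le> R \<Longrightarrow> e \<ge> 0 \<Longrightarrow>
      cmod (mode x (k + c * \<tau>) * gpow weight_exp k - mode x' (k + c * \<tau>') * gpow weight_exp k * of_real (exp (- e * k\<^sup>2)))
      \<le> C * (\<bar>x - x'\<bar> + \<bar>\<tau> - \<tau>'\<bar> + e) * (1 + \<bar>k\<bar>) ^ m"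
proof -
  let ?a = weight_exp
  define Q where "Q = 1 + \<bar>c\<bar> * R"
  have Q: "Q \<ge> 1" using R by (simp add: Q_def)
  obtain K1 m1 where K1: "K1 \<ge> 0" "\<And>x. cmod (gpow (- ?a) x) \<le> K1 * (1 + \<bar>x\<bar>) ^ m1"
    by (rule slow_growthE[OF gpow_slow[of "- ?a"]]) blast
  have "slow_growth (\<lambda>k. complex_of_real (- ?a) * complex_of_real (deriv g k) * gpow (- ?a - 1) k)"
    by (intro multiplier_slow multiplier_mult multiplier_const multiplier_deriv_g multiplier_gpow)
  then obtain K2 m2 where K2: "K2 \<ge> 0" "\<And>x. cmod (complex_of_real (- ?a) * complex_of_real (deriv g x) * gpow (- ?a - 1) x) \<le> K2 * (1 + \<bar>x\<bar>) ^ m2"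
    by (rule slow_growthE) blast
  obtain K3 m3 where K3: "K3 \<ge> 0" "\<And>x. cmod (gpow ?a x) \<le> K3 * (1 + \<bar>x\<bar>) ^ m3"
    by (rule slow_growthE[OF gpow_slow[of ?a]]) blast
  \<comment> \<open>The \<open>2\<close> pays for \<open>k\<^sup>2\<close> in the bound
    \<open>1 - exp (- e * k\<^sup>2) \<le> e * k\<^sup>2\<close>, and the phase costs one power; the
    rest comes from the two powers of \<open>g\<close> and from a derivative.\<close>
  define m where "m = 2 + m1 + m2 + m3"
  define C where "C = 2 * pi * (Q + R * \<bar>c\<bar>) * K1 * Q ^ m1 * K3 + \<bar>c\<bar> * K2 * Q ^ m2 * K3 + K1 * Q ^ m1 * K3"
  have C0: "0 \<le> 2 * pi * (Q + R * \<bar>c\<bar>) * K1 * Q ^ m1 * K3" "0 \<le> \<bar>c\<bar> * K2 * Q ^ m2 * K3" "0 \<le> K1 * Q ^ m1 * K3"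
    using K1(1) K2(1) K3(1) Q R by simp_all
  have C: "C \<ge> 0" unfolding C_def using C0 by linarith
  have kap: "1 + \<bar>k + c * \<tau>\<bar> \<le> Q * (1 + \<bar>k\<bar>)" if "\<bar>\<tau>\<bar> \<le> R" for k \<tau>
  proof -
    have "\<bar>c * \<tau>\<bar> \<le> \<bar>c\<bar> * R" using that by (simp add: abs_mult mult_left_mono)
    then have "\<bar>k + c * \<tau>\<bar> \<le> \<bar>k\<bar> + \<bar>c\<bar> * R" by linarith
    moreover have "0 \<le> \<bar>c\<bar> * R * \<bar>k\<bar>" using R by simp
    ultimately show ?thesis unfolding Q_def by (simp add: algebra_simps)
  qed
  have W: "cmod (gpow (- ?a) (k + c * \<tau>)) \<le> K1 * Q ^ m1 * (1 + \<bar>k\<bar>) ^ m1" if "\<bar>\<tau>\<bar> \<le> R" for k \<tau>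
  proof -
    have "K1 * (1 + \<bar>k + c * \<tau>\<bar>) ^ m1 \<le> K1 * (Q * (1 + \<bar>k\<bar>)) ^ m1"
      using K1(1) kap[OF that] by (intro mult_left_mono power_mono) auto
    then show ?thesis using K1(2)[of "k + c * \<tau>"] by (simp add: power_mult_distrib mult.assoc)
  qed
  have MG: "cmod (mode x (k + c * \<tau>) * gpow ?a k) \<le> (K1 * Q ^ m1 * K3) * (1 + \<bar>k\<bar>) ^ (m1 + m3)" if "\<bar>\<tau>\<bar> \<le> R" for k x \<tau>
  proof -
    have "cmod (mode x (k + c * \<tau>) * gpow ?a k) \<le> (K1 * Q ^ m1 * (1 + \<bar>k\<bar>) ^ m1) * (K3 * (1 + \<bar>k\<bar>) ^ m3)"
      unfolding norm_mult cmod_mode using W[OF that] K3(2) K1(1) Q by (intro mult_mono) auto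
    then show ?thesis by (simp add: power_add mult_ac)
  qed
  have pw: "(1 + \<bar>k\<bar>) ^ i \<le> (1 + \<bar>k\<bar>) ^ m" if "i \<le> m" for k :: real and i using that by (intro power_increasing) auto
  \<comment> \<open>Mean value inequality on the segment of wavenumbers reached with travel times in
    \<open>{-R..R}\<close>, where the derivative of the weight obeys a common bound.\<close>
  have D: "cmod (gpow (- ?a) (k + c * \<tau>) - gpow (- ?a) (k + c * \<tau>')) \<le> (K2 * Q ^ m2 * (1 + \<bar>k\<bar>) ^ m2) * (\<bar>c\<bar> * \<bar>\<tau> - \<tau>'\<bar>)"
    if t: "\<bar>\<tau>\<bar> \<le> R" "\<bar>\<tau>'\<bar> \<le> R" for k \<tau> \<tau>'
  proof -
    let ?S = "(\<lambda>\<sigma>. k + c * \<sigma>) ` {-R..R}"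
    have cv: "convex ?S"
      using convex_affinity[of "{-R..R}" k c] by simp
    have "norm (g (k + c * \<tau>) powr (- ?a) - g (k + c * \<tau>') powr (- ?a)) \<le> (K2 * Q ^ m2 * (1 + \<bar>k\<bar>) ^ m2) * norm ((k + c * \<tau>) - (k + c * \<tau>'))"
    proof (rule field_differentiable_bound[OF cv])
      fix z assume "z \<in> ?S"
      then obtain \<sigma> where s: "\<sigma> \<in> {-R..R}" "z = k + c * \<sigma>" by blast
      then have z: "z = k + c * \<sigma>" "\<bar>\<sigma>\<bar> \<le> R" by auto
      show "((\<lambda>k. g k powr (- ?a)) has_field_derivative (- ?a) * deriv g z * g z powr (- ?a - 1)) (at z within ?S)"
        by (rule has_field_derivative_at_within[OF DERIV_g_powr])
      have "norm ((- ?a) * deriv g z * g z powr (- ?a - 1)) = cmod (complex_of_real (- ?a) * complex_of_real (deriv g z) * gpow (- ?a - 1) z)"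
        unfolding gpow_def norm_mult norm_of_real by simp
      also have "\<dots> \<le> K2 * (1 + \<bar>z\<bar>) ^ m2" by (rule K2(2))
      also have "\<dots> \<le> K2 * (Q * (1 + \<bar>k\<bar>)) ^ m2" unfolding z(1) using K2(1) kap[OF z(2)] by (intro mult_left_mono power_mono) auto
      finally show "norm ((- ?a) * deriv g z * g z powr (- ?a - 1)) \<le> K2 * Q ^ m2 * (1 + \<bar>k\<bar>) ^ m2"
        by (simp add: power_mult_distrib mult.assoc)
    qed (rule imageI, use t in \<open>simp add: abs_le_iff\<close>)+
    moreover have "norm ((k + c * \<tau>) - (k + c * \<tau>')) = \<bar>c\<bar> * \<bar>\<tau> - \<tau>'\<bar>"
      by (simp add: abs_mult[symmetric] right_diff_distrib)
    ultimately show ?thesis unfolding gpow_def by (simp only: of_real_diff[symmetric] norm_of_real real_norm_def)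
  qed
  have L: "cmod (mode x (k + c * \<tau>) * gpow ?a k - mode x' (k + c * \<tau>') * gpow ?a k * of_real (exp (- e * k\<^sup>2)))
      \<le> C * (\<bar>x - x'\<bar> + \<bar>\<tau> - \<tau>'\<bar> + e) * (1 + \<bar>k\<bar>) ^ m"
    if h: "\<bar>x'\<bar> \<le> R" "\<bar>\<tau>\<bar> \<le> R" "\<bar>\<tau>'\<bar> \<le> R" "e \<ge> 0" for k x x' \<tau> \<tau>' e
  proof -
    define P where "P = 1 + \<bar>k\<bar>"
    have P: "P \<ge> 1" by (simp add: P_def)
    define d where "d = \<bar>x - x'\<bar> + \<bar>\<tau> - \<tau>'\<bar> + e"
    have d: "\<bar>x - x'\<bar> \<le> d" "\<bar>\<tau> - \<tau>'\<bar> \<le> d" "e \<le> d" "d \<ge> 0" using h(4) by (simp_all add: d_def)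
    let ?\<kappa> = "k + c * \<tau>" and ?\<kappa>' = "k + c * \<tau>'"
    \<comment> \<open>\<open>A\<close> carries the change of phase, \<open>B\<close> the change of
      the weight at the arrival point, \<open>E\<close> the cutoff.\<close>
    define A where "A = (cis (2 * pi * x * ?\<kappa>) - cis (2 * pi * x' * ?\<kappa>')) * (gpow (- ?a) ?\<kappa> * gpow ?a k)"
    define B where "B = cis (2 * pi * x' * ?\<kappa>') * ((gpow (- ?a) ?\<kappa> - gpow (- ?a) ?\<kappa>') * gpow ?a k)"
    define E where "E = mode x' ?\<kappa>' * gpow ?a k * of_real (1 - exp (- e * k\<^sup>2))"
    have eq: "mode x ?\<kappa> * gpow ?a k - mode x' ?\<kappa>' * gpow ?a k * of_real (exp (- e * k\<^sup>2)) = A + B + E"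
      unfolding A_def B_def E_def mode_def by (simp add: algebra_simps)
    have A: "cmod A \<le> (2 * pi * (Q + R * \<bar>c\<bar>) * K1 * Q ^ m1 * K3) * d * P ^ m"
    proof -
      have k1: "\<bar>?\<kappa>\<bar> \<le> Q * P" using kap[OF h(2), of k] by (simp add: P_def)
      have "cmod (cis (2 * pi * x * ?\<kappa>) - cis (2 * pi * x' * ?\<kappa>')) \<le> \<bar>2 * pi * x * ?\<kappa> - 2 * pi * x' * ?\<kappa>'\<bar>"
        by (rule cmod_cis_diff_le)
      also have "2 * pi * x * ?\<kappa> - 2 * pi * x' * ?\<kappa>' = 2 * pi * ((x - x') * ?\<kappa> + x' * (c * (\<tau> - \<tau>')))"
        by (simp add: algebra_simps)
      also have "\<bar>2 * pi * ((x - x') * ?\<kappa> + x' * (c * (\<tau> - \<tau>')))\<bar> \<le> 2 * pi * (d * (Q * P) + R * (\<bar>c\<bar> * d))"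
      proof -
        have "\<bar>(x - x') * ?\<kappa>\<bar> \<le> d * (Q * P)" unfolding abs_mult using d k1 by (intro mult_mono) auto
        moreover have "\<bar>x' * (c * (\<tau> - \<tau>'))\<bar> \<le> R * (\<bar>c\<bar> * d)" unfolding abs_mult using d h(1) R by (intro mult_mono) auto
        ultimately have "\<bar>(x - x') * ?\<kappa> + x' * (c * (\<tau> - \<tau>'))\<bar> \<le> d * (Q * P) + R * (\<bar>c\<bar> * d)" by linarith
        then show ?thesis by (simp add: abs_mult)
      qed
      also have "\<dots> \<le> 2 * pi * ((Q + R * \<bar>c\<bar>) * d * P)"
      proof -
        have "R * (\<bar>c\<bar> * d) * 1 \<le> R * (\<bar>c\<bar> * d) * P" using P R d(4) by (intro mult_left_mono) auto
        then have "d * (Q * P) + R * (\<bar>c\<bar> * d) \<le> (Q + R * \<bar>c\<bar>) * d * P" by (simp add: algebra_simps)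
        then show ?thesis by (rule mult_left_mono) simp
      qed
      finally have c1: "cmod (cis (2 * pi * x * ?\<kappa>) - cis (2 * pi * x' * ?\<kappa>')) \<le> 2 * pi * ((Q + R * \<bar>c\<bar>) * d * P)" .
      have c2: "cmod (gpow (- ?a) ?\<kappa> * gpow ?a k) \<le> (K1 * Q ^ m1 * K3) * P ^ (m1 + m3)"
        using MG[OF h(2), of 0 k] unfolding norm_mult cmod_mode P_def .
      have "cmod A \<le> (2 * pi * ((Q + R * \<bar>c\<bar>) * d * P)) * ((K1 * Q ^ m1 * K3) * P ^ (m1 + m3))"
        unfolding A_def norm_mult[of "_ - _"] using c1 c2 order_trans[OF norm_ge_zero c1] by (intro mult_mono) auto
      also have "\<dots> = (2 * pi * (Q + R * \<bar>c\<bar>) * K1 * Q ^ m1 * K3) * d * P ^ (1 + m1 + m3)"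
        by (simp add: power_add mult_ac)
      also have "\<dots> \<le> (2 * pi * (Q + R * \<bar>c\<bar>) * K1 * Q ^ m1 * K3) * d * P ^ m"
        using C0(1) d(4) pw[of "1 + m1 + m3" k] by (intro mult_left_mono) (auto simp: m_def P_def)
      finally show ?thesis .
    qed
    have B: "cmod B \<le> (\<bar>c\<bar> * K2 * Q ^ m2 * K3) * d * P ^ m"
    proof -
      have "cmod B = cmod (gpow (- ?a) ?\<kappa> - gpow (- ?a) ?\<kappa>') * cmod (gpow ?a k)" by (simp add: B_def norm_mult)
      also have "\<dots> \<le> ((K2 * Q ^ m2 * P ^ m2) * (\<bar>c\<bar> * d)) * (K3 * P ^ m3)"
      proof (rule mult_mono)
        have "(K2 * Q ^ m2 * P ^ m2) * (\<bar>c\<bar> * \<bar>\<tau> - \<tau>'\<bar>) \<le> (K2 * Q ^ m2 * P ^ m2) * (\<bar>c\<bar> * d)"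
          using K2(1) Q P d(2) by (intro mult_left_mono) auto
        then show "cmod (gpow (- ?a) ?\<kappa> - gpow (- ?a) ?\<kappa>') \<le> (K2 * Q ^ m2 * P ^ m2) * (\<bar>c\<bar> * d)"
          using D[OF h(2,3), of k] unfolding P_def by linarith
        show "cmod (gpow ?a k) \<le> K3 * P ^ m3" unfolding P_def by (rule K3(2))
      qed (use K2(1) Q P d(4) in auto)
      also have "\<dots> = (\<bar>c\<bar> * K2 * Q ^ m2 * K3) * d * P ^ (m2 + m3)" by (simp add: power_add mult_ac)
      also have "\<dots> \<le> (\<bar>c\<bar> * K2 * Q ^ m2 * K3) * d * P ^ m"
        using C0(2) d(4) pw[of "m2 + m3" k] by (intro mult_left_mono) (auto simp: m_def P_def)
      finally show ?thesis .
    qed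
    have E: "cmod E \<le> (K1 * Q ^ m1 * K3) * d * P ^ m"
    proof -
      have "\<bar>1 - exp (- e * k\<^sup>2)\<bar> \<le> e * k\<^sup>2"
      proof -
        have "1 + (- e * k\<^sup>2) \<le> exp (- e * k\<^sup>2)" by (rule exp_ge_add_one_self)
        moreover have "exp (- e * k\<^sup>2) \<le> 1" using h(4) by simp
        ultimately show ?thesis by linarith
      qed
      also have "\<dots> \<le> d * P ^ 2"
        using d h(4) unfolding P_def by (intro mult_mono) (auto simp: power2_eq_square algebra_simps)
      finally have "\<bar>1 - exp (- e * k\<^sup>2)\<bar> \<le> d * P ^ 2" .
      then have "cmod E \<le> ((K1 * Q ^ m1 * K3) * P ^ (m1 + m3)) * (d * P ^ 2)"
        unfolding E_def norm_mult[of _ "of_real _"] norm_of_real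
        using MG[OF h(3), of x' k] C0(3) P unfolding P_def by (intro mult_mono) auto
      also have "\<dots> = (K1 * Q ^ m1 * K3) * d * P ^ (2 + m1 + m3)" by (simp add: power_add power2_eq_square mult_ac)
      also have "\<dots> \<le> (K1 * Q ^ m1 * K3) * d * P ^ m"
        using C0(3) d(4) pw[of "2 + m1 + m3" k] by (intro mult_left_mono) (auto simp: m_def P_def)
      finally show ?thesis .
    qed
    have "cmod (A + B + E) \<le> cmod A + cmod B + cmod E" by (rule order_trans[OF norm_triangle_ineq add_right_mono[OF norm_triangle_ineq]])
    also have "\<dots> \<le> (2 * pi * (Q + R * \<bar>c\<bar>) * K1 * Q ^ m1 * K3) * d * P ^ m + (\<bar>c\<bar> * K2 * Q ^ m2 * K3) * d * P ^ m + (K1 * Q ^ m1 * K3) * d * P ^ m"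
      using A B E by linarith
    also have "\<dots> = C * d * P ^ m" by (simp add: C_def algebra_simps)
    finally show ?thesis unfolding eq d_def P_def .
  qed
  have G: "cmod (mode x (k + c * \<tau>) * gpow ?a k) \<le> C * (1 + \<bar>k\<bar>) ^ m" if "\<bar>\<tau>\<bar> \<le> R" for k x \<tau>
  proof -
    have "(K1 * Q ^ m1 * K3) * (1 + \<bar>k\<bar>) ^ (m1 + m3) \<le> C * (1 + \<bar>k\<bar>) ^ m"
      using C0 pw[of "m1 + m3" k] C by (intro mult_mono) (auto simp: m_def C_def)
    with MG[OF that, of x k] show ?thesis by linarith
  qed
  show ?thesis by (rule that[OF C G L])
qed

text \<open>The Gaussian factor makes this a Schwartz function of \<open>k\<close>, so that it comes
  from an admissible test function. Its rate \<open>(1/2) ^ n\<close> matches the dyadic mesh: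
  cutoff and rounding errors have the same order.\<close>

definition base_symbol :: "nat \<Rightarrow> real \<Rightarrow> real \<Rightarrow> real \<Rightarrow> complex" where
  "base_symbol n x \<tau> k = mode x (k + c * \<tau>) * gpow weight_exp k * of_real (exp (- ((1/2) ^ n) * k\<^sup>2))"

lemma schwartz_base_symbol: "schwartz (base_symbol n x \<tau>)"
proof -
  have "multiplier (\<lambda>k. mode x (k + c * \<tau>) * gpow weight_exp k)"
    by (intro multiplier_mult multiplier_shift multiplier_mode multiplier_gpow)
  then show ?thesis unfolding base_symbol_def[abs_def]
    by (intro multiplier_times_schwartz schwartz_gauss) simp_all
qed

text \<open>The transform undoes the inverse one in \<open>symbol\<close>. The forcing time is
  rounded inside the travel time, which makes the test function piecewise constant in
  \<open>s\<close> on \<open>{0..t}\<close>; \<open>t\<close> and \<open>x\<close> are left to be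
  rounded where the definition is used.\<close>

definition approx_test :: "nat \<Rightarrow> real \<Rightarrow> real \<Rightarrow> real \<Rightarrow> real \<Rightarrow> complex" where
  "approx_test n t x s y = indicator {0..t} s * fourier (base_symbol n x (t - dyadic n s)) y"

text \<open>On \<open>{0..t}\<close> only finitely many dyadic cells occur, so decay follows from
  that of the finitely many Schwartz functions \<open>F j\<close>; joint measurability is that of a
  countable case distinction on the cell.\<close>

lemma forcing_test_approx: "forcing_test (approx_test n t x)"
proof -
  define F where "F j = fourier (base_symbol n x (t - of_int j / 2 ^ n))" for j :: int
  have sF: "schwartz (F j)" for j unfolding F_def by (intro schwartz_fourier schwartz_base_symbol)
  have eq: "approx_test n t x s y = indicator {0..t} s * F \<lfloor>2 ^ n * s\<rfloor> y" for s y
    unfolding approx_test_def F_def dyadic_def ..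
  have "(\<lambda>w. F j (snd w)) \<in> borel_measurable (borel \<Otimes>\<^sub>M borel)" for j
    using schwartz_measurable[OF sF[of j]] by measurable
  then have "(\<lambda>w::real \<times> real. F \<lfloor>2 ^ n * fst w\<rfloor> (snd w)) \<in> borel_measurable (borel \<Otimes>\<^sub>M borel)"
    by (rule measurable_compose_countable) measurable
  then have m: "(\<lambda>(s, y). approx_test n t x s y) \<in> borel_measurable (borel \<Otimes>\<^sub>M borel)"
    unfolding eq case_prod_unfold by measurable
  have "\<exists>K. K \<ge> 0 \<and> (\<forall>y. cmod (F j y) \<le> K / (1 + y\<^sup>2))" for j
    by (rule rapid_decay_bound[OF schwartz_rapid[OF sF[of j]]]) blast
  then obtain K where K: "\<And>j. K j \<ge> 0" "\<And>j y. cmod (F j y) \<le> K j / (1 + y\<^sup>2)" by metis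
  define J where "J = {0..\<lfloor>2 ^ n * t\<rfloor>}"
  have "cmod (approx_test n t x s y) \<le> (\<Sum>j\<in>J. K j) / (1 + y\<^sup>2)" for s y
  proof (cases "s \<in> {0..t}")
    case True
    then have "2 ^ n * s \<le> 2 ^ n * t" by (intro mult_left_mono) auto
    then have "\<lfloor>2 ^ n * s\<rfloor> \<in> J" using True by (auto simp: J_def floor_mono)
    then have "K \<lfloor>2 ^ n * s\<rfloor> \<le> (\<Sum>j\<in>J. K j)" using K(1) by (intro member_le_sum) (auto simp: J_def)
    then have "K \<lfloor>2 ^ n * s\<rfloor> / (1 + y\<^sup>2) \<le> (\<Sum>j\<in>J. K j) / (1 + y\<^sup>2)" by (intro divide_right_mono) auto
    then show ?thesis unfolding eq using True K(2)[of "\<lfloor>2 ^ n * s\<rfloor>" y] by simp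
  next
    case False
    have "0 \<le> (\<Sum>j\<in>J. K j)" by (intro sum_nonneg K(1))
    then show ?thesis unfolding eq using False by simp
  qed
  moreover have "approx_test n t x s y = 0" if "\<bar>s\<bar> > \<bar>t\<bar>" for s y
    unfolding eq using that by (auto simp: indicator_def)
  ultimately show ?thesis unfolding forcing_test_def using m by blast
qed

lemma symbol_approx: "symbol (approx_test n t x) (s, k) = indicator {0..t} s * base_symbol n x (t - dyadic n s) k"
proof -
  have "symbol (approx_test n t x) (s, k) = indicator {0..t} s * fourier_inv (fourier (base_symbol n x (t - dyadic n s))) k"
    unfolding symbol_def fourier_inv_eq approx_test_def[abs_def] case_prod_conv fourier_scale ..
  then show ?thesis unfolding fourier_inv_fourier[OF schwartz_base_symbol] .
qed

lemma kernel_measurable: "kernel t x \<in> borel_measurable (borel \<Otimes>\<^sub>M borel)"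
proof -
  have [measurable]: "mode x \<in> borel_measurable borel" by (rule multiplier_measurable[OF multiplier_mode])
  show ?thesis unfolding kernel_def case_prod_unfold by measurable
qed

lemma kernel_square_integrable:
  assumes "t \<ge> 0" shows "square_integrable symbol_measure (kernel t x)"
proof -
  obtain C m where C: "C \<ge> 0"
    "\<And>k x \<tau>. \<bar>\<tau>\<bar> \<le> t \<Longrightarrow> cmod (mode x (k + c * \<tau>) * gpow weight_exp k) \<le> C * (1 + \<bar>k\<bar>) ^ m"
    by (rule mode_kernel_bounds[OF assms]) blast
  show ?thesis
  proof (rule strip_bound(1)[OF kernel_measurable assms])
    fix s k
    show "cmod (kernel t x (s, k)) \<le> indicator {0..t} s * (C * (1 + \<bar>k\<bar>) ^ m)"
      using C(2)[of "t - s" x k] by (auto simp: kernel_def indicator_def)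
  qed
qed

lemma approx_error:
  assumes t: "t \<ge> 0"
  shows "\<exists>C\<ge>0. \<forall>n. sqnorm symbol_measure (\<lambda>w. symbol (approx_test n (dyadic n t) (dyadic n x)) w - kernel t x w) \<le> C * (1/2) ^ n"
proof -
  \<comment> \<open>Leaves room for the rounding, which moves positions and times by at most
    \<open>1\<close>.\<close>
  define R where "R = t + \<bar>x\<bar> + 2"
  have R: "R \<ge> 0" using t by (simp add: R_def)
  obtain C m where C: "C \<ge> 0"
    "\<And>k x \<tau>. \<bar>\<tau>\<bar> \<le> R \<Longrightarrow> cmod (mode x (k + c * \<tau>) * gpow weight_exp k) \<le> C * (1 + \<bar>k\<bar>) ^ m"
    "\<And>k x x' \<tau> \<tau>' e. \<bar>x'\<bar> \<le> R \<Longrightarrow> \<bar>\<tau>\<bar> \<le> R \<Longrightarrow> \<bar>\<tau>'\<bar> \<le> R \<Longrightarrow> e \<ge> 0 \<Longrightarrow>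
      cmod (mode x (k + c * \<tau>) * gpow weight_exp k - mode x' (k + c * \<tau>') * gpow weight_exp k * of_real (exp (- e * k\<^sup>2)))
      \<le> C * (\<bar>x - x'\<bar> + \<bar>\<tau> - \<tau>'\<bar> + e) * (1 + \<bar>k\<bar>) ^ m"
    by (rule mode_kernel_bounds[OF R]) blast
  have mom: "moment j \<ge> 0" for j unfolding moment_def by simp
  define W where "W = moment (2 * m)"
  have "sqnorm symbol_measure (\<lambda>w. symbol (approx_test n (dyadic n t) (dyadic n x)) w - kernel t x w) \<le> (2 * ((4 * C)\<^sup>2 * t * W) + 2 * (C\<^sup>2 * W)) * (1/2) ^ n" for n
  proof -
    define tn where "tn = dyadic n t"
    define xn where "xn = dyadic n x"
    define q where "q = (1/2::real) ^ n"
    have q: "0 \<le> q" "q \<le> 1" unfolding q_def by (simp_all add: power_le_one)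
    have tn: "0 \<le> tn" "tn \<le> t" "t - tn \<le> q" using dyadic_bounds[where n = n and t = t] t by (auto simp: tn_def q_def)
    have xn: "\<bar>x - xn\<bar> \<le> q" using dyadic_bounds[where n = n and t = x] by (auto simp: xn_def q_def)
    \<comment> \<open>\<open>F\<close> is the error on the common strip \<open>{0..tn}\<close>,
      small pointwise; \<open>G\<close> is the part of the kernel over the remaining times up to
      \<open>t\<close>, not small but supported on a strip of length at most
      \<open>q\<close>.\<close>
    define F where "F = (\<lambda>w::real \<times> real. symbol (approx_test n tn xn) w - indicator {0..tn} (fst w) * kernel t x w)"
    define G where "G = (\<lambda>w::real \<times> real. (indicator {0..tn} (fst w) - 1) * kernel t x w)"
    have km: "kernel t x \<in> borel_measurable (borel \<Otimes>\<^sub>M borel)" by (rule kernel_measurable)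
    have sm: "symbol (approx_test n tn xn) \<in> borel_measurable (borel \<Otimes>\<^sub>M borel)"
      using square_integrable_measurable[OF symbol_square_integrable[OF forcing_test_approx]]
      by (simp cong: measurable_cong_sets add: sets_symbol_measure)
    have mF: "F \<in> borel_measurable (borel \<Otimes>\<^sub>M borel)" unfolding F_def using sm km by measurable
    have mG: "G \<in> borel_measurable (borel \<Otimes>\<^sub>M borel)" unfolding G_def using km by measurable
    have bF: "cmod (F (s, k)) \<le> indicator {0..t} s * ((4 * C * q) * (1 + \<bar>k\<bar>) ^ m)" for s k
    proof (cases "s \<in> {0..tn}")
      case True
      define \<tau> where "\<tau> = t - s"
      define \<tau>' where "\<tau>' = tn - dyadic n s"
      have s: "0 \<le> dyadic n s" "dyadic n s \<le> s" "s - dyadic n s \<le> q" using dyadic_bounds[where n = n and t = s] True by (auto simp: q_def)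
      have \<tau>: "\<bar>\<tau>\<bar> \<le> R" "\<bar>\<tau>'\<bar> \<le> R" "\<bar>\<tau> - \<tau>'\<bar> \<le> 2 * q" "\<bar>xn\<bar> \<le> R"
        using True s tn xn q by (auto simp: \<tau>_def \<tau>'_def R_def)
      have "F (s, k) = - (mode x (k + c * \<tau>) * gpow weight_exp k - mode xn (k + c * \<tau>') * gpow weight_exp k * of_real (exp (- q * k\<^sup>2)))"
        unfolding F_def symbol_approx base_symbol_def kernel_def using True tn by (simp add: \<tau>_def \<tau>'_def q_def)
      then have "cmod (F (s, k)) \<le> C * (\<bar>x - xn\<bar> + \<bar>\<tau> - \<tau>'\<bar> + q) * (1 + \<bar>k\<bar>) ^ m"
        using C(3)[OF \<tau>(4,1,2) q(1), of x k] by (simp add: norm_minus_commute)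
      \<comment> \<open>Rounding \<open>x\<close> costs \<open>q\<close>, the two roundings inside
        the travel time cost \<open>2 * q\<close>, and the cutoff another \<open>q\<close>.\<close>
      also have "\<dots> \<le> C * (4 * q) * (1 + \<bar>k\<bar>) ^ m"
        using C(1) \<tau>(3) xn by (intro mult_right_mono mult_left_mono) auto
      finally show ?thesis using True tn by (simp add: mult_ac)
    next
      case False
      then have "F (s, k) = 0" unfolding F_def symbol_approx by simp
      then show ?thesis using C(1) q by simp
    qed
    have bG: "cmod (G (s, k)) \<le> indicator {tn..t} s * (C * (1 + \<bar>k\<bar>) ^ m)" for s k
    proof (cases "s \<in> {tn..t} \<and> s \<notin> {0..tn}")
      case True
      have "cmod (G (s, k)) \<le> cmod (mode x (k + c * (t - s)) * gpow weight_exp k)"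
        using True by (auto simp: G_def kernel_def indicator_def)
      also have "\<dots> \<le> C * (1 + \<bar>k\<bar>) ^ m" using True tn by (intro C(2)) (auto simp: R_def)
      finally show ?thesis using True by simp
    next
      case False
      then have "G (s, k) = 0" using tn by (auto simp: G_def kernel_def indicator_def)
      then show ?thesis using C(1) by simp
    qed
    have eq: "(\<lambda>w. symbol (approx_test n tn xn) w - kernel t x w) = (\<lambda>w. F w + G w)"
      by (simp add: F_def G_def fun_eq_iff algebra_simps)
    have "sqnorm symbol_measure (\<lambda>w. symbol (approx_test n tn xn) w - kernel t x w) \<le> 2 * sqnorm symbol_measure F + 2 * sqnorm symbol_measure G"
      unfolding eq by (rule square_integrable_add(2)[OF strip_bound(1)[OF mF t bF] strip_bound(1)[OF mG tn(2) bG]])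
    also have "\<dots> \<le> 2 * ((4 * C * q)\<^sup>2 * (t - 0) * W) + 2 * (C\<^sup>2 * (t - tn) * W)"
      unfolding W_def by (intro add_mono mult_left_mono strip_bound(2)[OF mF t bF] strip_bound(2)[OF mG tn(2) bG]) auto
    also have "\<dots> \<le> 2 * ((4 * C)\<^sup>2 * t * W * q) + 2 * (C\<^sup>2 * W * q)"
    proof -
      have "q\<^sup>2 \<le> q" using q by (simp add: power2_eq_square mult_left_le)
      then have "((4 * C)\<^sup>2 * t * W) * q\<^sup>2 \<le> ((4 * C)\<^sup>2 * t * W) * q"
        using t mom by (intro mult_left_mono) (auto simp: W_def)
      then have 1: "(4 * C * q)\<^sup>2 * (t - 0) * W \<le> (4 * C)\<^sup>2 * t * W * q" by (simp add: power_mult_distrib mult_ac)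
      have "(C\<^sup>2 * W) * (t - tn) \<le> (C\<^sup>2 * W) * q" using tn(3) mom by (intro mult_left_mono) (auto simp: W_def)
      then have 2: "C\<^sup>2 * (t - tn) * W \<le> C\<^sup>2 * W * q" by (simp add: mult_ac)
      show ?thesis using 1 2 by linarith
    qed
    also have "\<dots> = (2 * ((4 * C)\<^sup>2 * t * W) + 2 * (C\<^sup>2 * W)) * (1/2) ^ n" by (simp add: q_def algebra_simps)
    finally show ?thesis unfolding tn_def xn_def .
  qed
  moreover have "0 \<le> 2 * ((4 * C)\<^sup>2 * t * W) + 2 * (C\<^sup>2 * W)" using t mom by (simp add: W_def)
  ultimately show ?thesis by blast
qed

text \<open>A pathwise limit, rather than a mean-square limit chosen separately for each
  \<open>(t, x)\<close>, is what gives joint measurability. On paths without convergence the value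
  of \<open>lim\<close> is arbitrary but harmless.\<close>

definition solution :: "real \<Rightarrow> real \<Rightarrow> 'w \<Rightarrow> complex" where
  "solution t x \<omega> = lim (\<lambda>n. f (approx_test n (dyadic n t) (dyadic n x)) \<omega>)"

lemma solution_measurable: "(\<lambda>(t, x, \<omega>). solution t x \<omega>) \<in> borel_measurable (borel \<Otimes>\<^sub>M (borel \<Otimes>\<^sub>M M))"
proof -
  have "(\<lambda>w. f (approx_test n (dyadic n (fst w)) (dyadic n (fst (snd w)))) (snd (snd w))) \<in> borel_measurable (borel \<Otimes>\<^sub>M (borel \<Otimes>\<^sub>M M))" for n
  proof -
    \<comment> \<open>At level \<open>n\<close> the pair \<open>(t, x)\<close> matters only through
      its cell, indexed by two integers; a countable family of measurable functions is glued along a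
      measurable index.\<close>
    define F where "F p w = f (approx_test n (of_int (fst p) / 2 ^ n) (of_int (snd p) / 2 ^ n)) (snd (snd w))"
      for p :: "int \<times> int" and w :: "real \<times> real \<times> 'w"
    have [measurable]: "f (approx_test n a b) \<in> borel_measurable M" for a b
      by (intro square_integrable_measurable forcing_square_integrable forcing_test_approx)
    have "F p \<in> borel_measurable (borel \<Otimes>\<^sub>M (borel \<Otimes>\<^sub>M M))" for p unfolding F_def[abs_def] by measurable
    moreover have "(\<lambda>w::real \<times> real \<times> 'w. (\<lfloor>2 ^ n * fst w\<rfloor>, \<lfloor>2 ^ n * fst (snd w)\<rfloor>)) \<in> measurable (borel \<Otimes>\<^sub>M (borel \<Otimes>\<^sub>M M)) (count_space UNIV)"
    proof -
      have "(\<lambda>w::real \<times> real \<times> 'w. (\<lfloor>2 ^ n * fst w\<rfloor>, \<lfloor>2 ^ n * fst (snd w)\<rfloor>)) \<in> measurable (borel \<Otimes>\<^sub>M (borel \<Otimes>\<^sub>M M)) (count_space UNIV \<Otimes>\<^sub>M count_space UNIV)"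
        by measurable
      then show ?thesis by (simp add: pair_measure_countable)
    qed
    ultimately have "(\<lambda>w. F (\<lfloor>2 ^ n * fst w\<rfloor>, \<lfloor>2 ^ n * fst (snd w)\<rfloor>) w) \<in> borel_measurable (borel \<Otimes>\<^sub>M (borel \<Otimes>\<^sub>M M))"
      by (rule measurable_compose_countable)
    then show ?thesis by (simp add: F_def dyadic_def)
  qed
  then have "(\<lambda>w. lim (\<lambda>n. f (approx_test n (dyadic n (fst w)) (dyadic n (fst (snd w)))) (snd (snd w)))) \<in> borel_measurable (borel \<Otimes>\<^sub>M (borel \<Otimes>\<^sub>M M))"
    by (rule borel_measurable_lim_metric)
  then show ?thesis unfolding solution_def case_prod_unfold .
qed

lemma solution_section_measurable: "solution t x \<in> borel_measurable M"
proof -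
  have "(\<lambda>\<omega>. (t, x, \<omega>)) \<in> measurable M (borel \<Otimes>\<^sub>M (borel \<Otimes>\<^sub>M M))" by measurable
  from measurable_compose[OF this solution_measurable] show ?thesis by simp
qed

text \<open>The isometry turns the explicit error of the symbols into a geometric Cauchy estimate
  for the random variables; \<open>4 * C\<close> arises as twice the sum of the two distances to the
  kernel.\<close>

lemma solution_represents:
  assumes t: "t \<ge> 0" shows "represents (solution t x) (kernel t x)"
proof -
  define \<Phi> where "\<Phi> n = approx_test n (dyadic n t) (dyadic n x)" for n
  have ft: "forcing_test (\<Phi> n)" for n unfolding \<Phi>_def by (rule forcing_test_approx)
  obtain C where C: "C \<ge> 0" "\<And>n. sqnorm symbol_measure (\<lambda>w. symbol (\<Phi> n) w - kernel t x w) \<le> C * (1/2) ^ n"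
    using approx_error[OF t, of x] unfolding \<Phi>_def by blast
  have cauchy: "sqnorm M (\<lambda>\<omega>. f (\<Phi> m) \<omega> - f (\<Phi> n) \<omega>) \<le> (4 * C) * (1/2) ^ n" if "n \<le> m" for n m
  proof -
    have "sqnorm M (\<lambda>\<omega>. f (\<Phi> m) \<omega> - f (\<Phi> n) \<omega>) \<le> 2 * (C * (1/2) ^ m) + 2 * (C * (1/2) ^ n)"
      unfolding forcing_isometry[OF ft ft]
      using sqnorm_diff_le[OF symbol_square_integrable[OF ft[of m]] symbol_square_integrable[OF ft[of n]] kernel_square_integrable[OF t, of x]]
        C(2)[of n] C(2)[of m] by linarith
    moreover have "C * (1/2) ^ m \<le> C * (1/2) ^ n" using C(1) that by (intro mult_left_mono power_decreasing) auto
    ultimately show ?thesis by linarith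
  qed
  have Y: "(\<lambda>n. f (\<Phi> n) \<omega>) \<longlonglongrightarrow> solution t x \<omega>" if "convergent (\<lambda>n. f (\<Phi> n) \<omega>)" for \<omega>
    using that unfolding solution_def \<Phi>_def by (rule convergent_LIMSEQ_iff[THEN iffD1])
  have C4: "4 * C \<ge> 0" using C(1) by simp
  note L = fast_cauchy_limit[OF forcing_square_integrable[OF ft] C4 cauchy solution_section_measurable Y]
  have l: "(\<lambda>n. C * (1/2::real) ^ n) \<longlonglongrightarrow> 0"
    using tendsto_mult[OF tendsto_const[of C] LIMSEQ_power_zero[of "1/2::real"]] by simp
  have ev: "\<forall>\<^sub>F n in sequentially. 0 \<le> sqnorm symbol_measure (\<lambda>w. symbol (\<Phi> n) w - kernel t x w)"
    "\<forall>\<^sub>F n in sequentially. sqnorm symbol_measure (\<lambda>w. symbol (\<Phi> n) w - kernel t x w) \<le> C * (1/2) ^ n"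
    by (rule always_eventually, rule allI, rule sqnorm_nonneg) (rule always_eventually, rule allI, rule C(2))
  have "(\<lambda>n. sqnorm symbol_measure (\<lambda>w. symbol (\<Phi> n) w - kernel t x w)) \<longlonglongrightarrow> 0"
    by (rule tendsto_sandwich[OF ev tendsto_const l])
  then show ?thesis unfolding represents_def using L(2,3) ft kernel_square_integrable[OF t] by blast
qed

end

section \<open>The weak equation\<close>

lemma set_integral_as_weight:
  fixes F :: "real \<Rightarrow> complex"
  shows "(LINT s:{0..t}|lborel. F s) = (LINT s|lborel. F s * indicator {0..t} s)"
  unfolding set_lebesgue_integral_def by (intro Bochner_Integration.integral_cong refl) (simp add: indicator_def)

lemma integrable_indicator_interval: "integrable lborel (indicator {a..b::real} :: real \<Rightarrow> complex)"
proof -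
  have "integrable lborel (\<lambda>x. indicator {a..b} x *\<^sub>R (1::complex))" by (rule borel_integrable_atLeastAtMost'[unfolded set_integrable_def]) simp
  moreover have "(\<lambda>x. indicator {a..b} x *\<^sub>R (1::complex)) = indicator {a..b}" by (auto simp: indicator_def fun_eq_iff)
  ultimately show ?thesis by simp
qed

text \<open>Cauchy--Schwarz with respect to the measure \<open>\<bar>\<rho>\<bar> dx\<close>.\<close>

lemma (in sigma_finite_measure) average_field:
  fixes v :: "real \<Rightarrow> 'a \<Rightarrow> complex" and \<rho> :: "real \<Rightarrow> complex"
  assumes vm: "(\<lambda>(x, \<omega>). v x \<omega>) \<in> borel_measurable (borel \<Otimes>\<^sub>M M)"
    and \<rho>: "integrable lborel \<rho>"
    and K: "K \<ge> 0"
    and v: "\<And>x. \<rho> x \<noteq> 0 \<Longrightarrow> square_integrable M (v x) \<and> sqnorm M (v x) \<le> K"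
  shows "square_integrable M (\<lambda>\<omega>. LINT x|lborel. v x \<omega> * \<rho> x)"
    and "sqnorm M (\<lambda>\<omega>. LINT x|lborel. v x \<omega> * \<rho> x) \<le> K * (LINT x|lborel. cmod (\<rho> x))\<^sup>2"
    and "square_integrable M Z \<Longrightarrow> (\<integral>\<omega>. (LINT x|lborel. v x \<omega> * \<rho> x) * cnj (Z \<omega>) \<partial>M)
       = (LINT x|lborel. (\<integral>\<omega>. v x \<omega> * cnj (Z \<omega>) \<partial>M) * \<rho> x)"
proof -
  interpret P: pair_sigma_finite lborel M ..
  have vm'[measurable]: "(\<lambda>w. v (fst w) (snd w)) \<in> borel_measurable (lborel \<Otimes>\<^sub>M M)"
    using vm by (simp add: case_prod_unfold cong: measurable_cong_sets)
  have vm2[measurable]: "(\<lambda>w. v (snd w) (fst w)) \<in> borel_measurable (M \<Otimes>\<^sub>M lborel)"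
    using measurable_compose[OF measurable_pair_swap' vm'] by (simp add: case_prod_unfold)
  have \<rho>m[measurable]: "\<rho> \<in> borel_measurable borel" using \<rho> by auto
  have vx: "(\<lambda>\<omega>. v x \<omega>) \<in> borel_measurable M" for x
    using measurable_compose[OF measurable_Pair1' vm', of x] by simp
  have Km: "(\<integral>\<^sup>+\<omega>. ennreal ((cmod (v x \<omega>))\<^sup>2) \<partial>M) \<le> ennreal K" if "\<rho> x \<noteq> 0" for x
  proof -
    have "(\<integral>\<^sup>+\<omega>. ennreal ((cmod (v x \<omega>))\<^sup>2) \<partial>M) = ennreal (sqnorm M (v x))"
      unfolding sqnorm_def using v[OF that] by (intro nn_integral_eq_integral) (auto simp: square_integrable_def)
    then show ?thesis using v[OF that] by (simp add: ennreal_leI)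
  qed
  have R: "(\<integral>\<^sup>+x. ennreal (cmod (\<rho> x)) \<partial>lborel) < \<infinity>"
    using \<rho> unfolding integrable_iff_bounded by simp
  \<comment> \<open>Absolute integrability on the product space, for Fubini: the product of
    \<open>v\<close> and \<open>W\<close> is bounded by the sum of their squares, whose integral
    over \<open>M\<close> is at most \<open>K\<close> plus that of \<open>W\<close>, uniformly where
    \<open>\<rho>\<close> does not vanish.\<close>
  have *: "integrable (lborel \<Otimes>\<^sub>M M) (\<lambda>w. v (fst w) (snd w) * \<rho> (fst w) * cnj (W (snd w)))" if W: "square_integrable M W" for W
  proof (rule integrableI_bounded)
    have [measurable]: "W \<in> borel_measurable M" using W by (simp add: square_integrable_def)
    show "(\<lambda>w. v (fst w) (snd w) * \<rho> (fst w) * cnj (W (snd w))) \<in> borel_measurable (lborel \<Otimes>\<^sub>M M)" by measurable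
    have W2: "(\<integral>\<^sup>+\<omega>. ennreal ((cmod (W \<omega>))\<^sup>2) \<partial>M) = ennreal (sqnorm M W)"
      unfolding sqnorm_def by (intro nn_integral_eq_integral square_integrable_integrable W) auto
    have "(\<integral>\<^sup>+w. ennreal (norm (v (fst w) (snd w) * \<rho> (fst w) * cnj (W (snd w)))) \<partial>(lborel \<Otimes>\<^sub>M M))
       = (\<integral>\<^sup>+x. \<integral>\<^sup>+\<omega>. ennreal (norm (v x \<omega> * \<rho> x * cnj (W \<omega>))) \<partial>M \<partial>lborel)"
      by (subst nn_integral_fst[symmetric]) auto
    also have "\<dots> \<le> (\<integral>\<^sup>+x. ennreal (cmod (\<rho> x)) * (ennreal K + ennreal (sqnorm M W)) \<partial>lborel)"
    proof (rule nn_integral_mono)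
      fix x :: real
      show "(\<integral>\<^sup>+\<omega>. ennreal (norm (v x \<omega> * \<rho> x * cnj (W \<omega>))) \<partial>M) \<le> ennreal (cmod (\<rho> x)) * (ennreal K + ennreal (sqnorm M W))"
      proof (cases "\<rho> x = 0")
        case False
        have [measurable]: "(\<lambda>\<omega>. v x \<omega>) \<in> borel_measurable M" by (rule vx)
        have "(\<integral>\<^sup>+\<omega>. ennreal (norm (v x \<omega> * \<rho> x * cnj (W \<omega>))) \<partial>M)
           \<le> (\<integral>\<^sup>+\<omega>. ennreal (cmod (\<rho> x)) * (ennreal ((cmod (v x \<omega>))\<^sup>2) + ennreal ((cmod (W \<omega>))\<^sup>2)) \<partial>M)"
        proof (rule nn_integral_mono)
          fix \<omega>
          have "cmod (\<rho> x) * (cmod (v x \<omega>) * cmod (W \<omega>)) \<le> cmod (\<rho> x) * ((cmod (v x \<omega>))\<^sup>2 + (cmod (W \<omega>))\<^sup>2)"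
            by (intro mult_left_mono two_mult_le_squares) auto
          then have "ennreal (norm (v x \<omega> * \<rho> x * cnj (W \<omega>))) \<le> ennreal (cmod (\<rho> x) * ((cmod (v x \<omega>))\<^sup>2 + (cmod (W \<omega>))\<^sup>2))"
            by (intro ennreal_leI) (simp add: norm_mult mult_ac)
          then show "ennreal (norm (v x \<omega> * \<rho> x * cnj (W \<omega>))) \<le> ennreal (cmod (\<rho> x)) * (ennreal ((cmod (v x \<omega>))\<^sup>2) + ennreal ((cmod (W \<omega>))\<^sup>2))"
            by (simp add: ennreal_mult)
        qed
        also have "\<dots> = ennreal (cmod (\<rho> x)) * ((\<integral>\<^sup>+\<omega>. ennreal ((cmod (v x \<omega>))\<^sup>2) \<partial>M) + ennreal (sqnorm M W))"
          by (subst nn_integral_cmult, measurable, subst nn_integral_add, measurable, simp only: W2)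
        also have "\<dots> \<le> ennreal (cmod (\<rho> x)) * (ennreal K + ennreal (sqnorm M W))"
          using Km[OF False] by (intro mult_left_mono add_right_mono) auto
        finally show ?thesis .
      qed simp
    qed
    also have "\<dots> = (\<integral>\<^sup>+x. ennreal (cmod (\<rho> x)) \<partial>lborel) * (ennreal K + ennreal (sqnorm M W))"
      by (rule nn_integral_multc) measurable
    also have "\<dots> < \<infinity>" using R by (simp add: ennreal_mult_less_top)
    finally show "(\<integral>\<^sup>+w. ennreal (norm (v (fst w) (snd w) * \<rho> (fst w) * cnj (W (snd w)))) \<partial>(lborel \<Otimes>\<^sub>M M)) < \<infinity>" .
  qed
  have m: "(\<lambda>\<omega>. LINT x|lborel. v x \<omega> * \<rho> x) \<in> borel_measurable M"
    by (rule lborel.borel_measurable_lebesgue_integral) (simp add: case_prod_unfold, measurable)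
  let ?R = "\<integral>\<^sup>+x. ennreal (cmod (\<rho> x)) \<partial>lborel"
  have bnd: "(\<integral>\<^sup>+\<omega>. ennreal (norm ((cmod (LINT x|lborel. v x \<omega> * \<rho> x))\<^sup>2)) \<partial>M) \<le> ?R * ennreal K * ?R"
  proof -
    have "(\<integral>\<^sup>+\<omega>. ennreal (norm ((cmod (LINT x|lborel. v x \<omega> * \<rho> x))\<^sup>2)) \<partial>M)
       \<le> (\<integral>\<^sup>+\<omega>. (\<integral>\<^sup>+x. ennreal (cmod (\<rho> x) * (cmod (v x \<omega>))\<^sup>2) \<partial>lborel) * ?R \<partial>M)"
    proof (rule nn_integral_mono)
      fix \<omega> assume \<omega>: "\<omega> \<in> space M"
      have [measurable]: "(\<lambda>x. v x \<omega>) \<in> borel_measurable lborel"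
        using measurable_compose[OF measurable_Pair2'[OF \<omega>] vm'] by simp
      let ?s = "\<lambda>x. ennreal (sqrt (cmod (\<rho> x)))"
      have "ennreal (cmod (LINT x|lborel. v x \<omega> * \<rho> x)) \<le> (\<integral>\<^sup>+x. ennreal (cmod (v x \<omega> * \<rho> x)) \<partial>lborel)"
        by (rule norm_integral_le_nn_integral)
      also have "\<dots> = (\<integral>\<^sup>+x. (ennreal (cmod (v x \<omega>)) * ?s x) * ?s x \<partial>lborel)"
        by (intro nn_integral_cong) (simp add: norm_mult ennreal_mult[symmetric] mult.assoc)
      finally have "ennreal (cmod (LINT x|lborel. v x \<omega> * \<rho> x)) ^ 2 \<le> (\<integral>\<^sup>+x. (ennreal (cmod (v x \<omega>)) * ?s x) * ?s x \<partial>lborel) ^ 2"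
        by (rule power_mono) simp
      also have "\<dots> \<le> (\<integral>\<^sup>+x. (ennreal (cmod (v x \<omega>)) * ?s x)\<^sup>2 \<partial>lborel) * (\<integral>\<^sup>+x. (?s x)\<^sup>2 \<partial>lborel)"
        by (rule Cauchy_Schwarz_nn_integral) measurable
      also have "(\<lambda>x. (ennreal (cmod (v x \<omega>)) * ?s x)\<^sup>2) = (\<lambda>x. ennreal (cmod (\<rho> x) * (cmod (v x \<omega>))\<^sup>2))"
        by (intro ext) (simp add: ennreal_mult[symmetric] ennreal_power power_mult_distrib mult.commute)
      also have "(\<lambda>x. (?s x)\<^sup>2) = (\<lambda>x. ennreal (cmod (\<rho> x)))" by (intro ext) (simp add: ennreal_power)
      finally show "ennreal (norm ((cmod (LINT x|lborel. v x \<omega> * \<rho> x))\<^sup>2)) \<le> (\<integral>\<^sup>+x. ennreal (cmod (\<rho> x) * (cmod (v x \<omega>))\<^sup>2) \<partial>lborel) * ?R"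
        by (simp add: ennreal_power)
    qed
    also have "\<dots> = (\<integral>\<^sup>+\<omega>. (\<integral>\<^sup>+x. ennreal (cmod (\<rho> x) * (cmod (v x \<omega>))\<^sup>2) \<partial>lborel) \<partial>M) * ?R"
      by (rule nn_integral_multc) (rule lborel.borel_measurable_nn_integral, simp add: case_prod_unfold, measurable)
    also have "(\<integral>\<^sup>+\<omega>. (\<integral>\<^sup>+x. ennreal (cmod (\<rho> x) * (cmod (v x \<omega>))\<^sup>2) \<partial>lborel) \<partial>M)
       = (\<integral>\<^sup>+x. (\<integral>\<^sup>+\<omega>. ennreal (cmod (\<rho> x) * (cmod (v x \<omega>))\<^sup>2) \<partial>M) \<partial>lborel)"
      by (rule P.Fubini') (simp add: case_prod_unfold, measurable)
    also have "\<dots> \<le> (\<integral>\<^sup>+x. ennreal (cmod (\<rho> x)) * ennreal K \<partial>lborel)"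
    proof (rule nn_integral_mono)
      fix x :: real
      show "(\<integral>\<^sup>+\<omega>. ennreal (cmod (\<rho> x) * (cmod (v x \<omega>))\<^sup>2) \<partial>M) \<le> ennreal (cmod (\<rho> x)) * ennreal K"
      proof (cases "\<rho> x = 0")
        case False
        have [measurable]: "(\<lambda>\<omega>. v x \<omega>) \<in> borel_measurable M" by (rule vx)
        have "(\<integral>\<^sup>+\<omega>. ennreal (cmod (\<rho> x) * (cmod (v x \<omega>))\<^sup>2) \<partial>M) = ennreal (cmod (\<rho> x)) * (\<integral>\<^sup>+\<omega>. ennreal ((cmod (v x \<omega>))\<^sup>2) \<partial>M)"
          by (simp add: ennreal_mult nn_integral_cmult)
        also have "\<dots> \<le> ennreal (cmod (\<rho> x)) * ennreal K" using Km[OF False] by (intro mult_left_mono) auto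
        finally show ?thesis .
      qed simp
    qed
    also have "\<dots> = ?R * ennreal K" by (rule nn_integral_multc) measurable
    finally show ?thesis by (simp add: mult_right_mono)
  qed
  show sq: "square_integrable M (\<lambda>\<omega>. LINT x|lborel. v x \<omega> * \<rho> x)"
    unfolding square_integrable_def
  proof (rule conjI[OF m integrableI_bounded])
    show "(\<lambda>\<omega>. (cmod (LINT x|lborel. v x \<omega> * \<rho> x))\<^sup>2) \<in> borel_measurable M" using m by measurable
    have "?R * ennreal K * ?R < \<infinity>" using R by (simp add: ennreal_mult_less_top)
    with bnd show "(\<integral>\<^sup>+\<omega>. ennreal (norm ((cmod (LINT x|lborel. v x \<omega> * \<rho> x))\<^sup>2)) \<partial>M) < \<infinity>" by (rule order_le_less_trans)
  qed
  show "sqnorm M (\<lambda>\<omega>. LINT x|lborel. v x \<omega> * \<rho> x) \<le> K * (LINT x|lborel. cmod (\<rho> x))\<^sup>2"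
  proof -
    have "ennreal (sqnorm M (\<lambda>\<omega>. LINT x|lborel. v x \<omega> * \<rho> x)) = (\<integral>\<^sup>+\<omega>. ennreal (norm ((cmod (LINT x|lborel. v x \<omega> * \<rho> x))\<^sup>2)) \<partial>M)"
      unfolding sqnorm_def using nn_integral_eq_integral[OF square_integrable_integrable[OF sq]] by simp
    also have "\<dots> \<le> ?R * ennreal K * ?R" by (rule bnd)
    also have "?R = ennreal (LINT x|lborel. cmod (\<rho> x))"
      by (intro nn_integral_eq_integral integrable_norm \<rho>) auto
    also have "ennreal (LINT x|lborel. cmod (\<rho> x)) * ennreal K * ennreal (LINT x|lborel. cmod (\<rho> x))
       = ennreal (K * (LINT x|lborel. cmod (\<rho> x))\<^sup>2)"
      using K by (simp add: ennreal_mult[symmetric] power2_eq_square mult_ac)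
    finally show ?thesis
      by (rule ennreal_le_iff[THEN iffD1, rotated]) (use K in simp)
  qed
  assume Z: "square_integrable M Z"
  have "integrable (lborel \<Otimes>\<^sub>M M) (\<lambda>(x, \<omega>). v x \<omega> * \<rho> x * cnj (Z \<omega>))"
    using *[OF Z] by (simp add: case_prod_unfold)
  from P.Fubini_integral[OF this]
  have "(\<integral>\<omega>. (LINT x|lborel. v x \<omega> * \<rho> x * cnj (Z \<omega>)) \<partial>M) = (LINT x|lborel. (\<integral>\<omega>. v x \<omega> * \<rho> x * cnj (Z \<omega>) \<partial>M))" .
  also have "(\<lambda>\<omega>. LINT x|lborel. v x \<omega> * \<rho> x * cnj (Z \<omega>)) = (\<lambda>\<omega>. (LINT x|lborel. v x \<omega> * \<rho> x) * cnj (Z \<omega>))" by simp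
  also have "(\<lambda>x. \<integral>\<omega>. v x \<omega> * \<rho> x * cnj (Z \<omega>) \<partial>M) = (\<lambda>x. (\<integral>\<omega>. v x \<omega> * cnj (Z \<omega>) \<partial>M) * \<rho> x)"
  proof
    fix x
    have "(\<lambda>\<omega>. v x \<omega> * \<rho> x * cnj (Z \<omega>)) = (\<lambda>\<omega>. v x \<omega> * cnj (Z \<omega>) * \<rho> x)" by (simp only: mult_ac)
    then show "(\<integral>\<omega>. v x \<omega> * \<rho> x * cnj (Z \<omega>) \<partial>M) = (\<integral>\<omega>. v x \<omega> * cnj (Z \<omega>) \<partial>M) * \<rho> x" by simp
  qed
  finally show "(\<integral>\<omega>. (LINT x|lborel. v x \<omega> * \<rho> x) * cnj (Z \<omega>) \<partial>M)
       = (LINT x|lborel. (\<integral>\<omega>. v x \<omega> * cnj (Z \<omega>) \<partial>M) * \<rho> x)" .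
qed

lemma cmod_integral_product_le:
  assumes "square_integrable M h" "square_integrable M k"
  shows "cmod (LINT x|M. h x * cnj (k x)) \<le> sqrt (sqnorm M h) * sqrt (sqnorm M k)"
  using integral_norm_bound[of M "\<lambda>x. h x * cnj (k x)"] cauchy_schwarz_integral[OF assms]
  by (simp add: norm_mult)

section \<open>Pairing random fields with test functions\<close>

context driven_evolution
begin

text \<open>The part of \<open>solution_from_zero\<close> that makes sense of pairings and of
  exchanging them with expectations; it is shared by the constructed field and by an arbitrary
  solution.\<close>

definition bounded_field :: "(real \<Rightarrow> real \<Rightarrow> 'w \<Rightarrow> complex) \<Rightarrow> bool" where
  "bounded_field u \<longleftrightarrow> (\<lambda>(t, x, \<omega>). u t x \<omega>) \<in> borel_measurable (borel \<Otimes>\<^sub>M (borel \<Otimes>\<^sub>M M)) \<and>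
     (\<forall>t\<ge>0. \<forall>x. square_integrable M (u t x)) \<and> (\<forall>T. \<exists>K. \<forall>t\<in>{0..T}. \<forall>x. sqnorm M (u t x) \<le> K)"

lemma bounded_fieldE:
  assumes "bounded_field u"
  obtains K where "K \<ge> 0" "\<And>t x. 0 \<le> t \<Longrightarrow> t \<le> T \<Longrightarrow> sqnorm M (u t x) \<le> K"
proof -
  obtain K where K: "\<forall>t\<in>{0..T}. \<forall>x. sqnorm M (u t x) \<le> K" using assms unfolding bounded_field_def by blast
  show ?thesis by (rule that[of "max 0 K"]) (use K in \<open>auto simp: max.coboundedI2\<close>)
qed

lemma bounded_field_square_integrable: "bounded_field u \<Longrightarrow> t \<ge> 0 \<Longrightarrow> square_integrable M (u t x)"
  unfolding bounded_field_def by blast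

lemma bounded_field_measurable:
  assumes "bounded_field u"
  shows "(\<lambda>(x, \<omega>). u t x \<omega>) \<in> borel_measurable (borel \<Otimes>\<^sub>M M)"
proof -
  have u: "(\<lambda>(t, x, \<omega>). u t x \<omega>) \<in> borel_measurable (borel \<Otimes>\<^sub>M (borel \<Otimes>\<^sub>M M))"
    using assms unfolding bounded_field_def by blast
  have "(\<lambda>w. (t, fst w, snd w)) \<in> measurable (borel \<Otimes>\<^sub>M M) (borel \<Otimes>\<^sub>M (borel \<Otimes>\<^sub>M M))" by measurable
  from measurable_compose[OF this u] show ?thesis by (simp add: case_prod_unfold)
qed

definition field_pairing :: "(real \<Rightarrow> real \<Rightarrow> 'w \<Rightarrow> complex) \<Rightarrow> (real \<Rightarrow> complex) \<Rightarrow> real \<Rightarrow> 'w \<Rightarrow> complex" where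
  "field_pairing u \<phi> t \<omega> = pairing (\<lambda>x. u t x \<omega>) \<phi>"

lemma field_pairing_average:
  assumes u: "bounded_field u" and t: "t \<ge> 0" and \<phi>: "schwartz \<phi>"
  shows "square_integrable M (field_pairing u \<phi> t)"
    and "square_integrable M Z \<Longrightarrow> (\<integral>\<omega>. field_pairing u \<phi> t \<omega> * cnj (Z \<omega>) \<partial>M)
      = (LINT x|lborel. (\<integral>\<omega>. u t x \<omega> * cnj (Z \<omega>) \<partial>M) * cnj (\<phi> x))"
proof -
  obtain K where K: "K \<ge> 0" "\<And>s x. 0 \<le> s \<Longrightarrow> s \<le> t \<Longrightarrow> sqnorm M (u s x) \<le> K"
    by (rule bounded_fieldE[OF u]) blast
  have i: "integrable lborel (\<lambda>x. cnj (\<phi> x))" by (intro schwartz_integrable schwartz_cnj \<phi>)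
  have e: "field_pairing u \<phi> t = (\<lambda>\<omega>. LINT x|lborel. u t x \<omega> * cnj (\<phi> x))"
    by (simp add: field_pairing_def[abs_def] pairing_def)
  have b: "square_integrable M (u t x) \<and> sqnorm M (u t x) \<le> K" for x
    using bounded_field_square_integrable[OF u t] K(2)[OF t] by simp
  show "square_integrable M (field_pairing u \<phi> t)"
    unfolding e by (rule average_field(1)[OF bounded_field_measurable[OF u] i K(1) b])
  show "square_integrable M Z \<Longrightarrow> (\<integral>\<omega>. field_pairing u \<phi> t \<omega> * cnj (Z \<omega>) \<partial>M)
      = (LINT x|lborel. (\<integral>\<omega>. u t x \<omega> * cnj (Z \<omega>) \<partial>M) * cnj (\<phi> x))"
    unfolding e by (rule average_field(3)[OF bounded_field_measurable[OF u] i K(1) b])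
qed

lemma field_pairing_bound:
  assumes u: "bounded_field u" and \<phi>: "schwartz \<phi>"
  obtains K where "K \<ge> 0" "\<And>t. 0 \<le> t \<Longrightarrow> t \<le> T \<Longrightarrow> sqnorm M (field_pairing u \<phi> t) \<le> K"
proof -
  obtain K where K: "K \<ge> 0" "\<And>t x. 0 \<le> t \<Longrightarrow> t \<le> T \<Longrightarrow> sqnorm M (u t x) \<le> K"
    by (rule bounded_fieldE[OF u]) blast
  have i: "integrable lborel (\<lambda>x. cnj (\<phi> x))" by (intro schwartz_integrable schwartz_cnj \<phi>)
  have "sqnorm M (field_pairing u \<phi> t) \<le> K * (LINT x|lborel. cmod (cnj (\<phi> x)))\<^sup>2" if "0 \<le> t" "t \<le> T" for t
  proof -
    have b: "square_integrable M (u t x) \<and> sqnorm M (u t x) \<le> K" for x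
      using bounded_field_square_integrable[OF u that(1)] K(2)[OF that] by simp
    show ?thesis unfolding field_pairing_def[abs_def] pairing_def
      by (rule average_field(2)[OF bounded_field_measurable[OF u] i K(1) b])
  qed
  then show ?thesis by (rule that[rotated]) (assumption | intro mult_nonneg_nonneg K(1) zero_le_power2)+
qed

lemma field_pairing_measurable:
  assumes u: "bounded_field u" and \<phi>: "schwartz \<phi>"
  shows "(\<lambda>(t, \<omega>). field_pairing u \<phi> t \<omega>) \<in> borel_measurable (borel \<Otimes>\<^sub>M M)"
proof -
  have um: "(\<lambda>w. u (fst w) (fst (snd w)) (snd (snd w))) \<in> borel_measurable (borel \<Otimes>\<^sub>M (borel \<Otimes>\<^sub>M M))"
    using u unfolding bounded_field_def by (simp add: case_prod_unfold)
  have "(\<lambda>w. (fst (fst w), snd w, snd (fst w))) \<in> measurable ((borel \<Otimes>\<^sub>M M) \<Otimes>\<^sub>M borel) (borel \<Otimes>\<^sub>M (borel \<Otimes>\<^sub>M M))" by measurable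
  from measurable_compose[OF this um]
  have [measurable]: "(\<lambda>w. u (fst (fst w)) (snd w) (snd (fst w))) \<in> borel_measurable ((borel \<Otimes>\<^sub>M M) \<Otimes>\<^sub>M borel)" by simp
  have [measurable]: "\<phi> \<in> borel_measurable borel" by (rule schwartz_measurable[OF \<phi>])
  show ?thesis unfolding field_pairing_def pairing_def case_prod_unfold
    by (rule lborel.borel_measurable_lebesgue_integral) (simp add: case_prod_unfold, measurable)
qed

lemma field_pairing_time_average:
  assumes u: "bounded_field u" and t: "t \<ge> 0" and \<phi>: "schwartz \<phi>"
  shows "square_integrable M (\<lambda>\<omega>. LINT s:{0..t}|lborel. field_pairing u \<phi> s \<omega>)"
    and "square_integrable M Z \<Longrightarrow> (\<integral>\<omega>. (LINT s:{0..t}|lborel. field_pairing u \<phi> s \<omega>) * cnj (Z \<omega>) \<partial>M)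
      = (LINT s:{0..t}|lborel. (\<integral>\<omega>. field_pairing u \<phi> s \<omega> * cnj (Z \<omega>) \<partial>M))"
proof -
  obtain K where K: "K \<ge> 0" "\<And>s. 0 \<le> s \<Longrightarrow> s \<le> t \<Longrightarrow> sqnorm M (field_pairing u \<phi> s) \<le> K"
    by (rule field_pairing_bound[OF u \<phi>]) blast
  \<comment> \<open>The weight is the indicator of \<open>{0..t}\<close>, and the bounds on the
    field are available there; this is why \<open>average_field\<close> asks for them only where the
    weight is nonzero.\<close>
  have b: "square_integrable M (field_pairing u \<phi> s) \<and> sqnorm M (field_pairing u \<phi> s) \<le> K"
    if "indicator {0..t} s \<noteq> (0::complex)" for s
    using that field_pairing_average(1)[OF u _ \<phi>] K(2) by (auto simp: indicator_def split: if_splits)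
  show "square_integrable M (\<lambda>\<omega>. LINT s:{0..t}|lborel. field_pairing u \<phi> s \<omega>)"
    unfolding set_integral_as_weight
    by (rule average_field(1)[OF field_pairing_measurable[OF u \<phi>] integrable_indicator_interval K(1) b])
  show "square_integrable M Z \<Longrightarrow> (\<integral>\<omega>. (LINT s:{0..t}|lborel. field_pairing u \<phi> s \<omega>) * cnj (Z \<omega>) \<partial>M)
      = (LINT s:{0..t}|lborel. (\<integral>\<omega>. field_pairing u \<phi> s \<omega> * cnj (Z \<omega>) \<partial>M))"
    unfolding set_integral_as_weight
    by (rule average_field(3)[OF field_pairing_measurable[OF u \<phi>] integrable_indicator_interval K(1) b])
qed

lemma represents_sqnorm_diff:
  assumes "represents X h" "represents Y k"
  shows "sqnorm M (\<lambda>\<omega>. X \<omega> - Y \<omega>) = sqnorm symbol_measure (\<lambda>w. h w - k w)"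
proof -
  have s: "square_integrable M X" "square_integrable M Y" "square_integrable symbol_measure h" "square_integrable symbol_measure k"
    using assms unfolding represents_def by blast+
  have "complex_of_real (sqnorm M (\<lambda>\<omega>. X \<omega> - Y \<omega>)) = complex_of_real (sqnorm symbol_measure (\<lambda>w. h w - k w))"
    by (simp only: sqnorm_diff_expand s represents_inner[OF assms(1) assms(1)] represents_inner[OF assms(1) assms(2)]
        represents_inner[OF assms(2) assms(1)] represents_inner[OF assms(2) assms(2)])
  then show ?thesis by (simp only: of_real_eq_iff)
qed

lemma represents_sqnorm:
  assumes "represents X h" shows "sqnorm M X = sqnorm symbol_measure h"
proof -
  have "complex_of_real (sqnorm M X) = complex_of_real (sqnorm symbol_measure h)"
    unfolding sqnorm_eq_inner by (rule represents_inner[OF assms assms])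
  then show ?thesis by (simp only: of_real_eq_iff)
qed

lemma kernel_bound:
  assumes T: "T \<ge> 0"
  obtains C m where "C \<ge> 0" "\<And>t x s k. 0 \<le> t \<Longrightarrow> t \<le> T \<Longrightarrow> cmod (kernel t x (s, k)) \<le> indicator {0..t} s * (C * (1 + \<bar>k\<bar>) ^ m)"
proof -
  obtain C m where C: "C \<ge> 0"
    "\<And>k x \<tau>. \<bar>\<tau>\<bar> \<le> T \<Longrightarrow> cmod (mode x (k + c * \<tau>) * gpow weight_exp k) \<le> C * (1 + \<bar>k\<bar>) ^ m"
    by (rule mode_kernel_bounds[OF T]) blast
  show ?thesis
  proof (rule that[OF C(1)])
    fix t x s k assume "0 \<le> t" "t \<le> T"
    then show "cmod (kernel t x (s, k)) \<le> indicator {0..t} s * (C * (1 + \<bar>k\<bar>) ^ m)"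
      using C(2)[of "t - s" x k] by (auto simp: kernel_def indicator_def)
  qed
qed

lemma moment_nonneg: "moment j \<ge> 0"
  unfolding moment_def by simp

lemma kernel_sqnorm_bound:
  assumes T: "T \<ge> 0"
  obtains K where "K \<ge> 0" "\<And>t x. 0 \<le> t \<Longrightarrow> t \<le> T \<Longrightarrow> sqnorm symbol_measure (kernel t x) \<le> K"
proof -
  obtain C m where C: "C \<ge> 0" "\<And>t x s k. 0 \<le> t \<Longrightarrow> t \<le> T \<Longrightarrow> cmod (kernel t x (s, k)) \<le> indicator {0..t} s * (C * (1 + \<bar>k\<bar>) ^ m)"
    by (rule kernel_bound[OF T]) blast
  have "sqnorm symbol_measure (kernel t x) \<le> C\<^sup>2 * T * moment (2 * m)" if t: "0 \<le> t" "t \<le> T" for t x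
  proof -
    have "sqnorm symbol_measure (kernel t x) \<le> C\<^sup>2 * (t - 0) * moment (2 * m)"
      by (rule strip_bound(2)[OF kernel_measurable t(1) C(2)[OF t]])
    also have "\<dots> \<le> C\<^sup>2 * T * moment (2 * m)" using t moment_nonneg by (intro mult_right_mono mult_left_mono) auto
    finally show ?thesis .
  qed
  then show ?thesis by (rule that[rotated]) (assumption | intro mult_nonneg_nonneg T moment_nonneg zero_le_power2)+
qed

lemma solution_bounded_field: "bounded_field solution"
  unfolding bounded_field_def
proof (intro conjI allI impI)
  show "square_integrable M (solution t x)" if "t \<ge> 0" for t x
    using solution_represents[OF that] unfolding represents_def by blast
  fix T :: real
  show "\<exists>K. \<forall>t\<in>{0..T}. \<forall>x. sqnorm M (solution t x) \<le> K"
  proof (cases "T \<ge> 0")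
    case True
    obtain K where "\<And>t x. 0 \<le> t \<Longrightarrow> t \<le> T \<Longrightarrow> sqnorm symbol_measure (kernel t x) \<le> K"
      by (rule kernel_sqnorm_bound[OF True]) blast
    then show ?thesis using represents_sqnorm[OF solution_represents] by (intro exI[of _ K]) auto
  qed auto
qed (rule solution_measurable)

lemma solution_mean_square_continuous:
  assumes t: "t \<ge> 0"
  shows "((\<lambda>y. sqnorm M (\<lambda>\<omega>. solution t y \<omega> - solution t x \<omega>)) \<longlongrightarrow> 0) (at x)"
proof -
  define R where "R = t + \<bar>x\<bar>"
  have R: "R \<ge> 0" using t by (simp add: R_def)
  obtain C m where C: "C \<ge> 0"
    "\<And>k x x' \<tau> \<tau>' e. \<bar>x'\<bar> \<le> R \<Longrightarrow> \<bar>\<tau>\<bar> \<le> R \<Longrightarrow> \<bar>\<tau>'\<bar> \<le> R \<Longrightarrow> e \<ge> 0 \<Longrightarrow>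
      cmod (mode x (k + c * \<tau>) * gpow weight_exp k - mode x' (k + c * \<tau>') * gpow weight_exp k * of_real (exp (- e * k\<^sup>2)))
      \<le> C * (\<bar>x - x'\<bar> + \<bar>\<tau> - \<tau>'\<bar> + e) * (1 + \<bar>k\<bar>) ^ m"
    by (rule mode_kernel_bounds[OF R]) blast
  \<comment> \<open>The difference bound is used with equal travel times and no cutoff.\<close>
  have b: "sqnorm M (\<lambda>\<omega>. solution t y \<omega> - solution t x \<omega>) \<le> (C * \<bar>y - x\<bar>)\<^sup>2 * (t - 0) * moment (2 * m)" for y
    unfolding represents_sqnorm_diff[OF solution_represents[OF t] solution_represents[OF t]]
  proof (rule strip_bound(2)[OF _ t])
    show "(\<lambda>w. kernel t y w - kernel t x w) \<in> borel_measurable (borel \<Otimes>\<^sub>M borel)"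
      using kernel_measurable by measurable
    fix s k
    show "cmod (kernel t y (s, k) - kernel t x (s, k)) \<le> indicator {0..t} s * (C * \<bar>y - x\<bar> * (1 + \<bar>k\<bar>) ^ m)"
      using C(2)[of x "t - s" "t - s" 0 y k] by (auto simp: kernel_def indicator_def R_def)
  qed
  have "((\<lambda>y. (C * \<bar>y - x\<bar>)\<^sup>2 * (t - 0) * moment (2 * m)) \<longlongrightarrow> (C * \<bar>x - x\<bar>)\<^sup>2 * (t - 0) * moment (2 * m)) (at x)"
    by (intro tendsto_intros)
  then have l: "((\<lambda>y. (C * \<bar>y - x\<bar>)\<^sup>2 * (t - 0) * moment (2 * m)) \<longlongrightarrow> 0) (at x)" by simp
  have ev: "\<forall>\<^sub>F y in at x. 0 \<le> sqnorm M (\<lambda>\<omega>. solution t y \<omega> - solution t x \<omega>)"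
    "\<forall>\<^sub>F y in at x. sqnorm M (\<lambda>\<omega>. solution t y \<omega> - solution t x \<omega>) \<le> (C * \<bar>y - x\<bar>)\<^sup>2 * (t - 0) * moment (2 * m)"
    by (rule always_eventually, rule allI, rule sqnorm_nonneg) (rule always_eventually, rule allI, rule b)
  show ?thesis by (rule tendsto_sandwich[OF ev tendsto_const l])
qed

lemma solution_initial: "AE \<omega> in M. solution 0 x \<omega> = 0"
proof -
  obtain C m where C: "C \<ge> 0" "\<And>t x s k. 0 \<le> t \<Longrightarrow> t \<le> 0 \<Longrightarrow> cmod (kernel t x (s, k)) \<le> indicator {0..t} s * (C * (1 + \<bar>k\<bar>) ^ m)"
    by (rule kernel_bound[of 0]) auto
  have "sqnorm symbol_measure (kernel 0 x) \<le> C\<^sup>2 * (0 - 0) * moment (2 * m)"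
    by (rule strip_bound(2)[OF kernel_measurable order_refl C(2)]) auto
  then have "sqnorm M (solution 0 x) = 0"
    using represents_sqnorm[OF solution_represents[of 0 x]] sqnorm_nonneg[of symbol_measure "kernel 0 x"] by simp
  moreover have "square_integrable M (solution 0 x)" by (rule bounded_field_square_integrable[OF solution_bounded_field]) simp
  ultimately show ?thesis by (intro sqnorm_eq_0)
qed

section \<open>The kernel tested in space and time\<close>

lemma sigma_finite_symbol_measure: "sigma_finite_measure symbol_measure"
proof -
  interpret P: pair_sigma_finite lborel spectral_measure by (rule pair_symbol_measure)
  show ?thesis unfolding symbol_measure_def by unfold_locales
qed

lemma borel_pair_symbol_measure:
  "measurable (borel \<Otimes>\<^sub>M symbol_measure) borel = measurable (borel \<Otimes>\<^sub>M (borel \<Otimes>\<^sub>M borel)) borel"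
  by (intro measurable_cong_sets sets_pair_measure_cong refl) (simp add: sets_symbol_measure)

text \<open>The symbol of the solution paired in space with a test function whose conjugated form is
  \<open>\<xi>\<close>: transport acts on the field, hence by duality on the argument of
  \<open>\<xi>\<close>.\<close>

definition profile :: "real \<Rightarrow> (real \<Rightarrow> complex) \<Rightarrow> real \<times> real \<Rightarrow> complex" where
  "profile t \<xi> = (\<lambda>(s, k). indicator {0..t} s * (gpow weight_exp k * cnj (\<xi> (k + c * (t - s)))))"

text \<open>Division by the weight \<open>g powr (H + 1/2)\<close>, after which
  \<open>dual_op\<close> is the constant coefficient operator \<open>c * \<partial>\<close>.\<close>

definition conjugated :: "(real \<Rightarrow> complex) \<Rightarrow> real \<Rightarrow> complex" where
  "conjugated \<zeta> k = gpow (- weight_exp) k * \<zeta> k"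

lemma schwartz_conjugated: "schwartz \<zeta> \<Longrightarrow> schwartz (conjugated \<zeta>)"
  unfolding conjugated_def[abs_def] by (rule schwartz_gpow)

lemma gpow_conjugated: "gpow weight_exp k * conjugated \<zeta> k = \<zeta> k"
  unfolding conjugated_def mult.assoc[symmetric] gpow_inverse by simp

lemma conjugated_dual_op:
  assumes "schwartz \<zeta>" shows "conjugated (dual_op \<zeta>) k = of_real c * vderiv (conjugated \<zeta>) k"
proof -
  have "gpow (- weight_exp) k * gpow weight_exp k = 1" using gpow_inverse[of "- weight_exp" k] by simp
  moreover have "gpow (- weight_exp) k * (of_real c * gpow weight_exp k * v) = (gpow (- weight_exp) k * gpow weight_exp k) * (of_real c * v)" for v
    by (simp only: mult_ac)
  ultimately have "gpow (- weight_exp) k * (of_real c * gpow weight_exp k * v) = of_real c * v" for v by simp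
  moreover have "conjugated \<zeta> = (\<lambda>k. gpow (- weight_exp) k * \<zeta> k)" by (intro ext) (rule conjugated_def)
  ultimately show ?thesis unfolding conjugated_def[of "dual_op \<zeta>"] dual_op_eq[OF assms] weight_exp_def[symmetric] by (simp only:)
qed

text \<open>The kernel depends on \<open>x\<close> only through
  \<open>cis (2 * pi * x * \<kappa>)\<close>, so integrating it against the conjugate of
  \<open>fourier_inv \<zeta>\<close> evaluates the conjugate of \<open>\<zeta>\<close> at the
  arrival point \<open>\<kappa>\<close>.\<close>

lemma kernel_average:
  assumes "schwartz \<zeta>"
  shows "(LINT x|lborel. kernel t x w * cnj (fourier_inv \<zeta> x)) = profile t (conjugated \<zeta>) w"
proof -
  obtain s k where w: "w = (s, k)" by (cases w)
  define \<kappa> where "\<kappa> = k + c * (t - s)"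
  have "(LINT x|lborel. kernel t x w * cnj (fourier_inv \<zeta> x))
     = (LINT x|lborel. (indicator {0..t} s * gpow (- weight_exp) \<kappa> * gpow weight_exp k) * (cis (2 * pi * x * \<kappa>) * cnj (fourier_inv \<zeta> x)))"
    unfolding kernel_def mode_def w case_prod_conv \<kappa>_def[symmetric]
    by (intro Bochner_Integration.integral_cong refl) (simp only: mult_ac)
  also have "\<dots> = (indicator {0..t} s * gpow (- weight_exp) \<kappa> * gpow weight_exp k) * fourier_inv (\<lambda>x. cnj (fourier_inv \<zeta> x)) \<kappa>"
    unfolding fourier_inv_def[of "\<lambda>x. cnj (fourier_inv \<zeta> x)"] by (rule integral_mult_right_zero)
  also have "fourier_inv (\<lambda>x. cnj (fourier_inv \<zeta> x)) \<kappa> = cnj (\<zeta> \<kappa>)"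
    unfolding cnj_fourier[symmetric] fourier_fourier_inv[OF assms] ..
  finally show ?thesis unfolding profile_def w conjugated_def case_prod_conv \<kappa>_def[symmetric] by (simp add: mult_ac)
qed

lemma profile_measurable:
  assumes "schwartz \<xi>"
  shows "(\<lambda>w. profile (fst w) \<xi> (snd w)) \<in> borel_measurable (borel \<Otimes>\<^sub>M (borel \<Otimes>\<^sub>M borel))"
proof -
  have [measurable]: "\<xi> \<in> borel_measurable borel" by (rule schwartz_measurable[OF assms])
  have "(\<lambda>w. (if 0 \<le> fst (snd w) \<and> fst (snd w) \<le> fst w then 1 else 0) *
     (gpow weight_exp (snd (snd w)) * cnj (\<xi> (snd (snd w) + c * (fst w - fst (snd w)))))) \<in> borel_measurable (borel \<Otimes>\<^sub>M (borel \<Otimes>\<^sub>M borel))"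
    by measurable
  then show ?thesis by (simp add: profile_def case_prod_unfold indicator_def)
qed

lemma profile_bound:
  assumes "schwartz \<xi>"
  obtains C m where "C \<ge> 0" "\<And>t s k. cmod (profile t \<xi> (s, k)) \<le> indicator {0..t} s * (C * (1 + \<bar>k\<bar>) ^ m)"
proof -
  obtain B where B: "\<And>x. cmod (\<xi> x) \<le> B" by (rule schwartz_bounded[OF assms]) blast
  have B0: "B \<ge> 0" using order_trans[OF norm_ge_zero B[of 0]] .
  obtain K m where K: "K \<ge> 0" "\<And>x. cmod (gpow weight_exp x) \<le> K * (1 + \<bar>x\<bar>) ^ m"
    by (rule slow_growthE[OF gpow_slow[of weight_exp]]) blast
  show ?thesis
  proof (rule that[of "K * B" m])
    fix t s k
    have "cmod (gpow weight_exp k * cnj (\<xi> (k + c * (t - s)))) \<le> (K * (1 + \<bar>k\<bar>) ^ m) * B"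
      unfolding norm_mult complex_mod_cnj using K B by (intro mult_mono) auto
    then show "cmod (profile t \<xi> (s, k)) \<le> indicator {0..t} s * (K * B * (1 + \<bar>k\<bar>) ^ m)"
      by (auto simp: profile_def indicator_def mult_ac)
  qed (use K B0 in simp)
qed

lemma profile_square_integrable:
  assumes \<xi>: "schwartz \<xi>"
  shows "t \<ge> 0 \<Longrightarrow> square_integrable symbol_measure (profile t \<xi>)"
    and "\<exists>K\<ge>0. \<forall>s. 0 \<le> s \<longrightarrow> s \<le> T \<longrightarrow> sqnorm symbol_measure (profile s \<xi>) \<le> K"
proof -
  obtain C m where C: "C \<ge> 0" "\<And>t s k. cmod (profile t \<xi> (s, k)) \<le> indicator {0..t} s * (C * (1 + \<bar>k\<bar>) ^ m)"
    by (rule profile_bound[OF \<xi>]) blast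
  have m: "profile t \<xi> \<in> borel_measurable (borel \<Otimes>\<^sub>M borel)" for t
    using measurable_compose[OF measurable_Pair1' profile_measurable[OF \<xi>], of t] by simp
  show "t \<ge> 0 \<Longrightarrow> square_integrable symbol_measure (profile t \<xi>)" by (rule strip_bound(1)[OF m _ C(2)])
  show "\<exists>K\<ge>0. \<forall>s. 0 \<le> s \<longrightarrow> s \<le> T \<longrightarrow> sqnorm symbol_measure (profile s \<xi>) \<le> K"
  proof (intro exI[of _ "C\<^sup>2 * \<bar>T\<bar> * moment (2 * m)"] conjI allI impI)
    show "0 \<le> C\<^sup>2 * \<bar>T\<bar> * moment (2 * m)" by (intro mult_nonneg_nonneg moment_nonneg) auto
    fix s assume s: "0 \<le> s" "s \<le> T"
    have "sqnorm symbol_measure (profile s \<xi>) \<le> C\<^sup>2 * (s - 0) * moment (2 * m)" by (rule strip_bound(2)[OF m s(1) C(2)])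
    also have "\<dots> \<le> C\<^sup>2 * \<bar>T\<bar> * moment (2 * m)" using s moment_nonneg by (intro mult_right_mono mult_left_mono) auto
    finally show "sqnorm symbol_measure (profile s \<xi>) \<le> C\<^sup>2 * \<bar>T\<bar> * moment (2 * m)" .
  qed
qed

text \<open>The space average is pulled out of the expectation, the isometry is applied to point
  values, and the average is pushed back inside on the side of the symbols;
  \<open>average_field\<close> serves for both moves. Only inner products with represented variables
  are computed, not a representation of the pairing itself.\<close>

lemma solution_pairing_inner:
  assumes t: "t \<ge> 0" and \<zeta>: "schwartz \<zeta>" and X: "represents X h"
  shows "(\<integral>\<omega>. field_pairing solution (fourier_inv \<zeta>) t \<omega> * cnj (X \<omega>) \<partial>M)
     = (LINT w|symbol_measure. profile t (conjugated \<zeta>) w * cnj (h w))"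
proof -
  interpret S: sigma_finite_measure symbol_measure by (rule sigma_finite_symbol_measure)
  have s\<phi>: "schwartz (fourier_inv \<zeta>)" by (rule schwartz_fourier_inv[OF \<zeta>])
  have i: "integrable lborel (\<lambda>x. cnj (fourier_inv \<zeta> x))" by (intro schwartz_integrable schwartz_cnj s\<phi>)
  have sX: "square_integrable M X" "square_integrable symbol_measure h" using X unfolding represents_def by blast+
  obtain K where K: "K \<ge> 0" "\<And>s x. 0 \<le> s \<Longrightarrow> s \<le> t \<Longrightarrow> sqnorm symbol_measure (kernel s x) \<le> K"
    by (rule kernel_sqnorm_bound[OF t]) blast
  have b: "square_integrable symbol_measure (kernel t x) \<and> sqnorm symbol_measure (kernel t x) \<le> K" for x
    using kernel_square_integrable[OF t] K(2)[OF t] by simp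
  have m: "(\<lambda>(x, w). kernel t x w) \<in> borel_measurable (borel \<Otimes>\<^sub>M symbol_measure)"
    unfolding borel_pair_symbol_measure kernel_def mode_def case_prod_unfold by measurable
  have "(\<integral>\<omega>. field_pairing solution (fourier_inv \<zeta>) t \<omega> * cnj (X \<omega>) \<partial>M)
     = (LINT x|lborel. (\<integral>\<omega>. solution t x \<omega> * cnj (X \<omega>) \<partial>M) * cnj (fourier_inv \<zeta> x))"
    by (rule field_pairing_average(2)[OF solution_bounded_field t s\<phi> sX(1)])
  also have "\<dots> = (LINT x|lborel. (LINT w|symbol_measure. kernel t x w * cnj (h w)) * cnj (fourier_inv \<zeta> x))"
    by (simp only: represents_inner[OF solution_represents[OF t] X])
  also have "\<dots> = (LINT w|symbol_measure. (LINT x|lborel. kernel t x w * cnj (fourier_inv \<zeta> x)) * cnj (h w))"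
    by (rule S.average_field(3)[OF m i K(1) b sX(2), symmetric])
  also have "\<dots> = (LINT w|symbol_measure. profile t (conjugated \<zeta>) w * cnj (h w))"
    by (simp only: kernel_average[OF \<zeta>])
  finally show ?thesis .
qed

text \<open>Along a characteristic the integrand is a total derivative in \<open>s\<close>. The
  upper end gives the profile at time \<open>t\<close>; the lower end, at the moment
  \<open>\<sigma>\<close> when the forcing acts, gives the symbol of the forcing term with a minus
  sign.\<close>

lemma profile_time_integral:
  assumes \<xi>: "schwartz \<xi>"
  shows "(LINT s|lborel. profile s (\<lambda>k. of_real c * vderiv \<xi> k) (\<sigma>, k) * indicator {0..t} s)
    = indicator {0..t} \<sigma> * (gpow weight_exp k * (cnj (\<xi> (k + c * (t - \<sigma>))) - cnj (\<xi> k)))"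
proof (cases "\<sigma> \<in> {0..t}")
  case True
  let ?f = "\<lambda>s. of_real c * cnj (vderiv \<xi> (k + c * (s - \<sigma>)))"
  have d: "((\<lambda>s. cnj (\<xi> (k + c * (s - \<sigma>)))) has_vector_derivative ?f s) (at s within {\<sigma>..t})" for s
  proof -
    have "((\<xi> \<circ> (\<lambda>s. k + c * (s - \<sigma>))) has_vector_derivative (c *\<^sub>R vderiv \<xi> (k + c * (s - \<sigma>)))) (at s)"
      by (rule vector_diff_chain_at) (auto intro!: derivative_eq_intros schwartz_vderiv[OF \<xi>])
    then have "((\<lambda>s. cnj (\<xi> (k + c * (s - \<sigma>)))) has_vector_derivative cnj (c *\<^sub>R vderiv \<xi> (k + c * (s - \<sigma>)))) (at s)"
      unfolding o_def by (rule has_vector_derivative_cnj)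
    moreover have "cnj (c *\<^sub>R v) = of_real c * cnj v" for v by (simp add: scaleR_conv_of_real)
    ultimately have "((\<lambda>s. cnj (\<xi> (k + c * (s - \<sigma>)))) has_vector_derivative ?f s) (at s)" by (simp only:)
    then show ?thesis by (rule has_vector_derivative_at_within)
  qed
  have "continuous_on {\<sigma>..t} (\<lambda>s. vderiv \<xi> (k + c * (s - \<sigma>)))"
  proof (rule continuous_on_compose2[OF schwartz_continuous[OF schwartz_vderiv(1)[OF \<xi>]]])
    show "continuous_on {\<sigma>..t} (\<lambda>s. k + c * (s - \<sigma>))" by (intro continuous_intros)
  qed simp
  then have cont: "continuous_on {\<sigma>..t} ?f"
    by (intro continuous_on_mult continuous_on_const continuous_on_cnj)
  have "(LINT s|lborel. profile s (\<lambda>k. of_real c * vderiv \<xi> k) (\<sigma>, k) * indicator {0..t} s)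
     = (LINT s|lborel. gpow weight_exp k * (indicator {\<sigma>..t} s *\<^sub>R ?f s))"
    using True by (intro Bochner_Integration.integral_cong refl) (auto simp: profile_def indicator_def)
  also have "\<dots> = gpow weight_exp k * (LINT s|lborel. indicator {\<sigma>..t} s *\<^sub>R ?f s)" by (rule integral_mult_right_zero)
  also have "(LINT s|lborel. indicator {\<sigma>..t} s *\<^sub>R ?f s) = cnj (\<xi> (k + c * (t - \<sigma>))) - cnj (\<xi> (k + c * (\<sigma> - \<sigma>)))"
    by (rule integral_FTC_atLeastAtMost[OF _ d cont]) (use True in auto)
  finally show ?thesis using True by simp
next
  case False
  then have z: "profile s (\<lambda>k. of_real c * vderiv \<xi> k) (\<sigma>, k) * indicator {0..t} s = 0" for s
    by (auto simp: profile_def indicator_def)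
  show ?thesis unfolding z using False by simp
qed

lemma solution_pairing_time_inner:
  assumes t: "t \<ge> 0" and \<zeta>: "schwartz \<zeta>" and X: "represents X h"
  shows "(\<integral>\<omega>. (LINT s:{0..t}|lborel. field_pairing solution (fourier_inv (dual_op \<zeta>)) s \<omega>) * cnj (X \<omega>) \<partial>M)
     = (LINT w|symbol_measure. (indicator {0..t} (fst w) * (gpow weight_exp (snd w) *
          (cnj (conjugated \<zeta> (snd w + c * (t - fst w))) - cnj (conjugated \<zeta> (snd w))))) * cnj (h w))"
proof -
  interpret S: sigma_finite_measure symbol_measure by (rule sigma_finite_symbol_measure)
  let ?\<xi> = "\<lambda>k. of_real c * vderiv (conjugated \<zeta>) k"
  have cd: "conjugated (dual_op \<zeta>) = ?\<xi>" by (intro ext conjugated_dual_op \<zeta>)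
  have s\<xi>: "schwartz ?\<xi>" by (intro schwartz_scale schwartz_vderiv schwartz_conjugated \<zeta>)
  have sd: "schwartz (dual_op \<zeta>)" by (rule schwartz_dual_op[OF \<zeta>])
  have sX: "square_integrable M X" "square_integrable symbol_measure h" using X unfolding represents_def by blast+
  obtain K where K: "K \<ge> 0" "\<And>s. 0 \<le> s \<Longrightarrow> s \<le> t \<Longrightarrow> sqnorm symbol_measure (profile s ?\<xi>) \<le> K"
    using profile_square_integrable(2)[OF s\<xi>, of t] by blast
  have b: "square_integrable symbol_measure (profile s ?\<xi>) \<and> sqnorm symbol_measure (profile s ?\<xi>) \<le> K"
    if "indicator {0..t} s \<noteq> (0::complex)" for s
    using that profile_square_integrable(1)[OF s\<xi>] K(2) by (auto simp: indicator_def split: if_splits)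
  have m: "(\<lambda>(s, w). profile s ?\<xi> w) \<in> borel_measurable (borel \<Otimes>\<^sub>M symbol_measure)"
    using profile_measurable[OF s\<xi>] unfolding borel_pair_symbol_measure by (simp add: case_prod_unfold)
  have pt: "(LINT s|lborel. profile s ?\<xi> w * indicator {0..t} s) = indicator {0..t} (fst w) * (gpow weight_exp (snd w) *
          (cnj (conjugated \<zeta> (snd w + c * (t - fst w))) - cnj (conjugated \<zeta> (snd w))))" for w
    using profile_time_integral[OF schwartz_conjugated[OF \<zeta>], where t = t and \<sigma> = "fst w" and k = "snd w"]
    unfolding prod.collapse .
  have "(\<integral>\<omega>. (LINT s:{0..t}|lborel. field_pairing solution (fourier_inv (dual_op \<zeta>)) s \<omega>) * cnj (X \<omega>) \<partial>M)
     = (LINT s:{0..t}|lborel. (\<integral>\<omega>. field_pairing solution (fourier_inv (dual_op \<zeta>)) s \<omega> * cnj (X \<omega>) \<partial>M))"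
    by (rule field_pairing_time_average(2)[OF solution_bounded_field t schwartz_fourier_inv[OF sd] sX(1)])
  also have "\<dots> = (LINT s:{0..t}|lborel. (LINT w|symbol_measure. profile s ?\<xi> w * cnj (h w)))"
    by (intro set_lebesgue_integral_cong) (auto simp: solution_pairing_inner[OF _ sd X] cd)
  also have "\<dots> = (LINT w|symbol_measure. (LINT s|lborel. profile s ?\<xi> w * indicator {0..t} s) * cnj (h w))"
    unfolding set_integral_as_weight
    by (rule S.average_field(3)[OF m integrable_indicator_interval K(1) b sX(2), symmetric])
  also have "\<dots> = (LINT w|symbol_measure. (indicator {0..t} (fst w) * (gpow weight_exp (snd w) *
          (cnj (conjugated \<zeta> (snd w + c * (t - fst w))) - cnj (conjugated \<zeta> (snd w))))) * cnj (h w))"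
    by (simp only: pt)
  finally show ?thesis .
qed

lemma forcing_term_symbol:
  assumes "schwartz \<zeta>"
  shows "symbol (\<lambda>s x. indicator {0..t} s * cnj (fourier_inv \<zeta> x)) w = indicator {0..t} (fst w) * (gpow weight_exp (snd w) * cnj (conjugated \<zeta> (snd w)))"
proof -
  obtain s k where w: "w = (s, k)" by (cases w)
  have "symbol (\<lambda>s x. indicator {0..t} s * cnj (fourier_inv \<zeta> x)) w = indicator {0..t} s * fourier_inv (\<lambda>x. cnj (fourier_inv \<zeta> x)) k"
    unfolding symbol_def w case_prod_conv fourier_inv_eq fourier_scale ..
  also have "fourier_inv (\<lambda>x. cnj (fourier_inv \<zeta> x)) k = cnj (\<zeta> k)"
    unfolding cnj_fourier[symmetric] fourier_fourier_inv[OF assms] ..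
  also have "cnj (\<zeta> k) = gpow weight_exp k * cnj (conjugated \<zeta> k)"
    using arg_cong[OF gpow_conjugated[of k \<zeta>], of cnj] by simp
  finally show ?thesis by (simp add: w)
qed

text \<open>The defect \<open>D\<close> of the equation is orthogonal to every represented variable,
  by the computation of symbols. But \<open>D\<close> is itself assembled from represented
  variables, by averages in space and time and a forcing term, so it is orthogonal to itself. This
  avoids proving that such averages are represented.\<close>

lemma solution_equation:
  assumes t: "t \<ge> 0" and \<zeta>: "schwartz \<zeta>"
  shows "AE \<omega> in M. field_pairing solution (fourier_inv \<zeta>) t \<omega> =
    (LINT s:{0..t}|lborel. field_pairing solution (fourier_inv (dual_op \<zeta>)) s \<omega>)
     + f (\<lambda>s x. indicator {0..t} s * cnj (fourier_inv \<zeta> x)) \<omega>"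
proof -
  define Y where "Y = field_pairing solution (fourier_inv \<zeta>) t"
  define I where "I = (\<lambda>\<omega>. LINT s:{0..t}|lborel. field_pairing solution (fourier_inv (dual_op \<zeta>)) s \<omega>)"
  define \<Phi> where "\<Phi> = (\<lambda>s x. indicator {0..t} s * cnj (fourier_inv \<zeta> x))"
  define D where "D = (\<lambda>\<omega>. Y \<omega> - I \<omega> - f \<Phi> \<omega>)"
  have s\<phi>: "schwartz (fourier_inv \<zeta>)" and s\<psi>: "schwartz (fourier_inv (dual_op \<zeta>))"
    by (intro schwartz_fourier_inv schwartz_dual_op \<zeta>)+
  have ft: "forcing_test \<Phi>" unfolding \<Phi>_def by (intro forcing_test_separable schwartz_cnj s\<phi>)
  have sY: "square_integrable M Y" unfolding Y_def by (rule field_pairing_average(1)[OF solution_bounded_field t s\<phi>])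
  have sI: "square_integrable M I" unfolding I_def by (rule field_pairing_time_average(1)[OF solution_bounded_field t s\<psi>])
  have sF: "square_integrable M (f \<Phi>)" by (rule forcing_square_integrable[OF ft])
  have sD: "square_integrable M D" unfolding D_def by (intro square_integrable_diff sY sI sF)
  have split: "(\<integral>\<omega>. D \<omega> * cnj (X \<omega>) \<partial>M) = (\<integral>\<omega>. Y \<omega> * cnj (X \<omega>) \<partial>M) - (\<integral>\<omega>. I \<omega> * cnj (X \<omega>) \<partial>M) - (\<integral>\<omega>. f \<Phi> \<omega> * cnj (X \<omega>) \<partial>M)"
    if X: "square_integrable M X" for X
  proof -
    have i: "integrable M (\<lambda>\<omega>. Y \<omega> * cnj (X \<omega>))" "integrable M (\<lambda>\<omega>. I \<omega> * cnj (X \<omega>))" "integrable M (\<lambda>\<omega>. f \<Phi> \<omega> * cnj (X \<omega>))"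
      by (intro square_integrable_product square_integrable_cnj sY sI sF X)+
    have "(\<integral>\<omega>. D \<omega> * cnj (X \<omega>) \<partial>M) = (\<integral>\<omega>. Y \<omega> * cnj (X \<omega>) - I \<omega> * cnj (X \<omega>) - f \<Phi> \<omega> * cnj (X \<omega>) \<partial>M)"
      by (simp add: D_def left_diff_distrib)
    then show ?thesis using i by simp
  qed
  have orth: "(\<integral>\<omega>. D \<omega> * cnj (X \<omega>) \<partial>M) = 0" if X: "represents X h" for X h
  proof -
    have sX: "square_integrable M X" "square_integrable symbol_measure h" using X unfolding represents_def by blast+
    let ?p = "profile t (conjugated \<zeta>)" and ?q = "symbol \<Phi>"
    have sp: "square_integrable symbol_measure ?p" by (rule profile_square_integrable(1)[OF schwartz_conjugated[OF \<zeta>] t])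
    have sq: "square_integrable symbol_measure ?q" by (rule symbol_square_integrable[OF ft])
    have i: "integrable symbol_measure (\<lambda>w. ?p w * cnj (h w))" "integrable symbol_measure (\<lambda>w. ?q w * cnj (h w))"
      by (intro square_integrable_product square_integrable_cnj sp sq sX)+
    \<comment> \<open>The equation at the level of symbols: the time integral is the profile minus
      the symbol of the forcing.\<close>
    have "(indicator {0..t} (fst w) * (gpow weight_exp (snd w) *
          (cnj (conjugated \<zeta> (snd w + c * (t - fst w))) - cnj (conjugated \<zeta> (snd w))))) = ?p w - ?q w" for w
      unfolding \<Phi>_def forcing_term_symbol[OF \<zeta>] profile_def case_prod_unfold by (simp add: right_diff_distrib)
    then have I: "(\<integral>\<omega>. I \<omega> * cnj (X \<omega>) \<partial>M) = (LINT w|symbol_measure. (?p w - ?q w) * cnj (h w))"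
      unfolding I_def solution_pairing_time_inner[OF t \<zeta> X] by (simp only:)
    also have "\<dots> = (LINT w|symbol_measure. ?p w * cnj (h w)) - (LINT w|symbol_measure. ?q w * cnj (h w))"
      unfolding left_diff_distrib by (rule Bochner_Integration.integral_diff[OF i])
    finally show ?thesis unfolding split[OF sX(1)] Y_def solution_pairing_inner[OF t \<zeta> X]
      represents_inner[OF represents_forcing[OF ft] X] by simp
  qed
  have conj0: "(\<integral>\<omega>. X \<omega> * cnj (D \<omega>) \<partial>M) = 0" if "represents X h" for X h
  proof -
    have "(\<integral>\<omega>. X \<omega> * cnj (D \<omega>) \<partial>M) = cnj (\<integral>\<omega>. D \<omega> * cnj (X \<omega>) \<partial>M)"
      by (simp add: Bochner_Integration.integral_cnj[symmetric] mult.commute del: Bochner_Integration.integral_cnj)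
    then show ?thesis using orth[OF that] by simp
  qed
  have p0: "(\<integral>\<omega>. field_pairing solution \<phi> s \<omega> * cnj (D \<omega>) \<partial>M) = 0" if "s \<ge> 0" "schwartz \<phi>" for s \<phi>
    unfolding field_pairing_average(2)[OF solution_bounded_field that sD] conj0[OF solution_represents[OF that(1)]] by simp
  have Y0: "(\<integral>\<omega>. Y \<omega> * cnj (D \<omega>) \<partial>M) = 0" unfolding Y_def by (rule p0[OF t s\<phi>])
  have I0: "(\<integral>\<omega>. I \<omega> * cnj (D \<omega>) \<partial>M) = 0"
  proof -
    have "(\<integral>\<omega>. I \<omega> * cnj (D \<omega>) \<partial>M) = (LINT s:{0..t}|lborel. (\<integral>\<omega>. field_pairing solution (fourier_inv (dual_op \<zeta>)) s \<omega> * cnj (D \<omega>) \<partial>M))"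
      unfolding I_def by (rule field_pairing_time_average(2)[OF solution_bounded_field t s\<psi> sD])
    also have "\<dots> = (LINT s:{0..t}|lborel. 0)" by (intro set_lebesgue_integral_cong) (auto simp: p0 s\<psi>)
    finally show ?thesis by simp
  qed
  have "complex_of_real (sqnorm M D) = 0"
    unfolding sqnorm_eq_inner split[OF sD] Y0 I0 conj0[OF represents_forcing[OF ft]] by simp
  then have "AE \<omega> in M. D \<omega> = 0" by (intro sqnorm_eq_0[OF sD]) simp
  then show ?thesis by eventually_elim (simp add: D_def Y_def I_def \<Phi>_def algebra_simps)
qed

text \<open>The null set on which \<open>u 0 x\<close> fails to vanish depends on \<open>x\<close>,
  so paths are not examined; instead the second moment of the pairing is computed by exchanging
  integrals.\<close>

lemma initial_pairing:
  assumes u: "bounded_field u" and z: "\<And>x. AE \<omega> in M. u 0 x \<omega> = 0" and \<phi>: "schwartz \<phi>"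
  shows "AE \<omega> in M. field_pairing u \<phi> 0 \<omega> = 0"
proof -
  have s: "square_integrable M (field_pairing u \<phi> 0)" by (rule field_pairing_average(1)[OF u _ \<phi>]) simp
  have "(\<integral>\<omega>. u 0 x \<omega> * cnj (field_pairing u \<phi> 0 \<omega>) \<partial>M) = 0" for x
    by (rule integral_eq_zero_AE) (use z[of x] in \<open>eventually_elim, simp\<close>)
  then have "complex_of_real (sqnorm M (field_pairing u \<phi> 0)) = 0"
    unfolding sqnorm_eq_inner field_pairing_average(2)[OF u order_refl \<phi> s] by simp
  then show ?thesis by (intro sqnorm_eq_0[OF s]) simp
qed

lemma solution_from_zero_bounded_field:
  assumes "solution_from_zero M f c g H u" shows "bounded_field u"
proof -
  have m: "(\<lambda>(t, x, \<omega>). u t x \<omega>) \<in> borel_measurable (borel \<Otimes>\<^sub>M (borel \<Otimes>\<^sub>M M))"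
    using assms unfolding solution_from_zero_def by blast
  have "u t x \<in> borel_measurable M" for t x
  proof -
    have "(\<lambda>\<omega>. (t, x, \<omega>)) \<in> measurable M (borel \<Otimes>\<^sub>M (borel \<Otimes>\<^sub>M M))" by measurable
    from measurable_compose[OF this m] show ?thesis by simp
  qed
  then show ?thesis using assms unfolding bounded_field_def solution_from_zero_def square_integrable_def sqnorm_def by blast
qed

lemma solves_evolution_iff:
  "solves_evolution M f c g H u \<longleftrightarrow> (\<forall>\<zeta> t. schwartz \<zeta> \<and> t \<ge> 0 \<longrightarrow>
     (AE \<omega> in M. field_pairing u (fourier_inv \<zeta>) t \<omega> = field_pairing u (fourier_inv \<zeta>) 0 \<omega>
       + (LINT s:{0..t}|lborel. field_pairing u (fourier_inv (dual_op \<zeta>)) s \<omega>)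
       + f (\<lambda>s x. indicator {0..t} s * cnj (fourier_inv \<zeta> x)) \<omega>))"
  unfolding solves_evolution_def adjoint_pair_iff field_pairing_def by blast

lemma solution_solves: "solution_from_zero M f c g H solution"
  unfolding solution_from_zero_def
proof (intro conjI allI impI)
  show "solves_evolution M f c g H solution"
    unfolding solves_evolution_iff
  proof (intro allI impI)
    fix \<zeta> :: "real \<Rightarrow> complex" and t :: real assume h: "schwartz \<zeta> \<and> t \<ge> 0"
    have "AE \<omega> in M. field_pairing solution (fourier_inv \<zeta>) 0 \<omega> = 0"
      using h by (intro initial_pairing solution_bounded_field solution_initial schwartz_fourier_inv) auto
    moreover have "AE \<omega> in M. field_pairing solution (fourier_inv \<zeta>) t \<omega> =
      (LINT s:{0..t}|lborel. field_pairing solution (fourier_inv (dual_op \<zeta>)) s \<omega>)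
       + f (\<lambda>s x. indicator {0..t} s * cnj (fourier_inv \<zeta> x)) \<omega>"
      using h by (intro solution_equation) auto
    ultimately show "AE \<omega> in M. field_pairing solution (fourier_inv \<zeta>) t \<omega> = field_pairing solution (fourier_inv \<zeta>) 0 \<omega>
       + (LINT s:{0..t}|lborel. field_pairing solution (fourier_inv (dual_op \<zeta>)) s \<omega>)
       + f (\<lambda>s x. indicator {0..t} s * cnj (fourier_inv \<zeta> x)) \<omega>"
      by eventually_elim simp
  qed
  show "AE \<omega> in M. solution 0 x \<omega> = 0" for x by (rule solution_initial)
  show "((\<lambda>y. \<integral>\<omega>. (cmod (solution t y \<omega> - solution t x \<omega>))\<^sup>2 \<partial>M) \<longlongrightarrow> 0) (at x)" if "0 \<le> t" for t x
    using solution_mean_square_continuous[OF that] unfolding sqnorm_def .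
  show "\<exists>K. \<forall>t\<in>{0..T}. \<forall>x. (\<integral>\<omega>. (cmod (solution t x \<omega>))\<^sup>2 \<partial>M) \<le> K" for T
    using solution_bounded_field unfolding bounded_field_def sqnorm_def by blast
  show "integrable M (\<lambda>\<omega>. (cmod (solution t x \<omega>))\<^sup>2)" if "0 \<le> t" for t x
    by (rule square_integrable_integrable[OF bounded_field_square_integrable[OF solution_bounded_field that]])
qed (rule solution_measurable)

end

section \<open>Uniqueness\<close>

text \<open>Uniformity in the shift \<open>r\<close> is the point: it gives integrable majorants for
  families of test functions transported over a bounded time.\<close>

lemma shift_product_bound:
  assumes w: "slow_growth w" and \<theta>: "rapid_decay \<theta>" and R: "R \<ge> 0"
  obtains K where "K \<ge> 0" "\<And>r k. \<bar>r\<bar> \<le> R \<Longrightarrow> cmod (w k * \<theta> (k + r)) \<le> K / (1 + k\<^sup>2)"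
proof -
  obtain C m where C: "C \<ge> 0" "\<And>x. cmod (w x) \<le> C * (1 + \<bar>x\<bar>) ^ m" by (rule slow_growthE[OF w]) blast
  obtain K where K: "\<And>x. cmod (\<theta> x) * (1 + \<bar>x\<bar>) ^ (m + 2) \<le> K" using \<theta> unfolding rapid_decay_def by blast
  have K0: "K \<ge> 0" using order_trans[OF mult_nonneg_nonneg[OF norm_ge_zero] K[of 0]] by simp
  show ?thesis
  proof (rule that[of "C * (1 + R) ^ (m + 2) * K"])
    show "0 \<le> C * (1 + R) ^ (m + 2) * K" using C(1) K0 R by simp
    fix r k :: real assume r: "\<bar>r\<bar> \<le> R"
    have "cmod (w k * \<theta> (k + r)) * (1 + k\<^sup>2) \<le> (C * (1 + \<bar>k\<bar>) ^ m * cmod (\<theta> (k + r))) * (1 + \<bar>k\<bar>)\<^sup>2"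
      unfolding norm_mult using C by (intro mult_mono mult_right_mono) (auto simp: power2_eq_square algebra_simps)
    also have "\<dots> = C * cmod (\<theta> (k + r)) * (1 + \<bar>k\<bar>) ^ (m + 2)" by (simp add: power_add power2_eq_square mult_ac)
    also have "\<dots> \<le> C * cmod (\<theta> (k + r)) * ((1 + R) * (1 + \<bar>k + r\<bar>)) ^ (m + 2)"
      using C(1) one_plus_shift_le[OF r, of k] by (intro mult_left_mono power_mono) auto
    also have "\<dots> = (C * (1 + R) ^ (m + 2)) * (cmod (\<theta> (k + r)) * (1 + \<bar>k + r\<bar>) ^ (m + 2))"
      by (simp only: power_mult_distrib mult_ac)
    also have "\<dots> \<le> (C * (1 + R) ^ (m + 2)) * K" using C(1) R K by (intro mult_left_mono) auto
    finally show "cmod (w k * \<theta> (k + r)) \<le> C * (1 + R) ^ (m + 2) * K / (1 + k\<^sup>2)"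
      by (simp add: pos_le_divide_eq add_pos_nonneg)
  qed
qed

text \<open>Two derivatives of \<open>\<alpha>\<close> buy the factor \<open>x\<^sup>2\<close>. The
  bound is explicit in integral norms of \<open>\<alpha>\<close> so that decay can be made uniform
  in a parameter.\<close>

lemma fourier_decay:
  assumes "schwartz \<alpha>"
  shows "cmod (fourier \<alpha> x) * (1 + x\<^sup>2) \<le> (LINT k|lborel. cmod (\<alpha> k)) + (LINT k|lborel. cmod (vderiv (vderiv \<alpha>) k))"
proof -
  have s1: "schwartz (vderiv \<alpha>)" and s2: "schwartz (vderiv (vderiv \<alpha>))" by (intro schwartz_vderiv assms)+
  have "fourier (vderiv (vderiv \<alpha>)) x = (2 * pi * \<i> * x) * ((2 * pi * \<i> * x) * fourier \<alpha> x)"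
    unfolding fourier_vderiv[OF s1] fourier_vderiv[OF assms] ..
  then have "cmod (fourier (vderiv (vderiv \<alpha>)) x) = (2 * pi * \<bar>x\<bar>) * ((2 * pi * \<bar>x\<bar>) * cmod (fourier \<alpha> x))"
    by (simp add: norm_mult)
  also have "\<dots> = (2 * pi)\<^sup>2 * (x\<^sup>2 * cmod (fourier \<alpha> x))"
    by (simp add: power2_eq_square mult_ac abs_mult_self_eq[symmetric, of x] del: abs_mult_self_eq)
  finally have e: "cmod (fourier (vderiv (vderiv \<alpha>)) x) = (2 * pi)\<^sup>2 * (x\<^sup>2 * cmod (fourier \<alpha> x))" .
  have "1 \<le> (2 * pi)\<^sup>2" using pi_gt3 by (intro one_le_power) simp
  then have "1 * (x\<^sup>2 * cmod (fourier \<alpha> x)) \<le> (2 * pi)\<^sup>2 * (x\<^sup>2 * cmod (fourier \<alpha> x))" by (intro mult_right_mono) auto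
  then have "x\<^sup>2 * cmod (fourier \<alpha> x) \<le> (LINT k|lborel. cmod (vderiv (vderiv \<alpha>) k))"
    using fourier_norm_le[OF schwartz_integrable[OF s2], of x] unfolding e by linarith
  then show ?thesis using fourier_norm_le[OF schwartz_integrable[OF assms], of x] by (simp add: algebra_simps)
qed

lemma integral_norm_bound_integral':
  fixes f :: "'a \<Rightarrow> complex"
  assumes "integrable M h" "\<And>x. cmod (f x) \<le> h x"
  shows "cmod (integral\<^sup>L M f) \<le> integral\<^sup>L M h"
proof (cases "integrable M f")
  case True
  then have "(LINT x|M. cmod (f x)) \<le> integral\<^sup>L M h" using assms by (intro integral_mono) auto
  then show ?thesis using integral_norm_bound[of M f] by linarith
next
  case False
  have "0 \<le> integral\<^sup>L M h" using assms(2) order_trans[OF norm_ge_zero] by (intro integral_nonneg_AE AE_I2) blast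
  then show ?thesis using False by (simp add: not_integrable_integral_eq)
qed

lemma vderiv_shift:
  assumes "schwartz (\<theta> :: real \<Rightarrow> complex)"
  shows "((\<lambda>k. \<theta> (k + r)) has_vector_derivative vderiv \<theta> (k + r)) (at k)"
proof -
  have "((\<theta> \<circ> (\<lambda>k. k + r)) has_vector_derivative (1 *\<^sub>R vderiv \<theta> (k + r))) (at k)"
    by (rule vector_diff_chain_at) (auto intro!: derivative_eq_intros schwartz_vderiv[OF assms])
  then show ?thesis by (simp add: o_def)
qed

section \<open>Test functions transported along characteristics\<close>

context regularization
begin

text \<open>The test function whose conjugated transform is \<open>\<theta>\<close> translated by
  \<open>r\<close>; letting \<open>r = c * (T - s)\<close> vary moves it along the characteristics
  that end at time \<open>T\<close>.\<close>

definition shifted :: "(real \<Rightarrow> complex) \<Rightarrow> real \<Rightarrow> real \<Rightarrow> complex" where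
  "shifted \<theta> r = fourier_inv (\<lambda>k. gpow (H + 1/2) k * \<theta> (k + r))"

lemma schwartz_shifted_symbol: "schwartz \<theta> \<Longrightarrow> schwartz (\<lambda>k. gpow b k * \<theta> (k + r))"
  by (intro schwartz_gpow schwartz_shift)

text \<open>Decay uniform in \<open>r\<close> follows from uniform integral bounds on the symbol and
  on its second derivative, which Leibniz splits into products of a derivative of the weight and a
  shifted derivative of \<open>\<theta>\<close>.\<close>

lemma shifted_bound:
  assumes \<theta>: "schwartz \<theta>" and R: "R \<ge> 0"
  obtains K where "K \<ge> 0" "\<And>r x. \<bar>r\<bar> \<le> R \<Longrightarrow> cmod (shifted \<theta> r x) \<le> K / (1 + x\<^sup>2)"
proof -
  define w where "w = gpow (H + 1/2)"
  have mw: "multiplier w" "multiplier (vderiv w)" "multiplier (vderiv (vderiv w))"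
    unfolding w_def by (intro multiplier_vderiv multiplier_gpow)+
  have s\<theta>: "schwartz (vderiv \<theta>)" "schwartz (vderiv (vderiv \<theta>))" by (intro schwartz_vderiv \<theta>)+
  obtain K0 where K0: "K0 \<ge> 0" "\<And>r k. \<bar>r\<bar> \<le> R \<Longrightarrow> cmod (w k * \<theta> (k + r)) \<le> K0 / (1 + k\<^sup>2)"
    by (rule shift_product_bound[OF multiplier_slow[OF mw(1)] schwartz_rapid[OF \<theta>] R]) blast
  obtain K1 where K1: "K1 \<ge> 0" "\<And>r k. \<bar>r\<bar> \<le> R \<Longrightarrow> cmod (w k * vderiv (vderiv \<theta>) (k + r)) \<le> K1 / (1 + k\<^sup>2)"
    by (rule shift_product_bound[OF multiplier_slow[OF mw(1)] schwartz_rapid[OF s\<theta>(2)] R]) blast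
  obtain K2 where K2: "K2 \<ge> 0" "\<And>r k. \<bar>r\<bar> \<le> R \<Longrightarrow> cmod (vderiv w k * vderiv \<theta> (k + r)) \<le> K2 / (1 + k\<^sup>2)"
    by (rule shift_product_bound[OF multiplier_slow[OF mw(2)] schwartz_rapid[OF s\<theta>(1)] R]) blast
  obtain K3 where K3: "K3 \<ge> 0" "\<And>r k. \<bar>r\<bar> \<le> R \<Longrightarrow> cmod (vderiv (vderiv w) k * \<theta> (k + r)) \<le> K3 / (1 + k\<^sup>2)"
    by (rule shift_product_bound[OF multiplier_slow[OF mw(3)] schwartz_rapid[OF \<theta>] R]) blast
  define P where "P = (LINT k::real|lborel. 1 / (1 + k\<^sup>2))"
  have P: "P \<ge> 0" unfolding P_def by (intro integral_nonneg_AE AE_I2) (simp add: add_nonneg_nonneg)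
  define K where "K = (K0 + (K1 + 2 * K2 + K3)) * P"
  have int: "integrable lborel (\<lambda>k::real. C * (1 / (1 + k\<^sup>2)))" for C by (intro integrable_mult_right integrable_inverse_square)
  have "cmod (shifted \<theta> r x) \<le> K / (1 + x\<^sup>2)" if r: "\<bar>r\<bar> \<le> R" for r x
  proof -
    define \<alpha> where "\<alpha> = (\<lambda>k. w k * \<theta> (k + r))"
    have s\<alpha>: "schwartz \<alpha>" unfolding \<alpha>_def w_def by (rule schwartz_shifted_symbol[OF \<theta>])
    have d1: "vderiv \<alpha> = (\<lambda>k. w k * vderiv \<theta> (k + r) + vderiv w k * \<theta> (k + r))"
      unfolding \<alpha>_def by (intro ext vderiv_mult multiplier_vderiv(2)[OF mw(1)] vderiv_shift \<theta>)
    have d2: "vderiv (vderiv \<alpha>) k = (w k * vderiv (vderiv \<theta>) (k + r) + vderiv w k * vderiv \<theta> (k + r))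
        + (vderiv w k * vderiv \<theta> (k + r) + vderiv (vderiv w) k * \<theta> (k + r))" for k
      unfolding d1
      by (intro vector_derivative_at has_vector_derivative_add has_vector_derivative_mult
          multiplier_vderiv(2)[OF mw(1)] multiplier_vderiv(2)[OF mw(2)] vderiv_shift s\<theta> \<theta>)
    have b2: "cmod (vderiv (vderiv \<alpha>) k) \<le> (K1 + 2 * K2 + K3) * (1 / (1 + k\<^sup>2))" for k
    proof -
      have "cmod (vderiv (vderiv \<alpha>) k) \<le> K1 / (1 + k\<^sup>2) + K2 / (1 + k\<^sup>2) + (K2 / (1 + k\<^sup>2) + K3 / (1 + k\<^sup>2))"
        unfolding d2 by (intro norm_triangle_le add_mono K1(2) K2(2) K3(2) r)
      then show ?thesis by (simp add: add_divide_distrib)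
    qed
    have "(LINT k|lborel. cmod (\<alpha> k)) \<le> (LINT k|lborel. K0 * (1 / (1 + k\<^sup>2)))"
      using K0(2)[OF r] by (intro integral_mono integrable_norm schwartz_integrable s\<alpha> int) (simp add: \<alpha>_def)
    moreover have "(LINT k|lborel. cmod (vderiv (vderiv \<alpha>) k)) \<le> (LINT k|lborel. (K1 + 2 * K2 + K3) * (1 / (1 + k\<^sup>2)))"
      by (intro integral_mono integrable_norm schwartz_integrable schwartz_vderiv s\<alpha> int b2)
    moreover have "cmod (shifted \<theta> r x) * (1 + x\<^sup>2) \<le> (LINT k|lborel. cmod (\<alpha> k)) + (LINT k|lborel. cmod (vderiv (vderiv \<alpha>) k))"
      using fourier_decay[OF s\<alpha>, of "- x"] unfolding shifted_def \<alpha>_def w_def fourier_inv_eq by simp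
    ultimately have "cmod (shifted \<theta> r x) * (1 + x\<^sup>2) \<le> (LINT k::real|lborel. K0 * (1 / (1 + k\<^sup>2))) + (LINT k::real|lborel. (K1 + 2 * K2 + K3) * (1 / (1 + k\<^sup>2)))"
      by linarith
    also have "\<dots> = K" unfolding integral_mult_right_zero P_def[symmetric] K_def by (simp only: distrib_right)
    finally show ?thesis by (simp add: pos_le_divide_eq add_pos_nonneg)
  qed
  moreover have "K \<ge> 0" unfolding K_def using K0(1) K1(1) K2(1) K3(1) P by simp
  ultimately show ?thesis using that by blast
qed

lemma shifted_measurable:
  assumes "schwartz \<theta>" shows "(\<lambda>w. shifted \<theta> (fst w) (snd w)) \<in> borel_measurable (borel \<Otimes>\<^sub>M borel)"
proof -
  have [measurable]: "\<theta> \<in> borel_measurable borel" by (rule schwartz_measurable[OF assms])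
  show ?thesis unfolding shifted_def fourier_inv_def
    by (rule lborel.borel_measurable_lebesgue_integral) (simp add: case_prod_unfold, measurable)
qed

text \<open>The derivative in \<open>r\<close> falls on \<open>\<theta>\<close>, here in integrated
  form: the fundamental theorem is applied for each wavenumber and the integrals are exchanged, so
  no differentiability in function spaces enters.\<close>

lemma shifted_FTC:
  assumes \<theta>: "schwartz \<theta>" and st: "\<sigma> \<le> T"
  shows "(LINT s|lborel. indicator {\<sigma>..T} s *\<^sub>R (of_real c * shifted (vderiv \<theta>) (c * (T - s)) x))
    = shifted \<theta> (c * (T - \<sigma>)) x - shifted \<theta> 0 x"
proof -
  define w where "w = gpow (H + 1/2)"
  have [measurable]: "w \<in> borel_measurable borel" unfolding w_def by measurable
  have s\<theta>: "schwartz (vderiv \<theta>)" by (rule schwartz_vderiv[OF \<theta>])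
  have [measurable]: "vderiv \<theta> \<in> borel_measurable borel" by (rule schwartz_measurable[OF s\<theta>])
  define R where "R = \<bar>c\<bar> * (T - \<sigma>)"
  have R: "R \<ge> 0" using st by (simp add: R_def)
  obtain K where K: "K \<ge> 0" "\<And>r k. \<bar>r\<bar> \<le> R \<Longrightarrow> cmod (w k * vderiv \<theta> (k + r)) \<le> K / (1 + k\<^sup>2)"
    unfolding w_def by (rule shift_product_bound[OF gpow_slow schwartz_rapid[OF s\<theta>] R]) blast
  let ?G = "\<lambda>s k. cis (2 * pi * k * x) * (indicator {\<sigma>..T} s * (of_real c * (w k * vderiv \<theta> (k + c * (T - s)))))"
  have i: "integrable (lborel \<Otimes>\<^sub>M lborel) (\<lambda>(s, k). ?G s k)"
  proof (rule Bochner_Integration.integrable_bound)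
    show "integrable (lborel \<Otimes>\<^sub>M lborel) (\<lambda>(s::real, k::real). indicator {\<sigma>..T} s * complex_of_real (\<bar>c\<bar> * K * (1 / (1 + k\<^sup>2))))"
      by (intro lborel_pair.integrable_product_mult integrable_indicator_interval integrable_of_real integrable_mult_right integrable_inverse_square)
    show "(\<lambda>(s, k). ?G s k) \<in> borel_measurable (lborel \<Otimes>\<^sub>M lborel)"
    proof -
      have "(\<lambda>w'. cis (2 * pi * snd w' * x) * (indicator {\<sigma>..T} (fst w') * (of_real c * (w (snd w') * vderiv \<theta> (snd w' + c * (T - fst w'))))))
         \<in> borel_measurable (borel \<Otimes>\<^sub>M borel)" by measurable
      then show ?thesis by (simp add: case_prod_unfold)
    qed
    have "norm (?G s k) \<le> norm (indicator {\<sigma>..T} s * complex_of_real (\<bar>c\<bar> * K * (1 / (1 + k\<^sup>2))))" for s k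
    proof (cases "s \<in> {\<sigma>..T}")
      case True
      have "\<bar>c * (T - s)\<bar> \<le> R" using True unfolding R_def abs_mult by (intro mult_left_mono) auto
      from mult_left_mono[OF K(2)[OF this, of k] abs_ge_zero[of c]]
      have 1: "norm (?G s k) \<le> \<bar>c\<bar> * (K / (1 + k\<^sup>2))" using True by (simp add: norm_mult)
      define z where "z = \<bar>c\<bar> * K * (1 / (1 + k\<^sup>2))"
      have "z \<ge> 0" using K(1) by (simp add: z_def add_nonneg_nonneg)
      then have "norm (indicator {\<sigma>..T} s * complex_of_real z) = z" using True by (simp add: norm_mult)
      then show ?thesis using 1 unfolding z_def by simp
    qed simp
    then show "AE w' in lborel \<Otimes>\<^sub>M lborel. norm (case w' of (s, k) \<Rightarrow> ?G s k)
      \<le> norm (case w' of (s, k) \<Rightarrow> indicator {\<sigma>..T} s * complex_of_real (\<bar>c\<bar> * K * (1 / (1 + k\<^sup>2))))"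
      by (intro AE_I2) (simp add: case_prod_unfold)
  qed
  have inner: "(LINT s|lborel. ?G s k) = cis (2 * pi * k * x) * (w k * \<theta> (k + c * (T - \<sigma>))) - cis (2 * pi * k * x) * (w k * \<theta> (k + 0))" for k
  proof -
    let ?f = "\<lambda>s. of_real c * vderiv \<theta> (k + c * (T - s))"
    have d: "((\<lambda>s. - \<theta> (k + c * (T - s))) has_vector_derivative ?f s) (at s within {\<sigma>..T})" for s
    proof -
      have "((\<theta> \<circ> (\<lambda>s. k + c * (T - s))) has_vector_derivative ((- c) *\<^sub>R vderiv \<theta> (k + c * (T - s)))) (at s)"
        by (rule vector_diff_chain_at) (auto intro!: derivative_eq_intros schwartz_vderiv[OF \<theta>])
      then have "((\<lambda>s. - \<theta> (k + c * (T - s))) has_vector_derivative - ((- c) *\<^sub>R vderiv \<theta> (k + c * (T - s)))) (at s)"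
        unfolding o_def by (rule has_vector_derivative_minus)
      moreover have "- ((- c) *\<^sub>R v) = of_real c * v" for v :: complex by (simp add: scaleR_conv_of_real)
      ultimately have "((\<lambda>s. - \<theta> (k + c * (T - s))) has_vector_derivative ?f s) (at s)" by (simp only:)
      then show ?thesis by (rule has_vector_derivative_at_within)
    qed
    have "continuous_on {\<sigma>..T} (\<lambda>s. vderiv \<theta> (k + c * (T - s)))"
    proof (rule continuous_on_compose2[OF schwartz_continuous[OF s\<theta>]])
      show "continuous_on {\<sigma>..T} (\<lambda>s. k + c * (T - s))" by (intro continuous_intros)
    qed simp
    then have cont: "continuous_on {\<sigma>..T} ?f" by (intro continuous_on_mult continuous_on_const)
    have "(LINT s|lborel. ?G s k) = (LINT s|lborel. (cis (2 * pi * k * x) * w k) * (indicator {\<sigma>..T} s *\<^sub>R ?f s))"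
      by (intro Bochner_Integration.integral_cong refl) (auto simp: indicator_def)
    also have "\<dots> = (cis (2 * pi * k * x) * w k) * (LINT s|lborel. indicator {\<sigma>..T} s *\<^sub>R ?f s)" by (rule integral_mult_right_zero)
    also have "(LINT s|lborel. indicator {\<sigma>..T} s *\<^sub>R ?f s) = - \<theta> (k + c * (T - T)) - - \<theta> (k + c * (T - \<sigma>))"
      by (rule integral_FTC_atLeastAtMost[OF st d cont])
    finally show ?thesis by (simp add: algebra_simps)
  qed
  have ic: "integrable lborel (\<lambda>k. cis (2 * pi * k * x) * (w k * \<theta> (k + r)))" for r
    unfolding w_def by (intro integrable_cis_mult schwartz_integrable schwartz_shifted_symbol \<theta>) measurable
  have "(LINT s|lborel. indicator {\<sigma>..T} s *\<^sub>R (of_real c * shifted (vderiv \<theta>) (c * (T - s)) x)) = (LINT s|lborel. LINT k|lborel. ?G s k)"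
  proof (rule Bochner_Integration.integral_cong[OF refl])
    fix s
    have "(LINT k|lborel. ?G s k) = (LINT k|lborel. (indicator {\<sigma>..T} s * of_real c) * (cis (2 * pi * k * x) * (w k * vderiv \<theta> (k + c * (T - s)))))"
      by (intro Bochner_Integration.integral_cong refl) (simp only: mult_ac)
    also have "\<dots> = (indicator {\<sigma>..T} s * of_real c) * shifted (vderiv \<theta>) (c * (T - s)) x"
      unfolding shifted_def fourier_inv_def w_def by (rule integral_mult_right_zero)
    finally show "indicator {\<sigma>..T} s *\<^sub>R (of_real c * shifted (vderiv \<theta>) (c * (T - s)) x) = (LINT k|lborel. ?G s k)"
      by (simp add: indicator_def)
  qed
  also have "\<dots> = (LINT k|lborel. LINT s|lborel. ?G s k)" by (rule lborel_pair.Fubini_integral[OF i, symmetric])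
  also have "\<dots> = shifted \<theta> (c * (T - \<sigma>)) x - shifted \<theta> 0 x"
    unfolding inner shifted_def fourier_inv_def w_def[symmetric] by (rule Bochner_Integration.integral_diff[OF ic ic])
  finally show ?thesis .
qed

text \<open>The weight cancels under conjugation and differentiation commutes with the shift, so the
  family of transported test functions is stable under the dual operator: \<open>\<theta>\<close> is
  replaced by \<open>c\<close> times its derivative.\<close>

lemma dual_op_shifted:
  assumes "schwartz \<theta>"
  shows "dual_op (\<lambda>k. gpow (H + 1/2) k * \<theta> (k + r)) = (\<lambda>k. of_real c * (gpow (H + 1/2) k * vderiv \<theta> (k + r)))"
proof
  fix k
  have s: "schwartz (\<lambda>k. gpow (H + 1/2) k * \<theta> (k + r))" by (rule schwartz_shifted_symbol[OF assms])
  have "gpow (- (H + 1/2)) j * (gpow (H + 1/2) j * \<theta> (j + r)) = \<theta> (j + r)" for j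
  proof -
    have "gpow (- (H + 1/2)) j * gpow (H + 1/2) j = 1"
      using gpow_inverse[of "- (H + 1/2)" j] unfolding minus_minus .
    then show ?thesis unfolding mult.assoc[symmetric] by simp
  qed
  then have e: "(\<lambda>j. gpow (- (H + 1/2)) j * (gpow (H + 1/2) j * \<theta> (j + r))) = (\<lambda>j. \<theta> (j + r))" by blast
  have "vderiv (\<lambda>j. gpow (- (H + 1/2)) j * (gpow (H + 1/2) j * \<theta> (j + r))) k = vderiv \<theta> (k + r)"
    unfolding e by (rule vector_derivative_at[OF vderiv_shift[OF assms]])
  then show "dual_op (\<lambda>k. gpow (H + 1/2) k * \<theta> (k + r)) k = of_real c * (gpow (H + 1/2) k * vderiv \<theta> (k + r))"
    unfolding dual_op_eq[OF s] by (simp only: mult.assoc)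
qed

text \<open>Along characteristics the test function is transported, and the weak equation for \<open>m\<close>
  integrated against the transported test function is a telescoping identity.\<close>

lemma transport_uniqueness:
  fixes m :: "real \<Rightarrow> real \<Rightarrow> complex"
  assumes mm: "(\<lambda>w. m (fst w) (snd w)) \<in> borel_measurable (borel \<Otimes>\<^sub>M borel)"
    and T: "T \<ge> 0" and B: "\<And>t x. 0 \<le> t \<Longrightarrow> t \<le> T \<Longrightarrow> cmod (m t x) \<le> B"
    and eq: "\<And>\<zeta> t. schwartz \<zeta> \<Longrightarrow> 0 \<le> t \<Longrightarrow> t \<le> T \<Longrightarrow> (LINT x|lborel. m t x * cnj (fourier_inv \<zeta> x))
       = (LINT s:{0..t}|lborel. LINT x|lborel. m s x * cnj (fourier_inv (dual_op \<zeta>) x))"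
    and \<phi>: "schwartz \<phi>"
  shows "(LINT x|lborel. m T x * cnj (\<phi> x)) = 0"
proof -
  have B0: "B \<ge> 0" using order_trans[OF norm_ge_zero B[OF order_refl T]] .
  note mm[measurable]
  \<comment> \<open>Chosen so that \<open>shifted \<theta> 0 = \<phi>\<close>.\<close>
  define \<theta> where "\<theta> = (\<lambda>k. gpow (- (H + 1/2)) k * fourier \<phi> k)"
  have s\<theta>: "schwartz \<theta>" unfolding \<theta>_def by (intro schwartz_gpow schwartz_fourier \<phi>)
  have s1: "schwartz (vderiv \<theta>)" and s2: "schwartz (vderiv (vderiv \<theta>))" by (intro schwartz_vderiv s\<theta>)+
  \<comment> \<open>The weak equation says that the time derivative of \<open>n t r \<psi>\<close>
    is \<open>c * n t r \<psi>'\<close>, while its derivative in \<open>r\<close> is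
    \<open>n t r \<psi>'\<close>; hence \<open>n t (c * (T - t)) \<psi>\<close> ought to be constant
    in \<open>t\<close>. The argument below is the integrated form of this, since no regularity of
    \<open>m\<close> in time is at hand.\<close>
  define n where "n t r \<psi> = (LINT x|lborel. m t x * cnj (shifted \<psi> r x))" for t r \<psi>
  have neq: "n t r \<psi> = of_real c * (LINT s|lborel. indicator {0..t} s * n s r (vderiv \<psi>))"
    if "schwartz \<psi>" "0 \<le> t" "t \<le> T" for t r \<psi>
  proof -
    have e: "fourier_inv (dual_op (\<lambda>k. gpow (H + 1/2) k * \<psi> (k + r))) x = of_real c * shifted (vderiv \<psi>) r x" for x
      unfolding dual_op_shifted[OF that(1)] shifted_def fourier_inv_eq by (rule fourier_scale)
    have "n t r \<psi> = (LINT s:{0..t}|lborel. LINT x|lborel. m s x * cnj (of_real c * shifted (vderiv \<psi>) r x))"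
      unfolding n_def using eq[OF schwartz_shifted_symbol[OF that(1), of "H + 1/2" r] that(2,3)] unfolding e shifted_def .
    also have "\<dots> = (LINT s:{0..t}|lborel. of_real c * n s r (vderiv \<psi>))"
    proof -
      have "(LINT x|lborel. m s x * cnj (of_real c * shifted (vderiv \<psi>) r x)) = of_real c * n s r (vderiv \<psi>)" for s
        unfolding n_def integral_mult_right_zero[symmetric]
        by (intro Bochner_Integration.integral_cong refl) simp
      then show ?thesis by (simp only:)
    qed
    also have "\<dots> = of_real c * (LINT s:{0..t}|lborel. n s r (vderiv \<psi>))" by (rule set_integral_mult_right)
    also have "(LINT s:{0..t}|lborel. n s r (vderiv \<psi>)) = (LINT s|lborel. indicator {0..t} s * n s r (vderiv \<psi>))"
      unfolding set_integral_as_weight by (simp only: mult.commute)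
    finally show ?thesis .
  qed
  define R where "R = \<bar>c\<bar> * T"
  have R: "R \<ge> 0" using T by (simp add: R_def)
  have rR: "\<bar>c * (T - s)\<bar> \<le> R" if "0 \<le> s" "s \<le> T" for s
    using that unfolding R_def abs_mult by (intro mult_left_mono) auto
  have nm: "(\<lambda>w. n (fst w) (c * (T - snd w)) \<psi>) \<in> borel_measurable (borel \<Otimes>\<^sub>M borel)" if ps: "schwartz \<psi>" for \<psi>
  proof -
    have "(\<lambda>w. (c * (T - snd (fst w)), snd w)) \<in> measurable ((borel \<Otimes>\<^sub>M borel) \<Otimes>\<^sub>M borel) (borel \<Otimes>\<^sub>M borel)" by measurable
    from measurable_compose[OF this shifted_measurable[OF that]]
    have [measurable]: "(\<lambda>w::(real \<times> real) \<times> real. shifted \<psi> (c * (T - snd (fst w))) (snd w)) \<in> borel_measurable ((borel \<Otimes>\<^sub>M borel) \<Otimes>\<^sub>M borel)" by simp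
    have "(\<lambda>w. (fst (fst w), snd w)) \<in> measurable ((borel \<Otimes>\<^sub>M borel) \<Otimes>\<^sub>M borel) (borel \<Otimes>\<^sub>M borel)" by measurable
    from measurable_compose[OF this mm]
    have [measurable]: "(\<lambda>w::(real \<times> real) \<times> real. m (fst (fst w)) (snd w)) \<in> borel_measurable ((borel \<Otimes>\<^sub>M borel) \<Otimes>\<^sub>M borel)" by simp
    show ?thesis unfolding n_def
      by (rule lborel.borel_measurable_lebesgue_integral) (simp add: case_prod_unfold, measurable)
  qed
  have nB: "\<exists>C\<ge>0. \<forall>s r. 0 \<le> s \<longrightarrow> s \<le> T \<longrightarrow> \<bar>r\<bar> \<le> R \<longrightarrow> cmod (n s r \<psi>) \<le> C" if ps: "schwartz \<psi>" for \<psi>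
  proof -
    obtain K where K: "K \<ge> 0" "\<And>r x. \<bar>r\<bar> \<le> R \<Longrightarrow> cmod (shifted \<psi> r x) \<le> K / (1 + x\<^sup>2)"
      by (rule shifted_bound[OF ps R]) blast
    have ig: "integrable lborel (\<lambda>x::real. B * K * (1 / (1 + x\<^sup>2)))" by (intro integrable_mult_right integrable_inverse_square)
    have "cmod (n s r \<psi>) \<le> (LINT x::real|lborel. B * K * (1 / (1 + x\<^sup>2)))" if h: "0 \<le> s" "s \<le> T" "\<bar>r\<bar> \<le> R" for s r
    proof -
      have "cmod (m s x * cnj (shifted \<psi> r x)) \<le> B * K * (1 / (1 + x\<^sup>2))" for x
      proof -
        have "cmod (m s x * cnj (shifted \<psi> r x)) \<le> B * (K / (1 + x\<^sup>2))"
          unfolding norm_mult complex_mod_cnj using B[OF h(1,2)] K(2)[OF h(3)] B0 by (intro mult_mono) auto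
        then show ?thesis by simp
      qed
      then show ?thesis unfolding n_def by (intro integral_norm_bound_integral' ig)
    qed
    moreover have "0 \<le> (LINT x::real|lborel. B * K * (1 / (1 + x\<^sup>2)))"
      using B0 K(1) by (intro integral_nonneg_AE AE_I2 mult_nonneg_nonneg) (auto simp: add_nonneg_nonneg)
    ultimately show ?thesis by blast
  qed
  have ftc: "(LINT s|lborel. indicator {\<sigma>..T} s * (of_real c * n \<sigma> (c * (T - s)) (vderiv \<psi>))) = n \<sigma> (c * (T - \<sigma>)) \<psi> - n \<sigma> 0 \<psi>"
    if \<psi>: "schwartz \<psi>" and \<sigma>: "0 \<le> \<sigma>" "\<sigma> \<le> T" for \<sigma> \<psi>
  proof -
    have s\<psi>: "schwartz (vderiv \<psi>)" by (rule schwartz_vderiv[OF \<psi>])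
    obtain K where K: "K \<ge> 0" "\<And>r x. \<bar>r\<bar> \<le> R \<Longrightarrow> cmod (shifted (vderiv \<psi>) r x) \<le> K / (1 + x\<^sup>2)"
      by (rule shifted_bound[OF s\<psi> R]) blast
    let ?G = "\<lambda>s x. m \<sigma> x * cnj (indicator {\<sigma>..T} s *\<^sub>R (of_real c * shifted (vderiv \<psi>) (c * (T - s)) x))"
    have m\<sigma>[measurable]: "m \<sigma> \<in> borel_measurable borel"
      using measurable_compose[OF measurable_Pair1' mm, of \<sigma>] by simp
    have "(\<lambda>w. (c * (T - fst w), snd w)) \<in> measurable (borel \<Otimes>\<^sub>M borel) (borel \<Otimes>\<^sub>M borel)" by measurable
    from measurable_compose[OF this shifted_measurable[OF s\<psi>]]
    have [measurable]: "(\<lambda>w::real \<times> real. shifted (vderiv \<psi>) (c * (T - fst w)) (snd w)) \<in> borel_measurable (borel \<Otimes>\<^sub>M borel)" by simp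
    have i: "integrable (lborel \<Otimes>\<^sub>M lborel) (\<lambda>(s, x). ?G s x)"
    proof (rule Bochner_Integration.integrable_bound)
      show "integrable (lborel \<Otimes>\<^sub>M lborel) (\<lambda>(s::real, x::real). indicator {\<sigma>..T} s * complex_of_real (B * \<bar>c\<bar> * K * (1 / (1 + x\<^sup>2))))"
        by (intro lborel_pair.integrable_product_mult integrable_indicator_interval integrable_of_real integrable_mult_right integrable_inverse_square)
      have "(\<lambda>w. m \<sigma> (snd w) * cnj (indicator {\<sigma>..T} (fst w) *\<^sub>R (of_real c * shifted (vderiv \<psi>) (c * (T - fst w)) (snd w)))) \<in> borel_measurable (borel \<Otimes>\<^sub>M borel)"
        by measurable
      then show "(\<lambda>(s, x). ?G s x) \<in> borel_measurable (lborel \<Otimes>\<^sub>M lborel)" by (simp add: case_prod_unfold)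
      have "norm (?G s x) \<le> norm (indicator {\<sigma>..T} s * complex_of_real (B * \<bar>c\<bar> * K * (1 / (1 + x\<^sup>2))))" for s x
      proof (cases "s \<in> {\<sigma>..T}")
        case True
        have "cmod (m \<sigma> x) * (\<bar>c\<bar> * cmod (shifted (vderiv \<psi>) (c * (T - s)) x)) \<le> B * (\<bar>c\<bar> * (K / (1 + x\<^sup>2)))"
          using True \<sigma> B[OF \<sigma>] K(2)[OF rR, of s x] B0 by (intro mult_mono mult_left_mono) auto
        then have 1: "norm (?G s x) \<le> B * (\<bar>c\<bar> * (K / (1 + x\<^sup>2)))" using True by (simp add: norm_mult)
        define z where "z = B * \<bar>c\<bar> * K * (1 / (1 + x\<^sup>2))"
        have "z \<ge> 0" using B0 K(1) by (simp add: z_def add_nonneg_nonneg)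
        then have "norm (indicator {\<sigma>..T} s * complex_of_real z) = z" using True by (simp add: norm_mult)
        then show ?thesis using 1 unfolding z_def by (simp add: mult.assoc)
      qed simp
      then show "AE w in lborel \<Otimes>\<^sub>M lborel. norm (case w of (s, x) \<Rightarrow> ?G s x)
        \<le> norm (case w of (s, x) \<Rightarrow> indicator {\<sigma>..T} s * complex_of_real (B * \<bar>c\<bar> * K * (1 / (1 + x\<^sup>2))))"
        by (intro AE_I2) (simp only: case_prod_unfold)
    qed
    have "(LINT s|lborel. indicator {\<sigma>..T} s * (of_real c * n \<sigma> (c * (T - s)) (vderiv \<psi>))) = (LINT s|lborel. LINT x|lborel. ?G s x)"
    proof (rule Bochner_Integration.integral_cong[OF refl])
      fix s
      have "(LINT x|lborel. ?G s x) = (LINT x|lborel. (indicator {\<sigma>..T} s * of_real c) * (m \<sigma> x * cnj (shifted (vderiv \<psi>) (c * (T - s)) x)))"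
        by (intro Bochner_Integration.integral_cong refl) (simp add: indicator_def)
      also have "\<dots> = (indicator {\<sigma>..T} s * of_real c) * n \<sigma> (c * (T - s)) (vderiv \<psi>)"
        unfolding n_def by (rule integral_mult_right_zero)
      finally show "indicator {\<sigma>..T} s * (of_real c * n \<sigma> (c * (T - s)) (vderiv \<psi>)) = (LINT x|lborel. ?G s x)"
        by (simp only: mult.assoc)
    qed
    also have "\<dots> = (LINT x|lborel. LINT s|lborel. ?G s x)" by (rule lborel_pair.Fubini_integral[OF i, symmetric])
    also have "\<dots> = (LINT x|lborel. m \<sigma> x * cnj (shifted \<psi> (c * (T - \<sigma>)) x) - m \<sigma> x * cnj (shifted \<psi> 0 x))"
    proof (rule Bochner_Integration.integral_cong[OF refl])
      fix x
      have "(LINT s|lborel. ?G s x) = m \<sigma> x * cnj (LINT s|lborel. indicator {\<sigma>..T} s *\<^sub>R (of_real c * shifted (vderiv \<psi>) (c * (T - s)) x))"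
        by (simp only: integral_mult_right_zero Bochner_Integration.integral_cnj)
      then show "(LINT s|lborel. ?G s x) = m \<sigma> x * cnj (shifted \<psi> (c * (T - \<sigma>)) x) - m \<sigma> x * cnj (shifted \<psi> 0 x)"
        unfolding shifted_FTC[OF \<psi> \<sigma>(2)] by (simp add: right_diff_distrib)
    qed
    also have "\<dots> = n \<sigma> (c * (T - \<sigma>)) \<psi> - n \<sigma> 0 \<psi>"
    proof -
      have "integrable lborel (\<lambda>x. m \<sigma> x * cnj (shifted \<psi> r x))" for r
      proof (rule Bochner_Integration.integrable_bound)
        have ss: "schwartz (shifted \<psi> r)" unfolding shifted_def by (intro schwartz_fourier_inv schwartz_shifted_symbol \<psi>)
        show "integrable lborel (\<lambda>x. B * cmod (shifted \<psi> r x))" by (intro integrable_mult_right integrable_norm schwartz_integrable ss)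
        show "(\<lambda>x. m \<sigma> x * cnj (shifted \<psi> r x)) \<in> borel_measurable lborel" using schwartz_measurable[OF ss] by measurable
        show "AE x in lborel. norm (m \<sigma> x * cnj (shifted \<psi> r x)) \<le> norm (B * cmod (shifted \<psi> r x))"
          using B[OF \<sigma>] B0 by (auto simp: norm_mult intro!: AE_I2 mult_right_mono)
      qed
      then show ?thesis unfolding n_def by (intro Bochner_Integration.integral_diff)
    qed
    finally show ?thesis .
  qed
  \<comment> \<open>\<open>D\<close> is evaluated by inserting the equation for
    \<open>vderiv \<theta>\<close>, which brings in a second derivative, exchanging the two times
    and undoing one derivative in \<open>r\<close> with \<open>ftc\<close>.\<close>
  define D where "D = (LINT s|lborel. indicator {0..T} s * (of_real c * n s (c * (T - s)) (vderiv \<theta>)))"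
  obtain C1 where C1: "C1 \<ge> 0" "\<And>s r. 0 \<le> s \<Longrightarrow> s \<le> T \<Longrightarrow> \<bar>r\<bar> \<le> R \<Longrightarrow> cmod (n s r (vderiv \<theta>)) \<le> C1" using nB[OF s1] by blast
  obtain C2 where C2: "C2 \<ge> 0" "\<And>s r. 0 \<le> s \<Longrightarrow> s \<le> T \<Longrightarrow> \<bar>r\<bar> \<le> R \<Longrightarrow> cmod (n s r (vderiv (vderiv \<theta>))) \<le> C2" using nB[OF s2] by blast
  let ?G = "\<lambda>s \<sigma>. indicator {0..T} s * (of_real c * (of_real c * (indicator {0..s} \<sigma> * n \<sigma> (c * (T - s)) (vderiv (vderiv \<theta>)))))"
  have i: "integrable (lborel \<Otimes>\<^sub>M lborel) (\<lambda>(s, \<sigma>). ?G s \<sigma>)"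
  proof (rule Bochner_Integration.integrable_bound)
    show "integrable (lborel \<Otimes>\<^sub>M lborel) (\<lambda>(s::real, \<sigma>::real). indicator {0..T} s * (complex_of_real (c\<^sup>2 * C2) * indicator {0..T} \<sigma>))"
      by (intro lborel_pair.integrable_product_mult integrable_indicator_interval integrable_mult_right)
    have "(\<lambda>w. (snd w, fst w)) \<in> measurable (borel \<Otimes>\<^sub>M borel) (borel \<Otimes>\<^sub>M borel)" by measurable
    from measurable_compose[OF this nm[OF s2]]
    have [measurable]: "(\<lambda>w. n (snd w) (c * (T - fst w)) (vderiv (vderiv \<theta>))) \<in> borel_measurable (borel \<Otimes>\<^sub>M borel)" by simp
    have "(\<lambda>w. indicator {0..T} (fst w) * (of_real c * (of_real c * ((if 0 \<le> snd w \<and> snd w \<le> fst w then 1 else 0) * n (snd w) (c * (T - fst w)) (vderiv (vderiv \<theta>)))))) \<in> borel_measurable (borel \<Otimes>\<^sub>M borel)"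
      by measurable
    then show "(\<lambda>(s, \<sigma>). ?G s \<sigma>) \<in> borel_measurable (lborel \<Otimes>\<^sub>M lborel)" by (simp add: case_prod_unfold indicator_def)
    have "norm (?G s \<sigma>) \<le> norm (indicator {0..T} s * (complex_of_real (c\<^sup>2 * C2) * indicator {0..T} \<sigma>))" for s \<sigma>
    proof (cases "s \<in> {0..T} \<and> \<sigma> \<in> {0..s}")
      case True
      have "cmod (n \<sigma> (c * (T - s)) (vderiv (vderiv \<theta>))) \<le> C2" using True by (intro C2 rR) auto
      then have "c\<^sup>2 * cmod (n \<sigma> (c * (T - s)) (vderiv (vderiv \<theta>))) \<le> c\<^sup>2 * C2" by (intro mult_left_mono) auto
      then show ?thesis using True C2(1) by (simp add: norm_mult power2_eq_square mult.assoc[symmetric])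
    qed auto
    then show "AE w in lborel \<Otimes>\<^sub>M lborel. norm (case w of (s, \<sigma>) \<Rightarrow> ?G s \<sigma>)
      \<le> norm (case w of (s, \<sigma>) \<Rightarrow> indicator {0..T} s * (complex_of_real (c\<^sup>2 * C2) * indicator {0..T} \<sigma>))"
      by (intro AE_I2) (simp only: case_prod_unfold)
  qed
  have "D = (LINT s|lborel. LINT \<sigma>|lborel. ?G s \<sigma>)"
    unfolding D_def
  proof (rule Bochner_Integration.integral_cong[OF refl])
    fix s
    show "indicator {0..T} s * (of_real c * n s (c * (T - s)) (vderiv \<theta>)) = (LINT \<sigma>|lborel. ?G s \<sigma>)"
    proof (cases "s \<in> {0..T}")
      case True
      then show ?thesis using neq[OF s1, of s "c * (T - s)"] by simp
    qed simp
  qed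
  also have "\<dots> = (LINT \<sigma>|lborel. LINT s|lborel. ?G s \<sigma>)" by (rule lborel_pair.Fubini_integral[OF i, symmetric])
  also have "\<dots> = (LINT \<sigma>|lborel. indicator {0..T} \<sigma> * (of_real c * n \<sigma> (c * (T - \<sigma>)) (vderiv \<theta>)) - indicator {0..T} \<sigma> * (of_real c * n \<sigma> 0 (vderiv \<theta>)))"
  proof (rule Bochner_Integration.integral_cong[OF refl])
    fix \<sigma>
    show "(LINT s|lborel. ?G s \<sigma>) = indicator {0..T} \<sigma> * (of_real c * n \<sigma> (c * (T - \<sigma>)) (vderiv \<theta>)) - indicator {0..T} \<sigma> * (of_real c * n \<sigma> 0 (vderiv \<theta>))"
    proof (cases "\<sigma> \<in> {0..T}")
      case True
      then have \<sigma>: "0 \<le> \<sigma>" "\<sigma> \<le> T" by auto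
      have "(LINT s|lborel. ?G s \<sigma>) = (LINT s|lborel. of_real c * (indicator {\<sigma>..T} s * (of_real c * n \<sigma> (c * (T - s)) (vderiv (vderiv \<theta>)))))"
        using \<sigma> by (intro Bochner_Integration.integral_cong refl) (auto simp: indicator_def)
      also have "\<dots> = of_real c * (n \<sigma> (c * (T - \<sigma>)) (vderiv \<theta>) - n \<sigma> 0 (vderiv \<theta>))"
        unfolding ftc[OF s1 \<sigma>, symmetric] by (rule integral_mult_right_zero)
      finally show ?thesis using True by (simp add: right_diff_distrib)
    next
      case False
      then have z: "?G s \<sigma> = 0" for s by (auto simp: indicator_def)
      show ?thesis unfolding z using False by simp
    qed
  qed
  \<comment> \<open>\<open>D\<close> reappears and cancels. The remaining integral equals
    \<open>n T 0 \<theta>\<close> by the equation for \<open>\<theta>\<close> itself, which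
    therefore vanishes.\<close>
  also have "\<dots> = D - (LINT \<sigma>|lborel. indicator {0..T} \<sigma> * (of_real c * n \<sigma> 0 (vderiv \<theta>)))"
    unfolding D_def
  proof (rule Bochner_Integration.integral_diff)
    have bi: "integrable lborel (\<lambda>\<sigma>. indicator {0..T} \<sigma> * (of_real c * F \<sigma>))"
      if "F \<in> borel_measurable borel" "\<And>\<sigma>. 0 \<le> \<sigma> \<Longrightarrow> \<sigma> \<le> T \<Longrightarrow> cmod (F \<sigma>) \<le> C1" for F :: "real \<Rightarrow> complex"
    proof (rule Bochner_Integration.integrable_bound)
      show "integrable lborel (\<lambda>\<sigma>. complex_of_real (\<bar>c\<bar> * C1) * indicator {0..T} \<sigma>)"
        by (intro integrable_mult_right integrable_indicator_interval)
      show "(\<lambda>\<sigma>. indicator {0..T} \<sigma> * (of_real c * F \<sigma>)) \<in> borel_measurable lborel" using that(1) by measurable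
      show "AE \<sigma> in lborel. norm (indicator {0..T} \<sigma> * (of_real c * F \<sigma>)) \<le> norm (complex_of_real (\<bar>c\<bar> * C1) * indicator {0..T} \<sigma>)"
        using that(2) C1(1) by (auto simp: norm_mult indicator_def intro!: AE_I2 mult_left_mono)
    qed
    have "(\<lambda>\<sigma>. (\<sigma>, \<sigma>)) \<in> measurable borel (borel \<Otimes>\<^sub>M borel)" "(\<lambda>\<sigma>. (\<sigma>, T)) \<in> measurable borel (borel \<Otimes>\<^sub>M borel)" by measurable
    from measurable_compose[OF this(1) nm[OF s1]] measurable_compose[OF this(2) nm[OF s1]]
    have "(\<lambda>\<sigma>. n \<sigma> (c * (T - \<sigma>)) (vderiv \<theta>)) \<in> borel_measurable borel" "(\<lambda>\<sigma>. n \<sigma> 0 (vderiv \<theta>)) \<in> borel_measurable borel" by simp_all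
    then show "integrable lborel (\<lambda>\<sigma>. indicator {0..T} \<sigma> * (of_real c * n \<sigma> (c * (T - \<sigma>)) (vderiv \<theta>)))"
      "integrable lborel (\<lambda>\<sigma>. indicator {0..T} \<sigma> * (of_real c * n \<sigma> 0 (vderiv \<theta>)))"
      using R by (auto intro!: bi C1(2) rR)
  qed
  finally have "(LINT \<sigma>|lborel. indicator {0..T} \<sigma> * (of_real c * n \<sigma> 0 (vderiv \<theta>))) = 0" by simp
  moreover have "(LINT \<sigma>|lborel. indicator {0..T} \<sigma> * (of_real c * n \<sigma> 0 (vderiv \<theta>))) = of_real c * (LINT \<sigma>|lborel. indicator {0..T} \<sigma> * n \<sigma> 0 (vderiv \<theta>))"
    by (simp only: mult.left_commute[of "indicator _ _"] integral_mult_right_zero)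
  ultimately have n0: "n T 0 \<theta> = 0" using neq[OF s\<theta> T order_refl, of 0] by (simp only:)
  have "gpow (H + 1/2) k * \<theta> (k + 0) = fourier \<phi> k" for k
    using gpow_inverse[of "H + 1/2" k] by (simp add: \<theta>_def mult.assoc[symmetric])
  then have "shifted \<theta> 0 = fourier_inv (fourier \<phi>)" unfolding shifted_def by simp
  then show ?thesis using n0 unfolding n_def fourier_inv_fourier[OF \<phi>] by simp
qed

end

lemma bounded_average_integrable:
  fixes m :: "real \<Rightarrow> real \<Rightarrow> complex"
  assumes mm: "(\<lambda>w. m (fst w) (snd w)) \<in> borel_measurable (borel \<Otimes>\<^sub>M borel)"
    and B: "\<And>t x. 0 \<le> t \<Longrightarrow> t \<le> T \<Longrightarrow> cmod (m t x) \<le> B" and \<phi>: "schwartz \<phi>"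
  shows "0 \<le> t \<Longrightarrow> t \<le> T \<Longrightarrow> integrable lborel (\<lambda>x. m t x * cnj (\<phi> x))"
    and "set_integrable lborel {0..T} (\<lambda>s. LINT x|lborel. m s x * cnj (\<phi> x))"
proof -
  have i\<phi>: "integrable lborel \<phi>" by (rule schwartz_integrable[OF \<phi>])
  have [measurable]: "\<phi> \<in> borel_measurable borel" by (rule schwartz_measurable[OF \<phi>])
  have b: "cmod (m s x * cnj (\<phi> x)) \<le> B * cmod (\<phi> x)" if "0 \<le> s" "s \<le> T" for s x
    unfolding norm_mult complex_mod_cnj using B[OF that] by (intro mult_right_mono) auto
  have ib: "integrable lborel (\<lambda>x. B * cmod (\<phi> x))" by (intro integrable_mult_right integrable_norm i\<phi>)
  show i: "integrable lborel (\<lambda>x. m t x * cnj (\<phi> x))" if t: "0 \<le> t" "t \<le> T" for t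
  proof (rule Bochner_Integration.integrable_bound[OF ib])
    have [measurable]: "m t \<in> borel_measurable borel"
      using measurable_compose[OF measurable_Pair1' mm, of t] by simp
    show "(\<lambda>x. m t x * cnj (\<phi> x)) \<in> borel_measurable lborel" by measurable
    show "AE x in lborel. norm (m t x * cnj (\<phi> x)) \<le> norm (B * cmod (\<phi> x))"
      unfolding real_norm_def by (intro AE_I2 order_trans[OF b[OF t] abs_ge_self])
  qed
  have n: "cmod (LINT x|lborel. m s x * cnj (\<phi> x)) \<le> (LINT x|lborel. B * cmod (\<phi> x))" if "0 \<le> s" "s \<le> T" for s
    by (rule integral_norm_bound_integral'[OF ib b[OF that]])
  have "(\<lambda>w. m (fst w) (snd w) * cnj (\<phi> (snd w))) \<in> borel_measurable (borel \<Otimes>\<^sub>M borel)"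
    using mm by measurable
  then have hm: "(\<lambda>s. LINT x|lborel. m s x * cnj (\<phi> x)) \<in> borel_measurable borel"
    by (intro lborel.borel_measurable_lebesgue_integral) (simp add: case_prod_unfold)
  show "set_integrable lborel {0..T} (\<lambda>s. LINT x|lborel. m s x * cnj (\<phi> x))"
    unfolding set_integrable_def
  proof (intro Bochner_Integration.integrable_bound[OF integrable_mult_right[OF integrable_indicator_interval[of 0 T], of "complex_of_real (LINT x|lborel. B * cmod (\<phi> x))"]])
    show "AE s in lborel. norm (indicator {0..T} s *\<^sub>R (LINT x|lborel. m s x * cnj (\<phi> x)))
      \<le> norm (complex_of_real (LINT x|lborel. B * cmod (\<phi> x)) * indicator {0..T} s)"
    proof (rule AE_I2)
      fix s :: real
      show "norm (indicator {0..T} s *\<^sub>R (LINT x|lborel. m s x * cnj (\<phi> x)))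
      \<le> norm (complex_of_real (LINT x|lborel. B * cmod (\<phi> x)) * indicator {0..T} s)"
      proof (cases "s \<in> {0..T}")
        case True
        then have "cmod (LINT x|lborel. m s x * cnj (\<phi> x)) \<le> \<bar>LINT x|lborel. B * cmod (\<phi> x)\<bar>"
          using n[of s] by (intro order_trans[OF n abs_ge_self]) auto
        then show ?thesis using True by (simp only: norm_mult norm_of_real indicator_simps norm_one scaleR_one mult_1_right)
      qed simp
    qed
    have "(\<lambda>s::real. indicator {0..T} s :: real) \<in> borel_measurable borel" by measurable
    from borel_measurable_scaleR[OF this hm]
    show "(\<lambda>s. indicator {0..T} s *\<^sub>R (LINT x|lborel. m s x * cnj (\<phi> x))) \<in> borel_measurable lborel" by simp
  qed
qed

section \<open>Uniqueness and identification of all solutions\<close>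

context driven_evolution
begin

text \<open>Pairing with a fixed \<open>Z\<close> yields a deterministic function of
  \<open>(t, x)\<close>, so the null sets of the weak equation, which depend on the test function,
  disappear.\<close>

definition correlation :: "(real \<Rightarrow> real \<Rightarrow> 'w \<Rightarrow> complex) \<Rightarrow> ('w \<Rightarrow> complex) \<Rightarrow> real \<Rightarrow> real \<Rightarrow> complex" where
  "correlation u Z t x = (\<integral>\<omega>. u t x \<omega> * cnj (Z \<omega>) \<partial>M)"

lemma correlation_measurable:
  assumes u: "bounded_field u" and Z: "square_integrable M Z"
  shows "(\<lambda>w. correlation u Z (fst w) (snd w)) \<in> borel_measurable (borel \<Otimes>\<^sub>M borel)"
proof -
  have um: "(\<lambda>(t, x, \<omega>). u t x \<omega>) \<in> borel_measurable (borel \<Otimes>\<^sub>M (borel \<Otimes>\<^sub>M M))"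
    using u unfolding bounded_field_def by blast
  have [measurable]: "Z \<in> borel_measurable M" by (rule square_integrable_measurable[OF Z])
  have "(\<lambda>p. (fst (fst p), snd (fst p), snd p)) \<in> measurable ((borel \<Otimes>\<^sub>M borel) \<Otimes>\<^sub>M M) (borel \<Otimes>\<^sub>M (borel \<Otimes>\<^sub>M M))" by measurable
  from measurable_compose[OF this um]
  have [measurable]: "(\<lambda>p::(real \<times> real) \<times> 'w. u (fst (fst p)) (snd (fst p)) (snd p)) \<in> borel_measurable ((borel \<Otimes>\<^sub>M borel) \<Otimes>\<^sub>M M)" by simp
  show ?thesis unfolding correlation_def
    by (rule borel_measurable_lebesgue_integral) (simp add: case_prod_unfold, measurable)
qed

lemma correlation_bound:
  assumes u: "bounded_field u" and Z: "square_integrable M Z"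
  obtains B where "\<And>t x. 0 \<le> t \<Longrightarrow> t \<le> T \<Longrightarrow> cmod (correlation u Z t x) \<le> B"
proof -
  obtain K where K: "K \<ge> 0" "\<And>t x. 0 \<le> t \<Longrightarrow> t \<le> T \<Longrightarrow> sqnorm M (u t x) \<le> K"
    by (rule bounded_fieldE[OF u, of T]) blast
  have "cmod (correlation u Z t x) \<le> sqrt K * sqrt (sqnorm M Z)" if h: "0 \<le> t" "t \<le> T" for t x
  proof -
    have "cmod (correlation u Z t x) \<le> sqrt (sqnorm M (u t x)) * sqrt (sqnorm M Z)"
      unfolding correlation_def by (rule cmod_integral_product_le[OF bounded_field_square_integrable[OF u h(1)] Z])
    also have "\<dots> \<le> sqrt K * sqrt (sqnorm M Z)"
      using K(2)[OF h] by (intro mult_right_mono) auto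
    finally show ?thesis .
  qed
  then show thesis by (rule that)
qed

lemma correlation_equation:
  assumes u: "solution_from_zero M f c g H u" and Z: "square_integrable M Z" and \<zeta>: "schwartz \<zeta>" and t: "t \<ge> 0"
  shows "(LINT x|lborel. correlation u Z t x * cnj (fourier_inv \<zeta> x))
    = (LINT s:{0..t}|lborel. LINT x|lborel. correlation u Z s x * cnj (fourier_inv (dual_op \<zeta>) x))
     + (\<integral>\<omega>. f (\<lambda>s x. indicator {0..t} s * cnj (fourier_inv \<zeta> x)) \<omega> * cnj (Z \<omega>) \<partial>M)"
proof -
  let ?F = "f (\<lambda>s x. indicator {0..t} s * cnj (fourier_inv \<zeta> x))"
  let ?D = "\<lambda>\<omega>. LINT s:{0..t}|lborel. field_pairing u (fourier_inv (dual_op \<zeta>)) s \<omega>"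
  have b: "bounded_field u" by (rule solution_from_zero_bounded_field[OF u])
  have s1: "schwartz (fourier_inv \<zeta>)" by (rule schwartz_fourier_inv[OF \<zeta>])
  have s2: "schwartz (fourier_inv (dual_op \<zeta>))" by (intro schwartz_fourier_inv schwartz_dual_op \<zeta>)
  have sF: "square_integrable M ?F"
    by (intro forcing_square_integrable forcing_test_separable schwartz_cnj s1)
  note sD = field_pairing_time_average[OF b t s2]
  note sP = field_pairing_average[OF b t s1]
  have z: "AE \<omega> in M. u 0 x \<omega> = 0" for x using u unfolding solution_from_zero_def by blast
  have "solves_evolution M f c g H u" using u unfolding solution_from_zero_def by blast
  then have "AE \<omega> in M. field_pairing u (fourier_inv \<zeta>) t \<omega> = field_pairing u (fourier_inv \<zeta>) 0 \<omega> + ?D \<omega> + ?F \<omega>"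
    unfolding solves_evolution_iff using \<zeta> t by blast
  with initial_pairing[OF b z s1]
  have e: "AE \<omega> in M. field_pairing u (fourier_inv \<zeta>) t \<omega> * cnj (Z \<omega>) = ?D \<omega> * cnj (Z \<omega>) + ?F \<omega> * cnj (Z \<omega>)"
    by eventually_elim (simp add: distrib_right)
  note [measurable] = square_integrable_measurable[OF Z] square_integrable_measurable[OF sF]
    square_integrable_measurable[OF sD(1)] square_integrable_measurable[OF sP(1)]
  have "(LINT x|lborel. correlation u Z t x * cnj (fourier_inv \<zeta> x)) = (\<integral>\<omega>. field_pairing u (fourier_inv \<zeta>) t \<omega> * cnj (Z \<omega>) \<partial>M)"
    unfolding correlation_def by (rule sP(2)[OF Z, symmetric])
  also have "\<dots> = (\<integral>\<omega>. ?D \<omega> * cnj (Z \<omega>) + ?F \<omega> * cnj (Z \<omega>) \<partial>M)"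
    by (rule integral_cong_AE[OF _ _ e]) measurable
  also have "\<dots> = (\<integral>\<omega>. ?D \<omega> * cnj (Z \<omega>) \<partial>M) + (\<integral>\<omega>. ?F \<omega> * cnj (Z \<omega>) \<partial>M)"
    by (intro Bochner_Integration.integral_add square_integrable_product square_integrable_cnj sD(1) sF Z)
  also have "(\<integral>\<omega>. ?D \<omega> * cnj (Z \<omega>) \<partial>M) = (LINT s:{0..t}|lborel. (\<integral>\<omega>. field_pairing u (fourier_inv (dual_op \<zeta>)) s \<omega> * cnj (Z \<omega>) \<partial>M))"
    by (rule sD(2)[OF Z])
  also have "\<dots> = (LINT s:{0..t}|lborel. LINT x|lborel. correlation u Z s x * cnj (fourier_inv (dual_op \<zeta>) x))"
    unfolding correlation_def
    by (rule set_lebesgue_integral_cong) (auto simp: field_pairing_average(2)[OF b _ s2 Z])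
  finally show ?thesis .
qed

lemma correlation_continuous:
  assumes u: "solution_from_zero M f c g H u" and Z: "square_integrable M Z" and t: "t \<ge> 0"
  shows "continuous_on UNIV (correlation u Z t)"
proof -
  have b: "bounded_field u" by (rule solution_from_zero_bounded_field[OF u])
  note si = bounded_field_square_integrable[OF b t]
  have "(correlation u Z t \<longlongrightarrow> correlation u Z t x) (at x)" for x
  proof (rule LIM_zero_cancel, rule Lim_null_comparison)
    have d: "correlation u Z t y - correlation u Z t x = (\<integral>\<omega>. (u t y \<omega> - u t x \<omega>) * cnj (Z \<omega>) \<partial>M)" for y
      unfolding correlation_def left_diff_distrib
      by (intro Bochner_Integration.integral_diff[symmetric] square_integrable_product square_integrable_cnj si Z)
    show "\<forall>\<^sub>F y in at x. norm (correlation u Z t y - correlation u Z t x) \<le> sqrt (sqnorm M (\<lambda>\<omega>. u t y \<omega> - u t x \<omega>)) * sqrt (sqnorm M Z)"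
      unfolding d by (intro always_eventually allI cmod_integral_product_le square_integrable_diff si Z)
    have "((\<lambda>y. sqnorm M (\<lambda>\<omega>. u t y \<omega> - u t x \<omega>)) \<longlongrightarrow> 0) (at x)"
      using u t unfolding solution_from_zero_def sqnorm_def by blast
    then have "((\<lambda>y. sqrt (sqnorm M (\<lambda>\<omega>. u t y \<omega> - u t x \<omega>)) * sqrt (sqnorm M Z)) \<longlongrightarrow> sqrt 0 * sqrt (sqnorm M Z)) (at x)"
      by (intro tendsto_intros)
    then show "((\<lambda>y. sqrt (sqnorm M (\<lambda>\<omega>. u t y \<omega> - u t x \<omega>)) * sqrt (sqnorm M Z)) \<longlongrightarrow> 0) (at x)" by simp
  qed
  then show ?thesis by (simp add: continuous_on_def)
qed

text \<open>\<open>Z\<close> is the difference of the two fields at the point under study, so that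
  the correlation of the difference with \<open>Z\<close> there is the second moment of
  \<open>Z\<close>. The forcing enters both correlation equations identically and cancels;
  mean-square continuity of the fields makes the weak conclusion pointwise.\<close>

lemma solution_unique:
  assumes u: "solution_from_zero M f c g H u" and v: "solution_from_zero M f c g H v" and T: "T \<ge> 0"
  shows "AE \<omega> in M. u T x \<omega> = v T x \<omega>"
proof -
  have bu: "bounded_field u" and bv: "bounded_field v" by (rule solution_from_zero_bounded_field[OF u] solution_from_zero_bounded_field[OF v])+
  define Z where "Z = (\<lambda>\<omega>. u T x \<omega> - v T x \<omega>)"
  have Z: "square_integrable M Z" unfolding Z_def
    by (intro square_integrable_diff bounded_field_square_integrable bu bv T)
  define m where "m = (\<lambda>t y. correlation u Z t y - correlation v Z t y)"
  note mu = correlation_measurable[OF bu Z] and mv = correlation_measurable[OF bv Z]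
  obtain B1 where B1: "\<And>t x. 0 \<le> t \<Longrightarrow> t \<le> T \<Longrightarrow> cmod (correlation u Z t x) \<le> B1"
    by (rule correlation_bound[OF bu Z]) blast
  obtain B2 where B2: "\<And>t x. 0 \<le> t \<Longrightarrow> t \<le> T \<Longrightarrow> cmod (correlation v Z t x) \<le> B2"
    by (rule correlation_bound[OF bv Z]) blast
  have mm: "(\<lambda>w. m (fst w) (snd w)) \<in> borel_measurable (borel \<Otimes>\<^sub>M borel)"
    unfolding m_def by (intro borel_measurable_diff mu mv)
  have mB: "cmod (m t y) \<le> B1 + B2" if "0 \<le> t" "t \<le> T" for t y
    unfolding m_def by (rule order_trans[OF norm_triangle_ineq4 add_mono[OF B1[OF that] B2[OF that]]])
  have split: "(LINT x|lborel. m t x * cnj (\<phi> x)) = (LINT x|lborel. correlation u Z t x * cnj (\<phi> x)) - (LINT x|lborel. correlation v Z t x * cnj (\<phi> x))"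
    if "schwartz \<phi>" "0 \<le> t" "t \<le> T" for t \<phi>
    unfolding m_def left_diff_distrib
    by (intro Bochner_Integration.integral_diff bounded_average_integrable(1)[OF mu B1 that] bounded_average_integrable(1)[OF mv B2 that])
  have meq: "(LINT x|lborel. m t x * cnj (fourier_inv \<zeta> x)) = (LINT s:{0..t}|lborel. LINT x|lborel. m s x * cnj (fourier_inv (dual_op \<zeta>) x))"
    if \<zeta>: "schwartz \<zeta>" and t: "0 \<le> t" "t \<le> T" for \<zeta> t
  proof -
    have s2: "schwartz (fourier_inv (dual_op \<zeta>))" by (intro schwartz_fourier_inv schwartz_dual_op \<zeta>)
    have B1': "\<And>s x. 0 \<le> s \<Longrightarrow> s \<le> t \<Longrightarrow> cmod (correlation u Z s x) \<le> B1"
      and B2': "\<And>s x. 0 \<le> s \<Longrightarrow> s \<le> t \<Longrightarrow> cmod (correlation v Z s x) \<le> B2" using B1 B2 t by auto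
    have "(LINT s:{0..t}|lborel. LINT x|lborel. m s x * cnj (fourier_inv (dual_op \<zeta>) x))
      = (LINT s:{0..t}|lborel. (LINT x|lborel. correlation u Z s x * cnj (fourier_inv (dual_op \<zeta>) x)) - (LINT x|lborel. correlation v Z s x * cnj (fourier_inv (dual_op \<zeta>) x)))"
      using t by (intro set_lebesgue_integral_cong) (auto intro!: split s2)
    also have "\<dots> = (LINT s:{0..t}|lborel. LINT x|lborel. correlation u Z s x * cnj (fourier_inv (dual_op \<zeta>) x)) - (LINT s:{0..t}|lborel. LINT x|lborel. correlation v Z s x * cnj (fourier_inv (dual_op \<zeta>) x))"
      by (intro set_integral_diff(2) bounded_average_integrable(2)[OF mu B1' s2] bounded_average_integrable(2)[OF mv B2' s2])
    finally show ?thesis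
      unfolding split[OF schwartz_fourier_inv[OF \<zeta>] t] correlation_equation[OF u Z \<zeta> t(1)] correlation_equation[OF v Z \<zeta> t(1)] by simp
  qed
  have "m T x = 0"
  proof (rule bounded_continuous_eq_zero)
    show "continuous_on UNIV (m T)" unfolding m_def
      by (intro continuous_on_diff correlation_continuous u v Z T)
    show "cmod (m T y) \<le> B1 + B2" for y by (rule mB[OF T order_refl])
    show "(LINT x|lborel. m T x * cnj (\<phi> x)) = 0" if "schwartz \<phi>" for \<phi>
      by (rule transport_uniqueness[OF mm T mB meq that])
  qed
  moreover have "m T x = (\<integral>\<omega>. u T x \<omega> * cnj (Z \<omega>) - v T x \<omega> * cnj (Z \<omega>) \<partial>M)"
    unfolding m_def correlation_def
    by (intro Bochner_Integration.integral_diff[symmetric] square_integrable_product square_integrable_cnj Z bounded_field_square_integrable bu bv T)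
  moreover have "(\<lambda>\<omega>. u T x \<omega> * cnj (Z \<omega>) - v T x \<omega> * cnj (Z \<omega>)) = (\<lambda>\<omega>. Z \<omega> * cnj (Z \<omega>))"
    by (simp add: Z_def left_diff_distrib)
  ultimately have "complex_of_real (sqnorm M Z) = 0" unfolding sqnorm_eq_inner by simp
  then have "sqnorm M Z = 0" by simp
  from sqnorm_eq_0[OF Z this] show ?thesis by eventually_elim (simp add: Z_def)
qed

text \<open>Through uniqueness every solution inherits the explicit kernel, to which all statements
  about second moments and laws are reduced.\<close>

lemma solution_from_zero_represents:
  assumes u: "solution_from_zero M f c g H u" and t: "t \<ge> 0"
  shows "represents (u t x) (kernel t x)"
proof (rule represents_cong_AE[OF solution_represents[OF t]])
  show "u t x \<in> borel_measurable M"
    by (rule square_integrable_measurable[OF bounded_field_square_integrable[OF solution_from_zero_bounded_field[OF u] t]])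
  show "AE \<omega> in M. solution t x \<omega> = u t x \<omega>" by (rule solution_unique[OF solution_solves u t])
qed

lemma solution_gaussian_family:
  assumes u: "solution_from_zero M f c g H u"
  shows "gaussian_family M ({0..} \<times> UNIV) (\<lambda>(t, x). u t x)"
  unfolding gaussian_family_def
proof (intro allI impI, elim conjE)
  fix J :: "(real \<times> real) set" and a :: "real \<times> real \<Rightarrow> complex"
  assume J: "finite J" "J \<subseteq> {0..} \<times> UNIV"
  have "represents ((\<lambda>(t, x). u t x) i) ((\<lambda>(t, x). kernel t x) i)" if "i \<in> J" for i
    using J that solution_from_zero_represents[OF u] by auto
  then have r: "\<And>i. i \<in> J \<Longrightarrow> represents (case i of (t, x) \<Rightarrow> u t x) (case i of (t, x) \<Rightarrow> kernel t x)" .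
  show "gaussian_rv M (\<lambda>\<omega>. Re (\<Sum>i\<in>J. a i * (case i of (t, x) \<Rightarrow> u t x) \<omega>))"
    by (rule represents_gaussian(1)[where X = "\<lambda>i. case i of (t, x) \<Rightarrow> u t x" and h = "\<lambda>i. case i of (t, x) \<Rightarrow> kernel t x", OF J(1)]) (rule r)
qed

end

section \<open>Covariance and long-time behaviour\<close>

text \<open>Everything is compared with the primitive \<open>F\<close> anchored at \<open>0\<close>,
  which is differentiable by the local fundamental theorem; its limits \<open>l\<close> and
  \<open>r\<close> at the two ends turn the integrals over half lines into differences.\<close>

lemma continuous_integrable_primitive:
  fixes w :: "real \<Rightarrow> real"
  assumes c: "continuous_on UNIV w" and i: "integrable lborel w"
  shows "((\<lambda>k. LINT s:{..k}|lborel. w s) has_real_derivative w k) (at k)"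
    and "((\<lambda>k. LINT s:{..k}|lborel. w s) \<longlongrightarrow> 0) at_bot"
    and "((\<lambda>k. LINT s:{..k}|lborel. w s) \<longlongrightarrow> (LINT s|lborel. w s)) at_top"
    and "(LINT s:{k..}|lborel. w s) = (LINT s|lborel. w s) - (LINT s:{..k}|lborel. w s)"
proof -
  have ic: "isCont w x" for x using c by (simp add: continuous_on_eq_continuous_at)
  define F where "F = (\<lambda>u. LBINT y=ereal 0..ereal u. w y)"
  have F: "(F has_real_derivative w k) (at k)" for k
  proof -
    have "((\<lambda>u. LBINT y=ereal 0..ereal u. w y) has_vector_derivative w k) (at k within {- \<bar>k\<bar> - 1..\<bar>k\<bar> + 1})"
      by (rule interval_integral_FTC2) (auto intro: continuous_on_subset[OF c])
    moreover have "at k within {- \<bar>k\<bar> - 1..\<bar>k\<bar> + 1} = at k" by (rule at_within_Icc_at) auto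
    ultimately show ?thesis by (simp add: has_real_derivative_iff_has_vector_derivative F_def)
  qed
  have si: "set_integrable lborel A w" if "A \<in> sets lborel" for A
    unfolding set_integrable_def using integrable_mult_indicator[OF that i] .
  have ftc: "(LINT s:{a..b}|lborel. w s) = F b - F a" if "a \<le> b" for a b
  proof -
    have "(LINT s:{a..b}|lborel. w s) = (LINT s|lborel. w s * indicator {a..b} s)"
      unfolding set_lebesgue_integral_def by (simp only: real_scaleR_def mult.commute)
    also have "\<dots> = F b - F a" by (rule integral_FTC_Icc_real[OF that F ic])
    finally show ?thesis .
  qed
  define l where "l = F 0 - (LINT s:{..0}|lborel. w s)"
  define r where "r = F 0 + (LINT s:{0..}|lborel. w s)"
  have lim_bot: "(F \<longlongrightarrow> F k - (LINT s:{..k}|lborel. w s)) at_bot" for k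
  proof -
    have "((\<lambda>a. F k - (LINT s:{a..k}|lborel. w s)) \<longlongrightarrow> F k - (LINT s:{..k}|lborel. w s)) at_bot"
      by (intro tendsto_intros tendsto_set_lebesgue_integral_at_bot si) auto
    moreover have "\<forall>\<^sub>F a in at_bot. F k - (LINT s:{a..k}|lborel. w s) = F a"
      using eventually_le_at_bot[of k] by eventually_elim (simp add: ftc)
    ultimately show ?thesis by (rule Lim_transform_eventually)
  qed
  have lim_top: "(F \<longlongrightarrow> F k + (LINT s:{k..}|lborel. w s)) at_top" for k
  proof -
    have "((\<lambda>b. F k + (LINT s:{k..b}|lborel. w s)) \<longlongrightarrow> F k + (LINT s:{k..}|lborel. w s)) at_top"
      by (intro tendsto_intros tendsto_set_lebesgue_integral_at_top si) auto
    moreover have "\<forall>\<^sub>F b in at_top. F k + (LINT s:{k..b}|lborel. w s) = F b"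
      using eventually_ge_at_top[of k] by eventually_elim (simp add: ftc)
    ultimately show ?thesis by (rule Lim_transform_eventually)
  qed
  have l: "(F \<longlongrightarrow> l) at_bot" unfolding l_def by (rule lim_bot)
  have r: "(F \<longlongrightarrow> r) at_top" unfolding r_def by (rule lim_top)
  have L: "(LINT s:{..k}|lborel. w s) = F k - l" for k
    using tendsto_unique[OF _ lim_bot[of k] l] by (simp add: trivial_limit_at_bot_linorder)
  have R: "(LINT s:{k..}|lborel. w s) = r - F k" for k
    using tendsto_unique[OF _ lim_top[of k] r] by simp
  have m: "((\<lambda>k. LINT s:{..k}|lborel. w s) \<longlongrightarrow> (LINT s|lborel. w s)) at_top"
    using tendsto_integral_at_top[OF sets_lborel i] by (simp add: set_lebesgue_integral_def)
  moreover have "((\<lambda>k. LINT s:{..k}|lborel. w s) \<longlongrightarrow> r - l) at_top" unfolding L by (intro tendsto_intros r)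
  ultimately have t: "(LINT s|lborel. w s) = r - l" by (intro tendsto_unique[of at_top]) auto
  show "((\<lambda>k. LINT s:{..k}|lborel. w s) has_real_derivative w k) (at k)"
    unfolding L using DERIV_diff[OF F[of k] DERIV_const[of l]] by simp
  have "((\<lambda>k. F k - l) \<longlongrightarrow> l - l) at_bot" by (intro tendsto_intros l)
  then show "((\<lambda>k. LINT s:{..k}|lborel. w s) \<longlongrightarrow> 0) at_bot" unfolding L by simp
  show "((\<lambda>k. LINT s:{..k}|lborel. w s) \<longlongrightarrow> (LINT s|lborel. w s)) at_top" by (rule m)
  show "(LINT s:{k..}|lborel. w s) = (LINT s|lborel. w s) - (LINT s:{..k}|lborel. w s)"
    unfolding L R t by simp
qed

section \<open>Spectral weight accumulated along characteristics\<close>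

context driven_evolution
begin

definition weight :: "real \<Rightarrow> real" where
  "weight k = g k powr (2 * H + 1) * density_re k"

lemma weighted_spectrum_eq: "weighted_spectrum g H Cf k = complex_of_real (weight k)"
  unfolding weighted_spectrum_def weight_def using spectrum_real[of k] by (simp add: spectrum_def)

lemma schwartz_weight: "schwartz (\<lambda>k. complex_of_real (weight k))"
  using schwartz_gpow[OF schwartz_spectrum, of "2 * H + 1"]
  by (simp add: gpow_def spectrum_real weight_def)

lemma weight_nonneg: "weight k \<ge> 0"
  unfolding weight_def by (simp add: density_re_nonneg)

lemma weight_continuous: "continuous_on UNIV weight"
proof -
  have "continuous_on UNIV (\<lambda>k. Re (complex_of_real (weight k)))"
    by (intro continuous_on_Re schwartz_continuous schwartz_weight)
  then show ?thesis by simp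
qed

lemma weight_integrable: "integrable lborel weight"
  using integrable_Re[OF schwartz_integrable[OF schwartz_weight]] by simp

definition primitive :: "real \<Rightarrow> real" where
  "primitive k = (LINT s:{..k}|lborel. weight s)"

definition mass :: real where
  "mass = (LINT s|lborel. weight s)"

lemmas primitive_facts = continuous_integrable_primitive[OF weight_continuous weight_integrable, folded primitive_def mass_def]

lemma primitive_bounds: "0 \<le> primitive k" "primitive k \<le> mass"
proof -
  show "0 \<le> primitive k" unfolding primitive_def set_lebesgue_integral_def
    by (intro integral_nonneg_AE AE_I2) (simp add: weight_nonneg)
  have "0 \<le> (LINT s:{k..}|lborel. weight s)" unfolding set_lebesgue_integral_def
    by (intro integral_nonneg_AE AE_I2) (simp add: weight_nonneg)
  then show "primitive k \<le> mass" using primitive_facts(4)[of k] by simp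
qed

lemma mass_nonneg: "mass \<ge> 0"
  using primitive_bounds[of 0] by linarith

lemma primitive_measurable [measurable]: "primitive \<in> borel_measurable borel"
  by (intro borel_measurable_continuous_onI continuous_at_imp_continuous_on ballI DERIV_isCont[OF primitive_facts(1)])

text \<open>Closed form of the time integral of \<open>weight (k - c * s)\<close>; division by
  \<open>c\<close> rather than by its modulus gives the right sign for both directions of
  transport.\<close>

definition accumulated :: "real \<Rightarrow> real \<Rightarrow> real" where
  "accumulated t k = (primitive k - primitive (k - c * t)) / c"

text \<open>As \<open>t\<close> grows, \<open>k - c * t\<close> leaves through one end of the line,
  where \<open>primitive\<close> has the limit \<open>0\<close> or \<open>mass\<close> according to
  the sign of \<open>c\<close>.\<close>

definition limit_density :: "real \<Rightarrow> real" where
  "limit_density k = (primitive k - (if c > 0 then 0 else mass)) / c"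

lemma accumulated_measurable [measurable]: "accumulated t \<in> borel_measurable borel"
  unfolding accumulated_def by measurable

lemma limit_density_measurable [measurable]: "limit_density \<in> borel_measurable borel"
  unfolding limit_density_def by measurable

lemma accumulated_integral:
  assumes t: "t \<ge> 0"
  shows "(LINT s:{0..t}|lborel. weight (k - c * s)) = accumulated t k"
proof -
  have d: "((\<lambda>s. - (primitive (k - c * s) / c)) has_real_derivative weight (k - c * s)) (at s)" for s
  proof -
    have "((\<lambda>s. k - c * s) has_real_derivative - c) (at s)" by (auto intro!: derivative_eq_intros)
    from DERIV_chain2[OF primitive_facts(1) this]
    have "((\<lambda>s. primitive (k - c * s)) has_real_derivative weight (k - c * s) * - c) (at s)" .
    from DERIV_minus[OF DERIV_cdivide[OF this, of c]] show ?thesis using c_nonzero by simp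
  qed
  have wc: "isCont weight x" for x using weight_continuous by (simp add: continuous_on_eq_continuous_at)
  have "(LINT s:{0..t}|lborel. weight (k - c * s)) = (LINT s|lborel. weight (k - c * s) * indicator {0..t} s)"
    unfolding set_lebesgue_integral_def by (simp only: real_scaleR_def mult.commute)
  also have "\<dots> = - (primitive (k - c * t) / c) - - (primitive (k - c * 0) / c)"
    by (rule integral_FTC_Icc_real[OF t d]) (intro isCont_o2[OF _ wc] continuous_intros)
  finally show ?thesis by (simp add: accumulated_def diff_divide_distrib)
qed

lemma accumulated_spectrum:
  assumes "t \<ge> 0"
  shows "(LINT s:{0..t}|lborel. weighted_spectrum g H Cf (k - c * s)) = of_real (accumulated t k)"
  unfolding weighted_spectrum_eq set_integral_complex_of_real accumulated_integral[OF assms] ..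

lemma accumulated_bounds:
  assumes "t \<ge> 0"
  shows "0 \<le> accumulated t k" "accumulated t k \<le> mass / \<bar>c\<bar>"
proof -
  show "0 \<le> accumulated t k" unfolding accumulated_integral[OF assms, symmetric] set_lebesgue_integral_def
    by (intro integral_nonneg_AE AE_I2) (simp add: weight_nonneg)
  have "\<bar>primitive k - primitive (k - c * t)\<bar> \<le> mass"
    using primitive_bounds[of k] primitive_bounds[of "k - c * t"] by linarith
  then have "\<bar>accumulated t k\<bar> \<le> mass / \<bar>c\<bar>"
    unfolding accumulated_def abs_divide by (intro divide_right_mono) auto
  then show "accumulated t k \<le> mass / \<bar>c\<bar>" by linarith
qed

lemma accumulated_tendsto: "((\<lambda>t. accumulated t k) \<longlongrightarrow> limit_density k) at_top"
proof -
  have "((\<lambda>t. primitive (k - c * t)) \<longlongrightarrow> (if c > 0 then 0 else mass)) at_top"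
  proof (cases "c > 0")
    case True
    have "filterlim (\<lambda>t. k - c * t) at_bot at_top" using True by real_asymp
    from filterlim_compose[OF primitive_facts(2) this] True show ?thesis by simp
  next
    case False
    then have "c < 0" using c_nonzero by simp
    then have "filterlim (\<lambda>t. k - c * t) at_top at_top" by real_asymp
    from filterlim_compose[OF primitive_facts(3) this] False show ?thesis by simp
  qed
  then show ?thesis unfolding accumulated_def limit_density_def
    by (intro tendsto_intros c_nonzero)
qed

lemma limit_density_bounds: "0 \<le> limit_density k" "limit_density k \<le> mass / \<bar>c\<bar>"
proof -
  have "\<forall>\<^sub>F t in at_top. 0 \<le> accumulated t k" "\<forall>\<^sub>F t in at_top. accumulated t k \<le> mass / \<bar>c\<bar>"
    using eventually_ge_at_top[of 0] by (eventually_elim, simp add: accumulated_bounds)+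
  then show "0 \<le> limit_density k" "limit_density k \<le> mass / \<bar>c\<bar>"
    using tendsto_lowerbound[OF accumulated_tendsto] tendsto_upperbound[OF accumulated_tendsto] by auto
qed

lemma limit_density_integral:
  "limit_density k = (if c > 0 then 1 / c * (LINT s:{..k}|lborel. weight s) else 1 / (- c) * (LINT s:{k..}|lborel. weight s))"
  using c_nonzero unfolding limit_density_def primitive_facts(4) primitive_def[symmetric]
  by (auto simp: field_simps)

text \<open>Which of the two limits is \<open>0\<close> depends on the sign of \<open>c\<close>, but
  the structure function sees only their sum.\<close>

lemma limit_density_at_infinity:
  obtains p q where "(limit_density \<longlongrightarrow> p) at_top" "(limit_density \<longlongrightarrow> q) at_bot" "p + q = mass / \<bar>c\<bar>"
proof (rule that)
  show "(limit_density \<longlongrightarrow> (mass - (if c > 0 then 0 else mass)) / c) at_top"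
    unfolding limit_density_def[abs_def] by (intro tendsto_intros primitive_facts c_nonzero)
  show "(limit_density \<longlongrightarrow> (0 - (if c > 0 then 0 else mass)) / c) at_bot"
    unfolding limit_density_def[abs_def] by (intro tendsto_intros primitive_facts c_nonzero)
  show "(mass - (if c > 0 then 0 else mass)) / c + (0 - (if c > 0 then 0 else mass)) / c = mass / \<bar>c\<bar>"
    using c_nonzero by (auto simp: field_simps)
qed

text \<open>At finite time the primitive enters only through a difference over a bounded shift, so
  its plateau at one end cancels and rapid decay survives by Peetre's inequality. Being Schwartz,
  the spectrum at time \<open>t\<close> can be inverted to give the correlation function; in the
  limit of large times a positive mass leaves the plateau in place.\<close>

lemma schwartz_accumulated:
  assumes t: "t \<ge> 0"
  shows "schwartz (\<lambda>k. complex_of_real (accumulated t k))"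
proof (rule schwartz_antiderivative)
  have rd: "rapid_decay (\<lambda>k. complex_of_real (weight k))" by (rule schwartz_rapid[OF schwartz_weight])
  show "rapid_decay (\<lambda>k. complex_of_real (accumulated t k))"
    unfolding rapid_decay_def
  proof
    fix m
    obtain K where K: "\<And>x. cmod (complex_of_real (weight x)) * (1 + \<bar>x\<bar>) ^ m \<le> K"
      using rd unfolding rapid_decay_def by blast
    define R where "R = \<bar>c\<bar> * t"
    have R: "R \<ge> 0" using t by (simp add: R_def)
    have b: "weight (k - c * s) * (1 + \<bar>k\<bar>) ^ m \<le> K * (1 + R) ^ m" if s: "0 \<le> s" "s \<le> t" for s k
    proof -
      have "\<bar>- (c * s)\<bar> \<le> R" unfolding R_def abs_minus_cancel abs_mult using s by (intro mult_left_mono) auto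
      from one_plus_shift_le[OF this, of k]
      have "(1 + \<bar>k\<bar>) ^ m \<le> ((1 + R) * (1 + \<bar>k - c * s\<bar>)) ^ m" by (intro power_mono) auto
      then have "weight (k - c * s) * (1 + \<bar>k\<bar>) ^ m \<le> weight (k - c * s) * ((1 + R) * (1 + \<bar>k - c * s\<bar>)) ^ m"
        by (intro mult_left_mono weight_nonneg)
      also have "\<dots> = (weight (k - c * s) * (1 + \<bar>k - c * s\<bar>) ^ m) * (1 + R) ^ m" by (simp only: power_mult_distrib mult_ac)
      also have "\<dots> \<le> K * (1 + R) ^ m"
        using K[of "k - c * s"] R weight_nonneg[of "k - c * s"] by (intro mult_right_mono) auto
      finally show ?thesis .
    qed
    have "cmod (complex_of_real (accumulated t k)) * (1 + \<bar>k\<bar>) ^ m \<le> (LINT s|lborel. K * (1 + R) ^ m * indicator {0..t} s)" for k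
    proof -
      have "cmod (complex_of_real (accumulated t k)) * (1 + \<bar>k\<bar>) ^ m = accumulated t k * (1 + \<bar>k\<bar>) ^ m"
        using accumulated_bounds(1)[OF t] by simp
      also have "\<dots> = (LINT s|lborel. (weight (k - c * s) * (1 + \<bar>k\<bar>) ^ m) * indicator {0..t} s)"
        unfolding accumulated_integral[OF t, symmetric] set_lebesgue_integral_def integral_mult_left_zero[symmetric] real_scaleR_def
        by (simp only: mult_ac)
      also have "\<dots> \<le> (LINT s|lborel. K * (1 + R) ^ m * indicator {0..t} s)"
      proof (rule integral_mono')
        show "integrable lborel (\<lambda>s. K * (1 + R) ^ m * indicator {0..t} s)" by (intro integrable_mult_right integrable_real_indicator) (use t in auto)
        have "0 \<le> K" using K[of 0] weight_nonneg[of 0] order_trans[OF _ K[of 0]] by simp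
        then show "weight (k - c * s) * (1 + \<bar>k\<bar>) ^ m * indicator {0..t} s \<le> K * (1 + R) ^ m * indicator {0..t} s" for s
          using b[of s k] by (auto simp: indicator_def)
        show "0 \<le> K * (1 + R) ^ m * indicator {0..t} s" for s using \<open>0 \<le> K\<close> R by simp
      qed
      finally show ?thesis .
    qed
    then show "\<exists>K. \<forall>k. cmod (complex_of_real (accumulated t k)) * (1 + \<bar>k\<bar>) ^ m \<le> K" by blast
  qed
  have s: "schwartz (\<lambda>k. complex_of_real (weight (k + - (c * t))))" by (rule schwartz_shift[OF schwartz_weight])
  show "schwartz (\<lambda>k. of_real (1 / c) * (complex_of_real (weight k) - complex_of_real (weight (k + - (c * t)))))"
    by (intro schwartz_scale schwartz_diff schwartz_weight s)
  fix k
  have "((\<lambda>k. k - c * t) has_real_derivative 1) (at k)" by (auto intro!: derivative_eq_intros)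
  from DERIV_chain2[OF primitive_facts(1) this]
  have "((\<lambda>k. primitive (k - c * t)) has_real_derivative weight (k - c * t)) (at k)" by simp
  from DERIV_cdivide[OF DERIV_diff[OF primitive_facts(1) this], of c]
  have "(accumulated t has_real_derivative (weight k - weight (k - c * t)) / c) (at k)" unfolding accumulated_def[abs_def] .
  then have "((\<lambda>k. complex_of_real (accumulated t k)) has_vector_derivative complex_of_real ((weight k - weight (k - c * t)) / c)) (at k)"
    by (rule has_vector_derivative_of_real)
  then show "((\<lambda>k. complex_of_real (accumulated t k)) has_vector_derivative of_real (1 / c) * (complex_of_real (weight k) - complex_of_real (weight (k + - (c * t))))) (at k)"
    by (simp add: of_real_diff)
qed

text \<open>Symbol of the correlation between times \<open>t + \<delta>\<close> and
  \<open>t\<close>, in the coordinates of arrival at time \<open>t\<close>; the later field has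
  travelled further by \<open>c * \<delta>\<close>.\<close>

definition cross_mode :: "real \<Rightarrow> real \<Rightarrow> real \<Rightarrow> real \<Rightarrow> complex" where
  "cross_mode \<delta> x y \<kappa> = mode x (\<kappa> + c * \<delta>) * cnj (mode y \<kappa>)"

lemma mode_section_measurable [measurable]: "mode x \<in> borel_measurable borel"
  by (rule multiplier_measurable[OF multiplier_mode])

lemma cross_mode_measurable [measurable]: "cross_mode \<delta> x y \<in> borel_measurable borel"
  unfolding cross_mode_def by measurable

lemma cross_mode_slow: "slow_growth (cross_mode \<delta> x y)"
proof -
  have "slow_growth (\<lambda>\<kappa>. cnj (mode y \<kappa>))"
    using multiplier_slow[OF multiplier_mode] by (simp add: slow_growth_def)
  then show ?thesis unfolding cross_mode_def
    by (intro slow_growth_mult multiplier_slow[OF multiplier_shift[OF multiplier_mode]])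
qed

lemma gpow_weight_spectrum: "gpow weight_exp k * cnj (gpow weight_exp k) * spectrum k = complex_of_real (weight k)"
proof -
  have "g k powr weight_exp * g k powr weight_exp = g k powr (2 * H + 1)"
    unfolding powr_add[symmetric] by (simp add: weight_exp_def)
  then show ?thesis unfolding gpow_cnj spectrum_real weight_def gpow_def
    by (simp only: complex_cnj_complex_of_real of_real_mult[symmetric])
qed

text \<open>The integration variable is changed from the wavenumber of the forcing to the wavenumber
  of arrival at time \<open>t\<close>. The factor from the modes then no longer depends on
  \<open>s\<close>, so after exchanging integrals the time integral acts on \<open>weight\<close>
  alone.\<close>

lemma kernel_covariance:
  assumes t: "t \<ge> 0" and \<delta>: "\<delta> \<ge> 0"
  shows "(LINT w|symbol_measure. kernel (t + \<delta>) x w * cnj (kernel t y w))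
    = (LINT \<kappa>|lborel. cross_mode \<delta> x y \<kappa> * of_real (accumulated t \<kappa>))"
proof -
  have t\<delta>: "t + \<delta> \<ge> 0" using t \<delta> by simp
  define A where "A = cross_mode \<delta> x y"
  have [measurable]: "A \<in> borel_measurable borel" unfolding A_def by measurable
  have wm [measurable]: "weight \<in> borel_measurable borel" by (rule borel_measurable_continuous_onI[OF weight_continuous])
  define R where "R = \<bar>c\<bar> * t"
  have R: "R \<ge> 0" using t by (simp add: R_def)
  obtain K where K: "K \<ge> 0" "\<And>r k. \<bar>r\<bar> \<le> R \<Longrightarrow> cmod (A k * of_real (weight (k + r))) \<le> K / (1 + k\<^sup>2)"
    unfolding A_def by (rule shift_product_bound[OF cross_mode_slow schwartz_rapid[OF schwartz_weight] R]) blast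
  \<comment> \<open>Forcing later than \<open>t\<close> reaches only the later field, so the strip
    is that of the earlier one.\<close>
  have pt: "kernel (t + \<delta>) x (s, k) * cnj (kernel t y (s, k)) * spectrum k
    = indicator {0..t} s * (A (k + c * (t - s)) * of_real (weight k))" for s k
  proof -
    have e: "k + c * (t + \<delta> - s) = k + c * (t - s) + c * \<delta>" by (simp add: algebra_simps)
    show ?thesis
    proof (cases "s \<in> {0..t}")
      case True
      then have "s \<in> {0..t + \<delta>}" using \<delta> by auto
      then show ?thesis using True unfolding kernel_def A_def cross_mode_def gpow_weight_spectrum[symmetric] e prod.case
        by (simp add: mult_ac)
    qed (simp add: kernel_def)
  qed
  let ?F = "\<lambda>s \<kappa>. indicator {0..t} s * (A \<kappa> * complex_of_real (weight (\<kappa> - c * (t - s))))"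
  have ig: "integrable (lborel \<Otimes>\<^sub>M lborel) (\<lambda>(s, \<kappa>). ?F s \<kappa>)"
  proof (rule Bochner_Integration.integrable_bound)
    show "integrable (lborel \<Otimes>\<^sub>M lborel) (\<lambda>(s::real, \<kappa>::real). indicator {0..t} s * complex_of_real (K * (1 / (1 + \<kappa>\<^sup>2))))"
      by (intro lborel_pair.integrable_product_mult integrable_indicator_interval integrable_of_real integrable_mult_right integrable_inverse_square)
    show "(\<lambda>(s, \<kappa>). ?F s \<kappa>) \<in> borel_measurable (lborel \<Otimes>\<^sub>M lborel)" by measurable
    have "norm (?F s \<kappa>) \<le> norm (indicator {0..t} s * complex_of_real (K * (1 / (1 + \<kappa>\<^sup>2))))" for s \<kappa>
    proof (cases "s \<in> {0..t}")
      case True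
      then have "\<bar>- (c * (t - s))\<bar> \<le> R" unfolding R_def abs_minus_cancel abs_mult by (intro mult_left_mono) auto
      from K(2)[OF this, of \<kappa>] have "cmod (A \<kappa> * complex_of_real (weight (\<kappa> - c * (t - s)))) \<le> \<bar>K * (1 / (1 + \<kappa>\<^sup>2))\<bar>" using K(1) by simp
      then show ?thesis using True by (simp only: norm_mult norm_of_real indicator_simps norm_one mult_1_left)
    qed simp
    then show "AE z in lborel \<Otimes>\<^sub>M lborel. norm (case z of (s, \<kappa>) \<Rightarrow> ?F s \<kappa>) \<le> norm (case z of (s::real, \<kappa>::real) \<Rightarrow> indicator {0..t} s * complex_of_real (K * (1 / (1 + \<kappa>\<^sup>2))))"
      by (intro AE_I2) (simp only: case_prod_unfold)
  qed
  have "(LINT w|symbol_measure. kernel (t + \<delta>) x w * cnj (kernel t y w))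
    = (LINT s|lborel. LINT k|lborel. kernel (t + \<delta>) x (s, k) * cnj (kernel t y (s, k)) * spectrum k)"
    by (intro integral_symbol_measure square_integrable_product square_integrable_cnj kernel_square_integrable t t\<delta>)
  also have "\<dots> = (LINT s|lborel. LINT \<kappa>|lborel. ?F s \<kappa>)"
  proof (rule Bochner_Integration.integral_cong[OF refl])
    fix s
    have "(LINT k|lborel. kernel (t + \<delta>) x (s, k) * cnj (kernel t y (s, k)) * spectrum k)
      = (LINT k|lborel. ?F s (c * (t - s) + 1 * k))"
      unfolding pt by (simp add: add.commute)
    also have "\<dots> = (LINT \<kappa>|lborel. ?F s \<kappa>)"
      using lborel_integral_real_affine[of 1 "?F s" "c * (t - s)", OF one_neq_zero] by (simp only: abs_one scaleR_one)
    finally show "(LINT k|lborel. kernel (t + \<delta>) x (s, k) * cnj (kernel t y (s, k)) * spectrum k) = (LINT \<kappa>|lborel. ?F s \<kappa>)" .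
  qed
  also have "\<dots> = (LINT \<kappa>|lborel. LINT s|lborel. ?F s \<kappa>)"
    by (rule lborel_pair.Fubini_integral[OF ig, symmetric])
  also have "\<dots> = (LINT \<kappa>|lborel. A \<kappa> * of_real (accumulated t \<kappa>))"
  proof (rule Bochner_Integration.integral_cong[OF refl])
    fix \<kappa>
    \<comment> \<open>Reversing time turns the age \<open>t - s\<close> of the forcing into the
      integration variable of \<open>accumulated\<close>.\<close>
    let ?G = "\<lambda>s::real. indicator {0..t} s * complex_of_real (weight (\<kappa> - c * s))"
    have "(LINT s|lborel. ?F s \<kappa>) = (LINT s|lborel. A \<kappa> * ?G (t + (-1) * s))"
      by (rule Bochner_Integration.integral_cong[OF refl]) (auto simp: indicator_def)
    also have "\<dots> = A \<kappa> * (LINT s|lborel. ?G (t + (-1) * s))" by (rule integral_mult_right_zero)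
    also have "(LINT s|lborel. ?G (t + (-1) * s)) = (LINT s|lborel. ?G s)"
      using lborel_integral_real_affine[of "-1" ?G t] by simp
    also have "(LINT s|lborel. ?G s) = (LINT s:{0..t}|lborel. complex_of_real (weight (\<kappa> - c * s)))"
      unfolding set_integral_as_weight by (simp only: mult.commute)
    also have "\<dots> = of_real (accumulated t \<kappa>)"
      unfolding set_integral_complex_of_real accumulated_integral[OF t] ..
    finally show "(LINT s|lborel. ?F s \<kappa>) = A \<kappa> * of_real (accumulated t \<kappa>)" .
  qed
  finally show ?thesis unfolding A_def .
qed

lemma solution_covariance:
  assumes u: "solution_from_zero M f c g H u" and t: "t \<ge> 0" and \<delta>: "\<delta> \<ge> 0"
  shows "(\<integral>\<omega>. u (t + \<delta>) x \<omega> * cnj (u t y \<omega>) \<partial>M)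
    = (LINT \<kappa>|lborel. cross_mode \<delta> x y \<kappa> * of_real (accumulated t \<kappa>))"
proof -
  have "t + \<delta> \<ge> 0" using t \<delta> by simp
  from represents_inner[OF solution_from_zero_represents[OF u this] solution_from_zero_represents[OF u t]]
  show ?thesis using kernel_covariance[OF t \<delta>] by simp
qed

definition evolved_spectrum :: "real \<Rightarrow> real \<Rightarrow> complex" where
  "evolved_spectrum t k = gpow (- (2 * H + 1)) k * of_real (accumulated t k)"

lemma schwartz_evolved_spectrum: "t \<ge> 0 \<Longrightarrow> schwartz (evolved_spectrum t)"
  unfolding evolved_spectrum_def[abs_def] by (intro schwartz_gpow schwartz_accumulated)

lemma cross_mode_equal_time: "cross_mode 0 x y \<kappa> = cis (2 * pi * \<kappa> * (x - y)) * gpow (- (2 * H + 1)) \<kappa>"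
proof -
  have "g \<kappa> powr (- weight_exp) * g \<kappa> powr (- weight_exp) = g \<kappa> powr (- (2 * H + 1))"
    unfolding powr_add[symmetric] by (simp add: weight_exp_def)
  then have a: "gpow (- weight_exp) \<kappa> * gpow (- weight_exp) \<kappa> = gpow (- (2 * H + 1)) \<kappa>"
    unfolding gpow_def by (simp only: of_real_mult[symmetric])
  have b: "cis (2 * pi * x * \<kappa>) * cis (- (2 * pi * y * \<kappa>)) = cis (2 * pi * \<kappa> * (x - y))"
    unfolding cis_mult by (simp add: algebra_simps)
  have "cross_mode 0 x y \<kappa> = (cis (2 * pi * x * \<kappa>) * cis (- (2 * pi * y * \<kappa>))) * (gpow (- weight_exp) \<kappa> * gpow (- weight_exp) \<kappa>)"
    unfolding cross_mode_def mode_def by (simp add: cis_cnj mult_ac)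
  then show ?thesis unfolding a b .
qed

lemma solution_equal_time_covariance:
  assumes u: "solution_from_zero M f c g H u" and t: "t \<ge> 0"
  shows "(\<integral>\<omega>. u t x \<omega> * cnj (u t y \<omega>) \<partial>M) = fourier_inv (evolved_spectrum t) (x - y)"
  using solution_covariance[OF u t order_refl, of x y]
  by (simp add: cross_mode_equal_time fourier_inv_def evolved_spectrum_def mult_ac)

text \<open>Comparison with \<open>(1 + \<bar>k\<bar>) powr - b\<close>, whose explicit primitive
  tends to \<open>0\<close> at infinity because \<open>b > 1\<close>. It is applied with
  \<open>b = 2 * H + 1\<close>.\<close>

lemma g_powr_integrable:
  assumes b: "b > 1" shows "integrable lborel (\<lambda>k. g k powr (- b))"
proof -
  obtain m where m: "m > 0" "\<And>k. m * (1 + \<bar>k\<bar>) \<le> g k" using g_lower by blast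
  have h: "integrable lborel (\<lambda>k::real. (1 + \<bar>k\<bar>) powr (- b) * indicator {0..} k)"
  proof (rule integrableI_nonneg)
    have "(\<integral>\<^sup>+k. ennreal ((1 + \<bar>k\<bar>) powr (- b)) * indicator {0..} k \<partial>lborel) = 0 - (- ((1 + 0) powr (1 - b) / (b - 1)))"
    proof (rule nn_integral_FTC_atLeast[where F = "\<lambda>k. - ((1 + k) powr (1 - b) / (b - 1))"])
      show "((\<lambda>k. - ((1 + k) powr (1 - b) / (b - 1))) has_real_derivative (1 + \<bar>k\<bar>) powr (- b)) (at k)" if k: "0 \<le> k" for k
      proof -
        have "((\<lambda>k. 1 + k) has_real_derivative 1) (at k)" by (auto intro!: derivative_eq_intros)
        from DERIV_fun_powr[OF this, of "1 - b"] k
        have "((\<lambda>k. (1 + k) powr (1 - b)) has_real_derivative (1 - b) * (1 + k) powr (- b)) (at k)" by simp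
        from DERIV_minus[OF DERIV_cdivide[OF this, of "b - 1"]]
        have "((\<lambda>k. - ((1 + k) powr (1 - b) / (b - 1))) has_real_derivative - ((1 - b) * (1 + k) powr (- b) / (b - 1))) (at k)" .
        moreover have "- ((1 - b) * (1 + k) powr (- b) / (b - 1)) = (1 + \<bar>k\<bar>) powr (- b)"
          using b k by (simp add: divide_simps) (simp add: algebra_simps)
        ultimately show ?thesis by (simp only:)
      qed
      show "((\<lambda>k. - ((1 + k) powr (1 - b) / (b - 1))) \<longlongrightarrow> 0) at_top" using b by real_asymp
    qed auto
    then show "(\<integral>\<^sup>+ (k::real). ennreal ((1 + \<bar>k\<bar>) powr (- b) * indicator {0..} k) \<partial>lborel) < \<infinity>"
      by (simp add: ennreal_mult'' ennreal_indicator)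
  qed auto
  from Bochner_Integration.integrable_add[OF h lborel_integrable_real_affine[OF h, of "-1" 0]]
  have s: "integrable lborel (\<lambda>k::real. m powr (- b) * ((1 + \<bar>k\<bar>) powr (- b) * indicator {0..} k + (1 + \<bar>k\<bar>) powr (- b) * indicator {0..} (- k)))"
    by (intro integrable_mult_right) simp
  show ?thesis
  proof (rule Bochner_Integration.integrable_bound[OF s], measurable, rule AE_I2)
    fix k
    have "g k powr (- b) \<le> (m * (1 + \<bar>k\<bar>)) powr (- b)"
      using m b by (intro powr_mono2') auto
    also have "\<dots> = m powr (- b) * (1 + \<bar>k\<bar>) powr (- b)" using m(1) by (intro powr_mult)
    also have "\<dots> \<le> m powr (- b) * ((1 + \<bar>k\<bar>) powr (- b) * indicator {0..} k + (1 + \<bar>k\<bar>) powr (- b) * indicator {0..} (- k))"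
      by (intro mult_left_mono) (auto simp: indicator_def)
    finally show "norm (g k powr (- b)) \<le> norm (m powr (- b) * ((1 + \<bar>k\<bar>) powr (- b) * indicator {0..} k + (1 + \<bar>k\<bar>) powr (- b) * indicator {0..} (- k)))"
      by simp
  qed
qed

text \<open>The weights at two different wavenumbers are decoupled by bounding a product by a sum of
  squares, so that integrability of a single power of \<open>g\<close> serves all lags.\<close>

lemma cmod_cross_mode_le:
  "cmod (cross_mode \<delta> x y \<kappa>) \<le> g (\<kappa> + c * \<delta>) powr (- (2 * H + 1)) + g \<kappa> powr (- (2 * H + 1))"
proof -
  have sq: "(g k powr (- weight_exp))\<^sup>2 = g k powr (- (2 * H + 1))" for k
    unfolding power2_eq_square powr_add[symmetric] by (simp add: weight_exp_def)
  have "cmod (cross_mode \<delta> x y \<kappa>) = g (\<kappa> + c * \<delta>) powr (- weight_exp) * g \<kappa> powr (- weight_exp)"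
    unfolding cross_mode_def norm_mult complex_mod_cnj cmod_mode by (simp add: gpow_def)
  also have "\<dots> \<le> (g (\<kappa> + c * \<delta>) powr (- weight_exp))\<^sup>2 + (g \<kappa> powr (- weight_exp))\<^sup>2" by (rule two_mult_le_squares)
  finally show ?thesis unfolding sq .
qed

definition limit_covariance :: "real \<Rightarrow> real \<Rightarrow> real \<Rightarrow> complex" where
  "limit_covariance \<delta> x y = (LINT \<kappa>|lborel. cross_mode \<delta> x y \<kappa> * of_real (limit_density \<kappa>))"

definition limit_structure :: "real \<Rightarrow> real" where
  "limit_structure l = (LINT k|lborel. (2 - 2 * cos (2 * pi * k * l)) * (g k powr (- (2 * H + 1)) * limit_density k))"

section \<open>Limits in time for positive \<open>H\<close>\<close>

context
  assumes H_pos: "H > 0"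
begin

lemma cross_mode_dominating:
  "integrable lborel (\<lambda>\<kappa>. (g (\<kappa> + c * \<delta>) powr (- (2 * H + 1)) + g \<kappa> powr (- (2 * H + 1))) * (mass / \<bar>c\<bar>))"
proof -
  have i: "integrable lborel (\<lambda>k. g k powr (- (2 * H + 1)))" using H_pos by (intro g_powr_integrable) simp
  from lborel_integrable_real_affine[OF i, of 1 "c * \<delta>"]
  have "integrable lborel (\<lambda>\<kappa>. g (\<kappa> + c * \<delta>) powr (- (2 * H + 1)))" by (simp add: add.commute)
  then show ?thesis by (intro integrable_mult_left Bochner_Integration.integrable_add i)
qed

lemma cross_mode_dominated:
  assumes "0 \<le> a" "a \<le> mass / \<bar>c\<bar>"
  shows "cmod (cross_mode \<delta> x y \<kappa> * of_real a)
    \<le> (g (\<kappa> + c * \<delta>) powr (- (2 * H + 1)) + g \<kappa> powr (- (2 * H + 1))) * (mass / \<bar>c\<bar>)"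
  unfolding norm_mult using assms by (intro mult_mono cmod_cross_mode_le) auto

lemma cross_mode_limit_integrable:
  "integrable lborel (\<lambda>\<kappa>. cross_mode \<delta> x y \<kappa> * of_real (limit_density \<kappa>))"
proof (rule Bochner_Integration.integrable_bound[OF cross_mode_dominating[of \<delta>]])
  show "AE \<kappa> in lborel. norm (cross_mode \<delta> x y \<kappa> * of_real (limit_density \<kappa>))
    \<le> norm ((g (\<kappa> + c * \<delta>) powr (- (2 * H + 1)) + g \<kappa> powr (- (2 * H + 1))) * (mass / \<bar>c\<bar>))"
    unfolding real_norm_def
    by (intro AE_I2 order_trans[OF cross_mode_dominated abs_ge_self] limit_density_bounds)
qed measurable

lemma covariance_tendsto:
  "((\<lambda>t. LINT \<kappa>|lborel. cross_mode \<delta> x y \<kappa> * of_real (accumulated t \<kappa>)) \<longlongrightarrow> limit_covariance \<delta> x y) at_top"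
  unfolding limit_covariance_def
proof (rule integral_dominated_convergence_at_top[OF _ _ cross_mode_dominating[of \<delta>]])
  show "AE \<kappa> in lborel. ((\<lambda>t. cross_mode \<delta> x y \<kappa> * of_real (accumulated t \<kappa>)) \<longlongrightarrow> cross_mode \<delta> x y \<kappa> * of_real (limit_density \<kappa>)) at_top"
    by (intro AE_I2 tendsto_intros accumulated_tendsto)
  show "\<forall>\<^sub>F t in at_top. AE \<kappa> in lborel. norm (cross_mode \<delta> x y \<kappa> * of_real (accumulated t \<kappa>))
    \<le> (g (\<kappa> + c * \<delta>) powr (- (2 * H + 1)) + g \<kappa> powr (- (2 * H + 1))) * (mass / \<bar>c\<bar>)"
    using eventually_ge_at_top[of 0]
    by eventually_elim (intro AE_I2 cross_mode_dominated accumulated_bounds)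
qed measurable

lemma solution_covariance_tendsto:
  assumes u: "solution_from_zero M f c g H u" and ts: "s \<le> t"
  shows "((\<lambda>T. \<integral>\<omega>. u (T + t) x \<omega> * cnj (u (T + s) y \<omega>) \<partial>M) \<longlongrightarrow> limit_covariance (t - s) x y) at_top"
proof -
  have "filterlim (\<lambda>T. T + s) at_top at_top" by (rule filterlim_tendsto_add_at_top[OF tendsto_const filterlim_ident, of s, unfolded add.commute[of s]])
  from filterlim_compose[OF covariance_tendsto this]
  have "((\<lambda>T. LINT \<kappa>|lborel. cross_mode (t - s) x y \<kappa> * of_real (accumulated (T + s) \<kappa>)) \<longlongrightarrow> limit_covariance (t - s) x y) at_top" .
  moreover have "\<forall>\<^sub>F T in at_top. (LINT \<kappa>|lborel. cross_mode (t - s) x y \<kappa> * of_real (accumulated (T + s) \<kappa>)) = (\<integral>\<omega>. u (T + t) x \<omega> * cnj (u (T + s) y \<omega>) \<partial>M)"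
    using eventually_ge_at_top[of "- s"]
  proof eventually_elim
    case (elim T)
    then have "T + s \<ge> 0" by simp
    from solution_covariance[OF u this, of "t - s"] ts show ?case by (simp add: algebra_simps)
  qed
  ultimately show ?thesis by (rule Lim_transform_eventually)
qed

lemma solution_asymptotically_stationary:
  assumes u: "solution_from_zero M f c g H u"
  shows "asymptotically_stationary M u"
  unfolding asymptotically_stationary_def
proof (intro exI allI conjI)
  fix t s x y :: real
  \<comment> \<open>\<open>limit_covariance\<close> is computed for nonnegative lags; negative ones
    follow by Hermitian symmetry.\<close>
  let ?R = "\<lambda>d x y. if d \<ge> 0 then limit_covariance d x y else cnj (limit_covariance (- d) y x)"
  show "((\<lambda>T. \<integral>\<omega>. u (T + t) x \<omega> * cnj (u (T + s) y \<omega>) \<partial>M) \<longlongrightarrow> ?R (t - s) x y) at_top"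
  proof (cases "s \<le> t")
    case True
    then show ?thesis using solution_covariance_tendsto[OF u True] by simp
  next
    case False
    then have "((\<lambda>T. cnj (\<integral>\<omega>. u (T + s) y \<omega> * cnj (u (T + t) x \<omega>) \<partial>M)) \<longlongrightarrow> cnj (limit_covariance (s - t) y x)) at_top"
      by (intro tendsto_cnj solution_covariance_tendsto[OF u]) simp
    moreover have "cnj (\<integral>\<omega>. u (T + s) y \<omega> * cnj (u (T + t) x \<omega>) \<partial>M) = (\<integral>\<omega>. u (T + t) x \<omega> * cnj (u (T + s) y \<omega>) \<partial>M)" for T
      unfolding Bochner_Integration.integral_cnj[symmetric] by (simp add: mult.commute)
    ultimately show ?thesis using False by simp
  qed
  have "\<forall>\<^sub>F T in at_top. 0 = (\<integral>\<omega>. u (T + t) x \<omega> * u (T + s) y \<omega> \<partial>M)"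
    using eventually_ge_at_top[of "- s"] eventually_ge_at_top[of "- t"]
  proof eventually_elim
    case (elim T)
    then have "T + s \<ge> 0" "T + t \<ge> 0" by simp_all
    then show ?case
      using represents_pseudo[OF solution_from_zero_represents[OF u] solution_from_zero_represents[OF u]] by simp
  qed
  then show "((\<lambda>T. \<integral>\<omega>. u (T + t) x \<omega> * u (T + s) y \<omega> \<partial>M) \<longlongrightarrow> (\<lambda>d x y. 0) (t - s) x y) at_top"
    by (rule Lim_transform_eventually[rotated]) simp
qed

lemma solution_equal_time_tendsto:
  assumes u: "solution_from_zero M f c g H u"
  shows "((\<lambda>t. \<integral>\<omega>. u t x \<omega> * cnj (u t y \<omega>) \<partial>M) \<longlongrightarrow> limit_covariance 0 x y) at_top"
  using solution_covariance_tendsto[OF u, of 0 0] by simp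

lemma solution_variance_tendsto:
  assumes u: "solution_from_zero M f c g H u"
  shows "((\<lambda>t. \<integral>\<omega>. (cmod (u t x \<omega>))\<^sup>2 \<partial>M) \<longlongrightarrow> Re (limit_covariance 0 0 0)) at_top"
proof -
  have "limit_covariance 0 x x = limit_covariance 0 0 0"
    unfolding limit_covariance_def by (simp add: cross_mode_equal_time)
  with tendsto_Re[OF solution_equal_time_tendsto[OF u, of x x]]
  show ?thesis unfolding sqnorm_eq_inner[symmetric] by (simp add: sqnorm_def)
qed

text \<open>The four covariances of an increment share one density, and their modes combine to
  \<open>2 - 2 * cos (2 * pi * \<kappa> * l)\<close>, the squared modulus of the symbol of the
  increment; the position \<open>x\<close> drops out.\<close>

lemma limit_structure_eq:
  "limit_covariance 0 (x + l) (x + l) - limit_covariance 0 (x + l) x - limit_covariance 0 x (x + l) + limit_covariance 0 x x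
    = complex_of_real (limit_structure l)"
proof -
  have e: "cross_mode 0 (x + l) (x + l) \<kappa> - cross_mode 0 (x + l) x \<kappa> - cross_mode 0 x (x + l) \<kappa> + cross_mode 0 x x \<kappa>
      = complex_of_real ((2 - 2 * cos (2 * pi * \<kappa> * l)) * g \<kappa> powr (- (2 * H + 1)))" for \<kappa>
  proof -
    have "cis (2 * pi * \<kappa> * l) + cis (- (2 * pi * \<kappa> * l)) = complex_of_real (2 * cos (2 * pi * \<kappa> * l))"
      by (simp add: complex_eq_iff)
    moreover have "cross_mode 0 (x + l) (x + l) \<kappa> - cross_mode 0 (x + l) x \<kappa> - cross_mode 0 x (x + l) \<kappa> + cross_mode 0 x x \<kappa>
      = (2 - (cis (2 * pi * \<kappa> * l) + cis (- (2 * pi * \<kappa> * l)))) * gpow (- (2 * H + 1)) \<kappa>"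
      unfolding cross_mode_equal_time by (simp add: algebra_simps)
    ultimately show ?thesis by (simp add: gpow_def)
  qed
  note i = cross_mode_limit_integrable[of 0]
  have "limit_covariance 0 (x + l) (x + l) - limit_covariance 0 (x + l) x - limit_covariance 0 x (x + l) + limit_covariance 0 x x
    = (LINT \<kappa>|lborel. cross_mode 0 (x + l) (x + l) \<kappa> * of_real (limit_density \<kappa>) - cross_mode 0 (x + l) x \<kappa> * of_real (limit_density \<kappa>)
       - cross_mode 0 x (x + l) \<kappa> * of_real (limit_density \<kappa>) + cross_mode 0 x x \<kappa> * of_real (limit_density \<kappa>))"
    unfolding limit_covariance_def by (simp add: i)
  also have "\<dots> = (LINT \<kappa>|lborel. complex_of_real ((2 - 2 * cos (2 * pi * \<kappa> * l)) * (g \<kappa> powr (- (2 * H + 1)) * limit_density \<kappa>)))"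
    unfolding left_diff_distrib[symmetric] distrib_right[symmetric] e of_real_mult[symmetric] by (simp only: mult.assoc)
  also have "\<dots> = complex_of_real (limit_structure l)"
    unfolding limit_structure_def by (rule integral_complex_of_real)
  finally show ?thesis .
qed

lemma solution_structure_tendsto:
  assumes u: "solution_from_zero M f c g H u"
  shows "((\<lambda>t. \<integral>\<omega>. (cmod (u t (x + l) \<omega> - u t x \<omega>))\<^sup>2 \<partial>M) \<longlongrightarrow> limit_structure l) at_top"
proof -
  let ?C = "\<lambda>t x y. \<integral>\<omega>. u t x \<omega> * cnj (u t y \<omega>) \<partial>M"
  have b: "bounded_field u" by (rule solution_from_zero_bounded_field[OF u])
  have "((\<lambda>t. ?C t (x + l) (x + l) - ?C t (x + l) x - ?C t x (x + l) + ?C t x x) \<longlongrightarrow> complex_of_real (limit_structure l)) at_top"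
    unfolding limit_structure_eq[of x l, symmetric] by (intro tendsto_intros solution_equal_time_tendsto u)
  moreover have "\<forall>\<^sub>F t in at_top. ?C t (x + l) (x + l) - ?C t (x + l) x - ?C t x (x + l) + ?C t x x
      = complex_of_real (sqnorm M (\<lambda>\<omega>. u t (x + l) \<omega> - u t x \<omega>))"
    using eventually_ge_at_top[of 0]
    by eventually_elim (intro sqnorm_diff_expand[symmetric] bounded_field_square_integrable b)
  ultimately have "((\<lambda>t. complex_of_real (sqnorm M (\<lambda>\<omega>. u t (x + l) \<omega> - u t x \<omega>))) \<longlongrightarrow> complex_of_real (limit_structure l)) at_top"
    by (rule Lim_transform_eventually)
  from tendsto_Re[OF this] show ?thesis by (simp add: sqnorm_def)
qed

end

section \<open>The small-scale equivalent of the structure function\<close>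

lemma structure_const_eq: "structure_const c g H Cf = complex_of_real (mass / \<bar>c\<bar> * increment_integral H)"
proof -
  have "(LINT s|lborel. weighted_spectrum g H Cf s) = complex_of_real mass"
    unfolding weighted_spectrum_eq mass_def by (rule integral_complex_of_real)
  then show ?thesis unfolding structure_const_def increment_integral_def
    by (simp only: of_real_mult[symmetric]) (simp add: divide_simps)
qed

lemma increment_integral_pos:
  assumes "0 < H" "H < 1" shows "increment_integral H > 0"
proof -
  have "sin (pi * H) > 0" using assms by (intro sin_gt_zero) (auto simp: field_simps)
  moreover have "Gamma (1 + 2 * H) > 0" using assms by (intro Gamma_real_pos) simp
  ultimately show ?thesis unfolding increment_integral_def by simp
qed

text \<open>Vanishing mass is treated apart: both sides are then identically \<open>0\<close>, which
  asymptotic equivalence admits, whereas the quotient argument divides by the constant.\<close>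

lemma structure_asymptotics:
  assumes H: "0 < H" "H < 1"
  shows "(\<lambda>l. complex_of_real (limit_structure l)) \<sim>[at_right 0] (\<lambda>l. structure_const c g H Cf * of_real (l powr (2 * H)))"
proof (cases "mass = 0")
  case True
  then have "limit_density k = 0" for k using limit_density_bounds[of k] by simp
  then have "limit_structure l = 0" for l unfolding limit_structure_def by simp
  then show ?thesis by (simp add: structure_const_eq True)
next
  case False
  define K where "K = mass / \<bar>c\<bar> * increment_integral H"
  have K: "K > 0" unfolding K_def using False mass_nonneg c_nonzero increment_integral_pos[OF H] by simp
  obtain p q where pq: "(limit_density \<longlongrightarrow> p) at_top" "(limit_density \<longlongrightarrow> q) at_bot" "p + q = mass / \<bar>c\<bar>"
    by (rule limit_density_at_infinity) blast
  have "((\<lambda>l. limit_structure l / l powr (2 * H)) \<longlongrightarrow> (p + q) * increment_integral H) (at_right 0)"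
    unfolding limit_structure_def
    by (rule structure_limit[OF H limit_density_measurable limit_density_bounds pq(1,2)])
  then have "((\<lambda>l. limit_structure l / l powr (2 * H) / K) \<longlongrightarrow> K / K) (at_right 0)"
    unfolding pq(3) K_def[symmetric] using K by (intro tendsto_intros) auto
  then have "((\<lambda>l. complex_of_real (limit_structure l / l powr (2 * H) / K)) \<longlongrightarrow> complex_of_real (K / K)) (at_right 0)"
    by (rule tendsto_of_real)
  then show ?thesis unfolding structure_const_eq K_def[symmetric] using K
    by (intro asymp_equivI') (simp add: divide_simps mult.commute)
qed

text \<open>Zero mass flattens the primitive, so its derivative \<open>weight\<close> vanishes
  everywhere; dividing by the positive power of \<open>g\<close> kills the spectrum, and inversion
  kills \<open>Cf\<close>.\<close>

lemma mass_pos: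
  assumes "Cf x \<noteq> 0" shows "mass > 0"
proof (rule ccontr)
  assume "\<not> mass > 0"
  then have "mass = 0" using mass_nonneg by simp
  then have "primitive = (\<lambda>k. 0)" using primitive_bounds by (auto intro: antisym)
  then have w: "weight k = 0" for k using DERIV_unique[OF primitive_facts(1)[of k]] by simp
  have "spectrum k = 0" for k using w[of k] g_pos[of k] unfolding weight_def spectrum_real by simp
  then have "fourier_inv spectrum x = 0" unfolding fourier_inv_def by simp
  then show False using assms fourier_inv_fourier[OF schwartz_of_real[OF schwartz_Cf]] unfolding spectrum_def by simp
qed

end

theorem proposition3:
  fixes M :: "'w measure"
    and f :: "(real \<Rightarrow> real \<Rightarrow> complex) \<Rightarrow> 'w \<Rightarrow> complex"
    and c L H :: real
    and g Cf :: "real \<Rightarrow> real"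
  assumes "prob_space M"
    and "c \<noteq> 0"
    and "L > 0"
    and "regularized_abs L g"
    and "schwartz Cf"
    and "\<And>x. Cf (- x) = Cf x"
    and "white_in_time_forcing M Cf f"
  shows
    "\<comment> \<open>the dynamics in Fourier space; \<open>deriv g k / g k\<close> is \<open>k / (g k)\<^sup>2\<close> for \<open>(g k)\<^sup>2 = k\<^sup>2 + 1 / L\<^sup>2\<close>\<close>
    (\<forall>u. solves_evolution M f c g H u \<longleftrightarrow>
      solves_fourier M f c (\<lambda>k. c * (H + 1/2) * (deriv g k / g k)) u)
    \<and> ((\<forall>k. (g k)\<^sup>2 = k\<^sup>2 + 1 / L\<^sup>2) \<longrightarrow>
      (\<forall>u. solves_evolution M f c g H u \<longleftrightarrow>
           solves_fourier M f c (\<lambda>k. c * (H + 1/2) * (k / (g k)\<^sup>2)) u))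
    \<comment> \<open>existence and uniqueness up to modification\<close>
    \<and> (\<exists>u. solution_from_zero M f c g H u)
    \<and> (\<forall>u v. solution_from_zero M f c g H u \<and> solution_from_zero M f c g H v \<longrightarrow>
      (\<forall>t\<ge>0. \<forall>x. AE \<omega> in M. u t x \<omega> = v t x \<omega>))
    \<comment> \<open>properties of the solution\<close>
    \<and> (\<forall>u. solution_from_zero M f c g H u \<longrightarrow>
      gaussian_family M ({0..} \<times> UNIV) (\<lambda>(t, x). u t x) \<and>
      (\<forall>t\<ge>0. \<forall>x. (\<integral>\<omega>. u t x \<omega> \<partial>M) = 0) \<and>
      (\<exists>Cu :: real \<Rightarrow> real \<Rightarrow> complex.
         (\<forall>t\<ge>0. \<forall>x y. (\<integral>\<omega>. u t x \<omega> * cnj (u t y \<omega>) \<partial>M) = Cu t (x - y)) \<and>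
         (\<forall>t\<ge>0. integrable lborel (Cu t)) \<and>
         (\<forall>t\<ge>0. \<forall>k. fourier (Cu t) k =
            of_real (g k powr (- (2 * H + 1))) *
            (LINT s:{0..t}|lborel. weighted_spectrum g H Cf (k - c * s))) \<and>
         (H > 0 \<longrightarrow>
            asymptotically_stationary M u \<and>
            (\<exists>V. \<forall>x. ((\<lambda>t. \<integral>\<omega>. (cmod (u t x \<omega>))\<^sup>2 \<partial>M) \<longlongrightarrow> V) at_top) \<and>
            (\<forall>k. ((\<lambda>t. fourier (Cu t) k) \<longlongrightarrow>
               (if c > 0
                then of_real (1 / c * g k powr (- (2 * H + 1))) *
                     (LINT s:{..k}|lborel. weighted_spectrum g H Cf s)
                else of_real (1 / (- c) * g k powr (- (2 * H + 1))) *
                     (LINT s:{k..}|lborel. weighted_spectrum g H Cf s))) at_top))) \<and>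
      (0 < H \<and> H < 1 \<longrightarrow>
         (\<exists>S :: real \<Rightarrow> real.
            (\<forall>l>0. \<forall>x. ((\<lambda>t. \<integral>\<omega>. (cmod (u t (x + l) \<omega> - u t x \<omega>))\<^sup>2 \<partial>M) \<longlongrightarrow> S l) at_top) \<and>
            (\<lambda>l. complex_of_real (S l)) \<sim>[at_right 0]
              (\<lambda>l. structure_const c g H Cf * of_real (l powr (2 * H))))))
    \<comment> \<open>the spectral integrals above converge, and the small-scale equivalent is not degenerate\<close>
    \<and> (integrable lborel (weighted_spectrum g H Cf))
    \<and> (0 < H \<and> H < 1 \<and> (\<exists>x. Cf x \<noteq> 0) \<longrightarrow>
      (\<exists>r>0. structure_const c g H Cf = complex_of_real r))"
proof -
  interpret prob_space M by fact
  interpret driven_evolution M L H c g f Cf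
    using assms by unfold_locales auto
  show ?thesis
  proof (intro conjI allI impI)
    show "solves_evolution M f c g H u \<longleftrightarrow> solves_fourier M f c (\<lambda>k. c * (H + 1/2) * (deriv g k / g k)) u" for u
      by (rule solves_evolution_iff_fourier)
    show "solves_evolution M f c g H u \<longleftrightarrow> solves_fourier M f c (\<lambda>k. c * (H + 1/2) * (k / (g k)\<^sup>2)) u"
      if "\<forall>k. (g k)\<^sup>2 = k\<^sup>2 + 1 / L\<^sup>2" for u
      unfolding solves_evolution_iff_fourier deriv_g_eq[OF that] ..
    show "\<exists>u. solution_from_zero M f c g H u" using solution_solves by blast
    show "AE \<omega> in M. u t x \<omega> = v t x \<omega>"
      if "solution_from_zero M f c g H u \<and> solution_from_zero M f c g H v" "0 \<le> t" for u v t x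
      using that solution_unique by blast
    show "integrable lborel (weighted_spectrum g H Cf)"
      using schwartz_integrable[OF schwartz_weight] by (simp add: weighted_spectrum_eq[abs_def])
    show "\<exists>r>0. structure_const c g H Cf = complex_of_real r" if "0 < H \<and> H < 1 \<and> (\<exists>x. Cf x \<noteq> 0)"
    proof (intro exI conjI)
      show "structure_const c g H Cf = complex_of_real (mass / \<bar>c\<bar> * increment_integral H)" by (rule structure_const_eq)
      show "mass / \<bar>c\<bar> * increment_integral H > 0"
        using that mass_pos increment_integral_pos c_nonzero by (intro mult_pos_pos divide_pos_pos) auto
    qed
    fix u
    assume u: "solution_from_zero M f c g H u"
    show "gaussian_family M ({0..} \<times> UNIV) (\<lambda>(t, x). u t x)" by (rule solution_gaussian_family[OF u])
    show "(\<integral>\<omega>. u t x \<omega> \<partial>M) = 0" if "0 \<le> t" for t x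
      by (rule represents_mean[OF solution_from_zero_represents[OF u that]])
    show "\<exists>S :: real \<Rightarrow> real.
            (\<forall>l>0. \<forall>x. ((\<lambda>t. \<integral>\<omega>. (cmod (u t (x + l) \<omega> - u t x \<omega>))\<^sup>2 \<partial>M) \<longlongrightarrow> S l) at_top) \<and>
            (\<lambda>l. complex_of_real (S l)) \<sim>[at_right 0]
              (\<lambda>l. structure_const c g H Cf * of_real (l powr (2 * H)))" if "0 < H \<and> H < 1"
    proof (intro exI conjI allI impI)
      show "((\<lambda>t. \<integral>\<omega>. (cmod (u t (x + l) \<omega> - u t x \<omega>))\<^sup>2 \<partial>M) \<longlongrightarrow> limit_structure l) at_top" for l x
        using that by (intro solution_structure_tendsto u) simp
      show "(\<lambda>l. complex_of_real (limit_structure l)) \<sim>[at_right 0] (\<lambda>l. structure_const c g H Cf * of_real (l powr (2 * H)))"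
        using that by (intro structure_asymptotics) auto
    qed
    have F: "fourier (fourier_inv (evolved_spectrum t)) k = evolved_spectrum t k" if "0 \<le> t" for t k
      by (simp add: fourier_fourier_inv schwartz_evolved_spectrum that)
    \<comment> \<open>The correlation function is defined from its spectrum; the covariance formula
      identifies it, and inversion returns the spectrum.\<close>
    let ?Cu = "\<lambda>t. fourier_inv (evolved_spectrum t)"
    show "\<exists>Cu :: real \<Rightarrow> real \<Rightarrow> complex.
         (\<forall>t\<ge>0. \<forall>x y. (\<integral>\<omega>. u t x \<omega> * cnj (u t y \<omega>) \<partial>M) = Cu t (x - y)) \<and>
         (\<forall>t\<ge>0. integrable lborel (Cu t)) \<and>
         (\<forall>t\<ge>0. \<forall>k. fourier (Cu t) k =
            of_real (g k powr (- (2 * H + 1))) *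
            (LINT s:{0..t}|lborel. weighted_spectrum g H Cf (k - c * s))) \<and>
         (H > 0 \<longrightarrow>
            asymptotically_stationary M u \<and>
            (\<exists>V. \<forall>x. ((\<lambda>t. \<integral>\<omega>. (cmod (u t x \<omega>))\<^sup>2 \<partial>M) \<longlongrightarrow> V) at_top) \<and>
            (\<forall>k. ((\<lambda>t. fourier (Cu t) k) \<longlongrightarrow>
               (if c > 0
                then of_real (1 / c * g k powr (- (2 * H + 1))) *
                     (LINT s:{..k}|lborel. weighted_spectrum g H Cf s)
                else of_real (1 / (- c) * g k powr (- (2 * H + 1))) *
                     (LINT s:{k..}|lborel. weighted_spectrum g H Cf s))) at_top))"
    proof (rule exI[where x = ?Cu], intro conjI allI impI)
      show "(\<integral>\<omega>. u t x \<omega> * cnj (u t y \<omega>) \<partial>M) = ?Cu t (x - y)" if "0 \<le> t" for t x y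
        by (rule solution_equal_time_covariance[OF u that])
      show "integrable lborel (?Cu t)" if "0 \<le> t" for t
        by (intro schwartz_integrable schwartz_fourier_inv schwartz_evolved_spectrum that)
      show "fourier (?Cu t) k = of_real (g k powr (- (2 * H + 1))) * (LINT s:{0..t}|lborel. weighted_spectrum g H Cf (k - c * s))"
        if "0 \<le> t" for t k
        unfolding F[OF that] accumulated_spectrum[OF that] evolved_spectrum_def gpow_def ..
      show "asymptotically_stationary M u" if "H > 0" by (rule solution_asymptotically_stationary[OF that u])
      show "\<exists>V. \<forall>x. ((\<lambda>t. \<integral>\<omega>. (cmod (u t x \<omega>))\<^sup>2 \<partial>M) \<longlongrightarrow> V) at_top" if "H > 0"
        by (rule exI, rule allI, rule solution_variance_tendsto[OF that u])
      fix k
      have "((\<lambda>t. evolved_spectrum t k) \<longlongrightarrow> gpow (- (2 * H + 1)) k * of_real (limit_density k)) at_top"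
        unfolding evolved_spectrum_def by (intro tendsto_intros accumulated_tendsto)
      moreover have "\<forall>\<^sub>F t in at_top. evolved_spectrum t k = fourier (?Cu t) k"
        using eventually_ge_at_top[of 0] by eventually_elim (simp add: F)
      ultimately have "((\<lambda>t. fourier (?Cu t) k) \<longlongrightarrow> gpow (- (2 * H + 1)) k * of_real (limit_density k)) at_top"
        by (rule Lim_transform_eventually)
      also have "gpow (- (2 * H + 1)) k * of_real (limit_density k) = (if c > 0
                then of_real (1 / c * g k powr (- (2 * H + 1))) *
                     (LINT s:{..k}|lborel. weighted_spectrum g H Cf s)
                else of_real (1 / (- c) * g k powr (- (2 * H + 1))) *
                     (LINT s:{k..}|lborel. weighted_spectrum g H Cf s))"
        unfolding limit_density_integral weighted_spectrum_eq set_integral_complex_of_real gpow_def by simp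
      finally show "((\<lambda>t. fourier (?Cu t) k) \<longlongrightarrow> (if c > 0
                then of_real (1 / c * g k powr (- (2 * H + 1))) *
                     (LINT s:{..k}|lborel. weighted_spectrum g H Cf s)
                else of_real (1 / (- c) * g k powr (- (2 * H + 1))) *
                     (LINT s:{k..}|lborel. weighted_spectrum g H Cf s))) at_top" .
    qed
  qed
qed

end
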